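(* Let $g$ be an admissible probability weight, let $\ell>0$, $T>0$, $\sigma=\mathrm{diag}(\sigma_1,\dots,\sigma_n)$, and let $$\mathcal H_0(\rho,x)=K(\rho,x)+\tfrac18\mathcal I(\rho)-\mathcal L(\rho),$$ where $$K(\rho,x)=\frac12\sum_{i=1}^n\sum_{j\in N(i)}\omega_{ij}(x_i-x_j)^2g(\rho_i,\rho_j),\qquad \mathcal L(\rho)=\sum_{i=1}^n(\rho_i\log\rho_i-\rho_i),$$ $$\mathcal I(\rho)=\frac12\sum_{i=1}^n\sum_{j\in N(i)}\omega_{ij}|\log\rho_i-\log\rho_j|^2\,\tilde g_{ij}(\rho),\qquad \tilde g_{ij}(\rho)=\frac{\rho_i-\rho_j}{\log\rho_i-\log\rho_j}.$$ Let $(F,h)$ be admissible costs (relative to this $\mathcal H_0$), and assume in addition that $F$ and $h$ are uniformly bounded. Then there exists a unique bounded viscosity solution $U$ in $(0,T)\times\mathcal P^\circ(G)\times\mathbb R^n$ of the Hamilton--Jacobi--Bellman equation $$\frac{\partial U}{\partial t}+H(t,\rho,x,\partial_\rho U,D_xU,D_x^2U)=0,\qquad U(T,\rho,x)=h(\rho,x).$$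
   Context: **Graph and simplex.** $G=(V,E,\omega)$ is a finite undirected connected weighted graph, $V=\{1,\dots,n\}$, $\omega_{jl}=\omega_{lj}>0$ if $(j,l)\in E$ and $\omega_{jl}=0$ otherwise; $N(i)$ is the set of neighbours of $i$. $\mathcal P(G)=\{\rho\in[0,1]^n:\sum_i\rho_i=1\}$; $\mathcal P^\circ(G)$ is its (relative) interior. $\|\cdot\|$ is the Euclidean norm; $D_x,D_\rho,D_x^2$ are Euclidean gradients/Hessian (formulas in $\rho$ being regarded as functions of $\rho\in(0,\infty)^n$). $\tilde g_{ij}(\rho)$ is extended by continuity as $\rho_i$ when $\rho_i=\rho_j$. **Admissible probability weight.** A symmetric function $g:[0,\infty)^2\to[0,\infty)$ such that: $g$ is continuous on $[0,\infty)^2$ and smooth on $(0,\infty)^2$; $\min\{t,r\}\le g(t,r)\le\max\{t,r\}$; $g(\lambda t,\lambda r)=\lambda g(t,r)$ for $\lambda,t,r\ge0$; $g$ is concave; $\int_0^1 g(r,1-r)^{-1/2}\,dr<\infty$. **Locally Lipschitz.** $f:\mathcal P^\circ(G)\times\mathbb R^n\to\mathbb R$ is locally Lipschitz if for all $R_1\in(0,\frac1n)$, $R_2>0$ there is $C=C(R_1,R_2)>0$ with $|f(\rho,x)-f(\mu,y)|\le C(\|\rho-\mu\|+\|x-y\|)$ whenever $\min_i\rho_i\wedge\min_i\mu_i\ge R_1$ and $\max_{(i,j)\in E}|x_i-x_j|\vee\max_{(i,j)\in E}|y_i-y_j|\le R_2$. **Admissible costs.** With $B_\ell=\{x\in\mathbb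 R^n:\|x\|\le\ell\}$: functions $F:[0,T]\times\mathcal P^\circ(G)\times\mathbb R^n\times B_\ell\to\mathbb R$ and $h:\mathcal P^\circ(G)\times\mathbb R^n\to\mathbb R$ such that: (i) $F,h$ are nonnegative and continuous; (ii) for $s\in[0,T]$, $\mathbb V\in B_\ell$, $F(s,\cdot,\cdot,\mathbb V)$ and $h$ are locally Lipschitz; (iii) for $(\rho,x,\mathbb V)$, $F(\cdot,\rho,x,\mathbb V)$ is globally Lipschitz on $[0,T]$; (iv) there are $p_1\ge0$ and $C=C(T,p_1,\ell)>0$ with $F(s,\rho,x,\mathbb V)\vee h(\rho,x)\le C(|\mathcal H_0(\rho,x)|^{p_1}+1)$ for all $s,\rho,x,\mathbb V$. **Hamiltonian.** With $\mathcal H_0^{\mathbb V}(\rho,x)=\mathcal H_0(\rho,x)+\sum_i\mathbb V_i\rho_i$, $H(t,\rho,x,p,q,Q)=\inf_{\mathbb V\in B_\ell}\{\langle p,D_x\mathcal H_0^{\mathbb V}(\rho,x)\rangle-\langle q,D_\rho\mathcal H_0^{\mathbb V}(\rho,x)\rangle+\frac12\mathrm{tr}(\sigma\sigma^\top Q)+F(t,\rho,x,\mathbb V)\}$ for $p,q\in\mathbb R^n$, $Q$ symmetric $n\times n$. **Fréchet derivative.** $f:\mathcal P(G)\to\mathbb R$ has Fréchet derivative $\partial_\rho f(\rho)=p$ at $\rho$ if $\sum_ip_i=0$ and $\lim_{s\to0}\frac{f((1-s)\rho+s\mu)-f(\rho)}{s}=\langle p,\mu-\rho\rangle$ for all $\mu\in\mathcal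 P(G)$; for smooth $f$, $\partial_\rho f=Df-\frac1n(Df^\top\mathbf 1)\mathbf 1$ with $\mathbf 1=(1,\dots,1)^\top$. **Viscosity solution.** A continuous $U$ (on $(0,T]\times\mathcal P^\circ(G)\times\mathbb R^n$) is a viscosity subsolution (resp. supersolution) if $U(T,\cdot)\le h$ (resp. $\ge h$) and for every $z_0=(t_0,\rho_0,x_0)\in(0,T)\times\mathcal P^\circ(G)\times\mathbb R^n$ and every $\varphi\in C^{1,1,2}((0,T)\times\mathcal P^\circ(G)\times\mathbb R^n)$ ($C^1$ in $t$, $C^1$ in $\rho$, $C^2$ in $x$) such that $U-\varphi$ has a local maximum (resp. minimum) at $z_0$, $\frac{\partial\varphi}{\partial t}(z_0)+H(z_0,\partial_\rho\varphi(z_0),D_x\varphi(z_0),D_x^2\varphi(z_0))\ge0$ (resp. $\le0$). A viscosity solution is both a sub- and a supersolution. *)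

theory Defs
  imports "HOL-Analysis.Analysis"
begin

section \<open>Weighted graphs and the probability simplex\<close>

text \<open>The vertex set is the whole index type \<open>'n\<close>, so \<open>n = CARD('n)\<close>; an undirected graph is a
  symmetric relation. Loops are not excluded; they contribute nothing to any expression below.\<close>

definition weighted_graph :: "('n::finite \<times> 'n) set \<Rightarrow> ('n \<Rightarrow> 'n \<Rightarrow> real) \<Rightarrow> bool" where
  "weighted_graph E \<omega> \<longleftrightarrow>
     sym E \<and> (\<forall>i j. (i, j) \<in> E\<^sup>*) \<and>
     (\<forall>i j. \<omega> i j = \<omega> j i) \<and>
     (\<forall>i j. (i, j) \<in> E \<longrightarrow> \<omega> i j > 0) \<and>
     (\<forall>i j. (i, j) \<notin> E \<longrightarrow> \<omega> i j = 0)"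

definition neighbours :: "('n \<times> 'n) set \<Rightarrow> 'n \<Rightarrow> 'n set" where
  "neighbours E i = {j. (i, j) \<in> E}"

definition prob_simplex :: "(real ^ 'n) set" where
  "prob_simplex = {\<rho>. (\<forall>i. 0 \<le> \<rho> $ i \<and> \<rho> $ i \<le> 1) \<and> (\<Sum>i\<in>UNIV. \<rho> $ i) = 1}"

definition open_simplex :: "(real ^ 'n) set" where
  "open_simplex = rel_interior prob_simplex"


section \<open>Admissible probability weights\<close>

primrec C_k_on :: "nat \<Rightarrow> 'a::real_normed_vector set \<Rightarrow> ('a \<Rightarrow> real) \<Rightarrow> bool" where
  "C_k_on 0 S f \<longleftrightarrow> continuous_on S f"
| "C_k_on (Suc k) S f \<longleftrightarrow>
     (\<forall>x\<in>S. f differentiable (at x)) \<and>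
     (\<forall>v. C_k_on k S (\<lambda>x. frechet_derivative f (at x) v))"

text \<open>Only meant for open \<open>S\<close>, since the derivatives are taken in the ambient space.\<close>

definition smooth_on :: "'a::real_normed_vector set \<Rightarrow> ('a \<Rightarrow> real) \<Rightarrow> bool" where
  "smooth_on S f \<longleftrightarrow> (\<forall>k. C_k_on k S f)"

text \<open>In the last condition the end points, where the weight may vanish, are left out because
  \<open>0 powr a = 0\<close>.\<close>

definition admissible_weight :: "(real \<Rightarrow> real \<Rightarrow> real) \<Rightarrow> bool" where
  "admissible_weight g \<longleftrightarrow>
     (\<forall>t\<ge>0. \<forall>r\<ge>0. g t r \<ge> 0 \<and> g t r = g r t) \<and>
     continuous_on ({0..} \<times> {0..}) (\<lambda>(t, r). g t r) \<and>
     smooth_on ({0<..} \<times> {0<..}) (\<lambda>(t, r). g t r) \<and>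
     (\<forall>t\<ge>0. \<forall>r\<ge>0. min t r \<le> g t r \<and> g t r \<le> max t r) \<and>
     (\<forall>c\<ge>0. \<forall>t\<ge>0. \<forall>r\<ge>0. g (c * t) (c * r) = c * g t r) \<and>
     concave_on ({0..} \<times> {0..}) (\<lambda>(t, r). g t r) \<and>
     set_integrable lborel {0<..<1} (\<lambda>r. g r (1 - r) powr (- 1 / 2))"


section \<open>The energy\<close>

definition kinetic ::
  "('n::finite \<times> 'n) set \<Rightarrow> ('n \<Rightarrow> 'n \<Rightarrow> real) \<Rightarrow> (real \<Rightarrow> real \<Rightarrow> real)
    \<Rightarrow> real ^ 'n \<Rightarrow> real ^ 'n \<Rightarrow> real" where
  "kinetic E \<omega> g \<rho> x =
     1 / 2 * (\<Sum>i\<in>UNIV. \<Sum>j\<in>neighbours E i. \<omega> i j * (x $ i - x $ j)\<^sup>2 * g (\<rho> $ i) (\<rho> $ j))"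

definition log_mean :: "real \<Rightarrow> real \<Rightarrow> real" where
  "log_mean a b = (if a = b then a else (a - b) / (ln a - ln b))"

definition fisher :: "('n::finite \<times> 'n) set \<Rightarrow> ('n \<Rightarrow> 'n \<Rightarrow> real) \<Rightarrow> real ^ 'n \<Rightarrow> real" where
  "fisher E \<omega> \<rho> =
     1 / 2 * (\<Sum>i\<in>UNIV. \<Sum>j\<in>neighbours E i.
       \<omega> i j * \<bar>ln (\<rho> $ i) - ln (\<rho> $ j)\<bar>\<^sup>2 * log_mean (\<rho> $ i) (\<rho> $ j))"

definition entropy :: "real ^ 'n \<Rightarrow> real" where
  "entropy \<rho> = (\<Sum>i\<in>UNIV. \<rho> $ i * ln (\<rho> $ i) - \<rho> $ i)"

definition energy ::
  "('n::finite \<times> 'n) set \<Rightarrow> ('n \<Rightarrow> 'n \<Rightarrow> real) \<Rightarrow> (real \<Rightarrow> real \<Rightarrow> real)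
    \<Rightarrow> real ^ 'n \<Rightarrow> real ^ 'n \<Rightarrow> real" where
  "energy E \<omega> g \<rho> x = kinetic E \<omega> g \<rho> x + 1 / 8 * fisher E \<omega> \<rho> - entropy \<rho>"


section \<open>Admissible costs\<close>

text \<open>The bounds on the maximum over the edges are written edgewise, so they hold vacuously if there
  are no edges, i.e. for the graph with one vertex.\<close>

definition locally_lipschitz ::
  "('n::finite \<times> 'n) set \<Rightarrow> (real ^ 'n \<Rightarrow> real ^ 'n \<Rightarrow> real) \<Rightarrow> bool" where
  "locally_lipschitz E f \<longleftrightarrow>
     (\<forall>R1 R2. 0 < R1 \<and> R1 < 1 / real CARD('n) \<and> 0 < R2 \<longrightarrow>
       (\<exists>C>0. \<forall>\<rho>\<in>open_simplex. \<forall>\<mu>\<in>open_simplex. \<forall>x y.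
         (\<forall>i. R1 \<le> \<rho> $ i \<and> R1 \<le> \<mu> $ i) \<and>
         (\<forall>(i, j)\<in>E. \<bar>x $ i - x $ j\<bar> \<le> R2 \<and> \<bar>y $ i - y $ j\<bar> \<le> R2) \<longrightarrow>
         \<bar>f \<rho> x - f \<mu> y\<bar> \<le> C * (norm (\<rho> - \<mu>) + norm (x - y))))"

text \<open>The control set is \<open>cball 0 l\<close>. As \<open>0 powr 0 = 0\<close>, the growth bound for \<open>p1 = 0\<close> differs
  from the one with \<open>0\<^sup>0 = 1\<close> by at most a factor 2 in the constant.\<close>

definition admissible_costs ::
  "('n::finite \<times> 'n) set \<Rightarrow> (real ^ 'n \<Rightarrow> real ^ 'n \<Rightarrow> real) \<Rightarrow> real \<Rightarrow> real
    \<Rightarrow> (real \<Rightarrow> real ^ 'n \<Rightarrow> real ^ 'n \<Rightarrow> real ^ 'n \<Rightarrow> real)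
    \<Rightarrow> (real ^ 'n \<Rightarrow> real ^ 'n \<Rightarrow> real) \<Rightarrow> bool" where
  "admissible_costs E H0 T l F h \<longleftrightarrow>
     (\<forall>s\<in>{0..T}. \<forall>\<rho>\<in>open_simplex. \<forall>x. \<forall>V\<in>cball 0 l. F s \<rho> x V \<ge> 0) \<and>
     (\<forall>\<rho>\<in>open_simplex. \<forall>x. h \<rho> x \<ge> 0) \<and>
     continuous_on ({0..T} \<times> open_simplex \<times> UNIV \<times> cball 0 l) (\<lambda>(s, \<rho>, x, V). F s \<rho> x V) \<and>
     continuous_on (open_simplex \<times> UNIV) (\<lambda>(\<rho>, x). h \<rho> x) \<and>
     (\<forall>s\<in>{0..T}. \<forall>V\<in>cball 0 l. locally_lipschitz E (\<lambda>\<rho> x. F s \<rho> x V)) \<and>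
     locally_lipschitz E h \<and>
     (\<forall>\<rho>\<in>open_simplex. \<forall>x. \<forall>V\<in>cball 0 l. \<exists>L. L-lipschitz_on {0..T} (\<lambda>s. F s \<rho> x V)) \<and>
     (\<exists>p1\<ge>0. \<exists>C>0. \<forall>s\<in>{0..T}. \<forall>\<rho>\<in>open_simplex. \<forall>x. \<forall>V\<in>cball 0 l.
        max (F s \<rho> x V) (h \<rho> x) \<le> C * (\<bar>H0 \<rho> x\<bar> powr p1 + 1))"


section \<open>The Hamiltonian\<close>

definition grad :: "('a::real_inner \<Rightarrow> real) \<Rightarrow> 'a \<Rightarrow> 'a" where
  "grad f x = (THE D. GDERIV f x :> D)"

definition diag :: "real ^ 'n \<Rightarrow> real ^ 'n ^ 'n" where
  "diag v = (\<chi> i j. if i = j then v $ i else 0)"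

definition controlled_energy ::
  "(real ^ 'n \<Rightarrow> real ^ 'n \<Rightarrow> real) \<Rightarrow> real ^ 'n \<Rightarrow> real ^ 'n \<Rightarrow> real ^ 'n \<Rightarrow> real" where
  "controlled_energy H0 V \<rho> x = H0 \<rho> x + (\<Sum>i\<in>UNIV. V $ i * \<rho> $ i)"

text \<open>The gradient in \<open>\<rho>\<close> is the Euclidean one in \<open>real ^ 'n\<close>, not the tangential one.\<close>

definition hamiltonian ::
  "(real ^ 'n \<Rightarrow> real ^ 'n \<Rightarrow> real) \<Rightarrow> real \<Rightarrow> real ^ 'n ^ 'n
    \<Rightarrow> (real \<Rightarrow> real ^ 'n \<Rightarrow> real ^ 'n \<Rightarrow> real ^ 'n \<Rightarrow> real)
    \<Rightarrow> real \<Rightarrow> real ^ 'n \<Rightarrow> real ^ 'n \<Rightarrow> real ^ 'n \<Rightarrow> real ^ 'n \<Rightarrow> real ^ 'n ^ 'n \<Rightarrow> real" where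
  "hamiltonian H0 l \<sigma> F t \<rho> x p q Q =
     (INF V\<in>cball 0 l.
        p \<bullet> grad (\<lambda>y. controlled_energy H0 V \<rho> y) x
      - q \<bullet> grad (\<lambda>r. controlled_energy H0 V r x) \<rho>
      + 1 / 2 * trace (\<sigma> ** transpose \<sigma> ** Q)
      + F t \<rho> x V)"


section \<open>Viscosity solutions\<close>

text \<open>For \<open>\<rho>\<close> in the open simplex, the only case used below, the set restricting \<open>s\<close> is a
  neighbourhood of \<open>0\<close>.\<close>

definition has_simplex_derivative ::
  "(real ^ 'n \<Rightarrow> real) \<Rightarrow> real ^ 'n \<Rightarrow> real ^ 'n \<Rightarrow> bool" where
  "has_simplex_derivative f p \<rho> \<longleftrightarrow>
     (\<Sum>i\<in>UNIV. p $ i) = 0 \<and>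
     (\<forall>\<mu>\<in>prob_simplex.
        ((\<lambda>s. (f ((1 - s) *\<^sub>R \<rho> + s *\<^sub>R \<mu>) - f \<rho>) / s) \<longlongrightarrow> p \<bullet> (\<mu> - \<rho>))
          (at 0 within {s. (1 - s) *\<^sub>R \<rho> + s *\<^sub>R \<mu> \<in> prob_simplex}))"

text \<open>\<open>test_function T \<phi> \<phi>t \<phi>\<rho> \<phi>x \<phi>xx\<close> says that \<open>\<phi>\<close> is of class \<open>C\<^sup>1\<close> in \<open>t\<close>, \<open>C\<^sup>1\<close> in \<open>\<rho>\<close> and
  \<open>C\<^sup>2\<close> in \<open>x\<close>, with these derivatives, jointly continuous in all variables.\<close>

definition test_function ::
  "real \<Rightarrow> (real \<times> (real ^ 'n) \<times> (real ^ 'n) \<Rightarrow> real)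
    \<Rightarrow> (real \<times> (real ^ 'n) \<times> (real ^ 'n) \<Rightarrow> real)
    \<Rightarrow> (real \<times> (real ^ 'n) \<times> (real ^ 'n) \<Rightarrow> real ^ 'n)
    \<Rightarrow> (real \<times> (real ^ 'n) \<times> (real ^ 'n) \<Rightarrow> real ^ 'n)
    \<Rightarrow> (real \<times> (real ^ 'n) \<times> (real ^ 'n) \<Rightarrow> real ^ 'n ^ 'n) \<Rightarrow> bool" where
  "test_function T \<phi> \<phi>t \<phi>\<rho> \<phi>x \<phi>xx \<longleftrightarrow>
     (let D = {0<..<T} \<times> open_simplex \<times> UNIV in
      continuous_on D \<phi> \<and> continuous_on D \<phi>t \<and> continuous_on D \<phi>\<rho> \<and>
      continuous_on D \<phi>x \<and> continuous_on D \<phi>xx \<and>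
      (\<forall>(t, \<rho>, x)\<in>D.
         ((\<lambda>s. \<phi> (s, \<rho>, x)) has_real_derivative \<phi>t (t, \<rho>, x)) (at t) \<and>
         has_simplex_derivative (\<lambda>r. \<phi> (t, r, x)) (\<phi>\<rho> (t, \<rho>, x)) \<rho> \<and>
         (GDERIV (\<lambda>y. \<phi> (t, \<rho>, y)) x :> \<phi>x (t, \<rho>, x)) \<and>
         ((\<lambda>y. \<phi>x (t, \<rho>, y)) has_derivative (\<lambda>v. \<phi>xx (t, \<rho>, x) *v v)) (at x)))"

definition viscosity_subsolution ::
  "real \<Rightarrow> (real \<Rightarrow> real ^ 'n \<Rightarrow> real ^ 'n \<Rightarrow> real ^ 'n \<Rightarrow> real ^ 'n \<Rightarrow> real ^ 'n ^ 'n \<Rightarrow> real)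
    \<Rightarrow> (real ^ 'n \<Rightarrow> real ^ 'n \<Rightarrow> real) \<Rightarrow> (real \<times> (real ^ 'n) \<times> (real ^ 'n) \<Rightarrow> real) \<Rightarrow> bool" where
  "viscosity_subsolution T H h U \<longleftrightarrow>
     continuous_on ({0<..T} \<times> open_simplex \<times> UNIV) U \<and>
     (\<forall>\<rho>\<in>open_simplex. \<forall>x. U (T, \<rho>, x) \<le> h \<rho> x) \<and>
     (\<forall>t\<in>{0<..<T}. \<forall>\<rho>\<in>open_simplex. \<forall>x. \<forall>\<phi> \<phi>t \<phi>\<rho> \<phi>x \<phi>xx.
        test_function T \<phi> \<phi>t \<phi>\<rho> \<phi>x \<phi>xx \<and>
        (\<forall>\<^sub>F z in at (t, \<rho>, x) within {0<..<T} \<times> open_simplex \<times> UNIV.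
           U z - \<phi> z \<le> U (t, \<rho>, x) - \<phi> (t, \<rho>, x)) \<longrightarrow>
        \<phi>t (t, \<rho>, x) + H t \<rho> x (\<phi>\<rho> (t, \<rho>, x)) (\<phi>x (t, \<rho>, x)) (\<phi>xx (t, \<rho>, x)) \<ge> 0)"

definition viscosity_supersolution ::
  "real \<Rightarrow> (real \<Rightarrow> real ^ 'n \<Rightarrow> real ^ 'n \<Rightarrow> real ^ 'n \<Rightarrow> real ^ 'n \<Rightarrow> real ^ 'n ^ 'n \<Rightarrow> real)
    \<Rightarrow> (real ^ 'n \<Rightarrow> real ^ 'n \<Rightarrow> real) \<Rightarrow> (real \<times> (real ^ 'n) \<times> (real ^ 'n) \<Rightarrow> real) \<Rightarrow> bool" where
  "viscosity_supersolution T H h U \<longleftrightarrow>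
     continuous_on ({0<..T} \<times> open_simplex \<times> UNIV) U \<and>
     (\<forall>\<rho>\<in>open_simplex. \<forall>x. U (T, \<rho>, x) \<ge> h \<rho> x) \<and>
     (\<forall>t\<in>{0<..<T}. \<forall>\<rho>\<in>open_simplex. \<forall>x. \<forall>\<phi> \<phi>t \<phi>\<rho> \<phi>x \<phi>xx.
        test_function T \<phi> \<phi>t \<phi>\<rho> \<phi>x \<phi>xx \<and>
        (\<forall>\<^sub>F z in at (t, \<rho>, x) within {0<..<T} \<times> open_simplex \<times> UNIV.
           U z - \<phi> z \<ge> U (t, \<rho>, x) - \<phi> (t, \<rho>, x)) \<longrightarrow>
        \<phi>t (t, \<rho>, x) + H t \<rho> x (\<phi>\<rho> (t, \<rho>, x)) (\<phi>x (t, \<rho>, x)) (\<phi>xx (t, \<rho>, x)) \<le> 0)"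

definition viscosity_solution ::
  "real \<Rightarrow> (real \<Rightarrow> real ^ 'n \<Rightarrow> real ^ 'n \<Rightarrow> real ^ 'n \<Rightarrow> real ^ 'n \<Rightarrow> real ^ 'n ^ 'n \<Rightarrow> real)
    \<Rightarrow> (real ^ 'n \<Rightarrow> real ^ 'n \<Rightarrow> real) \<Rightarrow> (real \<times> (real ^ 'n) \<times> (real ^ 'n) \<Rightarrow> real) \<Rightarrow> bool" where
  "viscosity_solution T H h U \<longleftrightarrow>
     viscosity_subsolution T H h U \<and> viscosity_supersolution T H h U"

definition bounded_viscosity_solution ::
  "real \<Rightarrow> (real \<Rightarrow> real ^ 'n \<Rightarrow> real ^ 'n \<Rightarrow> real ^ 'n \<Rightarrow> real ^ 'n \<Rightarrow> real ^ 'n ^ 'n \<Rightarrow> real)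
    \<Rightarrow> (real ^ 'n \<Rightarrow> real ^ 'n \<Rightarrow> real) \<Rightarrow> (real \<times> (real ^ 'n) \<times> (real ^ 'n) \<Rightarrow> real) \<Rightarrow> bool" where
  "bounded_viscosity_solution T H h U \<longleftrightarrow>
     viscosity_solution T H h U \<and> bounded (U ` ({0<..T} \<times> open_simplex \<times> UNIV))"

end

theory Submission
  imports Defs
begin

text \<open>The Hamiltonian is an infimum over controls of first order terms plus a second order term in
  \<open>x\<close> with constant coefficients, so a subsolution is a function that is a subsolution of the linear
  equation for each control separately. This permits a comparison proof without Ishii's lemma. On a
  small ball, replace a subsolution by its sup-convolution, freeze the drift at the centre, and
  approximate by a trigonometric polynomial, for which the constant coefficient resolvent
  \<open>(1 - \<lambda>\<^sup>-\<^sup>1 L)\<^sup>-\<^sup>1\<close> is explicit, so that the maximum principle with a quartic penalty bounds the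
  subsolution by this resolvent. Averaging over small boxes then gives a smooth function close to the
  subsolution which is an approximate subsolution for all controls at once, and it can be used as a
  test function for a strict supersolution.

  Globally, \<open>H0 + sqrt (1 + \<bar>x\<bar>\<^sup>2) / B\<close> is a Lyapunov function: the conservative part of the drift
  preserves \<open>H0\<close>, the control and the noise increase it at most linearly, and on \<open>H0 \<le> R\<close> the
  Fisher information keeps \<open>\<rho>\<close> away from the boundary and \<open>D\<^sub>\<rho> H0\<close> bounded by \<open>B\<close>, so its sublevel
  sets are compact. This localizes the comparison of bounded functions. Existence follows by Perron's
  method, with barriers at the terminal time.\<close>

section \<open>Trigonometric polynomials\<close>

definition c2_fun ::
  "('a::euclidean_space \<Rightarrow> real) \<Rightarrow> ('a \<Rightarrow> 'a) \<Rightarrow> ('a \<Rightarrow> 'a \<Rightarrow> 'a) \<Rightarrow> bool" where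
  "c2_fun f f1 f2 \<longleftrightarrow>
     (\<forall>z. (f has_derivative (\<lambda>v. f1 z \<bullet> v)) (at z)) \<and>
     (\<forall>z. (f1 has_derivative f2 z) (at z)) \<and>
     (\<forall>v. continuous_on UNIV (\<lambda>z. f2 z v))"

lemma gradient_zero_local_max:
  fixes f :: "'a::euclidean_space \<Rightarrow> real"
  assumes "(f has_derivative (\<lambda>v. p \<bullet> v)) (at z)" and "\<forall>\<^sub>F y in at z. f y \<le> f z"
  shows "p = 0"
proof -
  obtain S where S: "open S" "z \<in> S" "\<And>y. y \<in> S \<Longrightarrow> y \<noteq> z \<Longrightarrow> f y \<le> f z"
    using assms(2) unfolding eventually_at_topological by blast
  have "(\<lambda>v. p \<bullet> v) = (\<lambda>v. 0)"
    by (rule differential_zero_maxmin[OF S(2,1) assms(1)]) (metis S(3) order_refl)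
  then have "p \<bullet> p = 0" by (rule fun_cong)
  then show ?thesis by simp
qed

lemma hessian_nonpos_local_max:
  fixes f :: "'a::euclidean_space \<Rightarrow> real"
  assumes d1: "\<And>y. (f has_derivative (\<lambda>v. f1 y \<bullet> v)) (at y)"
    and d2: "(f1 has_derivative f2) (at z)"
    and mx: "\<forall>\<^sub>F y in at z. f y \<le> f z"
  shows "f2 v \<bullet> v \<le> 0"
proof (rule ccontr)
  assume "\<not> ?thesis"
  then have pos: "f2 v \<bullet> v > 0" by simp
  define g where "g s = f (z + s *\<^sub>R v)" for s
  define g' where "g' s = f1 (z + s *\<^sub>R v) \<bullet> v" for s
  have line: "((\<lambda>s. z + s *\<^sub>R v) has_derivative (\<lambda>h. h *\<^sub>R v)) (at s)" for s
    by (auto intro!: derivative_eq_intros)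
  have g1: "(g has_real_derivative g' s) (at s)" for s
  proof -
    have "(g has_derivative (\<lambda>h. f1 (z + s *\<^sub>R v) \<bullet> (h *\<^sub>R v))) (at s)"
      unfolding g_def by (rule has_derivative_compose[OF line d1])
    then show ?thesis
      unfolding has_field_derivative_def g'_def
      by (rule has_derivative_eq_rhs) (auto simp: fun_eq_iff)
  qed
  have "((\<lambda>s. f1 (z + s *\<^sub>R v)) has_derivative (\<lambda>h. f2 (h *\<^sub>R v))) (at 0)"
    using has_derivative_compose[OF line[of 0], of f1 f2] d2 by simp
  then have "((\<lambda>s. f1 (z + s *\<^sub>R v) \<bullet> v) has_derivative (\<lambda>h. f2 (h *\<^sub>R v) \<bullet> v)) (at 0)"
    by (rule has_derivative_inner_left)
  then have g2: "(g' has_real_derivative f2 v \<bullet> v) (at 0)"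
    unfolding g'_def has_field_derivative_def
    by (rule has_derivative_eq_rhs)
       (auto simp: fun_eq_iff linear_cmul[OF has_derivative_linear[OF d2]])
  have "f1 z = 0" by (rule gradient_zero_local_max[OF d1 mx])
  then have g'0: "g' 0 = 0" by (simp add: g'_def)
  obtain d where d: "d > 0" "\<And>h. 0 < h \<Longrightarrow> h < d \<Longrightarrow> g' h > 0"
    using DERIV_pos_inc_right[OF g2 pos] g'0 by auto
  have "((\<lambda>s. z + s *\<^sub>R v) \<longlongrightarrow> z) (at 0)"
    by (auto intro!: tendsto_eq_intros)
  moreover obtain S where S: "open S" "z \<in> S" "\<And>y. y \<in> S \<Longrightarrow> y \<noteq> z \<Longrightarrow> f y \<le> f z"
    using mx unfolding eventually_at_topological by blast
  ultimately have "\<forall>\<^sub>F s in at 0. z + s *\<^sub>R v \<in> S"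
    using topological_tendstoD by blast
  then obtain d' where d': "d' > 0" "\<And>s. s \<noteq> 0 \<Longrightarrow> \<bar>s\<bar> < d' \<Longrightarrow> z + s *\<^sub>R v \<in> S"
    unfolding eventually_at by (auto simp: dist_real_def)
  define s where "s = min d d' / 2"
  have s: "0 < s" "s < d" "s < d'" using d d' by (auto simp: s_def)
  have "\<exists>x. x > 0 \<and> x < s \<and> g s - g 0 = (s - 0) * g' x"
    using MVT2[of 0 s g g'] s g1 by blast
  then obtain x where x: "0 < x" "x < s" "g s - g 0 = s * g' x" by auto
  have "g' x > 0" using d(2) x s by simp
  then have "g s > g 0" using x s by (metis diff_gt_0_iff_gt mult_pos_pos)
  moreover have "g s \<le> g 0"
    using S(3)[OF d'(2)[of s]] s by (cases "z + s *\<^sub>R v = z") (auto simp: g_def)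
  ultimately show False by simp
qed

definition wave :: "'a::euclidean_space \<Rightarrow> real \<Rightarrow> real \<Rightarrow> 'a \<Rightarrow> real" where
  "wave k a b z = a * cos (k \<bullet> z) + b * sin (k \<bullet> z)"

inductive trig_poly :: "real \<Rightarrow> ('a::euclidean_space \<Rightarrow> real) \<Rightarrow> bool" for c where
  wave: "(\<And>v. v \<in> Basis \<Longrightarrow> \<exists>m::int. k \<bullet> v = c * of_int m) \<Longrightarrow> trig_poly c (wave k a b)"
| add: "trig_poly c f \<Longrightarrow> trig_poly c g \<Longrightarrow> trig_poly c (\<lambda>z. f z + g z)"

definition dd :: "'a::euclidean_space \<Rightarrow> ('a \<Rightarrow> real) \<Rightarrow> 'a \<Rightarrow> real" where
  "dd x f z = frechet_derivative f (at z) x"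

definition lin_gen :: "'a::euclidean_space \<Rightarrow> 'i set \<Rightarrow> ('i \<Rightarrow> 'a) \<Rightarrow> ('a \<Rightarrow> real) \<Rightarrow> 'a \<Rightarrow> real" where
  "lin_gen b I e f z = dd b f z + 1 / 2 * (\<Sum>i\<in>I. dd (e i) (dd (e i) f) z)"

lemma wave_has_derivative:
  "(wave k a b has_derivative (\<lambda>v. (k \<bullet> v) * wave k b (- a) z)) (at z)"
  unfolding wave_def[abs_def]
  by (auto intro!: derivative_eq_intros simp: fun_eq_iff algebra_simps)

lemma dd_eqI: "(f has_derivative f') (at z) \<Longrightarrow> dd x f z = f' x"
  unfolding dd_def by (simp add: frechet_derivative_at[symmetric])

lemma dd_wave: "dd x (wave k a b) = wave k ((k \<bullet> x) * b) (- (k \<bullet> x) * a)"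
  by (rule ext, subst dd_eqI[OF wave_has_derivative]) (simp add: wave_def algebra_simps)

lemma trig_poly_differentiable: "trig_poly c f \<Longrightarrow> f differentiable (at z)"
  by (induction rule: trig_poly.induct)
     (auto intro: differentiableI[OF wave_has_derivative])

lemma trig_poly_has_derivative:
  "trig_poly c f \<Longrightarrow> (f has_derivative (\<lambda>x. dd x f z)) (at z)"
  unfolding dd_def using frechet_derivative_works trig_poly_differentiable by fastforce

lemma trig_poly_continuous: "trig_poly c f \<Longrightarrow> continuous_on A f"
  by (meson differentiable_imp_continuous_within continuous_at_imp_continuous_on
      trig_poly_differentiable)

lemma dd_add:
  "trig_poly c f \<Longrightarrow> trig_poly c g \<Longrightarrow> dd x (\<lambda>z. f z + g z) = (\<lambda>z. dd x f z + dd x g z)"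
  by (rule ext) (rule dd_eqI, intro has_derivative_add trig_poly_has_derivative)

lemma trig_poly_dd: "trig_poly c f \<Longrightarrow> trig_poly c (dd x f)"
proof (induction rule: trig_poly.induct)
  case (wave k a b)
  then show ?case unfolding dd_wave by (rule trig_poly.wave)
next
  case (add f g)
  then show ?case by (simp add: dd_add trig_poly.add)
qed

lemma dd_sum_basis: "trig_poly c f \<Longrightarrow> dd x f z = (\<Sum>b\<in>Basis. (x \<bullet> b) * dd b f z)"
proof -
  assume "trig_poly c f"
  then interpret linear "\<lambda>x. dd x f z"
    by (rule has_derivative_linear[OF trig_poly_has_derivative])
  show ?thesis
    by (subst (1) euclidean_representation[of x, symmetric]) (simp add: sum scale)
qed

lemma dd_commute: "trig_poly c f \<Longrightarrow> dd x (dd y f) = dd y (dd x f)"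
proof (induction rule: trig_poly.induct)
  case (wave k a b)
  then show ?case by (simp add: dd_wave mult_ac)
next
  case (add f g)
  then show ?case by (simp add: dd_add[where c = c] trig_poly_dd)
qed

lemma trig_poly_scale: "trig_poly c f \<Longrightarrow> trig_poly c (\<lambda>z. s * f z)"
proof (induction rule: trig_poly.induct)
  case (wave k a b)
  have "(\<lambda>z. s * wave k a b z) = wave k (s * a) (s * b)"
    by (auto simp: wave_def fun_eq_iff algebra_simps)
  then show ?case using trig_poly.wave[OF wave] by simp
next
  case (add f g)
  then show ?case by (simp add: trig_poly.add distrib_left)
qed

lemma trig_poly_const: "trig_poly c (\<lambda>z. s)"
proof -
  have "trig_poly c (wave 0 s 0)" by (rule trig_poly.wave) (auto intro: exI[of _ 0])
  then show ?thesis by (simp add: wave_def[abs_def])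
qed

lemma trig_poly_sum: "(\<And>i. i \<in> S \<Longrightarrow> trig_poly c (f i)) \<Longrightarrow> trig_poly c (\<lambda>z. \<Sum>i\<in>S. f i z)"
  by (induction S rule: infinite_finite_induct) (auto intro: trig_poly_const trig_poly.add)

lemma trig_poly_wave_mult:
  assumes k: "\<And>v. v \<in> Basis \<Longrightarrow> \<exists>m::int. k \<bullet> v = c * of_int m"
    and g: "trig_poly c g"
  shows "trig_poly c (\<lambda>z. wave k a b z * g z)"
  using g
proof (induction rule: trig_poly.induct)
  case (wave j a' b')
  have p: "\<exists>m::int. (k + j) \<bullet> v = c * of_int m" and m: "\<exists>m::int. (k - j) \<bullet> v = c * of_int m"
    if v: "v \<in> Basis" for v
  proof -
    obtain m n :: int where mn: "k \<bullet> v = c * of_int m" "j \<bullet> v = c * of_int n"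
      using k[OF v] wave[OF v] by auto
    have "(k + j) \<bullet> v = c * of_int (m + n)" "(k - j) \<bullet> v = c * of_int (m - n)"
      by (simp_all add: inner_add_left inner_diff_left mn distrib_left right_diff_distrib)
    then show "\<exists>m::int. (k + j) \<bullet> v = c * of_int m" "\<exists>m::int. (k - j) \<bullet> v = c * of_int m"
      by blast+
  qed
  have "(\<lambda>z. wave k a b z * wave j a' b' z) =
     (\<lambda>z. 1 / 2 * (wave (k + j) (a * a' - b * b') (a * b' + b * a') z
        + wave (k - j) (a * a' + b * b') (b * a' - a * b') z))"
  proof
    fix z
    have "2 * (wave k a b z * wave j a' b' z) = wave (k + j) (a * a' - b * b') (a * b' + b * a') z
        + wave (k - j) (a * a' + b * b') (b * a' - a * b') z"
      unfolding wave_def inner_add_left inner_diff_left cos_add cos_diff sin_add sin_diff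
      by algebra
    then show "wave k a b z * wave j a' b' z =
      1 / 2 * (wave (k + j) (a * a' - b * b') (a * b' + b * a') z
        + wave (k - j) (a * a' + b * b') (b * a' - a * b') z)" by simp
  qed
  moreover have "trig_poly c \<dots>"
    by (intro trig_poly_scale trig_poly.add trig_poly.wave p m)
  ultimately show ?case by simp
next
  case (add f g)
  then show ?case by (simp add: trig_poly.add distrib_left)
qed

lemma trig_poly_mult: "trig_poly c f \<Longrightarrow> trig_poly c g \<Longrightarrow> trig_poly c (\<lambda>z. f z * g z)"
proof (induction rule: trig_poly.induct)
  case (wave k a b)
  then show ?case by (simp add: trig_poly_wave_mult)
next
  case (add f g)
  then show ?case by (simp add: trig_poly.add distrib_right)
qed

lemma dd_eq_inner: "trig_poly c f \<Longrightarrow> dd x f z = (\<Sum>b\<in>Basis. dd b f z *\<^sub>R b) \<bullet> x"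
  by (subst dd_sum_basis, assumption)
     (auto simp: inner_sum_left inner_commute[of x] mult.commute intro!: sum.cong)

lemma trig_poly_c2:
  assumes "trig_poly c f"
  shows "c2_fun f (\<lambda>z. \<Sum>b\<in>Basis. dd b f z *\<^sub>R b) (\<lambda>z v. \<Sum>b\<in>Basis. dd v (dd b f) z *\<^sub>R b)"
proof -
  have "(f has_derivative (\<lambda>v. (\<Sum>b\<in>Basis. dd b f z *\<^sub>R b) \<bullet> v)) (at z)" for z
    by (rule has_derivative_eq_rhs[OF trig_poly_has_derivative[OF assms]])
       (rule ext, rule dd_eq_inner[OF assms])
  moreover have "((\<lambda>z. \<Sum>b\<in>Basis. dd b f z *\<^sub>R b) has_derivative
      (\<lambda>v. \<Sum>b\<in>Basis. dd v (dd b f) z *\<^sub>R b)) (at z)" for z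
    by (intro has_derivative_sum has_derivative_scaleR_left trig_poly_has_derivative[of c]
        trig_poly_dd assms)
  moreover have "continuous_on UNIV (\<lambda>z. \<Sum>b\<in>Basis. dd v (dd b f) z *\<^sub>R b)" for v
    by (intro continuous_intros trig_poly_continuous[of c] trig_poly_dd assms)
  ultimately show ?thesis unfolding c2_fun_def by blast
qed

lemma lin_gen_add:
  "trig_poly c f \<Longrightarrow> trig_poly c g \<Longrightarrow>
    lin_gen b I e (\<lambda>z. f z + g z) = (\<lambda>z. lin_gen b I e f z + lin_gen b I e g z)"
  unfolding lin_gen_def
  by (auto simp: fun_eq_iff dd_add[where c = c] trig_poly_dd sum.distrib algebra_simps)

lemma trig_poly_lin_gen: "trig_poly c f \<Longrightarrow> trig_poly c (lin_gen b I e f)"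
  unfolding lin_gen_def[abs_def]
  by (intro trig_poly.add trig_poly_scale trig_poly_sum trig_poly_dd)

lemma lin_gen_wave:
  fixes k :: "'a::euclidean_space"
  defines "p \<equiv> \<lambda>b. k \<bullet> b"
  shows "lin_gen b I e (wave k \<alpha> \<beta>) =
    wave k ((k \<bullet> b) * \<beta> - (1/2 * (\<Sum>i\<in>I. (k \<bullet> e i)\<^sup>2)) * \<alpha>)
           (- (k \<bullet> b) * \<alpha> - (1/2 * (\<Sum>i\<in>I. (k \<bullet> e i)\<^sup>2)) * \<beta>)"
proof
  fix z
  have "(\<Sum>i\<in>I. dd (e i) (dd (e i) (wave k \<alpha> \<beta>)) z) = (\<Sum>i\<in>I. (k \<bullet> e i)\<^sup>2 * (- wave k \<alpha> \<beta> z))"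
    by (intro sum.cong) (auto simp: dd_wave wave_def power2_eq_square algebra_simps sum_negf)
  also have "\<dots> = (\<Sum>i\<in>I. (k \<bullet> e i)\<^sup>2) * (- wave k \<alpha> \<beta> z)"
    by (subst sum_distrib_right) simp
  finally show "lin_gen b I e (wave k \<alpha> \<beta>) z =
    wave k ((k \<bullet> b) * \<beta> - (1/2 * (\<Sum>i\<in>I. (k \<bullet> e i)\<^sup>2)) * \<alpha>)
           (- (k \<bullet> b) * \<alpha> - (1/2 * (\<Sum>i\<in>I. (k \<bullet> e i)\<^sup>2)) * \<beta>) z"
    unfolding lin_gen_def by (simp add: dd_wave wave_def algebra_simps)
qed

lemma trig_poly_resolvent:
  assumes "trig_poly c g" "lam > 0"
  shows "\<exists>f. trig_poly c f \<and> (\<forall>z. lam * f z - lin_gen b I e f z = lam * g z)"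
  using assms(1)
proof (induction rule: trig_poly.induct)
  case (wave k \<alpha> \<beta>)
  define p q where "p = k \<bullet> b" and "q = 1/2 * (\<Sum>i\<in>I. (k \<bullet> e i)\<^sup>2)"
  define s where "s = lam + q"
  have "q \<ge> 0" unfolding q_def by (simp add: sum_nonneg)
  then have "s > 0" using assms(2) by (simp add: s_def)
  then have "s\<^sup>2 + p\<^sup>2 > 0" by (simp add: add_pos_nonneg)
  then have D: "x * (s\<^sup>2 + p\<^sup>2) / (s\<^sup>2 + p\<^sup>2) = x" for x
    by (intro nonzero_mult_div_cancel_right less_imp_neq[symmetric])
  define a' b' where "a' = lam * (s * \<alpha> + p * \<beta>) / (s\<^sup>2 + p\<^sup>2)"
    and "b' = lam * (s * \<beta> - p * \<alpha>) / (s\<^sup>2 + p\<^sup>2)"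
  have "s * a' - p * b' = lam * \<alpha> * (s\<^sup>2 + p\<^sup>2) / (s\<^sup>2 + p\<^sup>2)"
    unfolding a'_def b'_def times_divide_eq_right diff_divide_distrib[symmetric]
    by (simp add: algebra_simps power2_eq_square)
  then have e1: "s * a' - p * b' = lam * \<alpha>" unfolding D .
  have "p * a' + s * b' = lam * \<beta> * (s\<^sup>2 + p\<^sup>2) / (s\<^sup>2 + p\<^sup>2)"
    unfolding a'_def b'_def times_divide_eq_right add_divide_distrib[symmetric]
    by (simp add: algebra_simps power2_eq_square)
  then have e2: "p * a' + s * b' = lam * \<beta>" unfolding D .
  have "lam * wave k a' b' z - lin_gen b I e (wave k a' b') z = lam * wave k \<alpha> \<beta> z" for z
  proof -
    have "lam * wave k a' b' z - lin_gen b I e (wave k a' b') z =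
      (s * a' - p * b') * cos (k \<bullet> z) + (p * a' + s * b') * sin (k \<bullet> z)"
      unfolding lin_gen_wave p_def[symmetric] q_def[symmetric] s_def wave_def
      by (simp add: algebra_simps)
    then show ?thesis unfolding e1 e2 by (simp add: wave_def algebra_simps)
  qed
  moreover have "trig_poly c (wave k a' b')" by (rule trig_poly.wave[OF wave])
  ultimately show ?case by blast
next
  case (add f g)
  then obtain f' g' where *: "trig_poly c f'" "\<And>z. lam * f' z - lin_gen b I e f' z = lam * f z"
    "trig_poly c g'" "\<And>z. lam * g' z - lin_gen b I e g' z = lam * g z" by blast
  show ?case
    by (rule exI[of _ "\<lambda>z. f' z + g' z"])
       (use *(2,4) in \<open>auto simp: trig_poly.add lin_gen_add[OF *(1,3)] *(1,3) algebra_simps\<close>)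
qed

lemma trig_poly_periodic:
  assumes "trig_poly c f" "c > 0"
  shows "f (z - (\<Sum>b\<in>Basis. (2 * pi / c * of_int (n b)) *\<^sub>R b)) = f z"
  using assms(1)
proof (induction rule: trig_poly.induct)
  case (wave k \<alpha> \<beta>)
  have "\<forall>v\<in>Basis. \<exists>m::int. k \<bullet> v = c * of_int m" using wave by blast
  then obtain m :: "'a \<Rightarrow> int" where m: "\<And>v. v \<in> Basis \<Longrightarrow> k \<bullet> v = c * of_int (m v)" by metis
  have "k \<bullet> (\<Sum>b\<in>Basis. (2 * pi / c * of_int (n b)) *\<^sub>R b)
      = (\<Sum>b\<in>Basis. 2 * pi * of_int (n b * m b))"
    unfolding inner_sum_right by (intro sum.cong) (auto simp: m assms(2) less_imp_neq[symmetric])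
  also have "\<dots> = 2 * pi * of_int (\<Sum>b\<in>Basis. n b * m b)"
    by (simp add: sum_distrib_left)
  finally have "k \<bullet> (z - (\<Sum>b\<in>Basis. (2 * pi / c * of_int (n b)) *\<^sub>R b))
     = k \<bullet> z - 2 * pi * of_int (\<Sum>b\<in>Basis. n b * m b)" by (simp add: inner_diff_right)
  then show ?case
    unfolding wave_def by (simp only: cos_diff sin_diff cos_int_2pin sin_int_2pin) simp
next
  case (add f g)
  then show ?case by simp
qed

lemma trig_poly_attains_max:
  fixes f :: "'a::euclidean_space \<Rightarrow> real"
  assumes "trig_poly c f" "c > 0"
  shows "\<exists>z. \<forall>y. f y \<le> f z"
proof -
  let ?B = "cbox (0::'a) ((2 * pi / c) *\<^sub>R One)"
  have "(0::'a) \<in> ?B" using assms(2) by (auto simp: mem_box)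
  then have "?B \<noteq> {}" by blast
  then obtain z where z: "z \<in> ?B" "\<And>y. y \<in> ?B \<Longrightarrow> f y \<le> f z"
    using continuous_attains_sup[OF compact_cbox _ trig_poly_continuous[OF assms(1)]] by blast
  have "f y \<le> f z" for y
  proof -
    define P where "P = 2 * pi / c"
    have P: "P > 0" using assms(2) by (simp add: P_def)
    define y' where "y' = y - (\<Sum>b\<in>Basis. (P * of_int \<lfloor>(y \<bullet> b) / P\<rfloor>) *\<^sub>R b)"
    have "y' \<bullet> b = P * frac ((y \<bullet> b) / P)" if "b \<in> Basis" for b
      using that P by (simp add: y'_def inner_diff_left inner_sum_left_Basis frac_def right_diff_distrib)
    then have "y' \<in> ?B"
      using P by (auto simp: mem_box P_def[symmetric] frac_ge_0 less_imp_le[OF frac_lt_1])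
    then have "f y' \<le> f z" by (rule z(2))
    moreover have "f y' = f y" unfolding y'_def P_def by (rule trig_poly_periodic[OF assms])
    ultimately show ?thesis by simp
  qed
  then show ?thesis by blast
qed

lemma lin_gen_le_0_at_max:
  assumes f: "trig_poly c f" and z: "\<And>y. f y \<le> f z"
  shows "lin_gen b I e f z \<le> 0"
proof -
  let ?f1 = "\<lambda>z. \<Sum>b\<in>Basis. dd b f z *\<^sub>R b"
  let ?f2 = "\<lambda>z v. \<Sum>b\<in>Basis. dd v (dd b f) z *\<^sub>R b"
  have c2: "c2_fun f ?f1 ?f2" by (rule trig_poly_c2[OF f])
  have ev: "\<forall>\<^sub>F y in at z. f y \<le> f z" by (simp add: z)
  have "?f1 z = 0"
    by (rule gradient_zero_local_max[OF _ ev]) (use c2 in \<open>auto simp: c2_fun_def\<close>)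
  moreover have "dd b f z = ?f1 z \<bullet> b" by (rule dd_eq_inner[OF f])
  ultimately have "dd b f z = 0" by simp
  moreover have "dd (e i) (dd (e i) f) z \<le> 0" for i
  proof -
    have "?f2 z (e i) \<bullet> e i \<le> 0"
      by (rule hessian_nonpos_local_max[OF _ _ ev, of ?f1]) (use c2 in \<open>auto simp: c2_fun_def\<close>)
    moreover have "?f2 z (e i) \<bullet> e i = dd (e i) (dd (e i) f) z"
      unfolding dd_eq_inner[OF trig_poly_dd[OF f], of "e i" "e i" z]
      by (simp add: dd_commute[OF f, of "e i"])
    ultimately show ?thesis by simp
  qed
  ultimately show ?thesis unfolding lin_gen_def by (simp add: sum_nonpos)
qed

lemma resolvent_le:
  fixes f :: "'a::euclidean_space \<Rightarrow> real"
  assumes f: "trig_poly c f" and "c > 0" "lam > 0"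
    and eq: "\<And>z. lam * f z - lin_gen b I e f z = lam * g z" and g: "\<And>z. g z \<le> C"
  shows "f y \<le> C"
proof -
  obtain z where z: "\<And>y. f y \<le> f z" using trig_poly_attains_max[OF f \<open>c > 0\<close>] by blast
  have "lam * f z \<le> lam * g z" using eq[of z] lin_gen_le_0_at_max[OF f z, of b I e] by simp
  then have "f z \<le> C" using \<open>lam > 0\<close> g[of z] by simp
  then show ?thesis using z[of y] by simp
qed

lemma lin_gen_minus: "trig_poly c f \<Longrightarrow> lin_gen b I e (\<lambda>z. - f z) = (\<lambda>z. - lin_gen b I e f z)"
proof -
  assume f: "trig_poly c f"
  have m: "dd x (\<lambda>z. - f z) = (\<lambda>z. - dd x f z)" if "trig_poly c f" for f x
    by (rule ext) (rule dd_eqI, intro has_derivative_minus trig_poly_has_derivative[OF that])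
  show ?thesis
    by (auto simp: fun_eq_iff lin_gen_def m[OF f] m[OF trig_poly_dd[OF f]] sum_negf)
qed

lemma resolvent_bound:
  fixes f :: "'a::euclidean_space \<Rightarrow> real"
  assumes f: "trig_poly c f" and "c > 0" "lam > 0"
    and eq: "\<And>z. lam * f z - lin_gen b I e f z = lam * g z" and g: "\<And>z. \<bar>g z\<bar> \<le> C"
  shows "\<bar>f y\<bar> \<le> C"
proof -
  have "f y \<le> C" by (rule resolvent_le[OF assms(1-4)]) (use g in \<open>meson abs_le_D1\<close>)
  moreover have "- f y \<le> C"
  proof (rule resolvent_le[OF _ assms(2,3), of "\<lambda>z. - f z" _ _ _ "\<lambda>z. - g z"])
    show "trig_poly c (\<lambda>z. - f z)" using trig_poly_scale[OF f, of "-1"] by simp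
    show "lam * - f z - lin_gen b I e (\<lambda>z. - f z) z = lam * - g z" for z
      using eq[of z] by (simp add: lin_gen_minus[OF f])
    show "- g z \<le> C" for z using g[of z] by simp
  qed
  ultimately show ?thesis by simp
qed

lemma trig_poly_sin_basis: "v \<in> Basis \<Longrightarrow> trig_poly c (\<lambda>z. sin (c * (z \<bullet> v)))"
proof -
  assume v: "v \<in> Basis"
  have "trig_poly c (wave (c *\<^sub>R v) 0 1)"
  proof (rule trig_poly.wave)
    fix w :: 'a assume w: "w \<in> Basis"
    have "(c *\<^sub>R v) \<bullet> w = c * of_int (if v = w then 1 else 0)"
      using v w by (simp add: inner_Basis)
    then show "\<exists>m::int. (c *\<^sub>R v) \<bullet> w = c * of_int m" by blast
  qed
  then show ?thesis by (simp add: wave_def[abs_def] inner_commute)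
qed

lemma trig_poly_real_polynomial:
  assumes "real_polynomial_function p"
  shows "trig_poly c (\<lambda>z. p (\<Sum>v\<in>Basis. sin (c * (z \<bullet> v)) *\<^sub>R v))"
  using assms
proof (induction rule: real_polynomial_function.induct)
  case (linear f)
  then interpret bounded_linear f .
  show ?case
    by (simp add: sum scaleR)
       (intro trig_poly_sum, subst mult.commute, intro trig_poly_scale trig_poly_sin_basis)
next
  case (const a)
  then show ?case by (rule trig_poly_const)
next
  case (add f g)
  then show ?case by (intro trig_poly.add)
next
  case (mult f g)
  then show ?case by (intro trig_poly_mult)
qed

text \<open>On a cube, \<open>c * z\<close> is recovered from its sine by \<open>arcsin\<close>, so polynomials in the sines of the
  coordinates are dense there; they are bounded globally by construction.\<close>

lemma trig_poly_approx:
  fixes u :: "'a::euclidean_space \<Rightarrow> real"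
  assumes "R > 0" "\<epsilon> > 0"
    and cont: "continuous_on {z. \<forall>v\<in>Basis. \<bar>z \<bullet> v\<bar> \<le> R} u"
    and bd: "\<And>z. (\<forall>v\<in>Basis. \<bar>z \<bullet> v\<bar> \<le> R) \<Longrightarrow> \<bar>u z\<bar> \<le> C"
  obtains c f where "c > 0" "trig_poly c f" "\<And>z. (\<forall>v\<in>Basis. \<bar>z \<bullet> v\<bar> \<le> R) \<Longrightarrow> \<bar>f z - u z\<bar> < \<epsilon>"
    "\<And>z. \<bar>f z\<bar> \<le> C + \<epsilon>"
proof -
  define c where "c = pi / (2 * R)"
  have c: "c > 0" using assms(1) by (simp add: c_def)
  let ?Q = "cbox (- One) (One::'a)"
  define \<Theta> where "\<Theta> y = (\<Sum>v\<in>Basis. (arcsin (y \<bullet> v) / c) *\<^sub>R v)" for y :: 'a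
  have inQ: "\<bar>y \<bullet> v\<bar> \<le> 1" if "y \<in> ?Q" "v \<in> Basis" for y v
    using that by (auto simp: mem_box abs_le_iff)
  have \<Theta>: "\<forall>v\<in>Basis. \<bar>\<Theta> y \<bullet> v\<bar> \<le> R" if "y \<in> ?Q" for y
  proof
    fix v :: 'a assume v: "v \<in> Basis"
    have "- 1 \<le> y \<bullet> v" "y \<bullet> v \<le> 1" using inQ[OF that v] by auto
    then have "- (pi / 2) \<le> arcsin (y \<bullet> v)" "arcsin (y \<bullet> v) \<le> pi / 2"
      using arcsin_lbound arcsin_ubound by auto
    then have "\<bar>arcsin (y \<bullet> v)\<bar> \<le> pi / 2" by simp
    then have "\<bar>arcsin (y \<bullet> v)\<bar> / c \<le> (pi / 2) / c"
      using c by (intro divide_right_mono) auto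
    also have "\<dots> = R" using assms(1) by (simp add: c_def field_simps)
    finally show "\<bar>\<Theta> y \<bullet> v\<bar> \<le> R"
      using v c by (simp add: \<Theta>_def inner_sum_left_Basis)
  qed
  have "continuous_on ?Q \<Theta>"
    unfolding \<Theta>_def
    by (intro continuous_intros) (use inQ c in \<open>auto simp: abs_le_iff\<close>)
  then have "continuous_on ?Q (u \<circ> \<Theta>)"
    by (intro continuous_on_compose continuous_on_subset[OF cont]) (use \<Theta> in auto)
  then obtain p where p: "real_polynomial_function p" "\<And>y. y \<in> ?Q \<Longrightarrow> \<bar>(u \<circ> \<Theta>) y - p y\<bar> < \<epsilon>"
    using Stone_Weierstrass_real_polynomial_function[OF compact_cbox _ assms(2)] by blast
  define S where "S z = (\<Sum>v\<in>Basis. sin (c * (z \<bullet> v)) *\<^sub>R v)" for z :: 'a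
  have S: "S z \<in> ?Q" for z
    by (auto simp: mem_box S_def inner_sum_left_Basis)
  have S\<Theta>: "\<Theta> (S z) = z" if "\<forall>v\<in>Basis. \<bar>z \<bullet> v\<bar> \<le> R" for z
  proof (rule euclidean_eqI)
    fix v :: 'a assume v: "v \<in> Basis"
    have "\<bar>c * (z \<bullet> v)\<bar> \<le> c * R" using that v c by (simp add: abs_mult)
    also have "\<dots> = pi / 2" using assms(1) by (simp add: c_def)
    finally have "arcsin (sin (c * (z \<bullet> v))) = c * (z \<bullet> v)"
      by (intro arcsin_sin) (auto simp: abs_le_iff)
    then show "\<Theta> (S z) \<bullet> v = z \<bullet> v"
      using v c by (simp add: \<Theta>_def S_def inner_sum_left_Basis)
  qed
  define f where "f z = p (S z)" for z
  show thesis
  proof (rule that[of c f])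
    show "trig_poly c f" unfolding f_def S_def by (rule trig_poly_real_polynomial[OF p(1)])
    show "\<bar>f z - u z\<bar> < \<epsilon>" if "\<forall>v\<in>Basis. \<bar>z \<bullet> v\<bar> \<le> R" for z
      using p(2)[OF S, of z] S\<Theta>[OF that] by (simp add: f_def abs_minus_commute)
    show "\<bar>f z\<bar> \<le> C + \<epsilon>" for z
      using p(2)[OF S, of z] bd[OF \<Theta>[OF S, of z]] by (simp add: f_def)
  qed (rule c)
qed

section \<open>Averaging over boxes\<close>

definition box_avg :: "real \<Rightarrow> 'a::euclidean_space \<Rightarrow> ('a \<Rightarrow> real) \<Rightarrow> 'a \<Rightarrow> real" where
  "box_avg \<epsilon> v f z = integral {-\<epsilon>..\<epsilon>} (\<lambda>s. f (z + s *\<^sub>R v)) / (2 * \<epsilon>)"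

definition sinc :: "real \<Rightarrow> real" where
  "sinc x = (if x = 0 then 1 else sin x / x)"

lemma trig_poly_line_integrable:
  assumes "trig_poly c f"
  shows "(\<lambda>s. f (z + s *\<^sub>R v)) integrable_on {-\<epsilon>..\<epsilon>}"
proof (rule integrable_continuous_interval)
  have "continuous_on {-\<epsilon>..\<epsilon>} (\<lambda>s. z + s *\<^sub>R v)" by (intro continuous_intros)
  then show "continuous_on {-\<epsilon>..\<epsilon>} (\<lambda>s. f (z + s *\<^sub>R v))"
    by (rule continuous_on_compose2[OF trig_poly_continuous[OF assms, of UNIV]]) simp
qed

lemma box_avg_wave:
  assumes "\<epsilon> > 0"
  shows "box_avg \<epsilon> v (wave k a b) =
    wave k (sinc (\<epsilon> * (k \<bullet> v)) * a) (sinc (\<epsilon> * (k \<bullet> v)) * b)"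
proof
  fix z
  define A B where "A = k \<bullet> z" and "B = k \<bullet> v"
  have w: "wave k a b (z + s *\<^sub>R v) = a * cos (A + B * s) + b * sin (A + B * s)" for s
    by (simp add: wave_def A_def B_def inner_add_right mult.commute)
  show "box_avg \<epsilon> v (wave k a b) z =
    wave k (sinc (\<epsilon> * (k \<bullet> v)) * a) (sinc (\<epsilon> * (k \<bullet> v)) * b) z"
  proof (cases "B = 0")
    case True
    then show ?thesis
      using assms unfolding box_avg_def w by (simp add: sinc_def wave_def A_def B_def)
  next
    case False
    define P where "P s = (a * sin (A + B * s) - b * cos (A + B * s)) / B" for s
    have "((\<lambda>s. a * cos (A + B * s) + b * sin (A + B * s)) has_integral P \<epsilon> - P (- \<epsilon>)) {-\<epsilon>..\<epsilon>}"
    proof (rule fundamental_theorem_of_calculus)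
      show "- \<epsilon> \<le> \<epsilon>" using assms by simp
      show "(P has_vector_derivative a * cos (A + B * s) + b * sin (A + B * s)) (at s within {-\<epsilon>..\<epsilon>})" for s
        unfolding P_def has_real_derivative_iff_has_vector_derivative[symmetric]
        using False by (auto intro!: derivative_eq_intros simp: field_simps)
    qed
    then have "box_avg \<epsilon> v (wave k a b) z = (P \<epsilon> - P (- \<epsilon>)) / (2 * \<epsilon>)"
      unfolding box_avg_def w by (simp add: integral_unique)
    also have "P \<epsilon> - P (- \<epsilon>) = 2 * sin (B * \<epsilon>) / B * (a * cos A + b * sin A)"
      unfolding P_def by (simp add: sin_add cos_add sin_diff cos_diff diff_divide_distrib[symmetric] algebra_simps)
    finally have "box_avg \<epsilon> v (wave k a b) z =
      sin (B * \<epsilon>) / (B * \<epsilon>) * (a * cos A + b * sin A)" by simp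
    moreover have "sinc (\<epsilon> * B) = sin (B * \<epsilon>) / (B * \<epsilon>)"
      using False assms by (simp add: sinc_def mult.commute)
    moreover have "wave k (r * a) (r * b) z = r * (a * cos A + b * sin A)" for r
      by (simp add: wave_def A_def algebra_simps)
    ultimately show ?thesis by (simp only: B_def)
  qed
qed

lemma box_avg_lincomb:
  assumes "trig_poly c f" "trig_poly c g"
  shows "box_avg \<epsilon> v (\<lambda>z. f z + s * g z) = (\<lambda>z. box_avg \<epsilon> v f z + s * box_avg \<epsilon> v g z)"
proof -
  have "integral {-\<epsilon>..\<epsilon>} (\<lambda>t. f (z + t *\<^sub>R v) + s * g (z + t *\<^sub>R v)) =
     integral {-\<epsilon>..\<epsilon>} (\<lambda>t. f (z + t *\<^sub>R v)) + s * integral {-\<epsilon>..\<epsilon>} (\<lambda>t. g (z + t *\<^sub>R v))" for z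
    by (subst integral_add)
       (auto intro!: trig_poly_line_integrable[of c] assms trig_poly_scale)
  then show ?thesis
    unfolding box_avg_def[abs_def] by (simp add: add_divide_distrib)
qed

lemma box_avg_add:
  "trig_poly c f \<Longrightarrow> trig_poly c g \<Longrightarrow>
    box_avg \<epsilon> v (\<lambda>z. f z + g z) = (\<lambda>z. box_avg \<epsilon> v f z + box_avg \<epsilon> v g z)"
  using box_avg_lincomb[of c f g \<epsilon> v 1] by simp

lemma trig_poly_box_avg: "trig_poly c f \<Longrightarrow> \<epsilon> > 0 \<Longrightarrow> trig_poly c (box_avg \<epsilon> v f)"
proof (induction rule: trig_poly.induct)
  case (wave k a b)
  then show ?case by (simp add: box_avg_wave trig_poly.wave)
next
  case (add f g)
  then show ?case by (simp add: box_avg_add[of c] trig_poly.add)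
qed

lemma dd_box_avg:
  "trig_poly c f \<Longrightarrow> \<epsilon> > 0 \<Longrightarrow> dd x (box_avg \<epsilon> v f) = box_avg \<epsilon> v (dd x f)"
proof (induction rule: trig_poly.induct)
  case (wave k a b)
  then show ?case by (simp add: box_avg_wave dd_wave mult_ac)
next
  case (add f g)
  then show ?case
    by (simp add: box_avg_add[of c] dd_add[of c] trig_poly_box_avg trig_poly_dd)
qed

lemma lin_gen_box_avg:
  "trig_poly c f \<Longrightarrow> \<epsilon> > 0 \<Longrightarrow> lin_gen b I e (box_avg \<epsilon> v f) = box_avg \<epsilon> v (lin_gen b I e f)"
proof (induction rule: trig_poly.induct)
  case (wave k a b')
  then show ?case by (simp add: box_avg_wave lin_gen_wave algebra_simps)
next
  case (add f g)
  then show ?case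
    by (simp add: box_avg_add[of c] lin_gen_add[of c] trig_poly_box_avg trig_poly_lin_gen)
qed

lemma dd_box_avg_same:
  "trig_poly c f \<Longrightarrow> \<epsilon> > 0 \<Longrightarrow>
    dd v (box_avg \<epsilon> v f) z = (f (z + \<epsilon> *\<^sub>R v) - f (z - \<epsilon> *\<^sub>R v)) / (2 * \<epsilon>)"
proof (induction rule: trig_poly.induct)
  case (wave k a b)
  show ?case
  proof (cases "k \<bullet> v = 0")
    case True
    then show ?thesis
      unfolding box_avg_wave[OF wave(2)] dd_wave
      by (simp add: wave_def inner_add_right inner_diff_right)
  next
    case False
    then show ?thesis
      using wave(2) unfolding box_avg_wave[OF wave(2)] dd_wave
      by (simp add: wave_def inner_add_right inner_diff_right
          sinc_def sin_add sin_diff cos_add cos_diff field_simps)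
  qed
next
  case (add f g)
  then show ?case
    by (simp add: box_avg_add[of c] dd_add[of c] trig_poly_box_avg add_divide_distrib[symmetric])
qed

lemma box_avg_ge:
  assumes "trig_poly c f" "\<epsilon> > 0" and m: "\<And>s. \<bar>s\<bar> \<le> \<epsilon> \<Longrightarrow> m \<le> f (z + s *\<^sub>R v)"
  shows "m \<le> box_avg \<epsilon> v f z"
proof -
  have "integral {-\<epsilon>..\<epsilon>} (\<lambda>s. m) \<le> integral {-\<epsilon>..\<epsilon>} (\<lambda>s. f (z + s *\<^sub>R v))"
    by (intro integral_le trig_poly_line_integrable[OF assms(1)]) (auto intro: m)
  then show ?thesis
    using \<open>\<epsilon> > 0\<close> by (simp add: box_avg_def pos_le_divide_eq mult.commute)
qed

lemma box_avg_le:
  assumes "trig_poly c f" "\<epsilon> > 0" and m: "\<And>s. \<bar>s\<bar> \<le> \<epsilon> \<Longrightarrow> f (z + s *\<^sub>R v) \<le> m"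
  shows "box_avg \<epsilon> v f z \<le> m"
proof -
  have "integral {-\<epsilon>..\<epsilon>} (\<lambda>s. f (z + s *\<^sub>R v)) \<le> integral {-\<epsilon>..\<epsilon>} (\<lambda>s. m)"
    by (intro integral_le trig_poly_line_integrable[OF assms(1)]) (auto intro: m)
  then show ?thesis
    using \<open>\<epsilon> > 0\<close> by (simp add: box_avg_def pos_divide_le_eq mult.commute)
qed

definition basis_list :: "'a::euclidean_space list" where
  "basis_list = (SOME bs. set bs = Basis \<and> distinct bs)"

lemma set_basis_list [simp]: "set (basis_list :: 'a::euclidean_space list) = Basis"
  and length_basis_list [simp]: "length (basis_list :: 'a::euclidean_space list) = DIM('a)"
proof -
  have *: "set (basis_list :: 'a list) = Basis \<and> distinct (basis_list :: 'a list)"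
    unfolding basis_list_def using someI_ex[OF finite_distinct_list[OF finite_Basis]] .
  then show "set (basis_list :: 'a list) = Basis" by simp
  show "length (basis_list :: 'a list) = DIM('a)" using * distinct_card by metis
qed

definition mollify :: "real \<Rightarrow> ('a::euclidean_space \<Rightarrow> real) \<Rightarrow> 'a \<Rightarrow> real" where
  "mollify \<epsilon> = foldr (box_avg \<epsilon>) basis_list"

lemma trig_poly_avgs: "trig_poly c f \<Longrightarrow> \<epsilon> > 0 \<Longrightarrow> trig_poly c (foldr (box_avg \<epsilon>) vs f)"
  by (induction vs) (auto intro: trig_poly_box_avg)

lemma trig_poly_mollify: "trig_poly c f \<Longrightarrow> \<epsilon> > 0 \<Longrightarrow> trig_poly c (mollify \<epsilon> f)"
  unfolding mollify_def by (rule trig_poly_avgs)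

lemma dd_mollify:
  assumes "trig_poly c f" "\<epsilon> > 0"
  shows "dd x (mollify \<epsilon> f) = mollify \<epsilon> (dd x f)"
proof -
  have "dd x (foldr (box_avg \<epsilon>) vs f) = foldr (box_avg \<epsilon>) vs (dd x f)" for vs
    by (induction vs) (auto simp: dd_box_avg[OF trig_poly_avgs[OF assms] assms(2)])
  then show ?thesis by (simp add: mollify_def)
qed

lemma lin_gen_mollify:
  assumes "trig_poly c f" "\<epsilon> > 0"
  shows "lin_gen b I e (mollify \<epsilon> f) = mollify \<epsilon> (lin_gen b I e f)"
proof -
  have "lin_gen b I e (foldr (box_avg \<epsilon>) vs f) = foldr (box_avg \<epsilon>) vs (lin_gen b I e f)" for vs
    by (induction vs) (auto simp: lin_gen_box_avg[OF trig_poly_avgs[OF assms] assms(2)])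
  then show ?thesis by (simp add: mollify_def)
qed

lemma mollify_lincomb:
  assumes "trig_poly c f" "trig_poly c g" "\<epsilon> > 0"
  shows "mollify \<epsilon> (\<lambda>z. f z + s * g z) = (\<lambda>z. mollify \<epsilon> f z + s * mollify \<epsilon> g z)"
proof -
  have "foldr (box_avg \<epsilon>) vs (\<lambda>z. f z + s * g z) =
     (\<lambda>z. foldr (box_avg \<epsilon>) vs f z + s * foldr (box_avg \<epsilon>) vs g z)" for vs
    by (induction vs)
       (auto simp: box_avg_lincomb[OF trig_poly_avgs[OF assms(1,3)] trig_poly_avgs[OF assms(2,3)]])
  then show ?thesis by (simp add: mollify_def)
qed

lemma avgs_bounds:
  fixes f :: "'a::euclidean_space \<Rightarrow> real" and \<epsilon> r :: real
  assumes "trig_poly c f" "\<epsilon> > 0"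
    and "\<And>v. v \<in> set vs \<Longrightarrow> norm v = 1"
    and "\<And>y. dist z y \<le> real (length vs) * \<epsilon> + r \<Longrightarrow> l \<le> f y \<and> f y \<le> u" "dist z y \<le> r"
  shows "l \<le> foldr (box_avg \<epsilon>) vs f y \<and> foldr (box_avg \<epsilon>) vs f y \<le> u"
  using assms(3-)
proof (induction vs arbitrary: y r)
  case Nil
  then show ?case by simp
next
  case (Cons v vs)
  have "l \<le> foldr (box_avg \<epsilon>) vs f (y + s *\<^sub>R v) \<and> foldr (box_avg \<epsilon>) vs f (y + s *\<^sub>R v) \<le> u"
    if s: "\<bar>s\<bar> \<le> \<epsilon>" for s
  proof (rule Cons.IH[of "r + \<epsilon>"])
    show "norm w = 1" if "w \<in> set vs" for w using Cons.prems(1) that by simp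
    show "l \<le> f x \<and> f x \<le> u" if "dist z x \<le> real (length vs) * \<epsilon> + (r + \<epsilon>)" for x
      by (rule Cons.prems(2)) (use that in \<open>simp add: algebra_simps\<close>)
    have "dist z (y + s *\<^sub>R v) \<le> dist z y + dist y (y + s *\<^sub>R v)" by (rule dist_triangle)
    also have "\<dots> \<le> r + \<epsilon>"
      using Cons.prems(3) s Cons.prems(1)[of v] by (simp add: dist_norm)
    finally show "dist z (y + s *\<^sub>R v) \<le> r + \<epsilon>" .
  qed
  then show ?case
    using box_avg_ge[OF trig_poly_avgs[OF assms(1,2)] assms(2)]
      box_avg_le[OF trig_poly_avgs[OF assms(1,2)] assms(2)] by simp
qed

lemma mollify_bounds:
  fixes f :: "'a::euclidean_space \<Rightarrow> real" and \<epsilon> r :: real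
  assumes "trig_poly c f" "\<epsilon> > 0"
    and "\<And>y. dist z y \<le> real DIM('a) * \<epsilon> + r \<Longrightarrow> l \<le> f y \<and> f y \<le> u" "dist z y \<le> r"
  shows "l \<le> mollify \<epsilon> f y \<and> mollify \<epsilon> f y \<le> u"
  unfolding mollify_def
  by (rule avgs_bounds[OF assms(1,2) _ _ assms(4)]) (use assms(3) in auto)

lemma mollify_abs_le:
  fixes f :: "'a::euclidean_space \<Rightarrow> real"
  assumes "trig_poly c f" "\<epsilon> > 0" "\<And>y. \<bar>f y\<bar> \<le> C"
  shows "\<bar>mollify \<epsilon> f y\<bar> \<le> C"
proof -
  have "- C \<le> mollify \<epsilon> f y \<and> mollify \<epsilon> f y \<le> C"
    by (rule mollify_bounds[OF assms(1,2), of y 0])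
       (use assms(3) in \<open>auto simp: abs_le_iff minus_le_iff\<close>)
  then show ?thesis by (simp add: abs_le_iff)
qed

lemma dd_mollify_bound:
  fixes f :: "'a::euclidean_space \<Rightarrow> real"
  assumes f: "trig_poly c f" and \<epsilon>: "\<epsilon> > 0" and C: "\<And>y. \<bar>f y\<bar> \<le> C"
  shows "\<bar>dd x (mollify \<epsilon> f) z\<bar> \<le> norm x * DIM('a) / \<epsilon> * C"
proof -
  have avgs: "\<bar>foldr (box_avg \<epsilon>) vs g y\<bar> \<le> D"
    if "trig_poly c g" "\<And>y. \<bar>g y\<bar> \<le> D" for vs g D y
  proof (induction vs arbitrary: y)
    case (Cons v vs)
    then have "- D \<le> foldr (box_avg \<epsilon>) vs g y \<and> foldr (box_avg \<epsilon>) vs g y \<le> D" for y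
      by (metis abs_le_D1 abs_le_D2 minus_le_iff)
    then show ?case
      using box_avg_ge[OF trig_poly_avgs[OF that(1) \<epsilon>, of vs] \<epsilon>, where m = "- D" and z = y and v = v]
        box_avg_le[OF trig_poly_avgs[OF that(1) \<epsilon>, of vs] \<epsilon>, where m = D and z = y and v = v] by (simp add: abs_le_iff)
  qed (simp add: that(2))
  have b: "\<bar>dd b (foldr (box_avg \<epsilon>) vs f) z\<bar> \<le> C / \<epsilon>" if "b \<in> set vs" for vs b z
    using that
  proof (induction vs arbitrary: z)
    case (Cons v vs)
    let ?g = "foldr (box_avg \<epsilon>) vs f"
    note g = trig_poly_avgs[OF f \<epsilon>, of vs]
    show ?case
    proof (cases "b = v")
      case True
      have "\<bar>?g (z + \<epsilon> *\<^sub>R v) - ?g (z - \<epsilon> *\<^sub>R v)\<bar> \<le> 2 * C"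
        using avgs[OF f C, of vs "z + \<epsilon> *\<^sub>R v"] avgs[OF f C, of vs "z - \<epsilon> *\<^sub>R v"] by linarith
      then show ?thesis
        using True \<epsilon> by (simp add: dd_box_avg_same[OF g \<epsilon>] field_simps)
    next
      case False
      then have "\<bar>dd b ?g y\<bar> \<le> C / \<epsilon>" for y using Cons by simp
      from avgs[OF trig_poly_dd[OF g] this, of "[v]" z] show ?thesis
        by (simp add: dd_box_avg[OF g \<epsilon>])
    qed
  qed simp
  have "\<bar>dd x (mollify \<epsilon> f) z\<bar> \<le> (\<Sum>b\<in>Basis. \<bar>(x \<bullet> b) * dd b (mollify \<epsilon> f) z\<bar>)"
    unfolding dd_sum_basis[OF trig_poly_mollify[OF f \<epsilon>], of x] by (rule sum_abs)
  also have "\<dots> \<le> (\<Sum>b\<in>(Basis::'a set). norm x * (C / \<epsilon>))"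
    unfolding abs_mult
    by (intro sum_mono mult_mono Basis_le_norm b[of _ basis_list, folded mollify_def]) auto
  finally show ?thesis by (simp add: mult_ac)
qed

lemma lin_gen_mollify_bound:
  fixes f :: "'a::euclidean_space \<Rightarrow> real"
  assumes f: "trig_poly c f" and \<epsilon>: "\<epsilon> > 0" and C: "\<And>y. \<bar>f y\<bar> \<le> C"
  shows "\<bar>lin_gen b I e (mollify \<epsilon> (mollify \<epsilon> f)) z\<bar>
    \<le> (norm b * DIM('a) / \<epsilon> + 1 / 2 * (\<Sum>i\<in>I. (norm (e i) * DIM('a) / \<epsilon>)\<^sup>2)) * C"
proof -
  note m = trig_poly_mollify[OF f \<epsilon>]
  have 1: "\<bar>dd b (mollify \<epsilon> (mollify \<epsilon> f)) z\<bar> \<le> norm b * DIM('a) / \<epsilon> * C"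
    by (rule dd_mollify_bound[OF m \<epsilon> mollify_abs_le[OF f \<epsilon> C]])
  have "\<bar>dd (e i) (dd (e i) (mollify \<epsilon> (mollify \<epsilon> f))) z\<bar> \<le> (norm (e i) * DIM('a) / \<epsilon>)\<^sup>2 * C" for i
    using dd_mollify_bound[OF trig_poly_dd[OF m] \<epsilon> dd_mollify_bound[OF f \<epsilon> C], of "e i" "e i" z]
    by (simp add: dd_mollify[OF m \<epsilon>] power2_eq_square mult_ac)
  then have "\<bar>\<Sum>i\<in>I. dd (e i) (dd (e i) (mollify \<epsilon> (mollify \<epsilon> f))) z\<bar>
     \<le> (\<Sum>i\<in>I. (norm (e i) * DIM('a) / \<epsilon>)\<^sup>2 * C)"
    by (intro order_trans[OF sum_abs] sum_mono)
  then have "1 / 2 * \<bar>\<Sum>i\<in>I. dd (e i) (dd (e i) (mollify \<epsilon> (mollify \<epsilon> f))) z\<bar>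
     \<le> 1 / 2 * (\<Sum>i\<in>I. (norm (e i) * DIM('a) / \<epsilon>)\<^sup>2) * C"
    by (simp add: sum_distrib_right)
  with 1 show ?thesis
    unfolding lin_gen_def distrib_right by (intro order_trans[OF abs_triangle_ineq]) simp
qed

section \<open>Local comparison with frozen coefficients\<close>

lemma c2_fun_add:
  assumes "c2_fun f f1 f2" "c2_fun g g1 g2"
  shows "c2_fun (\<lambda>z. f z + g z) (\<lambda>z. f1 z + g1 z) (\<lambda>z v. f2 z v + g2 z v)"
proof -
  have "((\<lambda>z. f z + g z) has_derivative (\<lambda>v. (f1 z + g1 z) \<bullet> v)) (at z)" for z
    using has_derivative_add[of f "\<lambda>v. f1 z \<bullet> v" "at z" g "\<lambda>v. g1 z \<bullet> v"] assms
    by (simp add: c2_fun_def inner_add_left)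
  moreover have "((\<lambda>z. f1 z + g1 z) has_derivative (\<lambda>v. f2 z v + g2 z v)) (at z)" for z
    using assms by (intro has_derivative_add) (auto simp: c2_fun_def)
  moreover have "continuous_on UNIV (\<lambda>z. f2 z v + g2 z v)" for v
    using assms by (intro continuous_intros) (auto simp: c2_fun_def)
  ultimately show ?thesis unfolding c2_fun_def by blast
qed

lemma c2_fun_shift:
  assumes "c2_fun f f1 f2"
  shows "c2_fun (\<lambda>z. f (z + a)) (\<lambda>z. f1 (z + a)) (\<lambda>z. f2 (z + a))"
proof -
  have sh: "((\<lambda>z. z + a) has_derivative (\<lambda>v. v)) (at z)" for z
    by (auto intro!: derivative_eq_intros)
  have "((\<lambda>z. f (z + a)) has_derivative (\<lambda>v. f1 (z + a) \<bullet> v)) (at z)" for z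
    using has_derivative_compose[OF sh, where g = f and g' = "\<lambda>v. f1 (z + a) \<bullet> v"] assms by (simp add: c2_fun_def)
  moreover have "((\<lambda>z. f1 (z + a)) has_derivative f2 (z + a)) (at z)" for z
    using has_derivative_compose[OF sh, where g = f1 and g' = "f2 (z + a)"] assms by (simp add: c2_fun_def)
  moreover have "continuous_on UNIV (\<lambda>z. f2 (z + a) v)" for v
  proof (rule continuous_on_compose2[of UNIV "\<lambda>z. f2 z v" UNIV "\<lambda>z. z + a"])
    show "continuous_on UNIV (\<lambda>z. f2 z v)" using assms by (simp add: c2_fun_def)
  qed (auto intro!: continuous_intros)
  ultimately show ?thesis unfolding c2_fun_def by blast
qed

lemma c2_fun_quartic:
  fixes z0 :: "'a::euclidean_space"
  shows "c2_fun (\<lambda>z. \<mu> * ((z - z0) \<bullet> (z - z0))\<^sup>2)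
     (\<lambda>z. (4 * \<mu> * ((z - z0) \<bullet> (z - z0))) *\<^sub>R (z - z0))
     (\<lambda>z v. (4 * \<mu> * ((z - z0) \<bullet> (z - z0))) *\<^sub>R v + (8 * \<mu> * ((z - z0) \<bullet> v)) *\<^sub>R (z - z0))"
  unfolding c2_fun_def
proof (intro conjI allI)
  fix z :: 'a
  show "((\<lambda>z. \<mu> * ((z - z0) \<bullet> (z - z0))\<^sup>2) has_derivative
     (\<lambda>v. ((4 * \<mu> * ((z - z0) \<bullet> (z - z0))) *\<^sub>R (z - z0)) \<bullet> v)) (at z)"
    by (auto intro!: derivative_eq_intros simp: fun_eq_iff inner_commute algebra_simps)
  show "((\<lambda>z. (4 * \<mu> * ((z - z0) \<bullet> (z - z0))) *\<^sub>R (z - z0)) has_derivative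
     (\<lambda>v. (4 * \<mu> * ((z - z0) \<bullet> (z - z0))) *\<^sub>R v + (8 * \<mu> * ((z - z0) \<bullet> v)) *\<^sub>R (z - z0))) (at z)"
    by (rule has_derivative_eq_rhs, (rule derivative_intros)+)
       (auto simp: fun_eq_iff inner_commute algebra_simps)
qed (intro continuous_intros)

lemma trig_poly_c2_lin_gen:
  assumes f: "trig_poly c f"
  shows "(\<Sum>v\<in>Basis. dd v f z *\<^sub>R v) \<bullet> b
     + 1 / 2 * (\<Sum>i\<in>I. (\<Sum>v\<in>Basis. dd (e i) (dd v f) z *\<^sub>R v) \<bullet> e i) = lin_gen b I e f z"
  unfolding lin_gen_def dd_eq_inner[OF f, of b]
  by (subst dd_eq_inner[OF trig_poly_dd[OF f]]) (simp add: dd_commute[OF f])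

lemma lin_gen_lincomb:
  assumes f: "trig_poly c f" and g: "trig_poly c g"
  shows "lin_gen b I e (\<lambda>z. f z + s * g z) = (\<lambda>z. lin_gen b I e f z + s * lin_gen b I e g z)"
proof -
  have *: "dd x (\<lambda>z. f z + s * g z) = (\<lambda>z. dd x f z + s * dd x g z)"
    if "trig_poly c f" "trig_poly c g" for f g x
    by (rule ext) (rule dd_eqI, intro has_derivative_add has_derivative_mult_right
        trig_poly_has_derivative[of c] that)
  show ?thesis
    by (auto simp: fun_eq_iff lin_gen_def *[OF f g] *[OF trig_poly_dd[OF f] trig_poly_dd[OF g]]
        sum.distrib sum_distrib_left algebra_simps)
qed

definition mollify4 :: "real \<Rightarrow> ('a::euclidean_space \<Rightarrow> real) \<Rightarrow> 'a \<Rightarrow> real" where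
  "mollify4 \<epsilon> f = mollify \<epsilon> (mollify \<epsilon> (mollify \<epsilon> (mollify \<epsilon> f)))"

lemma trig_poly_mollify4: "trig_poly c f \<Longrightarrow> \<epsilon> > 0 \<Longrightarrow> trig_poly c (mollify4 \<epsilon> f)"
  unfolding mollify4_def by (intro trig_poly_mollify)

lemma mollify4_lincomb:
  assumes "trig_poly c f" "trig_poly c g" "\<epsilon> > 0"
  shows "mollify4 \<epsilon> (\<lambda>z. f z + s * g z) = (\<lambda>z. mollify4 \<epsilon> f z + s * mollify4 \<epsilon> g z)"
  unfolding mollify4_def using assms by (simp add: mollify_lincomb[of c] trig_poly_mollify)

lemma mollify4_bounds:
  fixes f :: "'a::euclidean_space \<Rightarrow> real" and \<epsilon> :: real
  assumes f: "trig_poly c f" and \<epsilon>: "\<epsilon> > 0"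
    and b: "\<And>y. dist z y \<le> 4 * real DIM('a) * \<epsilon> \<Longrightarrow> l \<le> f y \<and> f y \<le> u"
  shows "l \<le> mollify4 \<epsilon> f z \<and> mollify4 \<epsilon> f z \<le> u"
proof -
  let ?D = "real DIM('a) * \<epsilon>"
  note m1 = trig_poly_mollify[OF f \<epsilon>]
  note m2 = trig_poly_mollify[OF m1 \<epsilon>]
  note m3 = trig_poly_mollify[OF m2 \<epsilon>]
  have b1: "l \<le> mollify \<epsilon> f y \<and> mollify \<epsilon> f y \<le> u" if "dist z y \<le> 3 * ?D" for y
    by (rule mollify_bounds[OF f \<epsilon> _ that]) (rule b, simp add: algebra_simps)
  have b2: "l \<le> mollify \<epsilon> (mollify \<epsilon> f) y \<and> mollify \<epsilon> (mollify \<epsilon> f) y \<le> u"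
    if "dist z y \<le> 2 * ?D" for y
    by (rule mollify_bounds[OF m1 \<epsilon> b1 that]) (simp add: algebra_simps)
  have b3: "l \<le> mollify \<epsilon> (mollify \<epsilon> (mollify \<epsilon> f)) y \<and> mollify \<epsilon> (mollify \<epsilon> (mollify \<epsilon> f)) y \<le> u"
    if "dist z y \<le> ?D" for y
    by (rule mollify_bounds[OF m2 \<epsilon> b2 that]) (simp add: algebra_simps)
  show ?thesis
    unfolding mollify4_def by (rule mollify_bounds[OF m3 \<epsilon> b3, of z 0]) auto
qed

text \<open>The constants below do not depend on the trigonometric polynomial nor on the centre \<open>z1\<close>: the
  bound on the iterated generator of \<open>mollify4\<close> uses four difference quotients only.\<close>

definition barrier_const :: "real \<Rightarrow> real \<Rightarrow> real \<Rightarrow> 'i set \<Rightarrow> ('i \<Rightarrow> 'a::euclidean_space) \<Rightarrow> real" where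
  "barrier_const C r B I e = 64 * (C + 1) / r ^ 4 * (4 * B + 6 * (\<Sum>i\<in>I. (norm (e i))\<^sup>2))\<^sup>2 / 4"

definition smoothing_const :: "real \<Rightarrow> real \<Rightarrow> 'i set \<Rightarrow> ('i \<Rightarrow> 'a::euclidean_space) \<Rightarrow> real" where
  "smoothing_const B \<epsilon> I e = B * DIM('a) / \<epsilon> + 1 / 2 * (\<Sum>i\<in>I. (norm (e i) * DIM('a) / \<epsilon>)\<^sup>2)"

lemma lin_gen_quartic_le:
  fixes y b :: "'a::euclidean_space"
  assumes y: "norm y \<le> 1" and b: "norm b \<le> B" and "\<mu> \<ge> 0"
  shows "((4 * \<mu> * (y \<bullet> y)) *\<^sub>R y) \<bullet> b
     + 1 / 2 * (\<Sum>i\<in>I. ((4 * \<mu> * (y \<bullet> y)) *\<^sub>R e i + (8 * \<mu> * (y \<bullet> e i)) *\<^sub>R y) \<bullet> e i)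
     \<le> \<mu> * (y \<bullet> y) * (4 * B + 6 * (\<Sum>i\<in>I. (norm (e i))\<^sup>2))"
proof -
  have "y \<bullet> b \<le> norm y * norm b" by (rule norm_cauchy_schwarz)
  also have "\<dots> \<le> 1 * B" by (intro mult_mono y b) auto
  finally have "4 * \<mu> * (y \<bullet> y) * (y \<bullet> b) \<le> 4 * \<mu> * (y \<bullet> y) * B"
    using \<open>\<mu> \<ge> 0\<close> by (intro mult_left_mono) auto
  moreover have "((4 * \<mu> * (y \<bullet> y)) *\<^sub>R e i + (8 * \<mu> * (y \<bullet> e i)) *\<^sub>R y) \<bullet> e i
      \<le> 12 * \<mu> * (y \<bullet> y) * (norm (e i))\<^sup>2" for i
  proof -
    have "(y \<bullet> e i)\<^sup>2 \<le> (y \<bullet> y) * (e i \<bullet> e i)" by (rule Cauchy_Schwarz_ineq)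
    then have "8 * \<mu> * (y \<bullet> e i)\<^sup>2 \<le> 8 * \<mu> * ((y \<bullet> y) * (e i \<bullet> e i))"
      using \<open>\<mu> \<ge> 0\<close> by (intro mult_left_mono) auto
    then show ?thesis
      by (simp add: inner_add_left power2_norm_eq_inner power2_eq_square[of "y \<bullet> e i"] mult_ac)
  qed
  then have "(\<Sum>i\<in>I. ((4 * \<mu> * (y \<bullet> y)) *\<^sub>R e i + (8 * \<mu> * (y \<bullet> e i)) *\<^sub>R y) \<bullet> e i)
      \<le> (\<Sum>i\<in>I. 12 * \<mu> * (y \<bullet> y) * (norm (e i))\<^sup>2)"
    by (intro sum_mono)
  then have "1 / 2 * (\<Sum>i\<in>I. ((4 * \<mu> * (y \<bullet> y)) *\<^sub>R e i + (8 * \<mu> * (y \<bullet> e i)) *\<^sub>R y) \<bullet> e i)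
      \<le> 6 * \<mu> * (y \<bullet> y) * (\<Sum>i\<in>I. (norm (e i))\<^sup>2)"
    by (simp add: sum_distrib_left[symmetric])
  ultimately show ?thesis by (simp add: algebra_simps)
qed

text \<open>The quartic penalty localizes the comparison of \<open>u\<close> with the resolvent at a cost that is
  quadratic in \<open>1 / lam\<close>, hence negligible against \<open>f1 / lam\<close>.\<close>

lemma frozen_resolvent_bound:
  fixes u ut \<phi> :: "'a::euclidean_space \<Rightarrow> real"
  assumes r: "0 < r" "r \<le> 1" and cont: "continuous_on (cball z1 r) u"
    and sub: "\<And>\<Phi> \<Phi>1 \<Phi>2 z. c2_fun \<Phi> \<Phi>1 \<Phi>2 \<Longrightarrow> z \<in> ball z1 r \<Longrightarrow>
       \<forall>\<^sub>F y in at z. u y - \<Phi> y \<le> u z - \<Phi> z \<Longrightarrow>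
       0 \<le> \<Phi>1 z \<bullet> b + 1 / 2 * (\<Sum>i\<in>I. \<Phi>2 z (e i) \<bullet> e i) + f1"
    and ut: "\<And>z. z \<in> cball z1 r \<Longrightarrow> \<bar>ut z - u z\<bar> \<le> \<epsilon>'" "\<And>z. \<bar>ut z\<bar> \<le> C" and \<epsilon>': "\<epsilon>' \<le> 1"
    and \<phi>: "trig_poly c \<phi>" "\<And>z. lam * \<phi> z - lin_gen b I e \<phi> z = lam * ut z" "\<And>z. \<bar>\<phi> z\<bar> \<le> C"
    and lam: "lam > 0" and b: "norm b \<le> B" and z0: "dist z1 z0 \<le> r / 2"
  shows "u z0 \<le> \<phi> z0 + \<epsilon>' + f1 / lam + barrier_const C r B I e / lam\<^sup>2"
proof -
  define \<mu> where "\<mu> = 64 * (C + 1) / r ^ 4"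
  define C2 where "C2 = 4 * B + 6 * (\<Sum>i\<in>I. (norm (e i))\<^sup>2)"
  define \<Lambda> where "\<Lambda> z = \<mu> * ((z - z0) \<bullet> (z - z0))\<^sup>2" for z
  have C: "C \<ge> 0" using ut(2)[of z0] by linarith
  then have \<mu>: "\<mu> \<ge> 0" using r by (simp add: \<mu>_def)
  have sub_cball: "cball z0 (r / 2) \<subseteq> cball z1 r"
  proof
    fix y assume "y \<in> cball z0 (r / 2)"
    then show "y \<in> cball z1 r" using z0 dist_triangle[of z1 y z0] by simp
  qed
  have "continuous_on (cball z0 (r / 2)) (\<lambda>y. u y - (\<phi> y + \<Lambda> y))"
    unfolding \<Lambda>_def
    by (intro continuous_intros continuous_on_subset[OF cont sub_cball] trig_poly_continuous[OF \<phi>(1)])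
  moreover have "cball z0 (r / 2) \<noteq> {}" using r by simp
  ultimately have "\<exists>z\<in>cball z0 (r / 2). \<forall>y\<in>cball z0 (r / 2).
      u y - (\<phi> y + \<Lambda> y) \<le> u z - (\<phi> z + \<Lambda> z)"
    by (intro continuous_attains_sup compact_cball)
  then obtain z where z: "z \<in> cball z0 (r / 2)"
    and zmax: "\<And>y. y \<in> cball z0 (r / 2) \<Longrightarrow> u y - (\<phi> y + \<Lambda> y) \<le> u z - (\<phi> z + \<Lambda> z)"
    by blast
  have z0max: "u z0 - \<phi> z0 \<le> u z - \<phi> z - \<Lambda> z"
    using zmax[of z0] r by (simp add: \<Lambda>_def)
  have ub: "\<bar>u y\<bar> \<le> C + 1" if "y \<in> cball z0 (r / 2)" for y
    using ut(1)[of y] ut(2)[of y] \<epsilon>' that sub_cball by fastforce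
  have "dist z0 z < r / 2"
  proof (rule ccontr)
    assume "\<not> ?thesis"
    then have "norm (z - z0) = r / 2" using z by (simp add: dist_norm norm_minus_commute)
    then have "(z - z0) \<bullet> (z - z0) = (r / 2)\<^sup>2" by (metis power2_norm_eq_inner)
    then have "\<Lambda> z = \<mu> * (r / 2) ^ 4" unfolding \<Lambda>_def by simp
    also have "\<dots> = 4 * (C + 1)" using r by (simp add: \<mu>_def power_divide)
    finally have "\<Lambda> z = 4 * (C + 1)" .
    then show False
      using z0max ub[OF z] ub[of z0] \<phi>(3)[of z] \<phi>(3)[of z0] r C by (simp add: abs_le_iff)
  qed
  then have zin: "z \<in> ball z0 (r / 2)" by simp
  have "\<forall>\<^sub>F y in at z. y \<in> ball z0 (r / 2)"
    using zin by (intro eventually_at_in_open') auto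
  then have ev: "\<forall>\<^sub>F y in at z. u y - (\<phi> y + \<Lambda> y) \<le> u z - (\<phi> z + \<Lambda> z)"
    by eventually_elim (auto intro: zmax)
  have zr: "z \<in> ball z1 r"
    using zin z0 dist_triangle[of z1 z z0] by simp
  let ?Y = "(z - z0) \<bullet> (z - z0)"
  have "0 \<le> lin_gen b I e \<phi> z + \<mu> * ?Y * C2 + f1"
    using sub[OF c2_fun_add[OF trig_poly_c2[OF \<phi>(1)] c2_fun_quartic[of \<mu> z0, folded \<Lambda>_def]] zr ev]
      trig_poly_c2_lin_gen[OF \<phi>(1), of z b e I]
      lin_gen_quartic_le[OF _ b \<mu>, of "z - z0" e I] zin r
    by (simp add: inner_add_left sum.distrib dist_norm norm_minus_commute C2_def distrib_left)
  then have "lam * (ut z - \<phi> z) \<le> f1 + \<mu> * ?Y * C2" using \<phi>(2)[of z] by (simp add: algebra_simps)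
  then have 1: "ut z - \<phi> z \<le> f1 / lam + \<mu> * ?Y * C2 / lam"
    using lam by (simp add: field_simps)
  define t where "t = C2 / lam"
  have young: "\<mu> * Y * t - \<mu> * Y\<^sup>2 \<le> \<mu> * t\<^sup>2 / 4" for Y
  proof -
    have "0 \<le> \<mu> * (t / 2 - Y)\<^sup>2" using \<mu> by simp
    then show ?thesis by (simp add: power2_diff power_divide algebra_simps)
  qed
  have "\<mu> * ?Y * C2 / lam - \<mu> * ?Y\<^sup>2 \<le> \<mu> * C2\<^sup>2 / 4 / lam\<^sup>2"
    using young[of ?Y] by (simp add: t_def power_divide mult.commute)
  then have 2: "\<mu> * ?Y * C2 / lam - \<Lambda> z \<le> barrier_const C r B I e / lam\<^sup>2"
    by (simp add: \<Lambda>_def barrier_const_def \<mu>_def C2_def)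
  have "u z \<le> ut z + \<epsilon>'" using ut(1)[of z] z sub_cball by fastforce
  then show ?thesis using z0max 1 2 by simp
qed

lemma frozen_inequality:
  fixes u ut :: "'a::euclidean_space \<Rightarrow> real"
  assumes r: "0 < r" "r \<le> 1" and cont: "continuous_on (cball z1 r) u"
    and sub: "\<And>\<Phi> \<Phi>1 \<Phi>2 z. c2_fun \<Phi> \<Phi>1 \<Phi>2 \<Longrightarrow> z \<in> ball z1 r \<Longrightarrow>
       \<forall>\<^sub>F y in at z. u y - \<Phi> y \<le> u z - \<Phi> z \<Longrightarrow>
       0 \<le> \<Phi>1 z \<bullet> b + 1 / 2 * (\<Sum>i\<in>I. \<Phi>2 z (e i) \<bullet> e i) + f1"
    and ut: "trig_poly c ut" "c > 0"
      "\<And>z. z \<in> cball z1 r \<Longrightarrow> \<bar>ut z - u z\<bar> \<le> \<epsilon>'" "\<And>z. \<bar>ut z\<bar> \<le> C" and \<epsilon>': "\<epsilon>' \<le> 1"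
    and lam: "lam > 0" and b: "norm b \<le> B"
    and \<epsilon>: "\<epsilon> > 0" "4 * real DIM('a) * \<epsilon> \<le> r / 2"
  shows "lin_gen b I e (mollify4 \<epsilon> ut) z1 \<ge>
     - f1 - 2 * lam * \<epsilon>' - (barrier_const C r B I e + (smoothing_const B \<epsilon> I e)\<^sup>2 * C) / lam"
proof -
  obtain \<phi> where \<phi>: "trig_poly c \<phi>" "\<And>z. lam * \<phi> z - lin_gen b I e \<phi> z = lam * ut z"
    using trig_poly_resolvent[OF ut(1) lam] by blast
  have \<phi>C: "\<bar>\<phi> z\<bar> \<le> C" for z by (rule resolvent_bound[OF \<phi>(1) ut(2) lam \<phi>(2) ut(4)])
  let ?L = "lin_gen b I e" and ?b = "barrier_const C r B I e"
  let ?l = "- f1 - 2 * lam * \<epsilon>' - ?b / lam"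
  have "?l \<le> ?L \<phi> y \<and> ?L \<phi> y \<le> 2 * lam * C" if "dist z1 y \<le> 4 * real DIM('a) * \<epsilon>" for y
  proof
    have y: "dist z1 y \<le> r / 2" using that \<epsilon>(2) by linarith
    have eq: "?L \<phi> y = lam * (\<phi> y - ut y)" using \<phi>(2)[of y] by (simp add: algebra_simps)
    have "ut y - \<epsilon>' \<le> u y" using ut(3)[of y] y r by force
    also have "u y \<le> \<phi> y + \<epsilon>' + f1 / lam + ?b / lam\<^sup>2"
      by (rule frozen_resolvent_bound[where ut = ut and c = c and \<phi> = \<phi> and ?z1.0 = z1 and r = r])
         (fact r cont sub ut \<epsilon>' \<phi> \<phi>C lam b y)+
    finally have "- f1 / lam - 2 * \<epsilon>' - ?b / lam\<^sup>2 \<le> \<phi> y - ut y" by simp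
    then have "lam * (- f1 / lam - 2 * \<epsilon>' - ?b / lam\<^sup>2) \<le> ?L \<phi> y"
      unfolding eq using lam by (intro mult_left_mono) auto
    moreover have "lam * (- f1 / lam - 2 * \<epsilon>' - ?b / lam\<^sup>2) = ?l"
      using lam by (simp add: algebra_simps power2_eq_square)
    ultimately show "?l \<le> ?L \<phi> y" by simp
    have "\<phi> y - ut y \<le> 2 * C" using \<phi>C[of y] ut(4)[of y] by linarith
    then have "lam * (\<phi> y - ut y) \<le> lam * (2 * C)" using lam by (intro mult_left_mono) auto
    then show "?L \<phi> y \<le> 2 * lam * C" by (simp add: eq)
  qed
  from mollify4_bounds[OF trig_poly_lin_gen[OF \<phi>(1)] \<epsilon>(1) this]
  have lower: "?l \<le> mollify4 \<epsilon> (?L \<phi>) z1" by simp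
  note L\<phi> = trig_poly_lin_gen[OF \<phi>(1)]
  have comm: "mollify4 \<epsilon> (?L f) = ?L (mollify4 \<epsilon> f)" if "trig_poly c f" for f
    using that \<epsilon>(1) by (simp add: mollify4_def lin_gen_mollify[of c] trig_poly_mollify)
  have "\<phi> = (\<lambda>z. ut z + 1 / lam * ?L \<phi> z)"
  proof
    fix z show "\<phi> z = ut z + 1 / lam * ?L \<phi> z"
      using \<phi>(2)[of z] lam by (simp add: field_simps)
  qed
  then have "mollify4 \<epsilon> \<phi> = mollify4 \<epsilon> (\<lambda>z. ut z + 1 / lam * ?L \<phi> z)" by simp
  also have "\<dots> = (\<lambda>z. mollify4 \<epsilon> ut z + 1 / lam * mollify4 \<epsilon> (?L \<phi>) z)"
    by (rule mollify4_lincomb[OF ut(1) L\<phi> \<epsilon>(1)])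
  finally have "?L (mollify4 \<epsilon> \<phi>) = ?L (\<lambda>z. mollify4 \<epsilon> ut z + 1 / lam * mollify4 \<epsilon> (?L \<phi>) z)"
    by simp
  also have "\<dots> = (\<lambda>z. ?L (mollify4 \<epsilon> ut) z + 1 / lam * ?L (mollify4 \<epsilon> (?L \<phi>)) z)"
    by (rule lin_gen_lincomb[OF trig_poly_mollify4[OF ut(1) \<epsilon>(1)] trig_poly_mollify4[OF L\<phi> \<epsilon>(1)]])
  finally have eq: "?L (mollify4 \<epsilon> \<phi>) z1
      = ?L (mollify4 \<epsilon> ut) z1 + 1 / lam * ?L (mollify4 \<epsilon> (?L \<phi>)) z1" by (rule fun_cong)
  let ?Q = "norm b * DIM('a) / \<epsilon> + 1 / 2 * (\<Sum>i\<in>I. (norm (e i) * DIM('a) / \<epsilon>)\<^sup>2)"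
  note m2 = trig_poly_mollify[OF trig_poly_mollify[OF \<phi>(1) \<epsilon>(1)] \<epsilon>(1)]
  have "mollify4 \<epsilon> (?L \<phi>) = mollify \<epsilon> (mollify \<epsilon> (?L (mollify \<epsilon> (mollify \<epsilon> \<phi>))))"
    using \<phi>(1) \<epsilon>(1) by (simp add: mollify4_def lin_gen_mollify[of c] trig_poly_mollify)
  then have "\<bar>?L (mollify4 \<epsilon> (?L \<phi>)) z1\<bar> \<le> ?Q * (?Q * C)"
    using lin_gen_mollify_bound[OF trig_poly_lin_gen[OF m2] \<epsilon>(1)
      lin_gen_mollify_bound[OF \<phi>(1) \<epsilon>(1) \<phi>C]] by simp
  also have "\<dots> \<le> smoothing_const B \<epsilon> I e * (smoothing_const B \<epsilon> I e * C)"
  proof -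
    have "?Q \<le> smoothing_const B \<epsilon> I e"
      unfolding smoothing_const_def using b \<epsilon>(1)
      by (intro add_mono divide_right_mono mult_right_mono sum_nonneg) auto
    moreover have "?Q \<ge> 0" using \<epsilon>(1) by (simp add: sum_nonneg)
    moreover have "C \<ge> 0" using \<phi>C[of z1] by linarith
    ultimately show ?thesis by (intro mult_mono) (auto intro: order_trans)
  qed
  finally have "- ((smoothing_const B \<epsilon> I e)\<^sup>2 * C) \<le> - ?L (mollify4 \<epsilon> (?L \<phi>)) z1"
    by (simp add: power2_eq_square abs_le_iff)
  then have "1 / lam * (- ((smoothing_const B \<epsilon> I e)\<^sup>2 * C)) \<le> 1 / lam * (- ?L (mollify4 \<epsilon> (?L \<phi>)) z1)"
    using lam by (intro mult_left_mono) auto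
  moreover have "?L (mollify4 \<epsilon> \<phi>) z1 = mollify4 \<epsilon> (?L \<phi>) z1" by (simp add: comm[OF \<phi>(1)])
  ultimately show ?thesis using lower eq by (simp add: add_divide_distrib)
qed

section \<open>Semicontinuous functions and sup-convolutions\<close>

definition usc_on :: "'a::metric_space set \<Rightarrow> ('a \<Rightarrow> real) \<Rightarrow> bool" where
  "usc_on S u \<longleftrightarrow> (\<forall>z\<in>S. \<forall>c>u z. \<exists>d>0. \<forall>y\<in>S. dist y z < d \<longrightarrow> u y < c)"

lemma usc_onD:
  assumes "usc_on S u" "z \<in> S" "u z < c"
  obtains d where "d > 0" "\<And>y. y \<in> S \<Longrightarrow> dist y z < d \<Longrightarrow> u y < c"
  using assms unfolding usc_on_def by metis

lemma usc_on_subset: "usc_on S u \<Longrightarrow> S' \<subseteq> S \<Longrightarrow> usc_on S' u"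
  unfolding usc_on_def by (meson subset_eq)

lemma usc_on_continuous: "continuous_on S u \<Longrightarrow> usc_on S u"
  unfolding usc_on_def
proof (intro ballI allI impI)
  fix z c assume "continuous_on S u" "z \<in> S" "u z < c"
  then obtain d where d: "d > 0" "\<And>y. y \<in> S \<Longrightarrow> dist y z < d \<Longrightarrow> dist (u y) (u z) < c - u z"
    unfolding continuous_on_iff by (metis diff_gt_0_iff_gt)
  have "u y < c" if "y \<in> S" "dist y z < d" for y
    using d(2)[OF that] unfolding dist_real_def by linarith
  then show "\<exists>d>0. \<forall>y\<in>S. dist y z < d \<longrightarrow> u y < c" using d(1) by blast
qed

lemma usc_on_add:
  assumes "usc_on S u" "usc_on S v"
  shows "usc_on S (\<lambda>z. u z + v z)"
  unfolding usc_on_def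
proof (intro ballI allI impI)
  fix z c assume z: "z \<in> S" "u z + v z < c"
  define h where "h = (c - u z - v z) / 2"
  have h: "h > 0" using z by (simp add: h_def)
  obtain d1 where d1: "d1 > 0" "\<And>y. y \<in> S \<Longrightarrow> dist y z < d1 \<Longrightarrow> u y < u z + h"
    using usc_onD[OF assms(1) z(1), of "u z + h"] h by auto
  obtain d2 where d2: "d2 > 0" "\<And>y. y \<in> S \<Longrightarrow> dist y z < d2 \<Longrightarrow> v y < v z + h"
    using usc_onD[OF assms(2) z(1), of "v z + h"] h by auto
  have "u y + v y < c" if "y \<in> S" "dist y z < min d1 d2" for y
    using d1(2)[of y] d2(2)[of y] that by (simp add: h_def field_simps)
  then show "\<exists>d>0. \<forall>y\<in>S. dist y z < d \<longrightarrow> u y + v y < c"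
    using d1(1) d2(1) by (intro exI[of _ "min d1 d2"]) auto
qed

lemma usc_on_seq:
  assumes "usc_on S u" "X \<longlonglongrightarrow> z" "\<And>n. X n \<in> S" "z \<in> S" "u z < c"
  shows "\<forall>\<^sub>F n in sequentially. u (X n) < c"
proof -
  obtain d where d: "d > 0" "\<And>y. y \<in> S \<Longrightarrow> dist y z < d \<Longrightarrow> u y < c"
    using usc_onD[OF assms(1,4,5)] by blast
  have "\<forall>\<^sub>F n in sequentially. dist (X n) z < d" by (rule tendstoD[OF assms(2) d(1)])
  then show ?thesis by eventually_elim (rule d(2)[OF assms(3)])
qed

lemma usc_attains_max:
  assumes "compact S" "S \<noteq> {}" "usc_on S u"
  obtains z where "z \<in> S" "\<And>y. y \<in> S \<Longrightarrow> u y \<le> u z"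
proof -
  define L where "L w = {y \<in> S. u w \<le> u y}" for w
  have cl: "closed (L w)" if "w \<in> S" for w
    unfolding closed_sequential_limits
  proof (intro allI impI, elim conjE)
    fix X l assume X: "\<forall>n. X n \<in> L w" "X \<longlonglongrightarrow> l"
    then have XS: "X n \<in> S" for n by (simp add: L_def)
    have l: "l \<in> S"
      using closed_sequentially[OF compact_imp_closed[OF assms(1)] XS X(2)] .
    have "u w \<le> u l"
    proof (rule ccontr)
      assume "\<not> ?thesis"
      then have "u l < u w" by simp
      then have "\<forall>\<^sub>F n in sequentially. u (X n) < u w"
        by (rule usc_on_seq[OF assms(3) X(2) XS l])
      then obtain n where "u (X n) < u w" by (auto dest: eventually_happens)
      then show False using X(1)[rule_format, of n] by (simp add: L_def)
    qed
    then show "l \<in> L w" using l by (simp add: L_def)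
  qed
  have "S \<inter> \<Inter> (L ` S) \<noteq> {}"
  proof (rule compact_imp_fip_image[OF assms(1) cl])
    fix I assume I: "finite I" "I \<subseteq> S"
    show "S \<inter> \<Inter> (L ` I) \<noteq> {}"
    proof (cases "I = {}")
      case False
      then obtain m where "m \<in> I" "\<And>w. w \<in> I \<Longrightarrow> u w \<le> u m"
        using finite_imageI[OF I(1), of u] Max_in[of "u ` I"] Max_ge[of "u ` I"]
        by (metis (no_types, lifting) imageE image_eqI image_is_empty)
      then have "m \<in> S \<inter> \<Inter> (L ` I)" using I(2) by (auto simp: L_def)
      then show ?thesis by blast
    qed (use assms(2) in simp)
  qed
  then obtain z where "z \<in> S" "\<And>w. w \<in> S \<Longrightarrow> z \<in> L w" by blast
  then show thesis by (intro that[of z]) (auto simp: L_def)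
qed

lemma doubling_penalty:
  fixes u w :: "'a::euclidean_space \<Rightarrow> real"
  assumes K: "compact K" and G: "open G"
    and usc: "usc_on K u" "usc_on K (\<lambda>z. - w z)"
    and M: "\<And>z. z \<in> K \<Longrightarrow> u z - w z \<le> M" "\<And>z. z \<in> K \<Longrightarrow> M \<le> u z - w z \<Longrightarrow> z \<in> G"
    and \<theta>: "\<theta> > 0"
  shows "\<exists>\<alpha>0>0. \<exists>\<gamma>>0. \<forall>\<alpha>\<ge>\<alpha>0. \<forall>z\<in>K. \<forall>z'\<in>K.
     M - \<gamma> \<le> u z' - w z - \<alpha> / 2 * (norm (z - z'))\<^sup>2 \<longrightarrow>
     \<alpha> * (norm (z - z'))\<^sup>2 \<le> \<theta> \<and> z \<in> G \<and> z' \<in> G"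
proof (rule ccontr)
  assume neg: "\<not> ?thesis"
  have ex: "\<exists>\<alpha> z z'. \<alpha> \<ge> real (Suc n) \<and> z \<in> K \<and> z' \<in> K \<and>
      M - 1 / real (Suc n) \<le> u z' - w z - \<alpha> / 2 * (norm (z - z'))\<^sup>2 \<and>
      \<not> (\<alpha> * (norm (z - z'))\<^sup>2 \<le> \<theta> \<and> z \<in> G \<and> z' \<in> G)" for n
  proof (rule ccontr)
    assume no: "\<not> ?thesis"
    have "0 < real (Suc n)" "0 < 1 / real (Suc n)" by simp_all
    then show False using neg no by blast
  qed
  then have "\<forall>n. \<exists>p. fst p \<ge> real (Suc n) \<and> fst (snd p) \<in> K \<and> snd (snd p) \<in> K \<and>
      M - 1 / real (Suc n) \<le> u (snd (snd p)) - w (fst (snd p))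
        - fst p / 2 * (norm (fst (snd p) - snd (snd p)))\<^sup>2 \<and>
      \<not> (fst p * (norm (fst (snd p) - snd (snd p)))\<^sup>2 \<le> \<theta> \<and> fst (snd p) \<in> G \<and> snd (snd p) \<in> G)"
    by (metis fst_conv snd_conv)
  then obtain p where p: "\<And>n. fst (p n) \<ge> real (Suc n) \<and> fst (snd (p n)) \<in> K \<and> snd (snd (p n)) \<in> K \<and>
      M - 1 / real (Suc n) \<le> u (snd (snd (p n))) - w (fst (snd (p n)))
        - fst (p n) / 2 * (norm (fst (snd (p n)) - snd (snd (p n))))\<^sup>2 \<and>
      \<not> (fst (p n) * (norm (fst (snd (p n)) - snd (snd (p n))))\<^sup>2 \<le> \<theta> \<and>
         fst (snd (p n)) \<in> G \<and> snd (snd (p n)) \<in> G)"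
    by metis
  define \<alpha> x y where "\<alpha> n = fst (p n)" and "x n = fst (snd (p n))" and "y n = snd (snd (p n))" for n
  have \<alpha>: "\<alpha> n \<ge> real (Suc n)" and x: "x n \<in> K" and y: "y n \<in> K"
    and le: "M - 1 / real (Suc n) \<le> u (y n) - w (x n) - \<alpha> n / 2 * (norm (x n - y n))\<^sup>2"
    and bad: "\<not> (\<alpha> n * (norm (x n - y n))\<^sup>2 \<le> \<theta> \<and> x n \<in> G \<and> y n \<in> G)" for n
    using p[of n] by (simp_all add: \<alpha>_def x_def y_def)
  have Kne: "K \<noteq> {}" using x by blast
  obtain a where a: "a \<in> K" "\<And>z. z \<in> K \<Longrightarrow> u z \<le> u a"
    using usc_attains_max[OF K Kne usc(1)] by blast
  obtain b where b: "b \<in> K" "\<And>z. z \<in> K \<Longrightarrow> - w z \<le> - w b"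
    using usc_attains_max[OF K Kne usc(2)] by blast
  define B where "B = 2 * (u a - w b - M + 1)"
  have B: "\<alpha> n * (norm (x n - y n))\<^sup>2 \<le> B" for n
  proof -
    have *: "X \<le> B" if "M - q \<le> u (y n) - w (x n) - X / 2" "q \<le> 1" for X q
      using that a(2)[OF y[of n]] b(2)[OF x[of n]] unfolding B_def by argo
    show ?thesis by (rule *[of "1 / real (Suc n)"]) (use le[of n] in auto)
  qed
  have xy: "(\<lambda>n. x n - y n) \<longlonglongrightarrow> 0"
  proof (rule Lim_null_comparison)
    have "(\<lambda>n. sqrt (B * inverse (real (Suc n)))) \<longlonglongrightarrow> sqrt (B * 0)"
      by (intro tendsto_intros LIMSEQ_inverse_real_of_nat)
    then show "(\<lambda>n. sqrt (B * inverse (real (Suc n)))) \<longlonglongrightarrow> 0" by simp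
    have "norm (x n - y n) \<le> sqrt (B * inverse (real (Suc n)))" for n
    proof (rule real_le_rsqrt)
      have "real (Suc n) * (norm (x n - y n))\<^sup>2 \<le> \<alpha> n * (norm (x n - y n))\<^sup>2"
        using \<alpha>[of n] by (intro mult_right_mono) auto
      then have "real (Suc n) * (norm (x n - y n))\<^sup>2 \<le> B" using B[of n] by linarith
      then show "(norm (x n - y n))\<^sup>2 \<le> B * inverse (real (Suc n))"
        by (simp add: field_simps)
    qed
    then show "\<forall>\<^sub>F n in sequentially. norm (x n - y n) \<le> sqrt (B * inverse (real (Suc n)))"
      by simp
  qed
  obtain l r where l: "l \<in> K" "strict_mono r" "(x \<circ> r) \<longlonglongrightarrow> l"
    using K x unfolding compact_def by meson
  have "(\<lambda>n. (x \<circ> r) n - (x (r n) - y (r n))) \<longlonglongrightarrow> l - 0"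
    by (intro tendsto_diff l(3) LIMSEQ_subseq_LIMSEQ[OF xy l(2), unfolded comp_def])
  then have yl: "(\<lambda>n. y (r n)) \<longlonglongrightarrow> l" by simp
  have xl: "(\<lambda>n. x (r n)) \<longlonglongrightarrow> l" using l(3) by (simp add: comp_def)
  have small: "\<forall>\<^sub>F n in sequentially. 1 / real (Suc (r n)) < h" if "h > 0" for h
  proof -
    have "(\<lambda>n. inverse (real (Suc (r n)))) \<longlonglongrightarrow> 0"
      using LIMSEQ_subseq_LIMSEQ[OF LIMSEQ_inverse_real_of_nat l(2)] by (simp add: comp_def)
    from order_tendstoD(2)[OF this that] show ?thesis by (simp add: inverse_eq_divide)
  qed
  have lim: "\<forall>\<^sub>F n in sequentially. u (y (r n)) < u l + h \<and> - w (x (r n)) < - w l + h \<and>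
      1 / real (Suc (r n)) < h" if "h > 0" for h
    using usc_on_seq[OF usc(1) yl y l(1), of "u l + h"]
      usc_on_seq[OF usc(2) xl x l(1), of "- w l + h"] small[OF that] that
    by (simp add: eventually_conj_iff)
  have "M \<le> u l - w l"
  proof (rule field_le_epsilon)
    fix h :: real assume "h > 0"
    then obtain n where n: "u (y (r n)) < u l + h / 3" "- w (x (r n)) < - w l + h / 3"
      "1 / real (Suc (r n)) < h / 3"
      using eventually_happens[OF lim[of "h / 3"]] by auto
    have "0 \<le> \<alpha> (r n) / 2 * (norm (x (r n) - y (r n)))\<^sup>2"
      using \<alpha>[of "r n"] by (intro mult_nonneg_nonneg) auto
    then show "M \<le> u l - w l + h" using le[of "r n"] n by linarith
  qed
  then have lG: "l \<in> G" using M(2) l(1) by blast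
  have "\<forall>\<^sub>F n in sequentially. x (r n) \<in> G" "\<forall>\<^sub>F n in sequentially. y (r n) \<in> G"
    using topological_tendstoD[OF xl G lG] topological_tendstoD[OF yl G lG] by auto
  then have "\<forall>\<^sub>F n in sequentially. x (r n) \<in> G \<and> y (r n) \<in> G \<and> u (y (r n)) < u l + \<theta> / 6 \<and>
      - w (x (r n)) < - w l + \<theta> / 6 \<and> 1 / real (Suc (r n)) < \<theta> / 6"
    using lim[of "\<theta> / 6"] \<theta> by (simp add: eventually_conj_iff)
  then obtain n where n: "x (r n) \<in> G" "y (r n) \<in> G" "u (y (r n)) < u l + \<theta> / 6"
      "- w (x (r n)) < - w l + \<theta> / 6" "1 / real (Suc (r n)) < \<theta> / 6"
    by (auto dest: eventually_happens)
  have "\<alpha> (r n) / 2 * (norm (x (r n) - y (r n)))\<^sup>2 \<le> \<theta> / 2"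
    using le[of "r n"] n M(1)[OF l(1)] by linarith
  then show False using bad[of "r n"] n by simp
qed

lemma sup_convolution:
  fixes u :: "'a::euclidean_space \<Rightarrow> real"
  assumes K: "compact K" "K \<noteq> {}" and usc: "usc_on K u" and "\<alpha> > 0"
    and R: "\<And>z. z \<in> K \<Longrightarrow> norm z \<le> R"
  obtains uc where "\<And>z. \<exists>z'\<in>K. uc z = u z' - \<alpha> / 2 * (norm (z - z'))\<^sup>2"
    "\<And>z y. y \<in> K \<Longrightarrow> u y - \<alpha> / 2 * (norm (z - y))\<^sup>2 \<le> uc z"
    "\<And>z y \<rho>. norm z \<le> \<rho> \<Longrightarrow> norm y \<le> \<rho> \<Longrightarrow> \<bar>uc z - uc y\<bar> \<le> \<alpha> * (R + \<rho>) * norm (z - y)"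
    "continuous_on UNIV uc"
proof -
  have "\<exists>z'\<in>K. \<forall>y\<in>K. u y - \<alpha> / 2 * (norm (z - y))\<^sup>2 \<le> u z' - \<alpha> / 2 * (norm (z - z'))\<^sup>2" for z
  proof -
    have "usc_on K (\<lambda>y. u y + - (\<alpha> / 2 * (norm (z - y))\<^sup>2))"
      by (intro usc_on_add usc usc_on_continuous continuous_intros)
    then obtain m where "m \<in> K"
      "\<And>y. y \<in> K \<Longrightarrow> u y + - (\<alpha> / 2 * (norm (z - y))\<^sup>2) \<le> u m + - (\<alpha> / 2 * (norm (z - m))\<^sup>2)"
      using usc_attains_max[OF K] by blast
    then show ?thesis by auto
  qed
  then obtain m where m: "\<And>z. m z \<in> K"
    "\<And>z y. y \<in> K \<Longrightarrow> u y - \<alpha> / 2 * (norm (z - y))\<^sup>2 \<le> u (m z) - \<alpha> / 2 * (norm (z - m z))\<^sup>2"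
    by metis
  define uc where "uc z = u (m z) - \<alpha> / 2 * (norm (z - m z))\<^sup>2" for z
  have one: "uc z - uc y \<le> \<alpha> * (R + \<rho>) * norm (z - y)" if "norm z \<le> \<rho>" "norm y \<le> \<rho>" for z y \<rho>
  proof -
    let ?a = "norm (y - m z)" and ?b = "norm (z - m z)"
    have a: "?a \<le> R + \<rho>" "?b \<le> R + \<rho>"
      using norm_triangle_ineq4[of y "m z"] norm_triangle_ineq4[of z "m z"] R[OF m(1)[of z]] that
      by linarith+
    have ab: "?a - ?b \<le> norm (z - y)"
      using norm_triangle_ineq2[of "y - m z" "z - m z"] by (simp add: norm_minus_commute)
    have "uc z - uc y \<le> \<alpha> / 2 * (?a\<^sup>2 - ?b\<^sup>2)"
      using m(2)[OF m(1)[of z], of y] by (simp add: uc_def algebra_simps)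
    also have "?a\<^sup>2 - ?b\<^sup>2 = (?a - ?b) * (?a + ?b)" by (simp add: power2_eq_square algebra_simps)
    also have "\<dots> \<le> norm (z - y) * (2 * (R + \<rho>))"
      using ab a by (intro mult_mono) auto
    finally show ?thesis using \<open>\<alpha> > 0\<close> by (simp add: mult_left_mono algebra_simps)
  qed
  have lip: "\<bar>uc z - uc y\<bar> \<le> \<alpha> * (R + \<rho>) * norm (z - y)" if "norm z \<le> \<rho>" "norm y \<le> \<rho>" for z y \<rho>
    using one[OF that] one[OF that(2,1)] by (simp add: abs_le_iff norm_minus_commute)
  have "isCont uc z" for z
  proof -
    let ?L = "\<alpha> * (R + (norm z + 1))"
    have "((\<lambda>y. uc y - uc z) \<longlongrightarrow> 0) (at z)"
    proof (rule Lim_null_comparison)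
      have "\<forall>\<^sub>F y in at z. y \<in> ball z 1" by (intro eventually_at_in_open') auto
      then show "\<forall>\<^sub>F y in at z. norm (uc y - uc z) \<le> ?L * norm (y - z)"
      proof eventually_elim
        case (elim y)
        then have "norm y \<le> norm z + 1"
          using norm_triangle_ineq2[of y z] by (simp add: dist_norm norm_minus_commute)
        then show ?case using lip[of y "norm z + 1" z] by simp
      qed
      have "((\<lambda>y. ?L * norm (y - z)) \<longlongrightarrow> ?L * norm (z - z)) (at z)" by (intro tendsto_intros)
      then show "((\<lambda>y. ?L * norm (y - z)) \<longlongrightarrow> 0) (at z)" by simp
    qed
    then show ?thesis unfolding isCont_def by (rule LIM_zero_cancel)
  qed
  then have "continuous_on UNIV uc" by (simp add: continuous_at_imp_continuous_on)
  then show thesis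
    by (intro that[of uc]) (use m lip in \<open>auto simp: uc_def\<close>)
qed

section \<open>Comparison for strict supersolutions\<close>

theorem strict_comparison:
  fixes u w :: "'a::euclidean_space \<Rightarrow> real" and \<beta> :: "'a \<Rightarrow> 'v \<Rightarrow> 'a" and F :: "'a \<Rightarrow> 'v \<Rightarrow> real"
    and e :: "'i \<Rightarrow> 'a"
  assumes G: "open G" "bounded G"
    and usc: "usc_on (closure G) u" "usc_on (closure G) (\<lambda>z. - w z)"
    and lip: "\<And>z y V. z \<in> G \<Longrightarrow> y \<in> G \<Longrightarrow> V \<in> A \<Longrightarrow> norm (\<beta> z V - \<beta> y V) \<le> Lb * norm (z - y)"
    and bd: "\<And>z V. z \<in> G \<Longrightarrow> V \<in> A \<Longrightarrow> norm (\<beta> z V) \<le> B"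
    and Fu: "\<And>\<eta>. \<eta> > 0 \<Longrightarrow> \<exists>d>0. \<forall>z\<in>G. \<forall>y\<in>G. \<forall>V\<in>A. dist z y < d \<longrightarrow> \<bar>F z V - F y V\<bar> < \<eta>"
    and sub: "\<And>\<Phi> \<Phi>1 \<Phi>2 z V. c2_fun \<Phi> \<Phi>1 \<Phi>2 \<Longrightarrow> z \<in> G \<Longrightarrow>
       \<forall>\<^sub>F y in at z. u y - \<Phi> y \<le> u z - \<Phi> z \<Longrightarrow> V \<in> A \<Longrightarrow>
       0 \<le> \<Phi>1 z \<bullet> \<beta> z V + 1 / 2 * (\<Sum>i\<in>I. \<Phi>2 z (e i) \<bullet> e i) + F z V"
    and super: "\<And>\<Phi> \<Phi>1 \<Phi>2 z. c2_fun \<Phi> \<Phi>1 \<Phi>2 \<Longrightarrow> z \<in> G \<Longrightarrow>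
       \<forall>\<^sub>F y in at z. w z - \<Phi> z \<le> w y - \<Phi> y \<Longrightarrow>
       \<exists>V\<in>A. \<Phi>1 z \<bullet> \<beta> z V + 1 / 2 * (\<Sum>i\<in>I. \<Phi>2 z (e i) \<bullet> e i) + F z V \<le> - \<kappa>"
    and \<kappa>: "\<kappa> > 0"
    and bdry: "\<And>z. z \<in> closure G \<Longrightarrow> z \<notin> G \<Longrightarrow> u z \<le> w z"
    and z: "z \<in> G"
  shows "u z \<le> w z"
proof (rule ccontr)
  assume "\<not> ?thesis"
  then have pos: "u z - w z > 0" by simp
  let ?K = "closure G"
  have K: "compact ?K" using G(2) by (simp add: compact_closure)
  have GK: "G \<subseteq> ?K" by (rule closure_subset)
  then have Kne: "?K \<noteq> {}" using z by blast
  have uscd: "usc_on ?K (\<lambda>z. u z + - w z)" by (rule usc_on_add[OF usc])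
  obtain zM where zM: "zM \<in> ?K" "\<And>y. y \<in> ?K \<Longrightarrow> u y + - w y \<le> u zM + - w zM"
    using usc_attains_max[OF K Kne uscd] by blast
  define M where "M = u zM - w zM"
  have M: "u y - w y \<le> M" if "y \<in> ?K" for y using zM(2)[OF that] by (simp add: M_def)
  have M0: "M > 0" using M[of z] pos z GK by fastforce
  have MG: "y \<in> G" if "y \<in> ?K" "M \<le> u y - w y" for y
    using bdry[OF that(1)] that(2) M0 by fastforce
  define Lp where "Lp = max Lb 0"
  have Lp: "Lp \<ge> 0" "Lb \<le> Lp" by (simp_all add: Lp_def)
  define Bp where "Bp = max B 0"
  have Bp: "Bp \<ge> 0" "B \<le> Bp" by (simp_all add: Bp_def)
  obtain R0 where R0: "\<And>y. y \<in> ?K \<Longrightarrow> norm y \<le> R0"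
    using compact_imp_bounded[OF K] unfolding bounded_iff by blast
  define R where "R = max R0 1"
  have R: "R > 0" "R \<ge> 1" and KR: "\<And>y. y \<in> ?K \<Longrightarrow> norm y \<le> R"
    using R0 by (auto simp: R_def le_max_iff_disj)
  define \<theta> where "\<theta> = \<kappa> / (16 * (Lp + 1))"
  have \<theta>: "\<theta> > 0" "Lp * \<theta> \<le> \<kappa> / 16"
    using \<kappa> Lp by (auto simp: \<theta>_def field_simps)
  obtain \<alpha>0 \<gamma> where \<alpha>0: "\<alpha>0 > 0" and \<gamma>: "\<gamma> > 0" and pen: "\<And>\<alpha> y y'. \<alpha> \<ge> \<alpha>0 \<Longrightarrow> y \<in> ?K \<Longrightarrow> y' \<in> ?K \<Longrightarrow>
     M - \<gamma> \<le> u y' - w y - \<alpha> / 2 * (norm (y - y'))\<^sup>2 \<Longrightarrow>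
     \<alpha> * (norm (y - y'))\<^sup>2 \<le> \<theta> \<and> y \<in> G \<and> y' \<in> G"
    using doubling_penalty[OF K G(1) usc M MG \<theta>(1)] by metis
  obtain d where d: "d > 0" "\<And>y y' V. y \<in> G \<Longrightarrow> y' \<in> G \<Longrightarrow> V \<in> A \<Longrightarrow> dist y y' < d \<Longrightarrow>
      \<bar>F y V - F y' V\<bar> < \<kappa> / 8"
    using Fu[of "\<kappa> / 8"] \<kappa> by auto
  define \<alpha> where "\<alpha> = max \<alpha>0 (\<theta> / d\<^sup>2 + 1)"
  have \<alpha>: "\<alpha> \<ge> \<alpha>0" "\<alpha> > 0" using \<alpha>0 by (auto simp: \<alpha>_def)
  have "\<theta> / d\<^sup>2 < \<alpha>" by (simp add: \<alpha>_def)
  then have \<alpha>d: "\<theta> < \<alpha> * d\<^sup>2" using d(1) by (simp add: field_simps)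
  obtain uc where uc: "\<And>z. \<exists>z'\<in>?K. uc z = u z' - \<alpha> / 2 * (norm (z - z'))\<^sup>2"
    "\<And>z y. y \<in> ?K \<Longrightarrow> u y - \<alpha> / 2 * (norm (z - y))\<^sup>2 \<le> uc z"
    "\<And>z y \<rho>. norm z \<le> \<rho> \<Longrightarrow> norm y \<le> \<rho> \<Longrightarrow> \<bar>uc z - uc y\<bar> \<le> \<alpha> * (R + \<rho>) * norm (z - y)"
    "continuous_on UNIV uc"
    using sup_convolution[OF K Kne usc(1) \<alpha>(2) KR] by metis
  define L where "L = \<alpha> * (R + (R + 1))"
  have L: "L > 0" using \<alpha> R by (simp add: L_def)
  define r where "r = min 1 (min (\<gamma> / (4 * L)) (\<kappa> / (16 * (Lp + 1) * L)))"
  have r: "r > 0" "r \<le> 1" using \<gamma> L \<kappa> Lp by (auto simp: r_def)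
  have Lr: "L * r \<le> \<gamma> / 4"
  proof -
    have "L * r \<le> L * (\<gamma> / (4 * L))" using L by (intro mult_left_mono) (auto simp: r_def)
    then show ?thesis using L by simp
  qed
  have LLr: "Lp * (L * r) \<le> \<kappa> / 16"
  proof -
    have "L * r \<le> L * (\<kappa> / (16 * (Lp + 1) * L))" using L by (intro mult_left_mono) (auto simp: r_def)
    also have "\<dots> = \<kappa> / (16 * (Lp + 1))" using L by simp
    finally have "Lp * (L * r) \<le> Lp * (\<kappa> / (16 * (Lp + 1)))" using Lp by (intro mult_left_mono) auto
    also have "\<dots> \<le> \<kappa> / 16" using \<kappa> Lp by (simp add: field_simps)
    finally show ?thesis .
  qed
  have near: "\<alpha> * (norm (z1 - z'))\<^sup>2 \<le> \<theta> \<and> z1 \<in> G \<and> z' \<in> G"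
    if z1: "z1 \<in> ?K" "M - \<gamma> / 2 \<le> uc z1 - w z1" and zz: "dist z1 y \<le> r"
      and z': "z' \<in> ?K" "uc y = u z' - \<alpha> / 2 * (norm (y - z'))\<^sup>2" for z1 y z'
  proof (rule pen[OF \<alpha>(1) z1(1) z'(1)])
    have n1: "norm z1 \<le> R" "norm z' \<le> R" using KR z1(1) z'(1) by auto
    have dy: "norm (z1 - y) \<le> r" using zz by (simp add: dist_norm)
    have ny: "norm y \<le> R + 1"
      using norm_triangle_ineq2[of y z1] dy n1 r by (simp add: norm_minus_commute)
    have "\<bar>uc z1 - uc y\<bar> \<le> L * norm (z1 - y)"
      using uc(3)[of z1 "R + 1" y] n1 ny by (simp add: L_def)
    also have "\<dots> \<le> L * r" using L dy by (intro mult_left_mono) auto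
    finally have 1: "uc z1 - uc y \<le> \<gamma> / 4" using Lr by linarith
    let ?a = "norm (z1 - z')" and ?b = "norm (y - z')"
    have ab: "?a \<le> 2 * R" "?b \<le> 2 * R + 1"
      using norm_triangle_ineq4[of z1 z'] norm_triangle_ineq4[of y z'] n1 ny by linarith+
    have "?a - ?b \<le> norm (z1 - y)"
      using norm_triangle_ineq2[of "z1 - z'" "y - z'"] by simp
    then have "(?a - ?b) * (?a + ?b) \<le> r * (2 * (2 * R + 1))"
      using ab dy r R by (intro mult_mono) auto
    then have "\<alpha> / 2 * ((?a - ?b) * (?a + ?b)) \<le> \<alpha> / 2 * (r * (2 * (2 * R + 1)))"
      using \<alpha> by (intro mult_left_mono) auto
    also have "\<dots> = L * r" by (simp add: L_def algebra_simps)
    finally have 2: "\<alpha> / 2 * ?a\<^sup>2 - \<alpha> / 2 * ?b\<^sup>2 \<le> \<gamma> / 4"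
      using Lr by (simp add: power2_eq_square algebra_simps)
    show "M - \<gamma> \<le> u z' - w z1 - \<alpha> / 2 * ?a\<^sup>2"
      using 1 2 z1(2) z'(2) \<gamma> by simp
  qed
  have frozen: "0 \<le> \<Phi>1 y \<bullet> \<beta> z1 V + 1 / 2 * (\<Sum>i\<in>I. \<Phi>2 y (e i) \<bullet> e i) + (F z1 V + \<kappa> / 4)"
    if z1: "z1 \<in> ?K" "M - \<gamma> / 2 \<le> uc z1 - w z1" and V: "V \<in> A" and c2: "c2_fun \<Phi> \<Phi>1 \<Phi>2"
      and y: "y \<in> ball z1 r" and ev: "\<forall>\<^sub>F x in at y. uc x - \<Phi> x \<le> uc y - \<Phi> y"
    for z1 V \<Phi> \<Phi>1 \<Phi>2 y
  proof -
    obtain z' where z': "z' \<in> ?K" "uc y = u z' - \<alpha> / 2 * (norm (y - z'))\<^sup>2" using uc(1) by blast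
    have nr: "\<alpha> * (norm (z1 - z'))\<^sup>2 \<le> \<theta>" "z1 \<in> G" "z' \<in> G"
      using near[OF z1 _ z'] y by auto
    have dy: "norm (z1 - y) \<le> r" using y by (simp add: dist_norm)
    have n1: "norm z1 \<le> R" "norm z' \<le> R" using KR z1(1) z'(1) by auto
    define g where "g = \<Phi>1 y"
    have c2': "c2_fun (\<lambda>x. \<Phi> (x + (y - z'))) (\<lambda>x. \<Phi>1 (x + (y - z'))) (\<lambda>x. \<Phi>2 (x + (y - z')))"
      by (rule c2_fun_shift[OF c2])
    obtain S where S: "open S" "y \<in> S" "\<And>x. x \<in> S \<Longrightarrow> x \<noteq> y \<Longrightarrow> uc x - \<Phi> x \<le> uc y - \<Phi> y"
      using ev unfolding eventually_at_topological by blast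
    have ev': "\<forall>\<^sub>F x in at z'. u x - \<Phi> (x + (y - z')) \<le> u z' - \<Phi> (z' + (y - z'))"
    proof -
      have "((\<lambda>x. x + (y - z')) \<longlongrightarrow> y) (at z')" by (auto intro!: tendsto_eq_intros)
      then have "\<forall>\<^sub>F x in at z'. x + (y - z') \<in> S"
        using S(1,2) by (rule topological_tendstoD)
      moreover have "\<forall>\<^sub>F x in at z'. x \<in> G" using G(1) nr(3) by (intro eventually_at_in_open')
      ultimately show ?thesis
      proof eventually_elim
        case (elim x)
        have "u x - \<alpha> / 2 * (norm (y - z'))\<^sup>2 \<le> uc (x + (y - z'))"
          using uc(2)[of x "x + (y - z')"] elim(2) GK by auto
        moreover have "uc (x + (y - z')) - \<Phi> (x + (y - z')) \<le> uc y - \<Phi> y"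
          using S(3)[OF elim(1)] by (cases "x + (y - z') = y") auto
        ultimately show ?case using z'(2) by simp
      qed
    qed
    have ineq: "0 \<le> g \<bullet> \<beta> z' V + 1 / 2 * (\<Sum>i\<in>I. \<Phi>2 y (e i) \<bullet> e i) + F z' V"
      using sub[OF c2' nr(3) ev' V] by (simp add: g_def)
    have "- (g + \<alpha> *\<^sub>R (y - z')) = 0"
    proof (rule gradient_zero_local_max)
      show "((\<lambda>x. - (\<Phi> x + \<alpha> / 2 * ((x - z') \<bullet> (x - z')))) has_derivative
         (\<lambda>v. (- (g + \<alpha> *\<^sub>R (y - z'))) \<bullet> v)) (at y)"
        using c2 unfolding c2_fun_def g_def
        by (auto intro!: derivative_eq_intros simp: fun_eq_iff inner_commute algebra_simps)
      show "\<forall>\<^sub>F x in at y. - (\<Phi> x + \<alpha> / 2 * ((x - z') \<bullet> (x - z')))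
          \<le> - (\<Phi> y + \<alpha> / 2 * ((y - z') \<bullet> (y - z')))"
        using ev
      proof eventually_elim
        case (elim x)
        then show ?case
          using uc(2)[OF z'(1), of x] z'(2) by (simp add: power2_norm_eq_inner)
      qed
    qed
    then have "g = \<alpha> *\<^sub>R (z' - y)" by (simp add: add_eq_0_iff scaleR_diff_right)
    then have ng: "norm g = \<alpha> * norm (z' - y)" using \<alpha> by simp
    have tri: "norm (z' - y) \<le> norm (z1 - z') + r"
      using norm_triangle_ineq[of "z' - z1" "z1 - y"] dy by (simp add: norm_minus_commute)
    have zz': "norm (z1 - z') \<le> 2 * R" using norm_triangle_ineq4[of z1 z'] n1 by linarith
    have "norm (\<beta> z' V - \<beta> z1 V) \<le> Lb * norm (z' - z1)" by (rule lip[OF nr(3,2) V])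
    also have "\<dots> \<le> Lp * norm (z1 - z')"
      using Lp by (simp add: norm_minus_commute mult_right_mono)
    finally have nb: "norm (\<beta> z' V - \<beta> z1 V) \<le> Lp * norm (z1 - z')" .
    have "g \<bullet> (\<beta> z' V - \<beta> z1 V) \<le> norm g * norm (\<beta> z' V - \<beta> z1 V)"
      by (rule norm_cauchy_schwarz)
    also have "\<dots> \<le> (\<alpha> * (norm (z1 - z') + r)) * (Lp * norm (z1 - z'))"
      unfolding ng using tri nb \<alpha> r by (intro mult_mono mult_left_mono) auto
    also have "\<dots> = Lp * (\<alpha> * (norm (z1 - z'))\<^sup>2) + Lp * (\<alpha> * norm (z1 - z') * r)"
      by (simp add: power2_eq_square algebra_simps)
    also have "\<dots> \<le> Lp * \<theta> + Lp * (L * r)"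
    proof -
      have "\<alpha> * norm (z1 - z') \<le> L" unfolding L_def using zz' \<alpha> by (intro mult_left_mono) auto
      then show ?thesis using nr(1) Lp r by (intro add_mono mult_left_mono mult_right_mono) auto
    qed
    finally have 1: "g \<bullet> \<beta> z' V - g \<bullet> \<beta> z1 V \<le> \<kappa> / 8"
      using \<theta>(2) LLr by (simp add: inner_diff_right)
    have "\<alpha> * (norm (z1 - z'))\<^sup>2 < \<alpha> * d\<^sup>2" using nr(1) \<alpha>d by linarith
    then have "(norm (z1 - z'))\<^sup>2 < d\<^sup>2" using \<alpha> by simp
    then have "dist z' z1 < d" using d(1) power2_less_imp_less[of "norm (z1 - z')" d]
      by (simp add: dist_norm norm_minus_commute)
    from d(2)[OF nr(3,2) V this] have "F z' V < F z1 V + \<kappa> / 8" by linarith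
    then show ?thesis using ineq 1 unfolding g_def by simp
  qed
  define D where "D = real DIM('a)"
  have D: "D > 0" by (simp add: D_def)
  define \<epsilon> where "\<epsilon> = min (r / 2) (\<gamma> / (16 * L)) / (4 * D)"
  have \<epsilon>: "\<epsilon> > 0" using r \<gamma> L D by (simp add: \<epsilon>_def)
  have D\<epsilon>: "4 * D * \<epsilon> = min (r / 2) (\<gamma> / (16 * L))" using D by (simp add: \<epsilon>_def)
  have D\<epsilon>1: "4 * D * \<epsilon> \<le> r / 2" and "4 * D * \<epsilon> \<le> \<gamma> / (16 * L)" unfolding D\<epsilon> by simp_all
  then have D\<epsilon>2: "L * (4 * D * \<epsilon>) \<le> \<gamma> / 16" using L by (simp add: field_simps)
  let ?Q = "{y::'a. \<forall>v\<in>Basis. \<bar>y \<bullet> v\<bar> \<le> R + 1}"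
  have "?Q = cbox (- ((R + 1) *\<^sub>R One)) ((R + 1) *\<^sub>R One)"
    by (auto simp: mem_box abs_le_iff minus_le_iff)
  then have "compact ?Q" by simp
  then have "compact (uc ` ?Q)" by (intro compact_continuous_image continuous_on_subset[OF uc(4)]) auto
  then have "bounded (uc ` ?Q)" by (rule compact_imp_bounded)
  then obtain C0 where "\<forall>x\<in>uc ` ?Q. norm x \<le> C0" unfolding bounded_iff by blast
  then have C0: "\<bar>uc y\<bar> \<le> C0" if "y \<in> ?Q" for y using that by fastforce
  define C where "C = C0 + 1"
  define Kc where "Kc = \<bar>barrier_const C r Bp I e + (smoothing_const Bp \<epsilon> I e)\<^sup>2 * C\<bar>"
  define lam where "lam = 8 * (Kc + 1) / \<kappa>"
  have lam: "lam > 0" using \<kappa> by (simp add: lam_def Kc_def add_nonneg_pos)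
  have Klam: "Kc / lam \<le> \<kappa> / 8"
  proof -
    have "Kc \<le> \<kappa> / 8 * lam" using \<kappa> by (simp add: lam_def)
    then show ?thesis using lam by (simp add: pos_divide_le_eq)
  qed
  define \<epsilon>' where "\<epsilon>' = min 1 (min (\<gamma> / 16) (\<kappa> / (16 * lam)))"
  have \<epsilon>': "\<epsilon>' > 0" "\<epsilon>' \<le> 1" "\<epsilon>' \<le> \<gamma> / 16" and "\<epsilon>' \<le> \<kappa> / (16 * lam)"
    using \<gamma> \<kappa> lam by (auto simp: \<epsilon>'_def)
  then have lam\<epsilon>': "2 * lam * \<epsilon>' \<le> \<kappa> / 8" using lam by (simp add: field_simps)
  have "continuous_on ?Q uc" by (rule continuous_on_subset[OF uc(4)]) simp
  then obtain c ut where ut: "c > 0" "trig_poly c ut"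
    "\<And>y. y \<in> ?Q \<Longrightarrow> \<bar>ut y - uc y\<bar> < \<epsilon>'" "\<And>y. \<bar>ut y\<bar> \<le> C0 + \<epsilon>'"
    using trig_poly_approx[of "R + 1" \<epsilon>' uc C0] R \<epsilon>'(1) C0 by auto
  have utC: "\<bar>ut y\<bar> \<le> C" for y using ut(4)[of y] \<epsilon>'(2) by (simp add: C_def)
  have inQ: "y \<in> ?Q" if "norm y \<le> R + 1" for y
    using that Basis_le_norm order_trans by blast
  define W where "W = mollify4 \<epsilon> ut"
  have W: "\<bar>W x - uc x\<bar> \<le> \<gamma> / 8" if x: "x \<in> ?K" for x
  proof -
    have nx: "norm x \<le> R" by (rule KR[OF x])
    have "uc x - \<gamma> / 8 \<le> ut y \<and> ut y \<le> uc x + \<gamma> / 8" if y: "dist x y \<le> 4 * real DIM('a) * \<epsilon>" for y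
    proof -
      have dxy: "norm (y - x) \<le> 4 * D * \<epsilon>" using y by (simp add: dist_norm D_def norm_minus_commute)
      then have ny: "norm y \<le> R + 1"
        using D\<epsilon>1 r nx norm_triangle_ineq2[of y x] by linarith
      have "\<bar>uc y - uc x\<bar> \<le> L * norm (y - x)"
        using uc(3)[of y "R + 1" x] ny nx by (simp add: L_def)
      also have "\<dots> \<le> L * (4 * D * \<epsilon>)" using L dxy by (intro mult_left_mono) auto
      finally show ?thesis using ut(3)[OF inQ[OF ny]] D\<epsilon>2 \<epsilon>'(3) by linarith
    qed
    then have "uc x - \<gamma> / 8 \<le> W x \<and> W x \<le> uc x + \<gamma> / 8"
      unfolding W_def by (rule mollify4_bounds[OF ut(2) \<epsilon>])
    then show ?thesis by linarith
  qed
  have "usc_on ?K (\<lambda>x. W x + - w x)"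
    unfolding W_def
    by (intro usc_on_add usc(2) usc_on_continuous trig_poly_continuous[OF trig_poly_mollify4[OF ut(2) \<epsilon>]])
  then obtain z1 where z1: "z1 \<in> ?K" "\<And>y. y \<in> ?K \<Longrightarrow> W y + - w y \<le> W z1 + - w z1"
    using usc_attains_max[OF K Kne] by blast
  have "u zM \<le> uc zM" using uc(2)[OF zM(1), of zM] by simp
  then have z1M: "M - \<gamma> / 2 \<le> uc z1 - w z1"
    using z1(2)[OF zM(1)] W[OF z1(1)] W[OF zM(1)] \<gamma> unfolding M_def by linarith
  obtain z1' where "z1' \<in> ?K" "uc z1 = u z1' - \<alpha> / 2 * (norm (z1 - z1'))\<^sup>2" using uc(1) by blast
  then have z1G: "z1 \<in> G" using near[OF z1(1) z1M, of z1 z1'] r by simp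
  have Wtp: "trig_poly c W" unfolding W_def by (rule trig_poly_mollify4[OF ut(2) \<epsilon>])
  have "\<forall>\<^sub>F y in at z1. y \<in> G" using G(1) z1G by (intro eventually_at_in_open')
  then have "\<forall>\<^sub>F y in at z1. w z1 - W z1 \<le> w y - W y"
  proof eventually_elim
    case (elim y)
    then show ?case using z1(2)[of y] GK by auto
  qed
  then obtain V where V: "V \<in> A" "lin_gen (\<beta> z1 V) I e W z1 + F z1 V \<le> - \<kappa>"
    using super[OF trig_poly_c2[OF Wtp] z1G] trig_poly_c2_lin_gen[OF Wtp] by metis
  have "norm (\<beta> z1 V) \<le> Bp" using bd[OF z1G V(1)] Bp by linarith
  have uccont: "continuous_on (cball z1 r) uc" by (rule continuous_on_subset[OF uc(4)]) simp
  have "lin_gen (\<beta> z1 V) I e (mollify4 \<epsilon> ut) z1 \<ge>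
     - (F z1 V + \<kappa> / 4) - 2 * lam * \<epsilon>' - (barrier_const C r Bp I e + (smoothing_const Bp \<epsilon> I e)\<^sup>2 * C) / lam"
  proof (rule frozen_inequality[OF r uccont, where c = c])
    show "0 \<le> \<Phi>1 y \<bullet> \<beta> z1 V + 1 / 2 * (\<Sum>i\<in>I. \<Phi>2 y (e i) \<bullet> e i) + (F z1 V + \<kappa> / 4)"
      if "c2_fun \<Phi> \<Phi>1 \<Phi>2" "y \<in> ball z1 r" "\<forall>\<^sub>F x in at y. uc x - \<Phi> x \<le> uc y - \<Phi> y" for \<Phi> \<Phi>1 \<Phi>2 y
      by (rule frozen[OF z1(1) z1M V(1) that])
    show "\<bar>ut y - uc y\<bar> \<le> \<epsilon>'" if "y \<in> cball z1 r" for y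
    proof -
      have "norm y \<le> R + 1"
        using that r KR[OF z1(1)] norm_triangle_ineq2[of y z1] by (simp add: dist_norm norm_minus_commute)
      then show ?thesis using ut(3)[OF inQ] by (simp add: less_imp_le)
    qed
    show "4 * real DIM('a) * \<epsilon> \<le> r / 2" using D\<epsilon>1 by (simp add: D_def)
    show "norm (\<beta> z1 V) \<le> Bp" by fact
  qed (rule ut utC \<epsilon>' lam \<epsilon>)+
  moreover have "(barrier_const C r Bp I e + (smoothing_const Bp \<epsilon> I e)\<^sup>2 * C) / lam \<le> \<kappa> / 8"
  proof -
    have "barrier_const C r Bp I e + (smoothing_const Bp \<epsilon> I e)\<^sup>2 * C \<le> Kc"
      unfolding Kc_def by (rule abs_ge_self)
    then have "(barrier_const C r Bp I e + (smoothing_const Bp \<epsilon> I e)\<^sup>2 * C) / lam \<le> Kc / lam"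
      using lam by (intro divide_right_mono) auto
    then show ?thesis using Klam by (rule order_trans)
  qed
  moreover have False if "X + f \<le> - \<kappa>" "X \<ge> - (f + \<kappa> / 4) - Z - Y" "Y \<le> \<kappa> / 8" "Z \<le> \<kappa> / 8"
    for X Y Z f using that \<kappa> by argo
  ultimately show False using V(2) lam\<epsilon>' unfolding W_def[symmetric] by blast
qed

section \<open>Test functions on the simplex\<close>

lemma convex_prob_simplex: "convex (prob_simplex :: (real ^ 'n) set)"
proof (rule convexI)
  fix x y :: "real ^ 'n" and a b :: real
  assume x: "x \<in> prob_simplex" and y: "y \<in> prob_simplex" and ab: "0 \<le> a" "0 \<le> b" "a + b = 1"
  have "a * x $ i + b * y $ i \<le> 1" for i
  proof -
    have "a * x $ i + b * y $ i \<le> a * 1 + b * 1"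
      using x y ab by (intro add_mono mult_left_mono) (auto simp: prob_simplex_def)
    then show ?thesis using ab by simp
  qed
  then show "a *\<^sub>R x + b *\<^sub>R y \<in> prob_simplex"
    using x y ab by (auto simp: prob_simplex_def sum.distrib sum_distrib_left[symmetric])
qed

lemma simplex_le_1:
  fixes \<rho> :: "real ^ 'n"
  assumes "\<And>i. 0 \<le> \<rho> $ i" "(\<Sum>i\<in>UNIV. \<rho> $ i) = 1"
  shows "\<rho> $ i \<le> 1"
  using member_le_sum[of i UNIV "\<lambda>i. \<rho> $ i"] assms by simp

lemma open_simplex_eq:
  "open_simplex = {\<rho> :: real ^ 'n. (\<forall>i. 0 < \<rho> $ i) \<and> (\<Sum>i\<in>UNIV. \<rho> $ i) = 1}"
proof -
  define c :: "real ^ 'n" where "c = (\<chi> i. 1 / real CARD('n))"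
  have c: "c \<in> prob_simplex" by (simp add: prob_simplex_def c_def)
  then have iff: "z \<in> open_simplex \<longleftrightarrow>
      (\<forall>x\<in>prob_simplex. \<exists>e>1. (1 - e) *\<^sub>R x + e *\<^sub>R z \<in> prob_simplex)" for z :: "real ^ 'n"
    unfolding open_simplex_def by (intro convex_rel_interior_iff[OF convex_prob_simplex]) auto
  show ?thesis
  proof (intro set_eqI iffI)
    fix z :: "real ^ 'n" assume z: "z \<in> open_simplex"
    then have zS: "z \<in> prob_simplex" unfolding open_simplex_def using rel_interior_subset by blast
    obtain e where e: "e > 1" "(1 - e) *\<^sub>R c + e *\<^sub>R z \<in> prob_simplex" using iff z c by blast
    have "0 < z $ i" for i
    proof -
      have "0 \<le> (1 - e) * (1 / real CARD('n)) + e * z $ i"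
        using e(2) by (simp add: prob_simplex_def c_def)
      moreover have "(1 - e) * (1 / real CARD('n)) < 0" using e(1) by (intro mult_neg_pos) auto
      ultimately have "0 < e * z $ i" by linarith
      then show ?thesis using e(1) by (simp add: zero_less_mult_iff)
    qed
    then show "z \<in> {\<rho>. (\<forall>i. 0 < \<rho> $ i) \<and> (\<Sum>i\<in>UNIV. \<rho> $ i) = 1}"
      using zS by (simp add: prob_simplex_def)
  next
    fix z :: "real ^ 'n" assume "z \<in> {\<rho>. (\<forall>i. 0 < \<rho> $ i) \<and> (\<Sum>i\<in>UNIV. \<rho> $ i) = 1}"
    then have z: "\<And>i. 0 < z $ i" "(\<Sum>i\<in>UNIV. z $ i) = 1" by auto
    define d where "d = Min (range (($) z))"
    have d: "d > 0" "\<And>i. d \<le> z $ i" using z(1) by (auto simp: d_def)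
    show "z \<in> open_simplex"
      unfolding iff
    proof
      fix x :: "real ^ 'n" assume x: "x \<in> prob_simplex"
      let ?y = "(1 - (1 + d)) *\<^sub>R x + (1 + d) *\<^sub>R z"
      have nonneg: "0 \<le> ?y $ i" for i
      proof -
        have "d * x $ i \<le> d * 1" using x d by (intro mult_left_mono) (auto simp: prob_simplex_def)
        moreover have "0 \<le> d * z $ i" using d(1) z(1)[of i] by simp
        ultimately show ?thesis using d(2)[of i] by (simp add: algebra_simps)
      qed
      have sum: "(\<Sum>i\<in>UNIV. ?y $ i) = 1"
        using x z(2) by (simp add: prob_simplex_def sum.distrib sum_subtractf sum_distrib_left[symmetric])
      have "?y \<in> prob_simplex"
        unfolding prob_simplex_def using nonneg simplex_le_1[OF nonneg sum] sum by blast
      then show "\<exists>e>1. (1 - e) *\<^sub>R x + e *\<^sub>R z \<in> prob_simplex"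
        using d(1) by (intro exI[of _ "1 + d"]) auto
    qed
  qed
qed

definition tang :: "real ^ 'n \<Rightarrow> real ^ 'n" where
  "tang v = v - ((\<Sum>i\<in>UNIV. v $ i) / real CARD('n)) *\<^sub>R 1"

definition simplex_proj :: "real ^ 'n \<Rightarrow> real ^ 'n" where
  "simplex_proj r = r + ((1 - (\<Sum>i\<in>UNIV. r $ i)) / real CARD('n)) *\<^sub>R 1"

lemma sum_tang [simp]: "(\<Sum>i\<in>UNIV. tang v $ i) = 0"
  by (simp add: tang_def sum_subtractf)

lemma linear_tang: "linear (tang :: real ^ 'n \<Rightarrow> real ^ 'n)"
proof (rule linearI)
  fix x y :: "real ^ 'n" and c :: real
  show "tang (x + y) = tang x + tang y"
    unfolding tang_def vector_add_component sum.distrib add_divide_distrib scaleR_left_distrib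
    by simp
  have "(\<Sum>i\<in>UNIV. (c *\<^sub>R x) $ i) = c * (\<Sum>i\<in>UNIV. x $ i)"
    by (simp add: sum_distrib_left)
  then show "tang (c *\<^sub>R x) = c *\<^sub>R tang x"
    by (simp add: tang_def scaleR_right_diff_distrib)
qed

lemma continuous_on_tang: "continuous_on A f \<Longrightarrow> continuous_on A (\<lambda>x. tang (f x))"
  unfolding tang_def by (intro continuous_intros) auto

lemma tang_inner:
  fixes v y :: "real ^ 'n"
  assumes "(\<Sum>i\<in>UNIV. y $ i) = 0"
  shows "tang v \<bullet> y = v \<bullet> y"
proof -
  have "(1::real ^ 'n) \<bullet> y = (\<Sum>i\<in>UNIV. y $ i)" by (simp add: inner_vec_def)
  then show ?thesis using assms by (simp add: tang_def inner_diff_left)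
qed

lemma sum_simplex_proj [simp]: "(\<Sum>i\<in>UNIV. simplex_proj r $ i) = 1"
  by (simp add: simplex_proj_def sum.distrib)

lemma simplex_proj_id: "(\<Sum>i\<in>UNIV. r $ i) = 1 \<Longrightarrow> simplex_proj r = r"
  by (simp add: simplex_proj_def)

lemma simplex_proj_diff: "simplex_proj r - simplex_proj s = tang (r - s)"
  by (simp add: vec_eq_iff simplex_proj_def tang_def sum_subtractf diff_divide_distrib)

lemma continuous_on_simplex_proj: "continuous_on A f \<Longrightarrow> continuous_on A (\<lambda>x. simplex_proj (f x))"
  unfolding simplex_proj_def by (intro continuous_intros) auto

lemma prob_simplex_sum: "\<mu> \<in> prob_simplex \<Longrightarrow> (\<Sum>i\<in>UNIV. \<mu> $ i) = 1"
  by (simp add: prob_simplex_def)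

lemma open_simplexD: "\<rho> \<in> open_simplex \<Longrightarrow> 0 < \<rho> $ i" "\<rho> \<in> open_simplex \<Longrightarrow> (\<Sum>i\<in>UNIV. \<rho> $ i) = 1"
  by (auto simp: open_simplex_eq)

lemma open_pos_orthant: "open {r :: real ^ 'n. \<forall>i. 0 < r $ i}"
proof -
  have "{r :: real ^ 'n. \<forall>i. 0 < r $ i} = (\<Inter>i\<in>UNIV. {r. 0 < r $ i})" by auto
  moreover have "open (\<Inter>i\<in>UNIV. {r :: real ^ 'n. 0 < r $ i})"
    by (intro open_INT ballI open_Collect_less continuous_intros) auto
  ultimately show ?thesis by simp
qed

lemma has_simplex_derivativeI:
  fixes f :: "real ^ 'n \<Rightarrow> real"
  assumes "(f has_derivative (\<lambda>v. p \<bullet> v)) (at \<rho>)" and "(\<Sum>i\<in>UNIV. \<rho> $ i) = 1"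
  shows "has_simplex_derivative f (tang p) \<rho>"
  unfolding has_simplex_derivative_def
proof (intro conjI ballI)
  fix \<mu> :: "real ^ 'n" assume \<mu>: "\<mu> \<in> prob_simplex"
  have line: "((\<lambda>s. (1 - s) *\<^sub>R \<rho> + s *\<^sub>R \<mu>) has_derivative (\<lambda>h. h *\<^sub>R (\<mu> - \<rho>))) (at 0)"
    by (auto intro!: derivative_eq_intros simp: algebra_simps)
  have "((\<lambda>s. f ((1 - s) *\<^sub>R \<rho> + s *\<^sub>R \<mu>)) has_derivative (\<lambda>h. p \<bullet> (h *\<^sub>R (\<mu> - \<rho>)))) (at 0)"
    using has_derivative_compose[OF line, where g = f and g' = "\<lambda>v. p \<bullet> v"] assms(1) by simp
  then have "((\<lambda>s. f ((1 - s) *\<^sub>R \<rho> + s *\<^sub>R \<mu>)) has_real_derivative p \<bullet> (\<mu> - \<rho>)) (at 0)"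
    unfolding has_field_derivative_def
    by (rule has_derivative_eq_rhs) (auto simp: fun_eq_iff)
  then have "((\<lambda>s. (f ((1 - s) *\<^sub>R \<rho> + s *\<^sub>R \<mu>) - f \<rho>) / s) \<longlongrightarrow> p \<bullet> (\<mu> - \<rho>)) (at 0)"
    unfolding DERIV_def by simp
  moreover have "tang p \<bullet> (\<mu> - \<rho>) = p \<bullet> (\<mu> - \<rho>)"
    by (rule tang_inner) (simp add: sum_subtractf prob_simplex_sum[OF \<mu>] assms(2))
  ultimately show "((\<lambda>s. (f ((1 - s) *\<^sub>R \<rho> + s *\<^sub>R \<mu>) - f \<rho>) / s) \<longlongrightarrow> tang p \<bullet> (\<mu> - \<rho>))
      (at 0 within {s. (1 - s) *\<^sub>R \<rho> + s *\<^sub>R \<mu> \<in> prob_simplex})"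
    by (auto intro: tendsto_within_subset)
qed simp

type_synonym 'n pt = "real \<times> (real ^ 'n) \<times> (real ^ 'n)"

lemma test_function_of_c2:
  fixes \<Phi> :: "'n::finite pt \<Rightarrow> real"
  assumes "c2_fun \<Phi> \<Phi>1 \<Phi>2"
  shows "test_function T \<Phi> (\<lambda>z. fst (\<Phi>1 z)) (\<lambda>z. tang (fst (snd (\<Phi>1 z)))) (\<lambda>z. snd (snd (\<Phi>1 z)))
     (\<lambda>z. matrix (\<lambda>v. snd (snd (\<Phi>2 z (0, 0, v)))))"
proof -
  have d1: "(\<Phi> has_derivative (\<lambda>v. \<Phi>1 z \<bullet> v)) (at z)"
    and d2: "(\<Phi>1 has_derivative \<Phi>2 z) (at z)"
    and c: "continuous_on UNIV (\<lambda>z. \<Phi>2 z v)" for z v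
    using assms unfolding c2_fun_def by blast+
  have c0: "continuous_on A \<Phi>" and c1: "continuous_on A \<Phi>1" for A
    using d1 d2 by (meson has_derivative_continuous continuous_at_imp_continuous_on)+
  have c2: "continuous_on A (\<lambda>z. matrix (\<lambda>v. snd (snd (\<Phi>2 z (0, 0, v)))))" for A
    unfolding matrix_def
    by (intro continuous_on_vec_lambda continuous_intros continuous_on_subset[OF c]) auto
  have t: "((\<lambda>s. \<Phi> (s, \<rho>, x)) has_real_derivative fst (\<Phi>1 (t, \<rho>, x))) (at t)" for t \<rho> x
  proof -
    have "((\<lambda>s. (s, \<rho>, x)) has_derivative (\<lambda>h. (h, 0, 0))) (at t)"
      by (intro derivative_intros)
    from has_derivative_compose[OF this d1]
    show ?thesis
      unfolding has_field_derivative_def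
      by (rule has_derivative_eq_rhs) (auto simp: fun_eq_iff inner_prod_def)
  qed
  have r: "((\<lambda>r. \<Phi> (t, r, x)) has_derivative (\<lambda>v. fst (snd (\<Phi>1 (t, \<rho>, x))) \<bullet> v)) (at \<rho>)" for t \<rho> x
  proof -
    have "((\<lambda>r. (t, r, x)) has_derivative (\<lambda>h. (0, h, 0))) (at \<rho>)"
      by (intro derivative_intros)
    from has_derivative_compose[OF this d1]
    show ?thesis by (rule has_derivative_eq_rhs) (auto simp: fun_eq_iff inner_prod_def)
  qed
  have lx: "((\<lambda>y. (t, \<rho>, y)) has_derivative (\<lambda>h. (0, 0, h))) (at x)" for t and \<rho> x :: "real ^ 'n"
    by (intro derivative_intros)
  have x: "GDERIV (\<lambda>y. \<Phi> (t, \<rho>, y)) x :> snd (snd (\<Phi>1 (t, \<rho>, x)))" for t \<rho> x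
    unfolding gderiv_def
    by (rule has_derivative_eq_rhs[OF has_derivative_compose[OF lx d1]])
       (auto simp: fun_eq_iff inner_prod_def inner_commute)
  have xx: "((\<lambda>y. snd (snd (\<Phi>1 (t, \<rho>, y)))) has_derivative
      (\<lambda>v. matrix (\<lambda>v. snd (snd (\<Phi>2 (t, \<rho>, x) (0, 0, v)))) *v v)) (at x)" for t \<rho> x
  proof -
    have d: "((\<lambda>y. snd (snd (\<Phi>1 (t, \<rho>, y)))) has_derivative
        (\<lambda>v. snd (snd (\<Phi>2 (t, \<rho>, x) (0, 0, v))))) (at x)"
      by (intro has_derivative_snd has_derivative_compose[OF lx d2])
    then show ?thesis
      using matrix_works[OF has_derivative_linear[OF d, folded linear_matrix_vector_mul_eq]] by simp
  qed
  show ?thesis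
    unfolding test_function_def Let_def
    by (auto intro!: c0 c1 c2 continuous_on_tang continuous_on_fst continuous_on_snd t x xx
        has_simplex_derivativeI r open_simplexD)
qed

lemma has_simplex_derivative_add:
  fixes f g :: "real ^ 'n \<Rightarrow> real"
  assumes "has_simplex_derivative f p \<rho>" "has_simplex_derivative g q \<rho>"
  shows "has_simplex_derivative (\<lambda>r. f r + g r) (p + q) \<rho>"
  unfolding has_simplex_derivative_def
proof (intro conjI ballI)
  show "(\<Sum>i\<in>UNIV. (p + q) $ i) = 0"
    using assms by (simp add: has_simplex_derivative_def sum.distrib)
  fix \<mu> :: "real ^ 'n" assume "\<mu> \<in> prob_simplex"
  then have "((\<lambda>s. (f ((1 - s) *\<^sub>R \<rho> + s *\<^sub>R \<mu>) - f \<rho>) / s + (g ((1 - s) *\<^sub>R \<rho> + s *\<^sub>R \<mu>) - g \<rho>) / s)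
      \<longlongrightarrow> p \<bullet> (\<mu> - \<rho>) + q \<bullet> (\<mu> - \<rho>)) (at 0 within {s. (1 - s) *\<^sub>R \<rho> + s *\<^sub>R \<mu> \<in> prob_simplex})"
    using assms by (intro tendsto_add) (auto simp: has_simplex_derivative_def)
  then show "((\<lambda>s. (f ((1 - s) *\<^sub>R \<rho> + s *\<^sub>R \<mu>) + g ((1 - s) *\<^sub>R \<rho> + s *\<^sub>R \<mu>) - (f \<rho> + g \<rho>)) / s)
      \<longlongrightarrow> (p + q) \<bullet> (\<mu> - \<rho>)) (at 0 within {s. (1 - s) *\<^sub>R \<rho> + s *\<^sub>R \<mu> \<in> prob_simplex})"
    by (simp add: inner_add_left add_divide_distrib[symmetric] algebra_simps)
qed

lemma test_function_add:
  assumes "test_function T \<phi> \<phi>t \<phi>\<rho> \<phi>x \<phi>xx" "test_function T \<psi> \<psi>t \<psi>\<rho> \<psi>x \<psi>xx"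
  shows "test_function T (\<lambda>z. \<phi> z + \<psi> z) (\<lambda>z. \<phi>t z + \<psi>t z) (\<lambda>z. \<phi>\<rho> z + \<psi>\<rho> z)
     (\<lambda>z. \<phi>x z + \<psi>x z) (\<lambda>z. \<phi>xx z + \<psi>xx z)"
proof -
  have g: "GDERIV (\<lambda>y. f y + g y) x :> p + q" if "GDERIV f x :> p" "GDERIV g x :> q"
    for f g :: "real ^ 'a \<Rightarrow> real" and p q x
    using that by (rule GDERIV_add)
  have d: "((\<lambda>y. f y + g y) has_derivative (\<lambda>v. (A + B) *v v)) (at x)"
    if "(f has_derivative (\<lambda>v. A *v v)) (at x)" "(g has_derivative (\<lambda>v. B *v v)) (at x)"
    for f g :: "real ^ 'a \<Rightarrow> real ^ 'a" and A B x
    using has_derivative_add[OF that] by (simp add: matrix_vector_mult_add_rdistrib)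
  show ?thesis
    using assms unfolding test_function_def Let_def
    by (auto intro!: continuous_on_add DERIV_add has_simplex_derivative_add g d)
qed

definition space_test ::
  "(real ^ 'n \<Rightarrow> real ^ 'n \<Rightarrow> real) \<Rightarrow> (real ^ 'n \<Rightarrow> real ^ 'n \<Rightarrow> real ^ 'n)
    \<Rightarrow> (real ^ 'n \<Rightarrow> real ^ 'n \<Rightarrow> real ^ 'n) \<Rightarrow> (real ^ 'n \<Rightarrow> real ^ 'n \<Rightarrow> real ^ 'n ^ 'n) \<Rightarrow> bool" where
  "space_test \<psi> \<psi>\<rho> \<psi>x \<psi>xx \<longleftrightarrow>
     (let D = open_simplex \<times> UNIV in
      continuous_on D (\<lambda>(\<rho>, x). \<psi> \<rho> x) \<and> continuous_on D (\<lambda>(\<rho>, x). \<psi>\<rho> \<rho> x) \<and>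
      continuous_on D (\<lambda>(\<rho>, x). \<psi>x \<rho> x) \<and> continuous_on D (\<lambda>(\<rho>, x). \<psi>xx \<rho> x) \<and>
      (\<forall>\<rho>\<in>open_simplex. \<forall>x.
         has_simplex_derivative (\<lambda>r. \<psi> r x) (\<psi>\<rho> \<rho> x) \<rho> \<and>
         (GDERIV (\<psi> \<rho>) x :> \<psi>x \<rho> x) \<and>
         (\<psi>x \<rho> has_derivative (\<lambda>v. \<psi>xx \<rho> x *v v)) (at x)))"

lemma test_function_time_mult:
  assumes \<psi>: "space_test \<psi> \<psi>\<rho> \<psi>x \<psi>xx"
    and a: "\<And>t. 0 < t \<Longrightarrow> t < T \<Longrightarrow> (a has_real_derivative a' t) (at t)"
    and a': "continuous_on {0<..<T} a'"
  shows "test_function T (\<lambda>(t, \<rho>, x). a t * \<psi> \<rho> x) (\<lambda>(t, \<rho>, x). a' t * \<psi> \<rho> x)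
     (\<lambda>(t, \<rho>, x). a t *\<^sub>R \<psi>\<rho> \<rho> x) (\<lambda>(t, \<rho>, x). a t *\<^sub>R \<psi>x \<rho> x) (\<lambda>(t, \<rho>, x). a t *\<^sub>R \<psi>xx \<rho> x)"
proof -
  let ?D = "{0<..<T} \<times> open_simplex \<times> (UNIV :: (real ^ 'a) set)"
  have ca: "continuous_on {0<..<T} a"
    using a by (intro continuous_at_imp_continuous_on) (auto intro: DERIV_isCont[OF a])
  have ta: "continuous_on ?D (\<lambda>z. a (fst z))" "continuous_on ?D (\<lambda>z. a' (fst z))"
    by (intro continuous_on_compose2[OF ca] continuous_on_compose2[OF a'] continuous_intros; auto)+
  have sp: "continuous_on ?D (\<lambda>z. f (fst (snd z)) (snd (snd z)))"
    if "continuous_on (open_simplex \<times> UNIV) (\<lambda>(\<rho>, x). f \<rho> x)"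
    for f :: "real ^ 'a \<Rightarrow> real ^ 'a \<Rightarrow> 'b::topological_space"
  proof -
    have "continuous_on (open_simplex \<times> UNIV) (\<lambda>p. f (fst p) (snd p))"
      using that by (simp add: case_prod_beta')
    then show ?thesis by (rule continuous_on_compose2) (auto intro!: continuous_intros)
  qed
  have s: "has_simplex_derivative (\<lambda>r. c * f r) (c *\<^sub>R p) \<rho>"
    if "has_simplex_derivative f p \<rho>" for f :: "real ^ 'a \<Rightarrow> real" and p \<rho> and c :: real
    unfolding has_simplex_derivative_def
  proof (intro conjI ballI)
    show "(\<Sum>i\<in>UNIV. (c *\<^sub>R p) $ i) = 0"
      using that by (simp add: has_simplex_derivative_def sum_distrib_left[symmetric])
    fix \<mu> :: "real ^ 'a" assume "\<mu> \<in> prob_simplex"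
    then have "((\<lambda>s. c * ((f ((1 - s) *\<^sub>R \<rho> + s *\<^sub>R \<mu>) - f \<rho>) / s)) \<longlongrightarrow> c * (p \<bullet> (\<mu> - \<rho>)))
        (at 0 within {s. (1 - s) *\<^sub>R \<rho> + s *\<^sub>R \<mu> \<in> prob_simplex})"
      using that by (intro tendsto_mult_left) (auto simp: has_simplex_derivative_def)
    then show "((\<lambda>s. (c * f ((1 - s) *\<^sub>R \<rho> + s *\<^sub>R \<mu>) - c * f \<rho>) / s) \<longlongrightarrow> (c *\<^sub>R p) \<bullet> (\<mu> - \<rho>))
        (at 0 within {s. (1 - s) *\<^sub>R \<rho> + s *\<^sub>R \<mu> \<in> prob_simplex})"
      by (simp add: right_diff_distrib)
  qed
  have g: "GDERIV (\<lambda>y. c * f y) x :> c *\<^sub>R p" if "GDERIV f x :> p"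
    for f :: "real ^ 'a \<Rightarrow> real" and p x and c :: real
    using has_derivative_mult_right[of f "\<lambda>h. h \<bullet> p" "at x" c] that by (simp add: gderiv_def)
  have d: "((\<lambda>y. c *\<^sub>R f y) has_derivative (\<lambda>v. (c *\<^sub>R A) *v v)) (at x)"
    if "(f has_derivative (\<lambda>v. A *v v)) (at x)" for f :: "real ^ 'a \<Rightarrow> real ^ 'a" and A x and c :: real
    using has_derivative_scaleR_right[OF that, of c] by (simp add: scaleR_matrix_vector_assoc)
  show ?thesis
    using \<psi> unfolding test_function_def Let_def space_test_def case_prod_beta
    by (auto intro!: continuous_on_mult continuous_on_scaleR ta sp[unfolded case_prod_beta]
        DERIV_cmult_right a s g d)
qed

section \<open>Comparison for the control problem\<close>

text \<open>The drift enters through \<open>Hx\<close> and \<open>Hr\<close>, which stand for the gradients of the energy in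
  \<open>x\<close> and \<open>\<rho>\<close>. Since the drift in \<open>x\<close> is unbounded near the boundary of the simplex, one Lyapunov
  function per energy level is used; its growth rate \<open>C0\<close> and its pointwise bound \<open>b\<close> are uniform
  in the level.\<close>

locale hjb_problem =
  fixes T l :: real and \<sigma> :: "real ^ 'n"
    and F :: "real \<Rightarrow> real ^ 'n \<Rightarrow> real ^ 'n \<Rightarrow> real ^ 'n \<Rightarrow> real"
    and h :: "real ^ 'n \<Rightarrow> real ^ 'n \<Rightarrow> real"
    and Hx Hr :: "real ^ 'n \<Rightarrow> real ^ 'n \<Rightarrow> real ^ 'n"
  assumes T_pos: "T > 0" and l_nonneg: "l \<ge> 0"
    and Hx_sum: "\<And>\<rho> x. \<rho> \<in> open_simplex \<Longrightarrow> (\<Sum>i\<in>UNIV. Hx \<rho> x $ i) = 0"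
    and Hx_cont: "continuous_on (open_simplex \<times> UNIV) (\<lambda>p. Hx (fst p) (snd p))"
    and Hr_cont: "continuous_on (open_simplex \<times> UNIV) (\<lambda>p. Hr (fst p) (snd p))"
    and drift_lipschitz: "\<And>K. compact K \<Longrightarrow> K \<subseteq> open_simplex \<times> UNIV \<Longrightarrow>
      \<exists>L. \<forall>p\<in>K. \<forall>q\<in>K. norm (Hx (fst p) (snd p) - Hx (fst q) (snd q)) \<le> L * norm (p - q) \<and>
        norm (Hr (fst p) (snd p) - Hr (fst q) (snd q)) \<le> L * norm (p - q)"
    and F_cont: "continuous_on ({0..T} \<times> open_simplex \<times> UNIV \<times> cball 0 l) (\<lambda>(s, \<rho>, x, V). F s \<rho> x V)"
    and F_nonneg: "\<And>s \<rho> x V. s \<in> {0..T} \<Longrightarrow> \<rho> \<in> open_simplex \<Longrightarrow> V \<in> cball 0 l \<Longrightarrow> 0 \<le> F s \<rho> x V"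
    and F_bound: "\<exists>M. \<forall>s\<in>{0..T}. \<forall>\<rho>\<in>open_simplex. \<forall>x. \<forall>V\<in>cball 0 l. F s \<rho> x V \<le> M"
    and h_cont: "continuous_on (open_simplex \<times> UNIV) (\<lambda>(\<rho>, x). h \<rho> x)"
    and h_nonneg: "\<And>\<rho> x. \<rho> \<in> open_simplex \<Longrightarrow> 0 \<le> h \<rho> x"
    and h_bound: "\<exists>M. \<forall>\<rho>\<in>open_simplex. \<forall>x. h \<rho> x \<le> M"
    and lyapunov: "\<exists>C0\<ge>0. \<exists>b. \<forall>R>0. \<exists>G0 K \<psi> \<psi>\<rho> \<psi>x \<psi>xx.
      openin (top_of_set (open_simplex \<times> UNIV)) G0 \<and> G0 \<subseteq> K \<and> compact K \<and>
      K \<subseteq> open_simplex \<times> UNIV \<and> space_test \<psi> \<psi>\<rho> \<psi>x \<psi>xx \<and>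
      (\<forall>\<rho>\<in>open_simplex. \<forall>x. 0 \<le> \<psi> \<rho> x \<and> \<psi> \<rho> x \<le> b \<rho> x \<and> ((\<rho>, x) \<notin> G0 \<longrightarrow> R \<le> \<psi> \<rho> x)) \<and>
      (\<forall>\<rho> x. (\<rho>, x) \<in> G0 \<longrightarrow> (\<forall>V\<in>cball 0 l.
         \<psi>\<rho> \<rho> x \<bullet> Hx \<rho> x - \<psi>x \<rho> x \<bullet> (Hr \<rho> x + V)
           + 1 / 2 * (\<Sum>i\<in>UNIV. (\<sigma> $ i)\<^sup>2 * \<psi>xx \<rho> x $ i $ i) \<le> C0 * (1 + \<psi> \<rho> x)))"
begin

definition dom0 :: "'n pt set" where "dom0 = {0<..<T} \<times> open_simplex \<times> UNIV"

definition dom1 :: "'n pt set" where "dom1 = {0<..T} \<times> open_simplex \<times> UNIV"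

definition gen :: "real ^ 'n \<Rightarrow> 'n pt \<Rightarrow> real ^ 'n \<Rightarrow> real ^ 'n \<Rightarrow> real ^ 'n ^ 'n \<Rightarrow> real" where
  "gen V z p q Q = p \<bullet> Hx (fst (snd z)) (snd (snd z)) - q \<bullet> (Hr (fst (snd z)) (snd (snd z)) + V)
     + 1 / 2 * (\<Sum>i\<in>UNIV. (\<sigma> $ i)\<^sup>2 * Q $ i $ i)"

definition cost :: "'n pt \<Rightarrow> real ^ 'n \<Rightarrow> real" where
  "cost z V = F (fst z) (fst (snd z)) (snd (snd z)) V"

definition visc_sub :: "('n pt \<Rightarrow> real) \<Rightarrow> bool" where
  "visc_sub u \<longleftrightarrow> (\<forall>z\<in>dom0. \<forall>\<phi> \<phi>t \<phi>\<rho> \<phi>x \<phi>xx. test_function T \<phi> \<phi>t \<phi>\<rho> \<phi>x \<phi>xx \<longrightarrow>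
     (\<forall>\<^sub>F y in at z within dom0. u y - \<phi> y \<le> u z - \<phi> z) \<longrightarrow>
     (\<forall>V\<in>cball 0 l. 0 \<le> \<phi>t z + gen V z (\<phi>\<rho> z) (\<phi>x z) (\<phi>xx z) + cost z V))"

definition visc_super :: "('n pt \<Rightarrow> real) \<Rightarrow> bool" where
  "visc_super w \<longleftrightarrow> (\<forall>z\<in>dom0. \<forall>\<phi> \<phi>t \<phi>\<rho> \<phi>x \<phi>xx. test_function T \<phi> \<phi>t \<phi>\<rho> \<phi>x \<phi>xx \<longrightarrow>
     (\<forall>\<^sub>F y in at z within dom0. w z - \<phi> z \<le> w y - \<phi> y) \<longrightarrow>
     (\<forall>\<epsilon>>0. \<exists>V\<in>cball 0 l. \<phi>t z + gen V z (\<phi>\<rho> z) (\<phi>x z) (\<phi>xx z) + cost z V \<le> \<epsilon>))"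

lemma gen_add: "gen V z (p + p') (q + q') (Q + Q') = gen V z p q Q + gen V z p' q' Q'"
  by (simp add: gen_def inner_add_left sum.distrib algebra_simps)

lemma gen_scale: "gen V z (c *\<^sub>R p) (c *\<^sub>R q) (c *\<^sub>R Q) = c * gen V z p q Q"
  by (simp add: gen_def sum_distrib_left algebra_simps)

end

definition pt_proj :: "'n::finite pt \<Rightarrow> 'n pt" where
  "pt_proj z = (fst z, simplex_proj (fst (snd z)), snd (snd z))"

lemma continuous_on_pt_proj: "continuous_on A pt_proj"
  unfolding pt_proj_def by (intro continuous_intros continuous_on_simplex_proj)

lemma pt_proj_shift:
  assumes "(\<Sum>i\<in>UNIV. fst (snd y) $ i) = 1"
  shows "pt_proj (y + (0, c *\<^sub>R 1, 0)) = y"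
proof -
  have "simplex_proj (fst (snd y) + c *\<^sub>R 1) = fst (snd y)"
    using assms by (simp add: simplex_proj_def sum.distrib vec_eq_iff field_simps)
  then show ?thesis by (simp add: pt_proj_def prod_eq_iff)
qed

lemma pt_proj_decomp: "\<exists>c. z = pt_proj z + (0, c *\<^sub>R 1, 0)"
  by (rule exI[of _ "- ((1 - (\<Sum>i\<in>UNIV. fst (snd z) $ i)) / real CARD('a))"])
     (simp add: pt_proj_def simplex_proj_def prod_eq_iff)

lemma eventually_at_shift:
  fixes p d :: "'a::real_normed_vector"
  assumes "\<forall>\<^sub>F y in at (p + d). Q y"
  shows "\<forall>\<^sub>F y in at p within A. Q (y + d)"
proof -
  obtain \<delta> where \<delta>: "\<delta> > 0" "\<And>y. y \<noteq> p + d \<Longrightarrow> dist y (p + d) < \<delta> \<Longrightarrow> Q y"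
    using assms unfolding eventually_at by auto
  then show ?thesis
    unfolding eventually_at by (intro exI[of _ \<delta>]) (auto simp: dist_norm)
qed

lemma usc_on_compose:
  assumes "usc_on S u" "continuous_on S' f" "f ` S' \<subseteq> S"
  shows "usc_on S' (\<lambda>z. u (f z))"
  unfolding usc_on_def
proof (intro ballI allI impI)
  fix z c assume z: "z \<in> S'" "u (f z) < c"
  obtain d where d: "d > 0" "\<And>y. y \<in> S \<Longrightarrow> dist y (f z) < d \<Longrightarrow> u y < c"
    using usc_onD[OF assms(1) _ z(2)] z(1) assms(3) by blast
  obtain d' where "d' > 0" "\<And>y. y \<in> S' \<Longrightarrow> dist y z < d' \<Longrightarrow> dist (f y) (f z) < d"
    using assms(2) z(1) d(1) unfolding continuous_on_iff by metis
  then show "\<exists>d>0. \<forall>y\<in>S'. dist y z < d \<longrightarrow> u (f y) < c"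
    using d(2) assms(3) by (intro exI[of _ d']) blast
qed

lemma simplex_proj_mem: "simplex_proj r \<in> open_simplex \<longleftrightarrow> simplex_proj r \<in> {r. \<forall>i. 0 < r $ i}"
  by (simp add: open_simplex_eq)

lemma space_test_const: "space_test (\<lambda>\<rho> x. 1) (\<lambda>\<rho> x. 0) (\<lambda>\<rho> x. 0) (\<lambda>\<rho> x. 0)"
  by (simp add: space_test_def Let_def has_simplex_derivative_def gderiv_def case_prod_beta)

context hjb_problem
begin

lemma dom0_subset: "dom0 \<subseteq> dom1"
  by (auto simp: dom0_def dom1_def)

lemma dom0_sum: "y \<in> dom0 \<Longrightarrow> (\<Sum>i\<in>UNIV. fst (snd y) $ i) = 1"
  by (auto simp: dom0_def open_simplexD)

text \<open>Functions on the simplex are extended to a full neighbourhood of it constantly in the normal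
  direction. The drift has no normal component, so this preserves sub- and supersolutions.\<close>

definition ext_drift :: "'n pt \<Rightarrow> real ^ 'n \<Rightarrow> 'n pt" where
  "ext_drift z V = (1, Hx (fst (snd (pt_proj z))) (snd (snd z)),
     - (Hr (fst (snd (pt_proj z))) (snd (snd z)) + V))"

definition noise :: "'n \<Rightarrow> 'n pt" where
  "noise i = (0, 0, \<sigma> $ i *\<^sub>R axis i 1)"

lemma gen_ext:
  assumes c2: "c2_fun \<Phi> \<Phi>1 \<Phi>2" and z: "pt_proj z \<in> dom0"
  shows "\<Phi>1 z \<bullet> ext_drift z V + 1 / 2 * (\<Sum>i\<in>UNIV. \<Phi>2 z (noise i) \<bullet> noise i)
     = fst (\<Phi>1 z) + gen V (pt_proj z) (tang (fst (snd (\<Phi>1 z)))) (snd (snd (\<Phi>1 z)))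
         (matrix (\<lambda>v. snd (snd (\<Phi>2 z (0, 0, v)))))"
proof -
  have lin: "linear (\<Phi>2 z)" using c2 has_derivative_linear unfolding c2_fun_def by blast
  have "\<Phi>2 z (noise i) \<bullet> noise i = (\<sigma> $ i)\<^sup>2 * matrix (\<lambda>v. snd (snd (\<Phi>2 z (0, 0, v)))) $ i $ i" for i
  proof -
    have n: "noise i = \<sigma> $ i *\<^sub>R (0, 0, axis i 1)" by (simp add: noise_def)
    have "\<Phi>2 z (noise i) = \<sigma> $ i *\<^sub>R \<Phi>2 z (0, 0, axis i 1)"
      unfolding n by (rule linear_cmul[OF lin])
    then have "\<Phi>2 z (noise i) \<bullet> noise i = (\<sigma> $ i)\<^sup>2 * (snd (snd (\<Phi>2 z (0, 0, axis i 1))) \<bullet> axis i 1)"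
      by (simp add: n inner_prod_def power2_eq_square)
    then show ?thesis by (simp add: inner_axis matrix_def)
  qed
  moreover have "tang (fst (snd (\<Phi>1 z))) \<bullet> Hx (fst (snd (pt_proj z))) (snd (snd z))
      = fst (snd (\<Phi>1 z)) \<bullet> Hx (fst (snd (pt_proj z))) (snd (snd z))"
    using z by (intro tang_inner Hx_sum) (auto simp: dom0_def pt_proj_def)
  ultimately show ?thesis
    by (simp add: gen_def ext_drift_def inner_prod_def pt_proj_def inner_diff_right inner_add_right)
qed

lemma ext_sub:
  assumes u: "visc_sub u" and c2: "c2_fun \<Phi> \<Phi>1 \<Phi>2" and z: "pt_proj z \<in> dom0"
    and ev: "\<forall>\<^sub>F y in at z. u (pt_proj y) - \<Phi> y \<le> u (pt_proj z) - \<Phi> z" and V: "V \<in> cball 0 l"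
  shows "0 \<le> \<Phi>1 z \<bullet> ext_drift z V + 1 / 2 * (\<Sum>i\<in>UNIV. \<Phi>2 z (noise i) \<bullet> noise i)
     + cost (pt_proj z) V"
proof -
  obtain c where c: "z = pt_proj z + (0, c *\<^sub>R 1, 0)" using pt_proj_decomp by blast
  let ?d = "(0, c *\<^sub>R 1, 0) :: 'n pt"
  note tf = test_function_of_c2[OF c2_fun_shift[OF c2, of ?d], of T]
  have "\<forall>\<^sub>F y in at (pt_proj z) within dom0. u (pt_proj (y + ?d)) - \<Phi> (y + ?d) \<le> u (pt_proj z) - \<Phi> z"
    using ev by (intro eventually_at_shift) (simp add: c[symmetric])
  moreover have "\<forall>\<^sub>F y in at (pt_proj z) within dom0. y \<in> dom0"
    unfolding eventually_at_filter by simp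
  ultimately have "\<forall>\<^sub>F y in at (pt_proj z) within dom0.
      u y - \<Phi> (y + ?d) \<le> u (pt_proj z) - \<Phi> (pt_proj z + ?d)"
    by eventually_elim (simp add: pt_proj_shift dom0_sum c[symmetric])
  then have "0 \<le> fst (\<Phi>1 (pt_proj z + ?d)) + gen V (pt_proj z) (tang (fst (snd (\<Phi>1 (pt_proj z + ?d)))))
      (snd (snd (\<Phi>1 (pt_proj z + ?d)))) (matrix (\<lambda>v. snd (snd (\<Phi>2 (pt_proj z + ?d) (0, 0, v)))))
      + cost (pt_proj z) V"
    using u tf z V unfolding visc_sub_def by blast
  then show ?thesis unfolding c[symmetric] gen_ext[OF c2 z] .
qed

lemma ext_super:
  assumes w: "visc_super w" and c2: "c2_fun \<Phi> \<Phi>1 \<Phi>2" and z: "pt_proj z \<in> dom0"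
    and N: "test_function T N Nt N\<rho> Nx Nxx"
    and gN: "\<And>V. V \<in> cball 0 l \<Longrightarrow>
       \<delta> \<le> Nt (pt_proj z) + gen V (pt_proj z) (N\<rho> (pt_proj z)) (Nx (pt_proj z)) (Nxx (pt_proj z))"
    and ev: "\<forall>\<^sub>F y in at z. w (pt_proj z) - N (pt_proj z) + \<theta> (\<Sum>i\<in>UNIV. fst (snd z) $ i) - \<Phi> z
       \<le> w (pt_proj y) - N (pt_proj y) + \<theta> (\<Sum>i\<in>UNIV. fst (snd y) $ i) - \<Phi> y"
    and \<epsilon>: "\<epsilon> > 0"
  shows "\<exists>V\<in>cball 0 l. \<Phi>1 z \<bullet> ext_drift z V + 1 / 2 * (\<Sum>i\<in>UNIV. \<Phi>2 z (noise i) \<bullet> noise i)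
     + cost (pt_proj z) V \<le> \<epsilon> - \<delta>"
proof -
  obtain c where c: "z = pt_proj z + (0, c *\<^sub>R 1, 0)" using pt_proj_decomp by blast
  let ?d = "(0, c *\<^sub>R 1, 0) :: 'n pt"
  note tf = test_function_add[OF test_function_of_c2[OF c2_fun_shift[OF c2, of ?d], of T] N]
  have sum: "(\<Sum>i\<in>UNIV. fst (snd (y + ?d)) $ i) = 1 + c * CARD('n)" if "y \<in> dom0" for y
    using dom0_sum[OF that] by (simp add: sum.distrib)
  have "\<forall>\<^sub>F y in at (pt_proj z) within dom0.
      w (pt_proj z) - N (pt_proj z) + \<theta> (\<Sum>i\<in>UNIV. fst (snd z) $ i) - \<Phi> z
       \<le> w (pt_proj (y + ?d)) - N (pt_proj (y + ?d)) + \<theta> (\<Sum>i\<in>UNIV. fst (snd (y + ?d)) $ i) - \<Phi> (y + ?d)"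
    using ev by (intro eventually_at_shift) (simp add: c[symmetric])
  moreover have "\<forall>\<^sub>F y in at (pt_proj z) within dom0. y \<in> dom0"
    unfolding eventually_at_filter by simp
  ultimately have "\<forall>\<^sub>F y in at (pt_proj z) within dom0.
      w (pt_proj z) - (\<Phi> (pt_proj z + ?d) + N (pt_proj z)) \<le> w y - (\<Phi> (y + ?d) + N y)"
  proof eventually_elim
    case (elim y)
    then show ?case
      using sum[OF elim(2)] sum[OF z] pt_proj_shift[OF dom0_sum[OF elim(2)]]
      by (simp add: c[symmetric])
  qed
  then obtain V where V: "V \<in> cball 0 l" "fst (\<Phi>1 (pt_proj z + ?d)) + Nt (pt_proj z)
     + gen V (pt_proj z) (tang (fst (snd (\<Phi>1 (pt_proj z + ?d)))) + N\<rho> (pt_proj z))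
      (snd (snd (\<Phi>1 (pt_proj z + ?d))) + Nx (pt_proj z))
      (matrix (\<lambda>v. snd (snd (\<Phi>2 (pt_proj z + ?d) (0, 0, v)))) + Nxx (pt_proj z))
      + cost (pt_proj z) V \<le> \<epsilon>"
    using w tf z \<epsilon> unfolding visc_super_def by blast
  show ?thesis
  proof (rule bexI[OF _ V(1)])
    show "\<Phi>1 z \<bullet> ext_drift z V + 1 / 2 * (\<Sum>i\<in>UNIV. \<Phi>2 z (noise i) \<bullet> noise i)
       + cost (pt_proj z) V \<le> \<epsilon> - \<delta>"
      using V(2) gN[OF V(1)] unfolding gen_ext[OF c2 z] c[symmetric] gen_add by linarith
  qed
qed

lemma near_terminal:
  assumes usc: "usc_on dom1 u" "usc_on dom1 (\<lambda>z. - w z)"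
    and K: "compact K" "K \<subseteq> open_simplex \<times> UNIV"
    and tm: "\<And>\<rho> x. \<rho> \<in> open_simplex \<Longrightarrow> u (T, \<rho>, x) \<le> w (T, \<rho>, x)"
    and "\<theta> > 0" "t0 < T" "0 < t0"
  shows "\<exists>T1. t0 < T1 \<and> T1 < T \<and> (\<forall>p\<in>K. u (T1, p) - w (T1, p) \<le> \<theta>)"
proof (rule ccontr)
  assume neg: "\<not> ?thesis"
  define s where "s n = T - (T - t0) / 2 * inverse (real (Suc n))" for n
  have s: "t0 < s n" "s n < T" for n
  proof -
    have "(T - t0) / 2 * inverse (real (Suc n)) \<le> (T - t0) / 2 * 1"
      using \<open>t0 < T\<close> by (intro mult_left_mono) (auto simp: inverse_eq_divide)
    then show "t0 < s n" using \<open>t0 < T\<close> unfolding s_def by argo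
    show "s n < T" using \<open>t0 < T\<close> by (simp add: s_def)
  qed
  then have "\<forall>n. \<exists>p. p \<in> K \<and> \<theta> < u (s n, p) - w (s n, p)" using neg by (meson not_le)
  then obtain p where p: "\<And>n. p n \<in> K" "\<And>n. \<theta> < u (s n, p n) - w (s n, p n)" by metis
  obtain q r where q: "q \<in> K" "strict_mono r" "(p \<circ> r) \<longlonglongrightarrow> q"
    using K(1) p(1) unfolding compact_def by meson
  have "s \<longlonglongrightarrow> T - (T - t0) / 2 * 0"
    unfolding s_def[abs_def] by (intro tendsto_intros LIMSEQ_inverse_real_of_nat)
  then have "s \<longlonglongrightarrow> T" by simp
  then have X: "(\<lambda>n. (s (r n), p (r n))) \<longlonglongrightarrow> (T, q)"
    using LIMSEQ_subseq_LIMSEQ[OF _ q(2), of s T] q(3) by (intro tendsto_Pair) (simp_all add: comp_def)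
  have dom: "(s (r n), p (r n)) \<in> dom1" for n
    using s[of "r n"] p(1)[of "r n"] K(2) \<open>0 < t0\<close> by (fastforce simp: dom1_def)
  have Tq: "(T, q) \<in> dom1" using q(1) K(2) T_pos by (auto simp: dom1_def)
  have "u (T, q) + - w (T, q) < \<theta>"
    using tm[of "fst q" "snd q"] q(1) K(2) \<open>\<theta> > 0\<close> by (cases q) auto
  from usc_on_seq[OF usc_on_add[OF usc] X dom Tq this]
  obtain n where "u (s (r n), p (r n)) + - w (s (r n), p (r n)) < \<theta>"
    by (auto dest: eventually_happens)
  then show False using p(2)[of "r n"] by simp
qed

lemma F_cont_compose:
  assumes "continuous_on A s" "continuous_on A r" "continuous_on A x" "continuous_on A V"
    and "\<And>a. a \<in> A \<Longrightarrow> s a \<in> {0..T} \<and> r a \<in> open_simplex \<and> V a \<in> cball 0 l"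
  shows "continuous_on A (\<lambda>a. F (s a) (r a) (x a) (V a))"
proof -
  have "continuous_on A (\<lambda>a. (\<lambda>(s, \<rho>, x, V). F s \<rho> x V) (s a, r a, x a, V a))"
    by (rule continuous_on_compose2[OF F_cont]) (use assms in \<open>auto intro!: continuous_intros\<close>)
  then show ?thesis by simp
qed

lemma comparison_penalized:
  assumes usc: "usc_on dom1 u" "usc_on dom1 (\<lambda>z. - w z)"
    and u: "visc_sub u" and w: "visc_super w"
    and M: "\<And>z. z \<in> dom1 \<Longrightarrow> \<bar>u z\<bar> \<le> M" "\<And>z. z \<in> dom1 \<Longrightarrow> \<bar>w z\<bar> \<le> M"
    and tm: "\<And>\<rho> x. \<rho> \<in> open_simplex \<Longrightarrow> u (T, \<rho>, x) \<le> w (T, \<rho>, x)"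
    and z: "(t0, \<rho>0, x0) \<in> dom0"
    and pos: "\<delta> > 0" "\<nu> > 0" "\<theta> > 0"
    and C0: "C0 \<ge> 0" and G0: "openin (top_of_set (open_simplex \<times> UNIV)) G0" "G0 \<subseteq> K"
    and K: "compact K" "K \<subseteq> open_simplex \<times> UNIV"
    and st: "space_test \<psi> \<psi>\<rho> \<psi>x \<psi>xx"
    and \<psi>: "\<And>\<rho> x. \<rho> \<in> open_simplex \<Longrightarrow> 0 \<le> \<psi> \<rho> x"
      "\<And>\<rho> x. \<rho> \<in> open_simplex \<Longrightarrow> (\<rho>, x) \<notin> G0 \<Longrightarrow> R \<le> \<psi> \<rho> x"
    and R: "2 * M \<le> \<delta> * (1 + R)"
    and lyap: "\<And>\<rho> x V. (\<rho>, x) \<in> G0 \<Longrightarrow> V \<in> cball 0 l \<Longrightarrow>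
         \<psi>\<rho> \<rho> x \<bullet> Hx \<rho> x - \<psi>x \<rho> x \<bullet> (Hr \<rho> x + V)
           + 1 / 2 * (\<Sum>i\<in>UNIV. (\<sigma> $ i)\<^sup>2 * \<psi>xx \<rho> x $ i $ i) \<le> C0 * (1 + \<psi> \<rho> x)"
  shows "u (t0, \<rho>0, x0) \<le> w (t0, \<rho>0, x0)
     + \<delta> * exp ((C0 + 1) * (T - t0)) * (1 + \<psi> \<rho>0 x0) + \<nu> / t0 + \<theta>"
proof -
  have t0: "0 < t0" "t0 < T" and \<rho>0: "\<rho>0 \<in> open_simplex" using z by (auto simp: dom0_def)
  have M0: "M \<ge> 0" using M(1)[of "(t0, \<rho>0, x0)"] z dom0_subset by force
  define a where "a t = \<delta> * exp ((C0 + 1) * (T - t))" for t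
  have a\<delta>: "\<delta> \<le> a t" if "t \<le> T" for t
    using that pos(1) C0 by (simp add: a_def)
  define a1 a2 where "a1 t = (C0 + 1) * a t" and "a2 t = a1 t + \<nu> / t\<^sup>2" for t
  have a1: "((\<lambda>t. - a t) has_real_derivative a1 t) (at t)" for t
    unfolding a_def[abs_def] a1_def by (auto intro!: derivative_eq_intros simp: a_def algebra_simps)
  have a2: "((\<lambda>t. - (a t + \<nu> / t)) has_real_derivative a2 t) (at t)" if "0 < t" for t
    unfolding a_def[abs_def] a2_def a1_def using that
    by (auto intro!: derivative_eq_intros simp: a_def power2_eq_square field_simps)
  have ca1: "continuous_on {0<..<T} a1" unfolding a1_def[abs_def] a_def by (intro continuous_intros)
  have ca2: "continuous_on {0<..<T} a2"
    unfolding a2_def[abs_def] by (intro continuous_intros ca1) auto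
  define N where "N z = (case z of (t, \<rho>, x) \<Rightarrow> - a t * \<psi> \<rho> x) + (case z of (t, \<rho>, x) \<Rightarrow> - (a t + \<nu> / t) * 1)"
    for z :: "'n pt"
  note tN = test_function_add[OF test_function_time_mult[OF st, of T "\<lambda>t. - a t" a1, OF a1 ca1]
      test_function_time_mult[OF space_test_const, of T "\<lambda>t. - (a t + \<nu> / t)" a2, OF a2 ca2],
      folded N_def[abs_def]]
  have N: "N (t, \<rho>, x) = - (a t * (1 + \<psi> \<rho> x) + \<nu> / t)" for t \<rho> x
    by (simp add: N_def algebra_simps)
  have "u (t0, \<rho>0, x0) \<le> w (t0, \<rho>0, x0) - N (t0, \<rho>0, x0) + \<theta>"
  proof (cases "(\<rho>0, x0) \<in> G0")
    case False
    have "2 * M \<le> \<delta> * (1 + R)" by (rule R)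
    also have "\<dots> \<le> a t0 * (1 + \<psi> \<rho>0 x0)"
    proof (rule mult_mono)
      show "1 + R \<le> 1 + \<psi> \<rho>0 x0" using \<psi>(2)[OF \<rho>0 False] by simp
      show "0 \<le> 1 + R" using M0 R pos(1) by (metis mult_nonneg_nonneg zero_le_mult_iff
            dual_order.trans mult_eq_0_iff not_less zero_le_numeral linorder_not_le)
    qed (use a\<delta>[of t0] t0 pos(1) in auto)
    finally have "2 * M \<le> a t0 * (1 + \<psi> \<rho>0 x0)" .
    moreover have "0 \<le> \<nu> / t0" using t0 pos by simp
    ultimately have "2 * M \<le> - N (t0, \<rho>0, x0)" unfolding N by linarith
    then show ?thesis
      using M(1)[of "(t0, \<rho>0, x0)"] M(2)[of "(t0, \<rho>0, x0)"] z dom0_subset pos(3)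
      by (auto simp: abs_le_iff)
  next
    case True
    define s0 where "s0 = min (t0 / 2) (\<nu> / (2 * M + 1))"
    have s0: "0 < s0" "s0 < t0" using t0 pos(2) M0 by (auto simp: s0_def)
    have s0\<nu>: "2 * M \<le> \<nu> / s0"
    proof -
      have "s0 \<le> \<nu> / (2 * M + 1)" by (simp add: s0_def)
      then have "s0 * (2 * M + 1) \<le> \<nu>" using M0 by (simp add: pos_le_divide_eq)
      then have "2 * M * s0 \<le> \<nu>" using s0(1) by (simp add: algebra_simps)
      then show ?thesis using s0(1) by (simp add: pos_le_divide_eq)
    qed
    obtain T1 where T1: "t0 < T1" "T1 < T" "\<And>p. p \<in> K \<Longrightarrow> u (T1, p) - w (T1, p) \<le> \<theta>"
      using near_terminal[OF usc K tm pos(3) t0(2,1)] by blast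
    let ?\<Sigma> = "\<lambda>z :: 'n pt. \<Sum>i\<in>UNIV. fst (snd z) $ i"
    define G where "G = {z. s0 < fst z \<and> fst z < T1 \<and> snd (pt_proj z) \<in> G0 \<and> \<bar>?\<Sigma> z - 1\<bar> < 1}"
    define Cl where "Cl = {z. s0 \<le> fst z \<and> fst z \<le> T1 \<and> snd (pt_proj z) \<in> K \<and> \<bar>?\<Sigma> z - 1\<bar> \<le> 1}"
    have cpp: "continuous_on A (\<lambda>z. snd (pt_proj z))" for A :: "'n pt set"
      by (intro continuous_intros continuous_on_pt_proj)
    have oG: "open G"
    proof -
      obtain O' where O': "open O'" "G0 = (open_simplex \<times> UNIV) \<inter> O'"
        using G0(1) by (auto simp: openin_open)
      have "snd (pt_proj z) \<in> G0 \<longleftrightarrow> snd (pt_proj z) \<in> O' \<inter> ({r. \<forall>i. 0 < r $ i} \<times> UNIV)" for z :: "'n pt"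
        using simplex_proj_mem[of "fst (snd z)"] by (auto simp: O'(2) pt_proj_def)
      then have eq: "G = {z. s0 < fst z} \<inter> {z. fst z < T1} \<inter> {z. \<bar>?\<Sigma> z - 1\<bar> < 1}
         \<inter> (\<lambda>z. snd (pt_proj z)) -` (O' \<inter> ({r. \<forall>i. 0 < r $ i} \<times> UNIV))"
        by (auto simp: G_def)
      have 1: "open ((\<lambda>z :: 'n pt. snd (pt_proj z)) -` (O' \<inter> ({r. \<forall>i. 0 < r $ i} \<times> UNIV)))"
        by (intro open_vimage cpp open_Int O'(1) open_Times open_pos_orthant open_UNIV)
      have 2: "open {z :: 'n pt. s0 < fst z}" "open {z :: 'n pt. fst z < T1}"
        "open {z :: 'n pt. \<bar>?\<Sigma> z - 1\<bar> < 1}"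
        by (intro open_Collect_less continuous_intros)+
      show ?thesis unfolding eq by (intro open_Int 1 2)
    qed
    have clCl: "closed Cl"
    proof -
      have eq: "Cl = {z. s0 \<le> fst z} \<inter> {z. fst z \<le> T1} \<inter> {z. \<bar>?\<Sigma> z - 1\<bar> \<le> 1}
         \<inter> (\<lambda>z. snd (pt_proj z)) -` K"
        by (auto simp: Cl_def)
      have 1: "closed ((\<lambda>z :: 'n pt. snd (pt_proj z)) -` K)"
        by (intro closed_vimage cpp compact_imp_closed K(1))
      have 2: "closed {z :: 'n pt. s0 \<le> fst z}" "closed {z :: 'n pt. fst z \<le> T1}"
        "closed {z :: 'n pt. \<bar>?\<Sigma> z - 1\<bar> \<le> 1}"
        by (intro closed_Collect_le continuous_intros)+
      show ?thesis unfolding eq by (intro closed_Int 1 2)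
    qed
    have GCl: "G \<subseteq> Cl" using G0(2) by (auto simp: G_def Cl_def)
    have clG: "closure G \<subseteq> Cl" by (rule closure_minimal[OF GCl clCl])
    have Cldom: "pt_proj z \<in> dom0" if "z \<in> Cl" for z
      using that s0(1) T1(2) K(2) by (auto simp: Cl_def dom0_def pt_proj_def)
    obtain k where k: "\<And>p. p \<in> K \<Longrightarrow> norm p \<le> k"
      using compact_imp_bounded[OF K(1)] unfolding bounded_iff by blast
    have bCl: "bounded Cl"
      unfolding bounded_iff
    proof (intro exI ballI)
      fix z assume z: "z \<in> Cl"
      obtain t r x where zz: "z = (t, r, x)" by (cases z) auto
      have p: "norm (simplex_proj r, x) \<le> k" using k[of "(simplex_proj r, x)"] z by (simp add: Cl_def zz pt_proj_def)
      then have n: "norm (simplex_proj r) \<le> k" "norm x \<le> k"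
        using norm_fst_le[of "simplex_proj r" x] norm_snd_le[of x "simplex_proj r"] by linarith+
      let ?c = "(1 - (\<Sum>i\<in>UNIV. r $ i)) / real CARD('n)"
      have "\<bar>?c\<bar> \<le> 1"
      proof -
        have "\<bar>1 - (\<Sum>i\<in>UNIV. r $ i)\<bar> \<le> 1" using z by (simp add: Cl_def zz abs_minus_commute)
        also have "1 \<le> real CARD('n)" by (simp add: Suc_leI)
        finally show ?thesis by (simp add: abs_divide divide_le_eq)
      qed
      then have "norm (?c *\<^sub>R (1 :: real ^ 'n)) \<le> 1 * norm (1 :: real ^ 'n)"
        unfolding norm_scaleR by (intro mult_right_mono) auto
      moreover have "r = simplex_proj r - ?c *\<^sub>R 1" by (simp add: simplex_proj_def)
      ultimately have "norm r \<le> k + norm (1 :: real ^ 'n)"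
        using norm_triangle_ineq4[of "simplex_proj r" "?c *\<^sub>R 1"] n(1) by simp
      moreover have "norm z \<le> \<bar>t\<bar> + (norm r + norm x)"
        unfolding zz using norm_Pair_le[of t "(r, x)"] norm_Pair_le[of r x] by simp
      moreover have "\<bar>t\<bar> \<le> T" using z s0 T1 by (simp add: Cl_def zz)
      ultimately show "norm z \<le> T + (k + norm (1 :: real ^ 'n) + k)" using n by linarith
    qed
    have bG: "bounded G" by (rule bounded_subset[OF bCl GCl])
    have compcl: "compact (closure G)" using bG by (simp add: compact_closure)
    have pdom: "pt_proj z \<in> dom0" if "z \<in> closure G" for z using Cldom clG that by blast
    have pdom1: "pt_proj ` closure G \<subseteq> dom1" using pdom dom0_subset by blast
    define uh where "uh z = u (pt_proj z)" for z
    define pen where "pen s = \<theta> + 2 * M * (s - 1)\<^sup>2" for s :: real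
    define wh where "wh z = w (pt_proj z) - N (pt_proj z) + pen (?\<Sigma> z)" for z
    have Ncont: "continuous_on dom0 N"
      using tN by (simp add: test_function_def Let_def dom0_def)
    have usc1: "usc_on (closure G) uh"
      unfolding uh_def[abs_def] by (rule usc_on_compose[OF usc(1) continuous_on_pt_proj pdom1])
    have usc2: "usc_on (closure G) (\<lambda>z. - wh z)"
    proof -
      have "continuous_on (closure G) (\<lambda>z. N (pt_proj z))"
        by (rule continuous_on_compose2[OF Ncont continuous_on_pt_proj]) (use pdom in auto)
      then have "continuous_on (closure G) (\<lambda>z. N (pt_proj z) - pen (?\<Sigma> z))"
        unfolding pen_def by (intro continuous_intros)
      from usc_on_add[OF usc_on_compose[OF usc(2) continuous_on_pt_proj pdom1] usc_on_continuous[OF this]]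
      show ?thesis by (simp add: wh_def algebra_simps)
    qed
    have zs: "(t0, \<rho>0, x0) \<in> G"
      using True s0 T1 \<rho>0 by (simp add: G_def pt_proj_def simplex_proj_id open_simplexD)
    obtain L where L: "\<And>p q. p \<in> K \<Longrightarrow> q \<in> K \<Longrightarrow> norm (Hx (fst p) (snd p) - Hx (fst q) (snd q)) \<le> L * norm (p - q)"
      "\<And>p q. p \<in> K \<Longrightarrow> q \<in> K \<Longrightarrow> norm (Hr (fst p) (snd p) - Hr (fst q) (snd q)) \<le> L * norm (p - q)"
      using drift_lipschitz[OF K] by blast
    obtain kt where kt: "\<And>v :: real ^ 'n. norm (tang v) \<le> kt * norm v"
      using linear_bounded[OF linear_tang] by blast
    have lip: "norm (ext_drift z V - ext_drift y V) \<le> 2 * \<bar>L\<bar> * (\<bar>kt\<bar> + 1) * norm (z - y)"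
      if zy: "z \<in> G" "y \<in> G" for z y V
    proof -
      let ?p = "snd (pt_proj z)" and ?q = "snd (pt_proj y)"
      have pq: "?p \<in> K" "?q \<in> K" using zy G0(2) by (auto simp: G_def)
      have eq: "ext_drift z V - ext_drift y V = (0, Hx (fst ?p) (snd ?p) - Hx (fst ?q) (snd ?q),
          Hr (fst ?q) (snd ?q) - Hr (fst ?p) (snd ?p))"
        by (simp add: ext_drift_def pt_proj_def)
      have "norm (ext_drift z V - ext_drift y V) \<le> norm (Hx (fst ?p) (snd ?p) - Hx (fst ?q) (snd ?q))
          + norm (Hr (fst ?q) (snd ?q) - Hr (fst ?p) (snd ?p))"
        unfolding eq by (intro order_trans[OF norm_Pair_le] order_trans[OF _ norm_Pair_le]) auto
      also have "\<dots> \<le> L * norm (?p - ?q) + L * norm (?q - ?p)"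
        by (intro add_mono L pq)
      also have "\<dots> \<le> 2 * \<bar>L\<bar> * norm (?p - ?q)"
        using mult_right_mono[OF abs_ge_self[of L] norm_ge_zero[of "?p - ?q"]]
        by (simp add: norm_minus_commute[of ?q])
      also have "\<dots> \<le> 2 * \<bar>L\<bar> * ((\<bar>kt\<bar> + 1) * norm (z - y))"
      proof (rule mult_left_mono)
        have "?p - ?q = (tang (fst (snd (z - y))), snd (snd (z - y)))"
          by (simp add: pt_proj_def simplex_proj_diff)
        then have "norm (?p - ?q) \<le> norm (tang (fst (snd (z - y)))) + norm (snd (snd (z - y)))"
          by (simp only: norm_Pair_le)
        also have "\<dots> \<le> \<bar>kt\<bar> * norm (z - y) + norm (z - y)"
        proof (rule add_mono)
          have n1: "norm (fst (snd q)) \<le> norm q" "norm (snd (snd q)) \<le> norm q" for q :: "'n pt"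
          proof -
            obtain t r x where "q = (t, r, x)" by (cases q) auto
            then show "norm (fst (snd q)) \<le> norm q" "norm (snd (snd q)) \<le> norm q"
              using norm_snd_le[of "(r, x)" t] norm_fst_le[of r x] norm_snd_le[of x r] by auto
          qed
          show "norm (snd (snd (z - y))) \<le> norm (z - y)" by (rule n1(2))
          have "norm (tang (fst (snd (z - y)))) \<le> kt * norm (fst (snd (z - y)))" by (rule kt)
          also have "\<dots> \<le> \<bar>kt\<bar> * norm (z - y)" using n1(1)[of "z - y"] by (intro mult_mono) auto
          finally show "norm (tang (fst (snd (z - y)))) \<le> \<bar>kt\<bar> * norm (z - y)" .
        qed
        finally show "norm (?p - ?q) \<le> (\<bar>kt\<bar> + 1) * norm (z - y)" by (simp add: algebra_simps)
      qed simp
      finally show ?thesis by (simp add: mult.assoc)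
    qed
    have "bounded ((\<lambda>p. Hx (fst p) (snd p)) ` K)" "bounded ((\<lambda>p. Hr (fst p) (snd p)) ` K)"
      by (intro compact_imp_bounded compact_continuous_image K(1)
          continuous_on_subset[OF Hx_cont K(2)] continuous_on_subset[OF Hr_cont K(2)])+
    then obtain b1 b2 where "\<forall>y\<in>(\<lambda>p. Hx (fst p) (snd p)) ` K. norm y \<le> b1"
      "\<forall>y\<in>(\<lambda>p. Hr (fst p) (snd p)) ` K. norm y \<le> b2"
      unfolding bounded_iff by blast
    then have b12: "norm (Hx (fst p) (snd p)) \<le> b1" "norm (Hr (fst p) (snd p)) \<le> b2" if "p \<in> K" for p
      using that by blast+
    have bd: "norm (ext_drift z V) \<le> 1 + b1 + (b2 + l)" if "z \<in> G" "V \<in> cball 0 l" for z V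
    proof -
      let ?p = "snd (pt_proj z)"
      have p: "?p \<in> K" using that G0(2) by (auto simp: G_def)
      have "norm (ext_drift z V) \<le> 1 + (norm (Hx (fst ?p) (snd ?p)) + norm (Hr (fst ?p) (snd ?p) + V))"
        unfolding ext_drift_def
        by (intro order_trans[OF norm_Pair_le] add_mono order_trans[OF norm_Pair_le])
           (auto simp: pt_proj_def norm_minus_cancel[of "Hr _ _ + V", symmetric] simp del: norm_minus_cancel)
      also have "norm (Hr (fst ?p) (snd ?p) + V) \<le> b2 + l"
        using norm_triangle_ineq[of "Hr (fst ?p) (snd ?p)" V] b12(2)[OF p] that(2) by simp
      finally show ?thesis using b12(1)[OF p] by simp
    qed
    have Fu: "\<exists>d>0. \<forall>z\<in>G. \<forall>y\<in>G. \<forall>V\<in>cball 0 l. dist z y < d \<longrightarrow> \<bar>cost (pt_proj z) V - cost (pt_proj y) V\<bar> < \<eta>"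
      if "\<eta> > 0" for \<eta>
    proof -
      have "continuous_on (closure G \<times> cball 0 l) (\<lambda>q. cost (pt_proj (fst q)) (snd q))"
        unfolding cost_def pt_proj_def fst_conv snd_conv
        by (intro F_cont_compose continuous_intros continuous_on_simplex_proj)
           (use pdom in \<open>force simp: dom0_def pt_proj_def\<close>)
      then have "uniformly_continuous_on (closure G \<times> cball 0 l) (\<lambda>q. cost (pt_proj (fst q)) (snd q))"
        by (intro compact_uniformly_continuous compact_Times compcl compact_cball)
      then have "\<exists>d>0. \<forall>q\<in>closure G \<times> cball 0 l. \<forall>q'\<in>closure G \<times> cball 0 l.
         dist q' q < d \<longrightarrow> dist (cost (pt_proj (fst q')) (snd q')) (cost (pt_proj (fst q)) (snd q)) < \<eta>"
        using that unfolding uniformly_continuous_on_def by blast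
      then obtain d where d: "d > 0" "\<forall>q\<in>closure G \<times> cball 0 l. \<forall>q'\<in>closure G \<times> cball 0 l.
         dist q' q < d \<longrightarrow> dist (cost (pt_proj (fst q')) (snd q')) (cost (pt_proj (fst q)) (snd q)) < \<eta>"
        by blast
      have "\<bar>cost (pt_proj z) V - cost (pt_proj y) V\<bar> < \<eta>"
        if "z \<in> G" "y \<in> G" "V \<in> cball 0 l" "dist z y < d" for z y V
        using d(2)[THEN bspec, of "(y, V)", THEN bspec, of "(z, V)"] that closure_subset[of G]
        by (auto simp: dist_Pair_Pair dist_real_def)
      then show ?thesis using d(1) by blast
    qed
    have "uh (t0, \<rho>0, x0) \<le> wh (t0, \<rho>0, x0)"
    proof (rule strict_comparison[OF oG bG usc1 usc2 lip bd Fu, where e = noise and I = UNIV and \<kappa> = "\<delta> / 2"])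
      show "0 \<le> \<Phi>1 z \<bullet> ext_drift z V + 1 / 2 * (\<Sum>i\<in>UNIV. \<Phi>2 z (noise i) \<bullet> noise i) + cost (pt_proj z) V"
        if "c2_fun \<Phi> \<Phi>1 \<Phi>2" "z \<in> G" "\<forall>\<^sub>F y in at z. uh y - \<Phi> y \<le> uh z - \<Phi> z" "V \<in> cball 0 l"
        for \<Phi> \<Phi>1 \<Phi>2 z V
        by (rule ext_sub[OF u that(1) Cldom[OF subsetD[OF GCl that(2)]] that(3)[unfolded uh_def] that(4)])
      show "\<exists>V\<in>cball 0 l. \<Phi>1 z \<bullet> ext_drift z V + 1 / 2 * (\<Sum>i\<in>UNIV. \<Phi>2 z (noise i) \<bullet> noise i)
          + cost (pt_proj z) V \<le> - (\<delta> / 2)"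
        if c2: "c2_fun \<Phi> \<Phi>1 \<Phi>2" and z: "z \<in> G" and ev: "\<forall>\<^sub>F y in at z. wh z - \<Phi> z \<le> wh y - \<Phi> y"
        for \<Phi> \<Phi>1 \<Phi>2 z
      proof -
        obtain t \<rho> x where p: "pt_proj z = (t, \<rho>, x)" by (cases "pt_proj z") auto
        have zd: "pt_proj z \<in> dom0" using z GCl Cldom by blast
        then have tt: "0 < t" "t < T" "\<rho> \<in> open_simplex" by (auto simp: p dom0_def)
        have g0: "(\<rho>, x) \<in> G0" using z p by (simp add: G_def)
        have "\<exists>V\<in>cball 0 l. \<Phi>1 z \<bullet> ext_drift z V + 1 / 2 * (\<Sum>i\<in>UNIV. \<Phi>2 z (noise i) \<bullet> noise i)
          + cost (pt_proj z) V \<le> \<delta> / 2 - \<delta>"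
        proof (rule ext_super[OF w c2 zd tN _ _ half_gt_zero[OF pos(1)]])
          show "\<forall>\<^sub>F y in at z. w (pt_proj z) - N (pt_proj z) + pen (?\<Sigma> z) - \<Phi> z
             \<le> w (pt_proj y) - N (pt_proj y) + pen (?\<Sigma> y) - \<Phi> y"
            using ev by (simp add: wh_def)
          fix V :: "real ^ 'n" assume V: "V \<in> cball 0 l"
          let ?g = "gen V (t, \<rho>, x) (\<psi>\<rho> \<rho> x) (\<psi>x \<rho> x) (\<psi>xx \<rho> x)"
          have "?g \<le> C0 * (1 + \<psi> \<rho> x)" using lyap[OF g0 V] by (simp add: gen_def)
          then have "a t * ?g \<le> a t * (C0 * (1 + \<psi> \<rho> x))"
            using a\<delta>[of t] tt pos(1) by (intro mult_left_mono) auto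
          moreover have "a1 t * \<psi> \<rho> x + a1 t = a t * (C0 * (1 + \<psi> \<rho> x)) + a t * (1 + \<psi> \<rho> x)"
            by (simp add: a1_def algebra_simps)
          moreover have "\<delta> * 1 \<le> a t * (1 + \<psi> \<rho> x)"
            using a\<delta>[of t] tt pos(1) \<psi>(1) by (intro mult_mono) auto
          moreover have "0 \<le> \<nu> / t\<^sup>2" using pos(2) by simp
          ultimately have "\<delta> \<le> a1 t * \<psi> \<rho> x + a2 t + - a t * ?g" unfolding a2_def by linarith
          moreover have "gen V (t, \<rho>, x) ((- a t) *\<^sub>R \<psi>\<rho> \<rho> x + - (a t + \<nu> / t) *\<^sub>R 0)
            ((- a t) *\<^sub>R \<psi>x \<rho> x + - (a t + \<nu> / t) *\<^sub>R 0) ((- a t) *\<^sub>R \<psi>xx \<rho> x + - (a t + \<nu> / t) *\<^sub>R 0)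
            = - a t * ?g"
            using gen_scale[of V "(t, \<rho>, x)" "- a t"] by simp
          ultimately show "\<delta> \<le> (case pt_proj z of (t, \<rho>, x) \<Rightarrow> a1 t * \<psi> \<rho> x) + (case pt_proj z of (t, \<rho>, x) \<Rightarrow> a2 t * 1)
            + gen V (pt_proj z)
              ((case pt_proj z of (t, \<rho>, x) \<Rightarrow> (- a t) *\<^sub>R \<psi>\<rho> \<rho> x) + (case pt_proj z of (t, \<rho>, x) \<Rightarrow> - (a t + \<nu> / t) *\<^sub>R 0))
              ((case pt_proj z of (t, \<rho>, x) \<Rightarrow> (- a t) *\<^sub>R \<psi>x \<rho> x) + (case pt_proj z of (t, \<rho>, x) \<Rightarrow> - (a t + \<nu> / t) *\<^sub>R 0))
              ((case pt_proj z of (t, \<rho>, x) \<Rightarrow> (- a t) *\<^sub>R \<psi>xx \<rho> x) + (case pt_proj z of (t, \<rho>, x) \<Rightarrow> - (a t + \<nu> / t) *\<^sub>R 0))"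
            unfolding p prod.case by simp
        qed
        then show ?thesis by simp
      qed
      show "\<delta> / 2 > 0" using pos(1) by simp
      show "uh z \<le> wh z" if z: "z \<in> closure G" "z \<notin> G" for z
      proof -
        obtain t \<rho> x where p: "pt_proj z = (t, \<rho>, x)" by (cases "pt_proj z") auto
        have zCl: "z \<in> Cl" using z(1) clG by blast
        have zd: "(t, \<rho>, x) \<in> dom0" using pdom[OF z(1)] by (simp add: p)
        then have tt: "0 < t" "t < T" "\<rho> \<in> open_simplex" by (auto simp: dom0_def)
        have ft: "fst z = t" using p by (simp add: pt_proj_def)
        have u2: "u (t, \<rho>, x) - w (t, \<rho>, x) \<le> 2 * M"
          using M(1)[of "(t, \<rho>, x)"] M(2)[of "(t, \<rho>, x)"] zd dom0_subset by (force simp: abs_le_iff)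
        have p1: "0 \<le> a t * (1 + \<psi> \<rho> x)" using a\<delta>[of t] tt pos(1) \<psi>(1)[OF tt(3), of x] by simp
        have p2: "0 \<le> \<nu> / t" using pos(2) tt by simp
        have p3: "0 \<le> 2 * M * (?\<Sigma> z - 1)\<^sup>2" using M0 by simp
        consider "t = s0" | "t = T1" | "(\<rho>, x) \<notin> G0" | "\<bar>?\<Sigma> z - 1\<bar> = 1"
          using z(2) zCl p ft by (force simp: G_def Cl_def)
        then have "u (t, \<rho>, x) - w (t, \<rho>, x) \<le> a t * (1 + \<psi> \<rho> x) + \<nu> / t + \<theta> + 2 * M * (?\<Sigma> z - 1)\<^sup>2"
        proof cases
          case 1
          then show ?thesis using u2 s0\<nu> p1 p3 pos(3) by simp
        next
          case 2
          then show ?thesis using T1(3)[of "(\<rho>, x)"] zCl p p1 p2 p3 by (simp add: Cl_def)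
        next
          case 3
          have "2 * M \<le> \<delta> * (1 + R)" by (rule R)
          also have "\<dots> \<le> \<delta> * (1 + \<psi> \<rho> x)" using \<psi>(2)[OF tt(3) 3] pos(1) by (intro mult_left_mono) auto
          also have "\<dots> \<le> a t * (1 + \<psi> \<rho> x)"
            using a\<delta>[of t] tt \<psi>(1)[OF tt(3), of x] by (intro mult_right_mono) auto
          finally show ?thesis using u2 p2 p3 pos(3) by simp
        next
          case 4
          then have "(?\<Sigma> z - 1)\<^sup>2 = 1" by (metis power2_abs one_power2)
          then show ?thesis using u2 p1 p2 pos(3) by simp
        qed
        then show ?thesis by (simp add: uh_def wh_def p N pen_def)
      qed
      show "(t0, \<rho>0, x0) \<in> G" by (rule zs)
    qed
    then show ?thesis
      using \<rho>0 by (simp add: uh_def wh_def pen_def pt_proj_def simplex_proj_id open_simplexD)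
  qed
  then show ?thesis by (simp add: N a_def)
qed

theorem comparison:
  assumes usc: "usc_on dom1 u" "usc_on dom1 (\<lambda>z. - w z)"
    and u: "visc_sub u" and w: "visc_super w"
    and M: "\<And>z. z \<in> dom1 \<Longrightarrow> \<bar>u z\<bar> \<le> M" "\<And>z. z \<in> dom1 \<Longrightarrow> \<bar>w z\<bar> \<le> M"
    and tm: "\<And>\<rho> x. \<rho> \<in> open_simplex \<Longrightarrow> u (T, \<rho>, x) \<le> w (T, \<rho>, x)"
    and z: "z \<in> dom1"
  shows "u z \<le> w z"
proof -
  obtain t \<rho> x where zz: "z = (t, \<rho>, x)" by (cases z) auto
  then have t: "0 < t" "t \<le> T" and \<rho>: "\<rho> \<in> open_simplex" using z by (auto simp: dom1_def)
  have M0: "M \<ge> 0" using M(1)[OF z] by linarith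
  show ?thesis
  proof (cases "t = T")
    case True
    then show ?thesis using tm[OF \<rho>] by (simp add: zz)
  next
    case False
    then have z0: "(t, \<rho>, x) \<in> dom0" using t \<rho> by (auto simp: dom0_def)
    obtain C0 b where C0: "C0 \<ge> 0" and ly: "\<forall>R>0. \<exists>G0 K \<psi> \<psi>\<rho> \<psi>x \<psi>xx.
      openin (top_of_set (open_simplex \<times> UNIV)) G0 \<and> G0 \<subseteq> K \<and> compact K \<and>
      K \<subseteq> open_simplex \<times> UNIV \<and> space_test \<psi> \<psi>\<rho> \<psi>x \<psi>xx \<and>
      (\<forall>\<rho>\<in>open_simplex. \<forall>x. 0 \<le> \<psi> \<rho> x \<and> \<psi> \<rho> x \<le> b \<rho> x \<and> ((\<rho>, x) \<notin> G0 \<longrightarrow> R \<le> \<psi> \<rho> x)) \<and>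
      (\<forall>\<rho> x. (\<rho>, x) \<in> G0 \<longrightarrow> (\<forall>V\<in>cball 0 l.
         \<psi>\<rho> \<rho> x \<bullet> Hx \<rho> x - \<psi>x \<rho> x \<bullet> (Hr \<rho> x + V)
           + 1 / 2 * (\<Sum>i\<in>UNIV. (\<sigma> $ i)\<^sup>2 * \<psi>xx \<rho> x $ i $ i) \<le> C0 * (1 + \<psi> \<rho> x)))"
      using lyapunov by blast
    have b0: "b \<rho> x \<ge> 0" using ly[rule_format, of 1] \<rho> by (metis order_trans zero_less_one)
    show ?thesis
    proof (rule field_le_epsilon)
      fix \<eta> :: real assume \<eta>: "\<eta> > 0"
      define E where "E = exp ((C0 + 1) * (T - t)) * (1 + b \<rho> x)"
      have E: "E > 0" unfolding E_def using b0 by (intro mult_pos_pos) auto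
      define \<delta> \<nu> R where "\<delta> = \<eta> / (3 * E)" and "\<nu> = \<eta> / 3 * t" and "R = 2 * M / \<delta> + 1"
      have pos: "\<delta> > 0" "\<nu> > 0" "\<eta> / 3 > 0" using \<eta> E t by (auto simp: \<delta>_def \<nu>_def)
      have R: "R > 0" "2 * M \<le> \<delta> * (1 + R)"
        using pos(1) M0 by (auto simp: R_def field_simps add_nonneg_pos)
      obtain G0 K \<psi> \<psi>\<rho> \<psi>x \<psi>xx where
        G0: "openin (top_of_set (open_simplex \<times> UNIV)) G0" "G0 \<subseteq> K" and K: "compact K"
        "K \<subseteq> open_simplex \<times> UNIV" and st: "space_test \<psi> \<psi>\<rho> \<psi>x \<psi>xx"
        and \<psi>: "\<forall>\<rho>\<in>open_simplex. \<forall>x. 0 \<le> \<psi> \<rho> x \<and> \<psi> \<rho> x \<le> b \<rho> x \<and> ((\<rho>, x) \<notin> G0 \<longrightarrow> R \<le> \<psi> \<rho> x)"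
        and lyap: "\<forall>\<rho> x. (\<rho>, x) \<in> G0 \<longrightarrow> (\<forall>V\<in>cball 0 l.
         \<psi>\<rho> \<rho> x \<bullet> Hx \<rho> x - \<psi>x \<rho> x \<bullet> (Hr \<rho> x + V)
           + 1 / 2 * (\<Sum>i\<in>UNIV. (\<sigma> $ i)\<^sup>2 * \<psi>xx \<rho> x $ i $ i) \<le> C0 * (1 + \<psi> \<rho> x))"
        using ly[rule_format, OF R(1)] by (elim exE conjE) blast
      have "u (t, \<rho>, x) \<le> w (t, \<rho>, x)
         + \<delta> * exp ((C0 + 1) * (T - t)) * (1 + \<psi> \<rho> x) + \<nu> / t + \<eta> / 3"
        by (rule comparison_penalized[OF usc u w M tm z0 pos C0 G0 K st _ _ R(2)])
           (use \<psi> lyap in auto)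
      also have "\<delta> * exp ((C0 + 1) * (T - t)) * (1 + \<psi> \<rho> x) \<le> \<delta> * E"
        unfolding E_def mult.assoc using \<psi> \<rho> pos(1) by (intro mult_left_mono) auto
      also have "\<delta> * E = \<eta> / 3" using E by (simp add: \<delta>_def)
      also have "\<nu> / t = \<eta> / 3" using t by (simp add: \<nu>_def)
      finally show "u z \<le> w z + \<eta>" by (simp add: zz)
    qed
  qed
qed

end

section \<open>Perron's method\<close>

lemma test_function_uminus:
  assumes "test_function T \<phi> \<phi>t \<phi>\<rho> \<phi>x \<phi>xx"
  shows "test_function T (\<lambda>z. - \<phi> z) (\<lambda>z. - \<phi>t z) (\<lambda>z. - \<phi>\<rho> z) (\<lambda>z. - \<phi>x z) (\<lambda>z. - \<phi>xx z)"
proof -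
  have s: "has_simplex_derivative (\<lambda>r. - f r) (- p) \<rho>"
    if "has_simplex_derivative f p \<rho>" for f :: "real ^ 'a \<Rightarrow> real" and p \<rho>
    unfolding has_simplex_derivative_def
  proof (intro conjI ballI)
    show "(\<Sum>i\<in>UNIV. (- p) $ i) = 0"
      using that by (simp add: has_simplex_derivative_def sum_negf)
    fix \<mu> :: "real ^ 'a" assume "\<mu> \<in> prob_simplex"
    then have "((\<lambda>s. - ((f ((1 - s) *\<^sub>R \<rho> + s *\<^sub>R \<mu>) - f \<rho>) / s)) \<longlongrightarrow> - (p \<bullet> (\<mu> - \<rho>)))
        (at 0 within {s. (1 - s) *\<^sub>R \<rho> + s *\<^sub>R \<mu> \<in> prob_simplex})"
      using that by (intro tendsto_minus) (auto simp: has_simplex_derivative_def)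
    then show "((\<lambda>s. (- f ((1 - s) *\<^sub>R \<rho> + s *\<^sub>R \<mu>) - - f \<rho>) / s) \<longlongrightarrow> (- p) \<bullet> (\<mu> - \<rho>))
        (at 0 within {s. (1 - s) *\<^sub>R \<rho> + s *\<^sub>R \<mu> \<in> prob_simplex})"
      by (simp add: minus_divide_left)
  qed
  have g: "GDERIV (\<lambda>y. - f y) x :> - p" if "GDERIV f x :> p" for f :: "real ^ 'a \<Rightarrow> real" and p x
    using that by (rule GDERIV_minus)
  have d: "((\<lambda>y. - f y) has_derivative (\<lambda>v. (- A) *v v)) (at x)"
    if "(f has_derivative (\<lambda>v. A *v v)) (at x)" for f :: "real ^ 'a \<Rightarrow> real ^ 'a" and A x
    by (rule has_derivative_eq_rhs[OF has_derivative_minus[OF that]])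
       (simp add: fun_eq_iff vec_eq_iff matrix_vector_mult_def sum_negf)
  show ?thesis
    using assms unfolding test_function_def Let_def
    by (auto intro!: continuous_on_minus DERIV_minus s g d)
qed

lemma simplex_line_in_open:
  fixes \<rho> \<mu> :: "real ^ 'n"
  assumes "\<rho> \<in> open_simplex" "\<mu> \<in> prob_simplex"
  shows "\<forall>\<^sub>F s in nhds 0. (1 - s) *\<^sub>R \<rho> + s *\<^sub>R \<mu> \<in> open_simplex"
proof -
  have "((\<lambda>s::real. (1 - s) *\<^sub>R \<rho> + s *\<^sub>R \<mu>) \<longlongrightarrow> (1 - 0) *\<^sub>R \<rho> + 0 *\<^sub>R \<mu>) (nhds 0)"
    by (intro tendsto_intros filterlim_ident)
  then have "((\<lambda>s::real. (1 - s) *\<^sub>R \<rho> + s *\<^sub>R \<mu>) \<longlongrightarrow> \<rho>) (nhds 0)" by simp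
  then have "\<forall>\<^sub>F s in nhds (0::real). (1 - s) *\<^sub>R \<rho> + s *\<^sub>R \<mu> \<in> {r. \<forall>i. 0 < r $ i}"
    by (rule topological_tendstoD[OF _ open_pos_orthant]) (use assms in \<open>simp add: open_simplexD\<close>)
  then show ?thesis
  proof eventually_elim
    case (elim s)
    have "(\<Sum>i\<in>UNIV. ((1 - s) *\<^sub>R \<rho> + s *\<^sub>R \<mu>) $ i) = 1"
      using assms by (simp add: sum.distrib sum_distrib_left[symmetric] open_simplexD prob_simplex_sum)
    with elim show ?case by (simp add: open_simplex_eq)
  qed
qed

lemma simplex_derivative_zero_local_max:
  fixes f :: "real ^ 'n \<Rightarrow> real"
  assumes d: "has_simplex_derivative f p \<rho>" and \<rho>: "\<rho> \<in> open_simplex"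
    and mx: "\<forall>\<^sub>F r in at \<rho> within open_simplex. f r \<le> f \<rho>"
  shows "p = 0"
proof -
  have z: "p \<bullet> (\<mu> - \<rho>) = 0" if \<mu>: "\<mu> \<in> prob_simplex" for \<mu>
  proof -
    let ?L = "\<lambda>s::real. (1 - s) *\<^sub>R \<rho> + s *\<^sub>R \<mu>"
    obtain S where S: "open S" "0 \<in> S" "\<And>s. s \<in> S \<Longrightarrow> ?L s \<in> open_simplex"
      using simplex_line_in_open[OF \<rho> \<mu>] unfolding eventually_nhds by blast
    have sub: "S \<subseteq> {s. ?L s \<in> prob_simplex}"
      using S(3) rel_interior_subset unfolding open_simplex_def by blast
    have at: "at 0 within {s. ?L s \<in> prob_simplex} = at 0"
      using at_within_open_subset[OF S(2,1) sub] .
    have "((\<lambda>s. (f (?L s) - f \<rho>) / s) \<longlongrightarrow> p \<bullet> (\<mu> - \<rho>)) (at 0 within {s. ?L s \<in> prob_simplex})"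
      using d \<mu> unfolding has_simplex_derivative_def by blast
    then have "((\<lambda>s. f (?L s)) has_real_derivative p \<bullet> (\<mu> - \<rho>)) (at 0)"
      unfolding DERIV_def at by simp
    moreover obtain e where e: "e > 0" "\<And>r. r \<in> open_simplex \<Longrightarrow> r \<noteq> \<rho> \<Longrightarrow> dist r \<rho> < e \<Longrightarrow> f r \<le> f \<rho>"
      using mx unfolding eventually_at by blast
    have "(?L \<longlongrightarrow> (1 - 0) *\<^sub>R \<rho> + 0 *\<^sub>R \<mu>) (nhds 0)" by (intro tendsto_intros filterlim_ident)
    then have "(?L \<longlongrightarrow> \<rho>) (nhds 0)" by simp
    then have "\<forall>\<^sub>F s in nhds 0. dist (?L s) \<rho> < e" using e(1) by (rule tendstoD)
    then have "\<forall>\<^sub>F s in nhds 0. f (?L s) \<le> f (?L 0)"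
      using simplex_line_in_open[OF \<rho> \<mu>]
    proof eventually_elim
      case (elim s)
      then show ?case using e(2)[of "?L s"] by (cases "?L s = \<rho>") auto
    qed
    then obtain e' where "e' > 0" "\<And>s. \<bar>0 - s\<bar> < e' \<Longrightarrow> f (?L s) \<le> f (?L 0)"
      unfolding eventually_nhds_metric by (auto simp: dist_real_def)
    ultimately show ?thesis by (intro DERIV_local_max[of "\<lambda>s. f (?L s)" _ 0 e']) auto
  qed
  have ax: "axis i 1 \<in> (prob_simplex :: (real ^ 'n) set)" for i
    by (auto simp: prob_simplex_def axis_def)
  have eq: "p $ i = p \<bullet> \<rho>" for i
    using z[OF ax[of i]] by (simp add: inner_diff_right inner_axis)
  have "real CARD('n) * (p \<bullet> \<rho>) = (\<Sum>i\<in>UNIV. p $ i)" by (simp add: eq)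
  also have "\<dots> = 0" using d by (simp add: has_simplex_derivative_def)
  finally have "p \<bullet> \<rho> = 0" by simp
  then show ?thesis by (simp add: vec_eq_iff eq)
qed

lemma eventually_at_slice:
  fixes f :: "'a::metric_space \<Rightarrow> 'b::metric_space"
  assumes ev: "\<forall>\<^sub>F y in at (f a) within D. Q y" and "Q (f a)" and A: "\<And>b. b \<in> A \<Longrightarrow> f b \<in> D"
    and f: "\<And>b. dist (f b) (f a) = dist b a"
  shows "\<forall>\<^sub>F b in at a within A. Q (f b)"
proof -
  obtain e where e: "e > 0" "\<And>y. y \<in> D \<Longrightarrow> y \<noteq> f a \<Longrightarrow> dist y (f a) < e \<Longrightarrow> Q y"
    using ev unfolding eventually_at by blast
  have "Q (f b)" if "b \<in> A" "dist b a < e" for b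
    using e(2)[OF A[OF that(1)]] that(2) assms(2) f[of b] by (cases "f b = f a") auto
  then show ?thesis unfolding eventually_at using e(1) by blast
qed

lemma compact_cball_Int:
  fixes x :: "'a::euclidean_space"
  assumes "open S" "closed C" "x \<in> S \<inter> C"
  obtains r0 where "r0 > 0" "\<And>r. r \<le> r0 \<Longrightarrow> compact (cball x r \<inter> (S \<inter> C))"
proof -
  obtain r0 where r0: "r0 > 0" "cball x r0 \<subseteq> S"
    using assms open_contains_cball by blast
  have "compact (cball x r \<inter> (S \<inter> C))" if "r \<le> r0" for r
  proof -
    have "cball x r \<inter> (S \<inter> C) = cball x r \<inter> C"
      using r0(2) that by (force simp: subset_eq)
    then show ?thesis using assms(2) by (simp add: compact_Int_closed)
  qed
  with r0(1) show thesis by (rule that)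
qed

definition usc_env :: "'a::metric_space set \<Rightarrow> ('a \<Rightarrow> real) \<Rightarrow> 'a \<Rightarrow> real" where
  "usc_env D f z = Inf {c. \<exists>d>0. \<forall>y\<in>D. dist y z < d \<longrightarrow> f y \<le> c}"

context
  fixes D :: "'a::metric_space set" and f :: "'a \<Rightarrow> real" and B :: real
  assumes bd: "\<And>z. z \<in> D \<Longrightarrow> \<bar>f z\<bar> \<le> B"
begin

lemma usc_env_le:
  assumes "z \<in> D" "d > 0" "\<And>y. y \<in> D \<Longrightarrow> dist y z < d \<Longrightarrow> f y \<le> c"
  shows "usc_env D f z \<le> c"
  unfolding usc_env_def
proof (rule cInf_lower)
  show "c \<in> {c. \<exists>d>0. \<forall>y\<in>D. dist y z < d \<longrightarrow> f y \<le> c}" using assms by blast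
  show "bdd_below {c. \<exists>d>0. \<forall>y\<in>D. dist y z < d \<longrightarrow> f y \<le> c}"
    by (rule bdd_belowI[of _ "f z"]) (use assms(1) in auto)
qed

lemma usc_env_ge: "z \<in> D \<Longrightarrow> f z \<le> usc_env D f z"
  unfolding usc_env_def
proof (rule cInf_greatest)
  assume z: "z \<in> D"
  have "\<forall>y\<in>D. dist y z < 1 \<longrightarrow> f y \<le> B" using bd by (meson abs_le_D1)
  then show "{c. \<exists>d>0. \<forall>y\<in>D. dist y z < d \<longrightarrow> f y \<le> c} \<noteq> {}" using zero_less_one by blast
  show "f z \<le> c" if "c \<in> {c. \<exists>d>0. \<forall>y\<in>D. dist y z < d \<longrightarrow> f y \<le> c}" for c
    using that z by auto
qed

lemma usc_env_less:
  assumes "z \<in> D" "usc_env D f z < c"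
  obtains d where "d > 0" "\<And>y. y \<in> D \<Longrightarrow> dist y z < d \<Longrightarrow> f y < c"
proof -
  have "\<forall>y\<in>D. dist y z < 1 \<longrightarrow> f y \<le> B" using bd by (meson abs_le_D1)
  then have "{c. \<exists>d>0. \<forall>y\<in>D. dist y z < d \<longrightarrow> f y \<le> c} \<noteq> {}" using zero_less_one by blast
  then obtain c' where "c' < c" "\<exists>d>0. \<forall>y\<in>D. dist y z < d \<longrightarrow> f y \<le> c'"
    using cInf_lessD[OF _ assms(2)[unfolded usc_env_def]] by blast
  then show thesis using that by (meson le_less_trans)
qed

lemma usc_on_env: "usc_on D (usc_env D f)"
  unfolding usc_on_def
proof (intro ballI allI impI)
  fix z c assume z: "z \<in> D" "usc_env D f z < c"
  then obtain c' where c': "usc_env D f z < c'" "c' < c" using dense by blast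
  obtain d where d: "d > 0" "\<And>y. y \<in> D \<Longrightarrow> dist y z < d \<Longrightarrow> f y < c'"
    using usc_env_less[OF z(1) c'(1)] by blast
  have "usc_env D f y < c" if y: "y \<in> D" "dist y z < d" for y
  proof -
    have "usc_env D f y \<le> c'"
    proof (rule usc_env_le[OF y(1), of "d - dist y z"])
      show "0 < d - dist y z" using y(2) by simp
      show "f x \<le> c'" if "x \<in> D" "dist x y < d - dist y z" for x
        using d(2)[OF that(1)] that(2) dist_triangle[of x z y] by simp
    qed
    then show ?thesis using c'(2) by simp
  qed
  then show "\<exists>d>0. \<forall>y\<in>D. dist y z < d \<longrightarrow> usc_env D f y < c" using d(1) by blast
qed

lemma usc_env_le_continuous:
  assumes "continuous_on D g" "z \<in> D" "e > 0" "\<And>y. y \<in> D \<Longrightarrow> dist y z < e \<Longrightarrow> f y \<le> g y"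
  shows "usc_env D f z \<le> g z"
proof (rule field_le_epsilon)
  fix \<eta> :: real assume "\<eta> > 0"
  then obtain d where d: "d > 0" "\<And>y. y \<in> D \<Longrightarrow> dist y z < d \<Longrightarrow> g y < g z + \<eta>"
    using usc_onD[OF usc_on_continuous[OF assms(1)] assms(2), of "g z + \<eta>"] by auto
  show "usc_env D f z \<le> g z + \<eta>"
  proof (rule usc_env_le[OF assms(2), of "min d e"])
    show "f y \<le> g z + \<eta>" if "y \<in> D" "dist y z < min d e" for y
      using assms(4)[of y] d(2)[of y] that by simp
  qed (use d(1) assms(3) in simp)
qed

lemma usc_env_abs: "z \<in> D \<Longrightarrow> \<bar>usc_env D f z\<bar> \<le> B"
proof -
  assume z: "z \<in> D"
  have "usc_env D f z \<le> B" by (rule usc_env_le[OF z zero_less_one]) (use bd in \<open>meson abs_le_D1\<close>)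
  moreover have "- B \<le> f z" using bd[OF z] by linarith
  ultimately show ?thesis using usc_env_ge[OF z] by linarith
qed

end

lemma usc_imp_continuous:
  assumes "usc_on S u" "usc_on S (\<lambda>z. - u z)"
  shows "continuous_on S u"
  unfolding continuous_on_iff
proof (intro ballI allI impI)
  fix z e assume z: "z \<in> S" "(e::real) > 0"
  obtain d1 where d1: "d1 > 0" "\<And>y. y \<in> S \<Longrightarrow> dist y z < d1 \<Longrightarrow> u y < u z + e"
    using usc_onD[OF assms(1) z(1), of "u z + e"] z(2) by auto
  obtain d2 where d2: "d2 > 0" "\<And>y. y \<in> S \<Longrightarrow> dist y z < d2 \<Longrightarrow> - u y < - u z + e"
    using usc_onD[OF assms(2) z(1), of "- u z + e"] z(2) by auto
  have "dist (u y) (u z) < e" if "y \<in> S" "dist y z < min d1 d2" for y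
    using d1(2)[of y] d2(2)[of y] that by (auto simp: dist_real_def abs_less_iff)
  then show "\<exists>d>0. \<forall>y\<in>S. dist y z < d \<longrightarrow> dist (u y) (u z) < e"
    using d1(1) d2(1) by (intro exI[of _ "min d1 d2"]) auto
qed

context hjb_problem
begin

definition sub_at :: "('n pt \<Rightarrow> real) \<Rightarrow> 'n pt \<Rightarrow> bool" where
  "sub_at u z \<longleftrightarrow> (\<forall>\<phi> \<phi>t \<phi>\<rho> \<phi>x \<phi>xx. test_function T \<phi> \<phi>t \<phi>\<rho> \<phi>x \<phi>xx \<longrightarrow>
     (\<forall>\<^sub>F y in at z within dom0. u y - \<phi> y \<le> u z - \<phi> z) \<longrightarrow>
     (\<forall>V\<in>cball 0 l. 0 \<le> \<phi>t z + gen V z (\<phi>\<rho> z) (\<phi>x z) (\<phi>xx z) + cost z V))"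

definition super_at :: "('n pt \<Rightarrow> real) \<Rightarrow> 'n pt \<Rightarrow> bool" where
  "super_at w z \<longleftrightarrow> (\<forall>\<phi> \<phi>t \<phi>\<rho> \<phi>x \<phi>xx. test_function T \<phi> \<phi>t \<phi>\<rho> \<phi>x \<phi>xx \<longrightarrow>
     (\<forall>\<^sub>F y in at z within dom0. w z - \<phi> z \<le> w y - \<phi> y) \<longrightarrow>
     (\<forall>\<epsilon>>0. \<exists>V\<in>cball 0 l. \<phi>t z + gen V z (\<phi>\<rho> z) (\<phi>x z) (\<phi>xx z) + cost z V \<le> \<epsilon>))"

lemma visc_sub_iff: "visc_sub u \<longleftrightarrow> (\<forall>z\<in>dom0. sub_at u z)"
  by (simp add: visc_sub_def sub_at_def)

lemma visc_super_iff: "visc_super w \<longleftrightarrow> (\<forall>z\<in>dom0. super_at w z)"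
  by (simp add: visc_super_def super_at_def)

lemma sub_at_mono:
  assumes v: "sub_at v z" and eq: "v z = u z" and le: "\<forall>\<^sub>F y in at z within dom0. v y \<le> u y"
  shows "sub_at u z"
  unfolding sub_at_def
proof (intro allI impI)
  fix \<phi> \<phi>t \<phi>\<rho> \<phi>x \<phi>xx
  assume tf: "test_function T \<phi> \<phi>t \<phi>\<rho> \<phi>x \<phi>xx"
    and ev: "\<forall>\<^sub>F y in at z within dom0. u y - \<phi> y \<le> u z - \<phi> z"
  from ev le have "\<forall>\<^sub>F y in at z within dom0. v y - \<phi> y \<le> v z - \<phi> z"
    by eventually_elim (simp add: eq)
  then show "\<forall>V\<in>cball 0 l. 0 \<le> \<phi>t z + gen V z (\<phi>\<rho> z) (\<phi>x z) (\<phi>xx z) + cost z V"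
    using v tf unfolding sub_at_def by blast
qed

lemma super_at_mono:
  assumes v: "super_at v z" and eq: "v z = u z" and le: "\<forall>\<^sub>F y in at z within dom0. u y \<le> v y"
  shows "super_at u z"
  unfolding super_at_def
proof (intro allI impI)
  fix \<phi> \<phi>t \<phi>\<rho> \<phi>x \<phi>xx and \<epsilon> :: real
  assume tf: "test_function T \<phi> \<phi>t \<phi>\<rho> \<phi>x \<phi>xx"
    and ev: "\<forall>\<^sub>F y in at z within dom0. u z - \<phi> z \<le> u y - \<phi> y" and "\<epsilon> > 0"
  from ev le have "\<forall>\<^sub>F y in at z within dom0. v z - \<phi> z \<le> v y - \<phi> y"
    by eventually_elim (simp add: eq)
  then show "\<exists>V\<in>cball 0 l. \<phi>t z + gen V z (\<phi>\<rho> z) (\<phi>x z) (\<phi>xx z) + cost z V \<le> \<epsilon>"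
    using v tf \<open>\<epsilon> > 0\<close> unfolding super_at_def by blast
qed

lemma test_function_local_max:
  assumes tf: "test_function T \<xi> \<xi>t \<xi>\<rho> \<xi>x \<xi>xx" and z: "z \<in> dom0"
    and mx: "\<forall>\<^sub>F y in at z within dom0. \<xi> y \<le> \<xi> z"
  shows "\<xi>t z + gen V z (\<xi>\<rho> z) (\<xi>x z) (\<xi>xx z) \<le> 0"
proof -
  obtain t \<rho> x where zz: "z = (t, \<rho>, x)" by (cases z) auto
  have t: "0 < t" "t < T" and \<rho>: "\<rho> \<in> open_simplex" using z by (auto simp: zz dom0_def)
  have D: "((\<lambda>s. \<xi> (s, \<rho>, x)) has_real_derivative \<xi>t (t, \<rho>, x)) (at t)"
    "has_simplex_derivative (\<lambda>r. \<xi> (t, r, x)) (\<xi>\<rho> (t, \<rho>, x)) \<rho>"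
    "\<And>y. GDERIV (\<lambda>y. \<xi> (t, \<rho>, y)) y :> \<xi>x (t, \<rho>, y)"
    "((\<lambda>y. \<xi>x (t, \<rho>, y)) has_derivative (\<lambda>v. \<xi>xx (t, \<rho>, x) *v v)) (at x)"
    using tf t \<rho> by (auto simp: test_function_def Let_def)
  have "\<forall>\<^sub>F s in at t within {0<..<T}. \<xi> (s, \<rho>, x) \<le> \<xi> z"
    by (rule eventually_at_slice[where f = "\<lambda>s. (s, \<rho>, x)" and D = dom0 and Q = "\<lambda>y. \<xi> y \<le> \<xi> z"])
       (use mx \<rho> in \<open>auto simp: zz dom0_def dist_Pair_Pair\<close>)
  then have "\<forall>\<^sub>F s in at t. \<xi> (s, \<rho>, x) \<le> \<xi> (t, \<rho>, x)"
    using at_within_open[of t "{0<..<T}"] t by (simp add: zz)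
  then obtain e where "e > 0" "\<And>s. s \<noteq> t \<Longrightarrow> dist s t < e \<Longrightarrow> \<xi> (s, \<rho>, x) \<le> \<xi> (t, \<rho>, x)"
    unfolding eventually_at by auto
  then have "\<xi>t (t, \<rho>, x) = 0"
    by (intro DERIV_local_max[OF D(1), of e]) (auto simp: dist_real_def abs_minus_commute, metis order_refl)
  moreover have "\<forall>\<^sub>F r in at \<rho> within open_simplex. \<xi> (t, r, x) \<le> \<xi> z"
    by (rule eventually_at_slice[where f = "\<lambda>r. (t, r, x)" and D = dom0 and Q = "\<lambda>y. \<xi> y \<le> \<xi> z"])
       (use mx t in \<open>auto simp: zz dom0_def dist_Pair_Pair\<close>)
  then have "\<xi>\<rho> (t, \<rho>, x) = 0"
    by (intro simplex_derivative_zero_local_max[OF D(2) \<rho>]) (simp add: zz)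
  moreover have evx: "\<forall>\<^sub>F y in at x. \<xi> (t, \<rho>, y) \<le> \<xi> (t, \<rho>, x)"
    using eventually_at_slice[where f = "\<lambda>y. (t, \<rho>, y)" and a = x and D = dom0
        and Q = "\<lambda>y. \<xi> y \<le> \<xi> z" and A = UNIV] mx t \<rho>
    by (auto simp: zz dom0_def dist_Pair_Pair)
  have Dx: "((\<lambda>y. \<xi> (t, \<rho>, y)) has_derivative (\<lambda>v. \<xi>x (t, \<rho>, y) \<bullet> v)) (at y)" for y
    using D(3)[of y] by (simp add: gderiv_def inner_commute)
  have "\<xi>x (t, \<rho>, x) = 0" by (rule gradient_zero_local_max[OF Dx evx])
  moreover have "\<xi>xx (t, \<rho>, x) $ i $ i \<le> 0" for i
    using hessian_nonpos_local_max[OF Dx D(4) evx, of "axis i 1"]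
    by (simp add: matrix_vector_mult_basis column_def inner_axis)
  then have "(\<Sum>i\<in>UNIV. (\<sigma> $ i)\<^sup>2 * \<xi>xx (t, \<rho>, x) $ i $ i) \<le> 0"
    by (intro sum_nonpos) (simp add: mult_nonneg_nonpos)
  ultimately show ?thesis by (simp add: zz gen_def)
qed

lemma gen_diff: "gen V z (p - p') (q - q') (Q - Q') = gen V z p q Q - gen V z p' q' Q'"
  using gen_add[of V z "p - p'" p' "q - q'" q' "Q - Q'" Q'] by simp

lemma sub_at_classical:
  assumes tf: "test_function T \<phi> \<phi>t \<phi>\<rho> \<phi>x \<phi>xx" and z: "z \<in> dom0"
    and pos: "\<And>V. V \<in> cball 0 l \<Longrightarrow> 0 \<le> \<phi>t z + gen V z (\<phi>\<rho> z) (\<phi>x z) (\<phi>xx z) + cost z V"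
  shows "sub_at \<phi> z"
  unfolding sub_at_def
proof (intro allI impI ballI)
  fix \<psi> \<psi>t \<psi>\<rho> \<psi>x \<psi>xx and V :: "real ^ 'n"
  assume t: "test_function T \<psi> \<psi>t \<psi>\<rho> \<psi>x \<psi>xx" and V: "V \<in> cball 0 l"
    and ev: "\<forall>\<^sub>F y in at z within dom0. \<phi> y - \<psi> y \<le> \<phi> z - \<psi> z"
  from test_function_local_max[OF test_function_add[OF tf test_function_uminus[OF t]] z, of V] ev
  show "0 \<le> \<psi>t z + gen V z (\<psi>\<rho> z) (\<psi>x z) (\<psi>xx z) + cost z V"
    using pos[OF V] by (simp add: gen_diff)
qed

lemma super_at_classical:
  assumes tf: "test_function T \<phi> \<phi>t \<phi>\<rho> \<phi>x \<phi>xx" and z: "z \<in> dom0"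
    and neg: "\<And>V. V \<in> cball 0 l \<Longrightarrow> \<phi>t z + gen V z (\<phi>\<rho> z) (\<phi>x z) (\<phi>xx z) + cost z V \<le> 0"
  shows "super_at \<phi> z"
  unfolding super_at_def
proof (intro allI impI)
  fix \<psi> \<psi>t \<psi>\<rho> \<psi>x \<psi>xx and \<epsilon> :: real
  assume t: "test_function T \<psi> \<psi>t \<psi>\<rho> \<psi>x \<psi>xx" and \<epsilon>: "\<epsilon> > 0"
    and ev: "\<forall>\<^sub>F y in at z within dom0. \<phi> z - \<psi> z \<le> \<phi> y - \<psi> y"
  have ev': "\<forall>\<^sub>F y in at z within dom0. \<psi> y + - \<phi> y \<le> \<psi> z + - \<phi> z"
    using ev by eventually_elim simp
  have V: "(0::real ^ 'n) \<in> cball 0 l" using l_nonneg by simp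
  have "\<psi>t z + gen 0 z (\<psi>\<rho> z) (\<psi>x z) (\<psi>xx z) + cost z 0 \<le> 0"
    using test_function_local_max[OF test_function_add[OF t test_function_uminus[OF tf]] z ev', of 0] neg[OF V]
    by (simp add: gen_diff)
  then show "\<exists>V\<in>cball 0 l. \<psi>t z + gen V z (\<psi>\<rho> z) (\<psi>x z) (\<psi>xx z) + cost z V \<le> \<epsilon>"
    using V \<epsilon> by (intro bexI[of _ 0]) auto
qed

lemma ham_continuous:
  assumes tf: "test_function T \<phi> \<phi>t \<phi>\<rho> \<phi>x \<phi>xx"
  shows "continuous_on (dom0 \<times> cball 0 l) (\<lambda>q. \<phi>t (fst q)
     + gen (snd q) (fst q) (\<phi>\<rho> (fst q)) (\<phi>x (fst q)) (\<phi>xx (fst q)) + cost (fst q) (snd q))"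
proof -
  let ?A = "dom0 \<times> cball (0::real ^ 'n) l"
  have c: "continuous_on ?A (\<lambda>q. f (fst q))" if "continuous_on dom0 f" for f :: "'n pt \<Rightarrow> 'b::topological_space"
    by (rule continuous_on_compose2[OF that continuous_on_fst[OF continuous_on_id]]) auto
  have t: "continuous_on dom0 \<phi>t" "continuous_on dom0 \<phi>\<rho>" "continuous_on dom0 \<phi>x" "continuous_on dom0 \<phi>xx"
    using tf by (simp_all add: test_function_def Let_def dom0_def)
  have H: "continuous_on dom0 (\<lambda>z. f (fst (snd z)) (snd (snd z)))"
    if "continuous_on (open_simplex \<times> UNIV) (\<lambda>p. f (fst p) (snd p))" for f :: "real ^ 'n \<Rightarrow> real ^ 'n \<Rightarrow> real ^ 'n"
    by (rule continuous_on_compose2[OF that]) (auto simp: dom0_def intro!: continuous_intros)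
  have "continuous_on ?A (\<lambda>q. cost (fst q) (snd q))"
    unfolding cost_def by (intro F_cont_compose continuous_intros) (auto simp: dom0_def)
  moreover have "continuous_on ?A (\<lambda>q. gen (snd q) (fst q) (\<phi>\<rho> (fst q)) (\<phi>x (fst q)) (\<phi>xx (fst q)))"
    unfolding gen_def
    by (intro continuous_intros c[OF H[OF Hx_cont]] c[OF H[OF Hr_cont]] c t)
  ultimately show ?thesis by (intro continuous_intros c t)
qed

lemma ham_continuous_slice:
  assumes tf: "test_function T \<phi> \<phi>t \<phi>\<rho> \<phi>x \<phi>xx" and V: "V \<in> cball 0 l"
  shows "continuous_on dom0 (\<lambda>z. \<phi>t z + gen V z (\<phi>\<rho> z) (\<phi>x z) (\<phi>xx z) + cost z V)"
proof -
  have 1: "continuous_on dom0 (\<lambda>z. (z, V))" by (intro continuous_intros)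
  have 2: "(\<lambda>z. (z, V)) ` dom0 \<subseteq> dom0 \<times> cball 0 l" using V by auto
  from continuous_on_compose2[OF ham_continuous[OF tf] 1 2] show ?thesis by simp
qed

lemma dom0_eq: "dom0 = ({0<..<T} \<times> {r. \<forall>i. 0 < r $ i} \<times> UNIV) \<inter> {z. (\<Sum>i\<in>UNIV. fst (snd z) $ i) = 1}"
  by (auto simp: dom0_def open_simplex_eq)

lemma compact_nbhd:
  assumes "z \<in> dom0"
  obtains r0 where "r0 > 0" "\<And>r. r \<le> r0 \<Longrightarrow> compact (cball z r \<inter> dom0)"
proof -
  have 1: "open ({0<..<T} \<times> {r :: real ^ 'n. \<forall>i. 0 < r $ i} \<times> (UNIV :: (real ^ 'n) set))"
    by (intro open_Times open_pos_orthant) auto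
  have 2: "closed {z :: 'n pt. (\<Sum>i\<in>UNIV. fst (snd z) $ i) = 1}"
    by (intro closed_Collect_eq continuous_intros)
  show thesis
    using compact_cball_Int[OF 1 2, of z] assms that unfolding dom0_eq by blast
qed

text \<open>The quartic has vanishing first and second derivatives at its centre, so it makes a local
  extremum strict without changing the equation there.\<close>

definition quartic :: "real \<Rightarrow> 'n pt \<Rightarrow> 'n pt \<Rightarrow> real" where
  "quartic \<mu> z0 z = \<mu> * ((z - z0) \<bullet> (z - z0))\<^sup>2"

lemma quartic_eq: "quartic \<mu> z0 z = \<mu> * dist z z0 ^ 4"
  by (simp add: quartic_def dist_norm power2_norm_eq_inner[symmetric])

lemma strict_test_function:
  assumes tf: "test_function T \<phi> \<phi>t \<phi>\<rho> \<phi>x \<phi>xx"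
  obtains \<psi>t \<psi>\<rho> \<psi>x \<psi>xx where "test_function T (\<lambda>z. \<phi> z + quartic \<mu> z0 z) \<psi>t \<psi>\<rho> \<psi>x \<psi>xx"
    "\<psi>t z0 = \<phi>t z0" "\<psi>\<rho> z0 = \<phi>\<rho> z0" "\<psi>x z0 = \<phi>x z0" "\<psi>xx z0 = \<phi>xx z0"
proof -
  let ?Q1 = "\<lambda>z. (4 * \<mu> * ((z - z0) \<bullet> (z - z0))) *\<^sub>R (z - z0)"
  let ?Q2 = "\<lambda>z v. (4 * \<mu> * ((z - z0) \<bullet> (z - z0))) *\<^sub>R v + (8 * \<mu> * ((z - z0) \<bullet> v)) *\<^sub>R (z - z0)"
  note t = test_function_add[OF tf test_function_of_c2[OF c2_fun_quartic[of \<mu> z0]], folded quartic_def]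
  have "tang (0 :: real ^ 'n) = 0" by (simp add: tang_def)
  moreover have "matrix (\<lambda>v :: real ^ 'n. (0 :: real ^ 'n)) = 0" by (simp add: matrix_def vec_eq_iff)
  ultimately show thesis by (intro that[OF t]) auto
qed

end

definition sq_dist :: "real ^ 'n \<Rightarrow> real ^ 'n \<Rightarrow> real ^ 'n \<Rightarrow> real ^ 'n \<Rightarrow> real" where
  "sq_dist \<rho>0 x0 \<rho> x = (dist (\<rho>, x) (\<rho>0, x0))\<^sup>2"

lemma space_test_sq_dist:
  "space_test (sq_dist \<rho>0 x0) (\<lambda>\<rho> x. tang (2 *\<^sub>R (\<rho> - \<rho>0))) (\<lambda>\<rho> x. 2 *\<^sub>R (x - x0)) (\<lambda>\<rho> x. mat 2)"
proof -
  have eq: "sq_dist \<rho>0 x0 \<rho> x = (\<rho> - \<rho>0) \<bullet> (\<rho> - \<rho>0) + (x - x0) \<bullet> (x - x0)" for \<rho> x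
    by (simp add: sq_dist_def dist_norm power2_norm_eq_inner inner_prod_def)
  have "((\<lambda>r. (r - \<rho>0) \<bullet> (r - \<rho>0) + (x - x0) \<bullet> (x - x0)) has_derivative (\<lambda>v. (2 *\<^sub>R (\<rho> - \<rho>0)) \<bullet> v)) (at \<rho>)" for \<rho> x
    by (auto intro!: derivative_eq_intros simp: fun_eq_iff inner_commute)
  then have r: "has_simplex_derivative (\<lambda>r. (r - \<rho>0) \<bullet> (r - \<rho>0) + (x - x0) \<bullet> (x - x0)) (tang (2 *\<^sub>R (\<rho> - \<rho>0))) \<rho>"
    if "\<rho> \<in> open_simplex" for \<rho> x
    by (rule has_simplex_derivativeI) (rule open_simplexD(2)[OF that])
  have x: "GDERIV (\<lambda>y. (\<rho> - \<rho>0) \<bullet> (\<rho> - \<rho>0) + (y - x0) \<bullet> (y - x0)) x :> 2 *\<^sub>R (x - x0)" for \<rho> x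
    unfolding gderiv_def by (auto intro!: derivative_eq_intros simp: fun_eq_iff inner_commute)
  have m: "mat 2 *v v = 2 *\<^sub>R v" for v :: "real ^ 'a"
    by (simp add: vec_eq_iff matrix_vector_mult_def mat_def if_distrib if_distribR cong: if_cong)
  have xx: "((\<lambda>y. 2 *\<^sub>R (y - x0)) has_derivative (\<lambda>v. mat 2 *v v)) (at x)" for x
    unfolding m by (auto intro!: derivative_eq_intros)
  show ?thesis
    unfolding space_test_def Let_def eq case_prod_beta eq[abs_def]
    by (intro conjI ballI allI r x xx continuous_intros continuous_on_tang)
qed

context hjb_problem
begin

definition subsols :: "('n pt \<Rightarrow> real) set" where
  "subsols = {u. usc_on dom1 u \<and> (\<exists>B. \<forall>z\<in>dom1. \<bar>u z\<bar> \<le> B) \<and>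
     (\<forall>\<rho>\<in>open_simplex. \<forall>x. u (T, \<rho>, x) \<le> h \<rho> x) \<and> visc_sub u}"

lemma local_generator_bound:
  assumes st: "space_test \<psi> \<psi>\<rho> \<psi>x \<psi>xx" and \<rho>0: "\<rho>0 \<in> open_simplex" and "d > 0"
  obtains r B where "r > 0" "r \<le> d" "B \<ge> 0" "\<And>t \<rho> x V. \<rho> \<in> open_simplex \<Longrightarrow> dist (\<rho>, x) (\<rho>0, x0) \<le> r \<Longrightarrow>
     V \<in> cball 0 l \<Longrightarrow> \<bar>gen V (t, \<rho>, x) (\<psi>\<rho> \<rho> x) (\<psi>x \<rho> x) (\<psi>xx \<rho> x)\<bar> \<le> B"
proof -
  have 1: "open ({r :: real ^ 'n. \<forall>i. 0 < r $ i} \<times> (UNIV :: (real ^ 'n) set))"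
    by (intro open_Times open_pos_orthant) auto
  have 2: "closed {z :: (real ^ 'n) \<times> (real ^ 'n). (\<Sum>i\<in>UNIV. fst z $ i) = 1}"
    by (intro closed_Collect_eq continuous_intros)
  have eq: "open_simplex \<times> UNIV = ({r :: real ^ 'n. \<forall>i. 0 < r $ i} \<times> (UNIV :: (real ^ 'n) set))
      \<inter> {z. (\<Sum>i\<in>UNIV. fst z $ i) = 1}" by (auto simp: open_simplex_eq)
  have "(\<rho>0, x0) \<in> open_simplex \<times> UNIV" using \<rho>0 by simp
  then obtain r0 where r0: "r0 > 0"
    "\<And>r. r \<le> r0 \<Longrightarrow> compact (cball (\<rho>0, x0) r \<inter> (open_simplex \<times> UNIV))"
    using compact_cball_Int[OF 1 2, of "(\<rho>0, x0)"] unfolding eq by blast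
  define r where "r = min r0 d"
  let ?C = "cball (\<rho>0, x0) r \<inter> (open_simplex \<times> UNIV)"
  have C: "compact ?C" by (rule r0(2)) (simp add: r_def)
  let ?A = "?C \<times> cball (0 :: real ^ 'n) l"
  have c: "continuous_on ?A (\<lambda>q. f (fst (fst q)) (snd (fst q)))"
    if "continuous_on (open_simplex \<times> UNIV) (\<lambda>p. f (fst p) (snd p))"
    for f :: "real ^ 'n \<Rightarrow> real ^ 'n \<Rightarrow> 'b::topological_space"
    by (rule continuous_on_compose2[OF that continuous_on_fst[OF continuous_on_id]]) auto
  have t: "continuous_on (open_simplex \<times> UNIV) (\<lambda>p. \<psi>\<rho> (fst p) (snd p))"
    "continuous_on (open_simplex \<times> UNIV) (\<lambda>p. \<psi>x (fst p) (snd p))"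
    "continuous_on (open_simplex \<times> UNIV) (\<lambda>p. \<psi>xx (fst p) (snd p))"
    using st by (simp_all add: space_test_def Let_def case_prod_beta')
  have "continuous_on ?A (\<lambda>q. gen (snd q) (0, fst q) (\<psi>\<rho> (fst (fst q)) (snd (fst q)))
     (\<psi>x (fst (fst q)) (snd (fst q))) (\<psi>xx (fst (fst q)) (snd (fst q))))"
    unfolding gen_def snd_conv
    by (intro continuous_intros c[OF Hx_cont] c[OF Hr_cont] c[OF t(1)] c[OF t(2)] c[OF t(3)])
  from compact_imp_bounded[OF compact_continuous_image[OF this compact_Times[OF C compact_cball]]]
  obtain B where B: "\<forall>y\<in>(\<lambda>q. gen (snd q) (0, fst q) (\<psi>\<rho> (fst (fst q)) (snd (fst q)))
     (\<psi>x (fst (fst q)) (snd (fst q))) (\<psi>xx (fst (fst q)) (snd (fst q)))) ` ?A. norm y \<le> B"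
    unfolding bounded_iff by blast
  show thesis
  proof (rule that[of r "\<bar>B\<bar>"])
    show "r > 0" "r \<le> d" using r0(1) \<open>d > 0\<close> by (auto simp: r_def)
    show "\<bar>gen V (t, \<rho>, x) (\<psi>\<rho> \<rho> x) (\<psi>x \<rho> x) (\<psi>xx \<rho> x)\<bar> \<le> \<bar>B\<bar>"
      if "\<rho> \<in> open_simplex" "dist (\<rho>, x) (\<rho>0, x0) \<le> r" "V \<in> cball 0 l" for t \<rho> x V
    proof -
      have "((\<rho>, x), V) \<in> ?A" using that by (simp add: dist_commute)
      then have "norm (gen V (0, \<rho>, x) (\<psi>\<rho> \<rho> x) (\<psi>x \<rho> x) (\<psi>xx \<rho> x)) \<le> B"
        using bspec[OF B imageI] by fastforce
      then show ?thesis by (simp add: gen_def)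
    qed
  qed simp
qed

lemma affine_test_function:
  "test_function T ((\<lambda>(t, \<rho>, x). (c + k * (T - t)) * 1) :: 'n pt \<Rightarrow> real) (\<lambda>(t, \<rho>, x). - k * 1)
     (\<lambda>(t, \<rho>, x). (c + k * (T - t)) *\<^sub>R 0) (\<lambda>(t, \<rho>, x). (c + k * (T - t)) *\<^sub>R 0)
     (\<lambda>(t, \<rho>, x). (c + k * (T - t)) *\<^sub>R 0)"
  by (rule test_function_time_mult[OF space_test_const]) (auto intro!: derivative_eq_intros)

lemma quadratic_test_function:
  fixes \<rho>0 x0 :: "real ^ 'n"
  shows "test_function T (\<lambda>z. (case z of (t, \<rho>, x) \<Rightarrow> A * sq_dist \<rho>0 x0 \<rho> x)
       + (case z of (t, \<rho>, x) \<Rightarrow> (c + k * (T - t)) * 1))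
     (\<lambda>z. (case z of (t, \<rho>, x) \<Rightarrow> 0 * sq_dist \<rho>0 x0 \<rho> x) + (case z of (t, \<rho>, x) \<Rightarrow> - k * 1))
     (\<lambda>z. (case z of (t, \<rho>, x) \<Rightarrow> A *\<^sub>R tang (2 *\<^sub>R (\<rho> - \<rho>0)))
       + (case z of (t, \<rho>, x) \<Rightarrow> (c + k * (T - t)) *\<^sub>R 0))
     (\<lambda>z. (case z of (t, \<rho>, x) \<Rightarrow> A *\<^sub>R (2 *\<^sub>R (x - x0)))
       + (case z of (t, \<rho>, x) \<Rightarrow> (c + k * (T - t)) *\<^sub>R 0))
     (\<lambda>z. (case z of (t, \<rho>, x) \<Rightarrow> A *\<^sub>R mat 2) + (case z of (t, \<rho>, x) \<Rightarrow> (c + k * (T - t)) *\<^sub>R 0))"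
  by (intro test_function_add affine_test_function test_function_time_mult[OF space_test_sq_dist])
     (auto intro!: derivative_eq_intros)

lemma h_near:
  assumes "\<rho>0 \<in> open_simplex" "\<epsilon> > 0"
  obtains d where "d > 0" "\<And>\<rho> x. \<rho> \<in> open_simplex \<Longrightarrow> dist (\<rho>, x) (\<rho>0, x0) \<le> d \<Longrightarrow> \<bar>h \<rho> x - h \<rho>0 x0\<bar> \<le> \<epsilon>"
proof -
  have "(\<rho>0, x0) \<in> open_simplex \<times> UNIV" using assms by simp
  then obtain d where d: "d > 0" "\<And>p. p \<in> open_simplex \<times> UNIV \<Longrightarrow> dist p (\<rho>0, x0) < d \<Longrightarrow>
      dist ((\<lambda>(\<rho>, x). h \<rho> x) p) ((\<lambda>(\<rho>, x). h \<rho> x) (\<rho>0, x0)) < \<epsilon>"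
    using h_cont assms(2) unfolding continuous_on_iff by blast
  show thesis
  proof (rule that[of "d / 2"])
    show "\<bar>h \<rho> x - h \<rho>0 x0\<bar> \<le> \<epsilon>" if "\<rho> \<in> open_simplex" "dist (\<rho>, x) (\<rho>0, x0) \<le> d / 2" for \<rho> x
      using d(2)[of "(\<rho>, x)"] that d(1) by (simp add: dist_real_def)
  qed (use d(1) in simp)
qed

lemma continuous_on_quadratic:
  "continuous_on dom1 (\<lambda>z. (case z of (t, \<rho>, x) \<Rightarrow> A * sq_dist \<rho>0 x0 \<rho> x)
       + (case z of (t, \<rho>, x) \<Rightarrow> (c + k * (T - t)) * 1))"
  unfolding case_prod_beta sq_dist_def prod.collapse by (intro continuous_intros)

lemma upper_barrier:
  assumes \<rho>0: "\<rho>0 \<in> open_simplex" and \<epsilon>: "\<epsilon> > 0"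
  shows "\<exists>w B. continuous_on dom1 w \<and> visc_super w \<and> (\<forall>z\<in>dom1. \<bar>w z\<bar> \<le> B) \<and>
    (\<forall>\<rho>\<in>open_simplex. \<forall>x. h \<rho> x \<le> w (T, \<rho>, x)) \<and> w (T, \<rho>0, x0) \<le> h \<rho>0 x0 + \<epsilon>"
proof -
  obtain MF where MF0: "\<And>s \<rho> x V. s \<in> {0..T} \<Longrightarrow> \<rho> \<in> open_simplex \<Longrightarrow> V \<in> cball 0 l \<Longrightarrow> F s \<rho> x V \<le> MF"
    using F_bound by blast
  obtain Mh where Mh: "\<And>\<rho> x. \<rho> \<in> open_simplex \<Longrightarrow> h \<rho> x \<le> Mh" using h_bound by blast
  have Mh0: "Mh \<ge> 0" using Mh[OF \<rho>0] h_nonneg[OF \<rho>0] order_trans by blast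
  have MF: "MF \<ge> 0"
    using MF0[of T \<rho>0 0 x0] F_nonneg[of T \<rho>0 0 x0] \<rho>0 T_pos l_nonneg by fastforce
  obtain d where d: "d > 0" "\<And>\<rho> x. \<rho> \<in> open_simplex \<Longrightarrow> dist (\<rho>, x) (\<rho>0, x0) \<le> d \<Longrightarrow> \<bar>h \<rho> x - h \<rho>0 x0\<bar> \<le> \<epsilon>"
    using h_near[OF \<rho>0 \<epsilon>] by blast
  obtain r B where r: "r > 0" "r \<le> d" and B: "B \<ge> 0" "\<And>t \<rho> x V. \<rho> \<in> open_simplex \<Longrightarrow> dist (\<rho>, x) (\<rho>0, x0) \<le> r \<Longrightarrow>
     V \<in> cball 0 l \<Longrightarrow> \<bar>gen V (t, \<rho>, x) (tang (2 *\<^sub>R (\<rho> - \<rho>0))) (2 *\<^sub>R (x - x0)) (mat 2)\<bar> \<le> B"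
    using local_generator_bound[OF space_test_sq_dist[of \<rho>0 x0] \<rho>0 d(1), where ?x0.0 = x0] by blast
  define A where "A = (Mh + MF * T + 1) / r\<^sup>2"
  have A: "A \<ge> 0" using Mh0 MF T_pos by (simp add: A_def)
  have Ar: "A * r\<^sup>2 = Mh + MF * T + 1" using r by (simp add: A_def)
  define k where "k = A * B + MF"
  have k: "k \<ge> 0" using A B MF by (simp add: k_def)
  let ?c = "h \<rho>0 x0 + \<epsilon>"
  define Q where "Q z = (case z of (t, \<rho>, x) \<Rightarrow> A * sq_dist \<rho>0 x0 \<rho> x)
       + (case z of (t, \<rho>, x) \<Rightarrow> (?c + k * (T - t)) * 1)" for z :: "'n pt"
  define P :: "'n pt \<Rightarrow> real" where "P = (\<lambda>(t, \<rho>, x). (Mh + MF * (T - t)) * 1)"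
  have Q: "Q (t, \<rho>, x) = A * sq_dist \<rho>0 x0 \<rho> x + (?c + k * (T - t))" for t \<rho> x by (simp add: Q_def)
  have P: "P (t, \<rho>, x) = Mh + MF * (T - t)" for t and \<rho> x :: "real ^ 'n" by (simp add: P_def)
  note tQ = quadratic_test_function[of A \<rho>0 x0 ?c k, folded Q_def[abs_def]]
  note tP = affine_test_function[of Mh MF, folded P_def]
  have near: "dist (\<rho>, x) (\<rho>0, x0) \<le> r" if "Q (t, \<rho>, x) < P (t, \<rho>, x)" "0 < t" "t \<le> T" "\<rho> \<in> open_simplex" for t \<rho> x
  proof (rule ccontr)
    assume "\<not> ?thesis"
    then have "r\<^sup>2 \<le> sq_dist \<rho>0 x0 \<rho> x" using r unfolding sq_dist_def by (intro power_mono) auto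
    then have "A * r\<^sup>2 \<le> A * sq_dist \<rho>0 x0 \<rho> x" using A by (intro mult_left_mono)
    moreover have "MF * (T - t) \<le> MF * T" using MF that by (intro mult_left_mono) auto
    moreover have "0 \<le> k * (T - t)" using k that by simp
    moreover have "0 \<le> h \<rho>0 x0" by (rule h_nonneg[OF \<rho>0])
    ultimately show False using that(1) Ar \<epsilon> unfolding Q P by linarith
  qed
  show ?thesis
  proof (intro exI[of _ "\<lambda>z. min (P z) (Q z)"] exI[of _ "Mh + MF * T"] conjI ballI allI)
    have "continuous_on dom1 P" unfolding P_def case_prod_beta by (intro continuous_intros)
    then show "continuous_on dom1 (\<lambda>z. min (P z) (Q z))"
      unfolding Q_def by (intro continuous_on_min continuous_on_quadratic)
    show "\<bar>min (P z) (Q z)\<bar> \<le> Mh + MF * T" if z: "z \<in> dom1" for z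
    proof -
      obtain t \<rho> x where zz: "z = (t, \<rho>, x)" by (cases z) auto
      then have t: "0 < t" "t \<le> T" using z by (auto simp: dom1_def)
      have "0 \<le> MF * (T - t)" "MF * (T - t) \<le> MF * T" using MF t by (auto intro!: mult_left_mono)
      moreover have "0 \<le> Q z"
        unfolding zz Q using A k t h_nonneg[OF \<rho>0] \<epsilon>
        by (intro add_nonneg_nonneg mult_nonneg_nonneg) (auto simp: sq_dist_def)
      ultimately show ?thesis using Mh0 unfolding zz P by (simp add: min_def)
    qed
    show "h \<rho> x \<le> min (P (T, \<rho>, x)) (Q (T, \<rho>, x))" if \<rho>: "\<rho> \<in> open_simplex" for \<rho> x
    proof -
      have "h \<rho> x \<le> Q (T, \<rho>, x)"
      proof (cases "Q (T, \<rho>, x) < P (T, \<rho>, x)")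
        case True
        then have "dist (\<rho>, x) (\<rho>0, x0) \<le> d" using near[OF True] \<rho> T_pos r by fastforce
        from d(2)[OF \<rho> this] have "h \<rho> x \<le> ?c" by linarith
        also have "\<dots> \<le> Q (T, \<rho>, x)" using A by (simp add: Q sq_dist_def)
        finally show ?thesis .
      qed (use Mh[OF \<rho>, of x] in \<open>simp add: P\<close>)
      then show ?thesis using Mh[OF \<rho>, of x] by (simp add: P)
    qed
    show "min (P (T, \<rho>0, x0)) (Q (T, \<rho>0, x0)) \<le> h \<rho>0 x0 + \<epsilon>" by (simp add: Q sq_dist_def min_def)
    show "visc_super (\<lambda>z. min (P z) (Q z))"
      unfolding visc_super_iff
    proof
      fix z assume z: "z \<in> dom0"
      obtain t \<rho> x where zz: "z = (t, \<rho>, x)" by (cases z) auto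
      then have t: "0 < t" "t < T" and \<rho>: "\<rho> \<in> open_simplex" using z by (auto simp: dom0_def)
      have cost: "cost z V \<le> MF" if "V \<in> cball 0 l" for V
        using MF0[of t \<rho> V x] t \<rho> that by (simp add: cost_def zz)
      show "super_at (\<lambda>z. min (P z) (Q z)) z"
      proof (cases "Q z < P z")
        case False
        have "super_at P z"
          by (rule super_at_classical[OF tP z]) (use cost in \<open>force simp: zz gen_def\<close>)
        then show ?thesis by (rule super_at_mono) (use False in auto)
      next
        case True
        have n: "dist (\<rho>, x) (\<rho>0, x0) \<le> r" using near[of t \<rho> x] True t \<rho> by (simp add: zz)
        have "super_at Q z"
        proof (rule super_at_classical[OF tQ z])
          fix V :: "real ^ 'n" assume V: "V \<in> cball 0 l"
          let ?g = "gen V (t, \<rho>, x) (tang (2 *\<^sub>R (\<rho> - \<rho>0))) (2 *\<^sub>R (x - x0)) (mat 2)"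
          have "?g \<le> B" using B(2)[OF \<rho> n V, of t] by linarith
          then have "A * ?g \<le> A * B" using A by (intro mult_left_mono)
          then have "- k + A * ?g + cost z V \<le> 0" using cost[OF V] by (simp add: k_def)
          moreover have "A * ?g = gen V (t, \<rho>, x) (A *\<^sub>R tang (2 *\<^sub>R (\<rho> - \<rho>0))) (A *\<^sub>R (2 *\<^sub>R (x - x0))) (A *\<^sub>R mat 2)"
            by (rule gen_scale[symmetric])
          ultimately show "(case z of (t, \<rho>, x) \<Rightarrow> 0 * sq_dist \<rho>0 x0 \<rho> x) + (case z of (t, \<rho>, x) \<Rightarrow> - k * 1)
             + gen V z ((case z of (t, \<rho>, x) \<Rightarrow> A *\<^sub>R tang (2 *\<^sub>R (\<rho> - \<rho>0)))
                 + (case z of (t, \<rho>, x) \<Rightarrow> (?c + k * (T - t)) *\<^sub>R 0))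
               ((case z of (t, \<rho>, x) \<Rightarrow> A *\<^sub>R (2 *\<^sub>R (x - x0)))
                 + (case z of (t, \<rho>, x) \<Rightarrow> (?c + k * (T - t)) *\<^sub>R 0))
               ((case z of (t, \<rho>, x) \<Rightarrow> A *\<^sub>R mat 2) + (case z of (t, \<rho>, x) \<Rightarrow> (?c + k * (T - t)) *\<^sub>R 0))
             + cost z V \<le> 0"
            unfolding zz prod.case by simp
        qed
        then show ?thesis by (rule super_at_mono) (use True in auto)
      qed
    qed
  qed
qed

lemma lower_barrier:
  assumes \<rho>0: "\<rho>0 \<in> open_simplex" and \<epsilon>: "\<epsilon> > 0"
  obtains u where "u \<in> subsols" "continuous_on dom1 u" "h \<rho>0 x0 - \<epsilon> \<le> u (T, \<rho>0, x0)"
proof -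
  obtain Mh where Mh: "\<And>\<rho> x. \<rho> \<in> open_simplex \<Longrightarrow> h \<rho> x \<le> Mh" using h_bound by blast
  have Mh0: "Mh \<ge> 0" using Mh[OF \<rho>0] h_nonneg[OF \<rho>0] order_trans by blast
  obtain d where d: "d > 0" "\<And>\<rho> x. \<rho> \<in> open_simplex \<Longrightarrow> dist (\<rho>, x) (\<rho>0, x0) \<le> d \<Longrightarrow> \<bar>h \<rho> x - h \<rho>0 x0\<bar> \<le> \<epsilon>"
    using h_near[OF \<rho>0 \<epsilon>] by blast
  obtain r B where r: "r > 0" "r \<le> d" and B: "B \<ge> 0" "\<And>t \<rho> x V. \<rho> \<in> open_simplex \<Longrightarrow> dist (\<rho>, x) (\<rho>0, x0) \<le> r \<Longrightarrow>
     V \<in> cball 0 l \<Longrightarrow> \<bar>gen V (t, \<rho>, x) (tang (2 *\<^sub>R (\<rho> - \<rho>0))) (2 *\<^sub>R (x - x0)) (mat 2)\<bar> \<le> B"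
    using local_generator_bound[OF space_test_sq_dist[of \<rho>0 x0] \<rho>0 d(1), where ?x0.0 = x0] by blast
  define A where "A = (Mh + 1) / r\<^sup>2"
  have A: "A \<ge> 0" using Mh0 by (simp add: A_def)
  have Ar: "A * r\<^sup>2 = Mh + 1" using r by (simp add: A_def)
  define k where "k = A * B"
  have k: "k \<ge> 0" using A B by (simp add: k_def)
  let ?c = "h \<rho>0 x0 - \<epsilon>"
  define Q where "Q z = (case z of (t, \<rho>, x) \<Rightarrow> - A * sq_dist \<rho>0 x0 \<rho> x)
       + (case z of (t, \<rho>, x) \<Rightarrow> (?c + - k * (T - t)) * 1)" for z :: "'n pt"
  define P :: "'n pt \<Rightarrow> real" where "P = (\<lambda>(t, \<rho>, x). (0 + 0 * (T - t)) * 1)"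
  have Q: "Q (t, \<rho>, x) = - A * sq_dist \<rho>0 x0 \<rho> x + (?c - k * (T - t))" for t \<rho> x by (simp add: Q_def)
  have P: "P (t, \<rho>, x) = 0" for t and \<rho> x :: "real ^ 'n" by (simp add: P_def)
  note tQ = quadratic_test_function[of "- A" \<rho>0 x0 ?c "- k", folded Q_def[abs_def]]
  note tP = affine_test_function[of 0 0, folded P_def]
  have Qc: "Q (t, \<rho>, x) \<le> ?c" if "t \<le> T" for t \<rho> x
  proof -
    have "0 \<le> A * sq_dist \<rho>0 x0 \<rho> x" "0 \<le> k * (T - t)" using A k that by (auto simp: sq_dist_def)
    then show ?thesis unfolding Q by simp
  qed
  have near: "dist (\<rho>, x) (\<rho>0, x0) \<le> r" if "0 < Q (t, \<rho>, x)" "t \<le> T" "\<rho> \<in> open_simplex" for t \<rho> x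
  proof (rule ccontr)
    assume "\<not> ?thesis"
    then have "r\<^sup>2 \<le> sq_dist \<rho>0 x0 \<rho> x" using r unfolding sq_dist_def by (intro power_mono) auto
    then have "A * r\<^sup>2 \<le> A * sq_dist \<rho>0 x0 \<rho> x" using A by (intro mult_left_mono)
    moreover have "0 \<le> k * (T - t)" using k that by simp
    ultimately show False using that(1) Ar \<epsilon> Mh[OF \<rho>0, of x0] unfolding Q by simp
  qed
  define u where "u z = max (P z) (Q z)" for z
  have cont: "continuous_on dom1 u"
  proof -
    have "continuous_on dom1 P" unfolding P_def case_prod_beta by (intro continuous_intros)
    then show ?thesis unfolding u_def Q_def by (intro continuous_on_max continuous_on_quadratic)
  qed
  have "\<bar>u z\<bar> \<le> \<bar>?c\<bar>" if z: "z \<in> dom1" for z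
  proof -
    obtain t \<rho> x where zz: "z = (t, \<rho>, x)" by (cases z) auto
    have "Q z \<le> ?c" using z Qc unfolding zz by (simp add: dom1_def)
    then show ?thesis unfolding u_def zz P by (simp add: max_def)
  qed
  moreover have "u (T, \<rho>, x) \<le> h \<rho> x" if \<rho>: "\<rho> \<in> open_simplex" for \<rho> x
  proof (cases "0 < Q (T, \<rho>, x)")
    case True
    then have "dist (\<rho>, x) (\<rho>0, x0) \<le> d" using near[OF True] \<rho> r by fastforce
    from d(2)[OF \<rho> this] have "?c \<le> h \<rho> x" by linarith
    then show ?thesis using Qc[of T \<rho> x] h_nonneg[OF \<rho>] by (simp add: u_def P)
  qed (use h_nonneg[OF \<rho>, of x] in \<open>simp add: u_def P\<close>)
  moreover have "visc_sub u"
    unfolding visc_sub_iff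
  proof
    fix z assume z: "z \<in> dom0"
    obtain t \<rho> x where zz: "z = (t, \<rho>, x)" by (cases z) auto
    then have t: "0 < t" "t < T" and \<rho>: "\<rho> \<in> open_simplex" using z by (auto simp: dom0_def)
    have cost: "0 \<le> cost z V" if "V \<in> cball 0 l" for V
      using F_nonneg[of t \<rho> V x] t \<rho> that by (simp add: cost_def zz)
    show "sub_at u z"
    proof (cases "0 < Q z")
      case False
      have "sub_at P z"
        by (rule sub_at_classical[OF tP z]) (use cost in \<open>force simp: zz gen_def\<close>)
      then show ?thesis by (rule sub_at_mono) (use False in \<open>auto simp: u_def zz P\<close>)
    next
      case True
      have n: "dist (\<rho>, x) (\<rho>0, x0) \<le> r" using near[of t \<rho> x] True t \<rho> by (simp add: zz)
      have "sub_at Q z"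
      proof (rule sub_at_classical[OF tQ z])
        fix V :: "real ^ 'n" assume V: "V \<in> cball 0 l"
        let ?g = "gen V (t, \<rho>, x) (tang (2 *\<^sub>R (\<rho> - \<rho>0))) (2 *\<^sub>R (x - x0)) (mat 2)"
        have "?g \<le> B" using B(2)[OF \<rho> n V, of t] by linarith
        then have "A * ?g \<le> A * B" using A by (intro mult_left_mono)
        then have "0 \<le> k + - A * ?g + cost z V" using cost[OF V] by (simp add: k_def)
        moreover have "gen V (t, \<rho>, x) ((- A) *\<^sub>R tang (2 *\<^sub>R (\<rho> - \<rho>0))) ((- A) *\<^sub>R (2 *\<^sub>R (x - x0))) ((- A) *\<^sub>R mat 2) = - A * ?g"
          by (rule gen_scale)
        ultimately show "0 \<le> (case z of (t, \<rho>, x) \<Rightarrow> 0 * sq_dist \<rho>0 x0 \<rho> x) + (case z of (t, \<rho>, x) \<Rightarrow> - (- k) * 1)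
           + gen V z ((case z of (t, \<rho>, x) \<Rightarrow> (- A) *\<^sub>R tang (2 *\<^sub>R (\<rho> - \<rho>0)))
               + (case z of (t, \<rho>, x) \<Rightarrow> (?c + - k * (T - t)) *\<^sub>R 0))
             ((case z of (t, \<rho>, x) \<Rightarrow> (- A) *\<^sub>R (2 *\<^sub>R (x - x0)))
               + (case z of (t, \<rho>, x) \<Rightarrow> (?c + - k * (T - t)) *\<^sub>R 0))
             ((case z of (t, \<rho>, x) \<Rightarrow> (- A) *\<^sub>R mat 2) + (case z of (t, \<rho>, x) \<Rightarrow> (?c + - k * (T - t)) *\<^sub>R 0))
           + cost z V"
          unfolding zz prod.case by simp
      qed
      then show ?thesis by (rule sub_at_mono) (use True in \<open>auto simp: u_def zz P\<close>)
    qed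
  qed
  ultimately have "u \<in> subsols" unfolding subsols_def using usc_on_continuous[OF cont] by blast
  moreover have "?c \<le> u (T, \<rho>0, x0)" by (simp add: u_def Q sq_dist_def)
  ultimately show thesis using cont by (intro that)
qed

definition perron :: "'n pt \<Rightarrow> real" where
  "perron z = (SUP u\<in>subsols. u z)"

lemma subsolD:
  assumes "u \<in> subsols"
  shows "usc_on dom1 u" "visc_sub u" "\<And>\<rho> x. \<rho> \<in> open_simplex \<Longrightarrow> u (T, \<rho>, x) \<le> h \<rho> x"
    "\<exists>B. \<forall>z\<in>dom1. \<bar>u z\<bar> \<le> B"
  using assms by (auto simp: subsols_def)

lemma subsol_le_super:
  assumes u: "u \<in> subsols" and w: "continuous_on dom1 w" "visc_super w"
    and B: "\<And>z. z \<in> dom1 \<Longrightarrow> \<bar>w z\<bar> \<le> B"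
    and h: "\<And>\<rho> x. \<rho> \<in> open_simplex \<Longrightarrow> h \<rho> x \<le> w (T, \<rho>, x)" and z: "z \<in> dom1"
  shows "u z \<le> w z"
proof -
  obtain B' where B': "\<And>z. z \<in> dom1 \<Longrightarrow> \<bar>u z\<bar> \<le> B'" using subsolD(4)[OF u] by blast
  have c: "continuous_on dom1 (\<lambda>z. - w z)" by (intro continuous_intros w(1))
  show ?thesis
  proof (rule comparison[OF subsolD(1)[OF u] usc_on_continuous[OF c] subsolD(2)[OF u] w(2) _ _ _ z])
    show "\<bar>u y\<bar> \<le> max B B'" "\<bar>w y\<bar> \<le> max B B'" if "y \<in> dom1" for y
      using B[OF that] B'[OF that] by (simp_all add: le_max_iff_disj)
    show "u (T, \<rho>, x) \<le> w (T, \<rho>, x)" if "\<rho> \<in> open_simplex" for \<rho> x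
      using subsolD(3)[OF u that] h[OF that] by (rule order_trans)
  qed
qed

lemma simplex_nonempty: "\<exists>\<rho> :: real ^ 'n. \<rho> \<in> open_simplex"
  by (rule exI[of _ "\<chi> i. 1 / real CARD('n)"]) (simp add: open_simplex_eq)

lemma subsols_bounded_above:
  "\<exists>B. \<forall>u\<in>subsols. \<forall>z\<in>dom1. u z \<le> B"
proof -
  obtain \<rho>0 :: "real ^ 'n" where \<rho>0: "\<rho>0 \<in> open_simplex" using simplex_nonempty by blast
  obtain w B where w: "continuous_on dom1 w" "visc_super w" "\<And>z. z \<in> dom1 \<Longrightarrow> \<bar>w z\<bar> \<le> B"
    "\<And>\<rho> x. \<rho> \<in> open_simplex \<Longrightarrow> h \<rho> x \<le> w (T, \<rho>, x)"
    using upper_barrier[OF \<rho>0 zero_less_one, where ?x0.0 = 0] by blast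
  have "u z \<le> B" if "u \<in> subsols" "z \<in> dom1" for u z
    using subsol_le_super[OF that(1) w that(2)] w(3)[OF that(2)] by linarith
  then show ?thesis by blast
qed

lemma subsol_le_perron:
  assumes "u \<in> subsols" "z \<in> dom1"
  shows "u z \<le> perron z"
proof -
  obtain B where "\<forall>u\<in>subsols. \<forall>z\<in>dom1. u z \<le> B" using subsols_bounded_above by blast
  then have "bdd_above ((\<lambda>u. u z) ` subsols)" using assms(2) by (intro bdd_aboveI2[of _ _ B]) blast
  then show ?thesis unfolding perron_def by (rule cSUP_upper[OF assms(1)])
qed

lemma subsols_nonempty: "subsols \<noteq> {}"
  using simplex_nonempty lower_barrier[OF _ zero_less_one] by blast

lemma perron_bounded: "\<exists>B. \<forall>z\<in>dom1. \<bar>perron z\<bar> \<le> B"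
proof -
  obtain B where B: "\<forall>u\<in>subsols. \<forall>z\<in>dom1. u z \<le> B" using subsols_bounded_above by blast
  obtain u0 where u0: "u0 \<in> subsols" using subsols_nonempty by blast
  obtain B0 where B0: "\<And>z. z \<in> dom1 \<Longrightarrow> \<bar>u0 z\<bar> \<le> B0" using subsolD(4)[OF u0] by blast
  have "\<bar>perron z\<bar> \<le> max B B0" if z: "z \<in> dom1" for z
  proof -
    have "perron z \<le> B" unfolding perron_def
      by (rule cSUP_least[OF subsols_nonempty]) (use B z in blast)
    moreover have "- B0 \<le> perron z" using subsol_le_perron[OF u0 z] B0[OF z] by linarith
    ultimately show ?thesis by linarith
  qed
  then show ?thesis by blast
qed

lemma compact_nbhd_dom1:
  assumes "z \<in> dom0"
  obtains r0 where "r0 > 0" "\<And>r. r \<le> r0 \<Longrightarrow> compact (cball z r \<inter> dom0)"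
    "\<And>y. y \<in> dom1 \<Longrightarrow> dist y z \<le> r0 \<Longrightarrow> y \<in> dom0"
proof -
  obtain r0 where r0: "r0 > 0" "\<And>r. r \<le> r0 \<Longrightarrow> compact (cball z r \<inter> dom0)"
    using compact_nbhd[OF assms] by blast
  have zT: "fst z < T" using assms by (auto simp: dom0_def)
  show thesis
  proof (rule that[of "min r0 ((T - fst z) / 2)"])
    show "y \<in> dom0" if "y \<in> dom1" "dist y z \<le> min r0 ((T - fst z) / 2)" for y
    proof -
      have "\<bar>fst y - fst z\<bar> \<le> (T - fst z) / 2"
        using dist_fst_le[of y z] that(2) by (simp add: dist_real_def)
      then have "fst y - fst z \<le> (T - fst z) / 2" by (rule abs_le_D1)
      then have "fst y < T" using zT by argo
      then show ?thesis using that(1) by (auto simp: dom0_def dom1_def)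
    qed
  qed (use r0 zT in auto)
qed

lemma eventually_within_less:
  assumes "\<forall>\<^sub>F y in at z within D. Q y" "Q z"
  obtains d where "d > 0" "\<And>y. y \<in> D \<Longrightarrow> dist y z < d \<Longrightarrow> Q y"
  using assms unfolding eventually_at by metis

lemma visc_sub_env: "visc_sub (usc_env dom1 perron)"
  unfolding visc_sub_iff
proof
  fix z0 assume z0: "z0 \<in> dom0"
  then have z01: "z0 \<in> dom1" using dom0_subset by blast
  obtain B where B: "\<And>z. z \<in> dom1 \<Longrightarrow> \<bar>perron z\<bar> \<le> B" using perron_bounded by blast
  note le = subsol_le_perron
  let ?U = "usc_env dom1 perron"
  show "sub_at ?U z0"
    unfolding sub_at_def
  proof (intro allI impI ballI)
    fix \<phi> \<phi>t \<phi>\<rho> \<phi>x \<phi>xx and V :: "real ^ 'n"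
    assume tf: "test_function T \<phi> \<phi>t \<phi>\<rho> \<phi>x \<phi>xx" and V: "V \<in> cball 0 l"
      and ev: "\<forall>\<^sub>F y in at z0 within dom0. ?U y - \<phi> y \<le> ?U z0 - \<phi> z0"
    show "0 \<le> \<phi>t z0 + gen V z0 (\<phi>\<rho> z0) (\<phi>x z0) (\<phi>xx z0) + cost z0 V"
    proof (rule ccontr)
      assume neg: "\<not> ?thesis"
      obtain \<psi>t \<psi>\<rho> \<psi>x \<psi>xx where t': "test_function T (\<lambda>z. \<phi> z + quartic 1 z0 z) \<psi>t \<psi>\<rho> \<psi>x \<psi>xx"
        and at: "\<psi>t z0 = \<phi>t z0" "\<psi>\<rho> z0 = \<phi>\<rho> z0" "\<psi>x z0 = \<phi>x z0" "\<psi>xx z0 = \<phi>xx z0"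
        using strict_test_function[OF tf] by blast
      define \<psi> where "\<psi> z = \<phi> z + quartic 1 z0 z" for z
      define E where "E z = \<psi>t z + gen V z (\<psi>\<rho> z) (\<psi>x z) (\<psi>xx z) + cost z V" for z
      have Ec: "continuous_on dom0 E" unfolding E_def by (rule ham_continuous_slice[OF t' V])
      have E0: "E z0 < 0" using neg by (simp add: E_def at)
      have \<psi>c: "continuous_on dom0 \<psi>" using t' by (simp add: \<psi>_def test_function_def Let_def dom0_def)
      obtain d1 where d1: "d1 > 0" "\<And>y. y \<in> dom0 \<Longrightarrow> dist y z0 < d1 \<Longrightarrow> E y < 0"
        using usc_onD[OF usc_on_continuous[OF Ec] z0 E0] by blast
      obtain d2 where d2: "d2 > 0" "\<And>y. y \<in> dom0 \<Longrightarrow> dist y z0 < d2 \<Longrightarrow> ?U y - \<phi> y \<le> ?U z0 - \<phi> z0"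
        using eventually_within_less[OF ev] by blast
      obtain r0 where r0: "r0 > 0" "\<And>r. r \<le> r0 \<Longrightarrow> compact (cball z0 r \<inter> dom0)"
        "\<And>y. y \<in> dom1 \<Longrightarrow> dist y z0 \<le> r0 \<Longrightarrow> y \<in> dom0"
        using compact_nbhd_dom1[OF z0] by blast
      define r where "r = min r0 (min d1 d2 / 2)"
      have r: "r > 0" "r \<le> r0" "r < d1" "r < d2" using r0(1) d1(1) d2(1) by (auto simp: r_def)
      let ?C = "cball z0 r \<inter> dom0"
      define \<eta> where "\<eta> = r ^ 4 / 4"
      have \<eta>: "\<eta> > 0" using r(1) by (simp add: \<eta>_def)
      obtain d3 where d3: "d3 > 0" "\<And>y. y \<in> dom0 \<Longrightarrow> dist y z0 < d3 \<Longrightarrow> \<psi> y < \<psi> z0 + \<eta>"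
        using usc_onD[OF usc_on_continuous[OF \<psi>c] z0, of "\<psi> z0 + \<eta>"] \<eta> by auto
      have "\<exists>y\<in>dom1. dist y z0 < min d3 r \<and> ?U z0 - \<eta> < perron y"
      proof (rule ccontr)
        assume "\<not> ?thesis"
        then have "perron y \<le> ?U z0 - \<eta>" if "y \<in> dom1" "dist y z0 < min d3 r" for y
          using that by force
        then have "?U z0 \<le> ?U z0 - \<eta>"
          using usc_env_le[of dom1 perron, OF B z01, where d = "min d3 r"] d3(1) r(1) by auto
        then show False using \<eta> by simp
      qed
      then obtain y1 where y1: "y1 \<in> dom1" "dist y1 z0 < d3" "dist y1 z0 < r" "?U z0 - \<eta> < perron y1"
        by auto
      have y1d: "y1 \<in> dom0" using r0(3)[OF y1(1)] y1(3) r(2) by simp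
      have "bdd_above ((\<lambda>u. u y1) ` subsols)"
        by (rule bdd_aboveI2) (rule le[OF _ y1(1)])
      then obtain u where u: "u \<in> subsols" "?U z0 - \<eta> < u y1"
        using y1(4) unfolding perron_def by (auto simp: less_cSUP_iff[OF subsols_nonempty])
      have C: "compact ?C" by (rule r0(2)[OF r(2)])
      have y1C: "y1 \<in> ?C" using y1(3) y1d by (simp add: dist_commute)
      have "usc_on ?C (\<lambda>y. u y + - \<psi> y)"
        using dom0_subset
        by (intro usc_on_add usc_on_subset[OF subsolD(1)[OF u(1)]] usc_on_continuous
            continuous_intros continuous_on_subset[OF \<psi>c]) auto
      then obtain y2 where y2: "y2 \<in> ?C" "\<And>y. y \<in> ?C \<Longrightarrow> u y + - \<psi> y \<le> u y2 + - \<psi> y2"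
        using usc_attains_max[OF C] y1C by blast
      have y2d: "y2 \<in> dom0" "y2 \<in> dom1" "dist y2 z0 \<le> r"
        using y2(1) dom0_subset by (auto simp: dist_commute)
      have "u y2 \<le> ?U y2" using le[OF u(1) y2d(2)] usc_env_ge[of dom1 perron, OF B y2d(2)] by simp
      moreover have "?U y2 - \<phi> y2 \<le> ?U z0 - \<phi> z0" using d2(2)[OF y2d(1)] y2d(3) r(4) by simp
      moreover have "\<psi> y1 < \<psi> z0 + \<eta>" by (rule d3(2)[OF y1d y1(2)])
      moreover have "\<psi> z0 = \<phi> z0" "\<psi> y2 = \<phi> y2 + dist y2 z0 ^ 4" by (simp_all add: \<psi>_def quartic_eq)
      ultimately have "dist y2 z0 ^ 4 < 2 * \<eta>" using y2(2)[OF y1C] u(2) by linarith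
      also have "2 * \<eta> < r ^ 4" using r(1) by (simp add: \<eta>_def)
      finally have y2r: "dist y2 z0 < r" using r(1) by (meson less_imp_le power_less_imp_less_base)
      have "\<forall>\<^sub>F y in at y2 within dom0. y \<in> ball z0 r \<and> y \<in> dom0"
      proof (rule eventually_conj)
        have "\<forall>\<^sub>F y in at y2. y \<in> ball z0 r"
          using y2r by (intro eventually_at_in_open') (auto simp: dist_commute)
        then show "\<forall>\<^sub>F y in at y2 within dom0. y \<in> ball z0 r"
          by (rule filter_leD[OF at_le, rotated]) simp
        show "\<forall>\<^sub>F y in at y2 within dom0. y \<in> dom0" unfolding eventually_at_filter by simp
      qed
      then have "\<forall>\<^sub>F y in at y2 within dom0. u y - \<psi> y \<le> u y2 - \<psi> y2"
      proof eventually_elim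
        case (elim y)
        then show ?case using y2(2)[of y] by auto
      qed
      then have "0 \<le> E y2"
        using subsolD(2)[OF u(1)] t' y2d(1) V unfolding visc_sub_def E_def \<psi>_def by blast
      then show False using d1(2)[OF y2d(1)] y2d(3) r(3) by simp
    qed
  qed
qed

lemma perron_subsol: "usc_env dom1 perron \<in> subsols"
proof -
  obtain B where B: "\<And>z. z \<in> dom1 \<Longrightarrow> \<bar>perron z\<bar> \<le> B" using perron_bounded by blast
  note le = subsol_le_perron
  have "usc_env dom1 perron (T, \<rho>0, x0) \<le> h \<rho>0 x0" if \<rho>0: "\<rho>0 \<in> open_simplex" for \<rho>0 x0
  proof (rule field_le_epsilon)
    fix \<epsilon> :: real assume \<epsilon>: "\<epsilon> > 0"
    obtain w B' where w: "continuous_on dom1 w" "visc_super w" "\<And>z. z \<in> dom1 \<Longrightarrow> \<bar>w z\<bar> \<le> B'"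
      "\<And>\<rho> x. \<rho> \<in> open_simplex \<Longrightarrow> h \<rho> x \<le> w (T, \<rho>, x)" and w0: "w (T, \<rho>0, x0) \<le> h \<rho>0 x0 + \<epsilon>"
      using upper_barrier[OF \<rho>0 \<epsilon>, where ?x0.0 = x0] by blast
    have "perron z \<le> w z" if "z \<in> dom1" for z
      unfolding perron_def by (rule cSUP_least[OF subsols_nonempty]) (rule subsol_le_super[OF _ w that])
    then have "usc_env dom1 perron (T, \<rho>0, x0) \<le> w (T, \<rho>0, x0)"
      by (intro usc_env_le_continuous[of dom1 perron, OF B w(1) _ zero_less_one])
         (use \<rho>0 T_pos in \<open>auto simp: dom1_def\<close>)
    then show "usc_env dom1 perron (T, \<rho>0, x0) \<le> h \<rho>0 x0 + \<epsilon>" using w0 by simp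
  qed
  then show ?thesis
    unfolding subsols_def
    using usc_on_env[of dom1 perron, OF B] usc_env_abs[of dom1 perron, OF B] visc_sub_env by blast
qed

definition lsc_perron :: "'n pt \<Rightarrow> real" where
  "lsc_perron z = - usc_env dom1 (\<lambda>z. - perron z) z"

lemma lsc_perron_ge:
  assumes "continuous_on dom1 g" "z \<in> dom1" "e > 0" "\<And>y. y \<in> dom1 \<Longrightarrow> dist y z < e \<Longrightarrow> g y \<le> perron y"
  shows "g z \<le> lsc_perron z"
proof -
  obtain B where B: "\<And>z. z \<in> dom1 \<Longrightarrow> \<bar>perron z\<bar> \<le> B" using perron_bounded by blast
  have "usc_env dom1 (\<lambda>z. - perron z) z \<le> - g z"
  proof (rule usc_env_le_continuous[of dom1 "\<lambda>z. - perron z" B "\<lambda>z. - g z", OF _ _ assms(2,3)])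
    show "\<bar>- perron y\<bar> \<le> B" if "y \<in> dom1" for y using B[OF that] by simp
    show "continuous_on dom1 (\<lambda>z. - g z)" by (intro continuous_intros assms(1))
    show "- perron y \<le> - g y" if "y \<in> dom1" "dist y z < e" for y using assms(4)[OF that] by simp
  qed
  then show ?thesis by (simp add: lsc_perron_def)
qed

lemma usc_on_glue:
  assumes u: "usc_on D u" and b: "continuous_on A b" "A \<subseteq> D"
    and O: "open O1" "open O2" "D \<subseteq> O1 \<union> O2" "O1 \<inter> D \<subseteq> A"
    and v: "\<And>y. y \<in> O1 \<inter> D \<Longrightarrow> v y = max (u y) (b y)" "\<And>y. y \<in> O2 \<inter> D \<Longrightarrow> v y = u y"
  shows "usc_on D v"
  unfolding usc_on_def
proof (intro ballI allI impI)
  fix z c assume z: "z \<in> D" "v z < c"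
  show "\<exists>d>0. \<forall>y\<in>D. dist y z < d \<longrightarrow> v y < c"
  proof (cases "z \<in> O1")
    case True
    then have zA: "z \<in> A" and vz: "u z < c" "b z < c" using z O(4) v(1) by auto
    obtain d1 where d1: "d1 > 0" "\<And>y. y \<in> D \<Longrightarrow> dist y z < d1 \<Longrightarrow> u y < c"
      using usc_onD[OF u z(1) vz(1)] by blast
    obtain d2 where d2: "d2 > 0" "\<And>y. y \<in> A \<Longrightarrow> dist y z < d2 \<Longrightarrow> b y < c"
      using usc_onD[OF usc_on_continuous[OF b(1)] zA vz(2)] by blast
    obtain d3 where d3: "d3 > 0" "\<And>y. dist y z < d3 \<Longrightarrow> y \<in> O1"
      using O(1) True unfolding open_dist by blast
    have "v y < c" if "y \<in> D" "dist y z < min d1 (min d2 d3)" for y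
      using d1(2)[of y] d2(2)[of y] d3(2)[of y] v(1)[of y] that O(4) by auto
    then show ?thesis using d1(1) d2(1) d3(1) by (intro exI[of _ "min d1 (min d2 d3)"]) auto
  next
    case False
    then have z2: "z \<in> O2" using z(1) O(3) by blast
    then have "u z < c" using z v(2) by auto
    then obtain d1 where d1: "d1 > 0" "\<And>y. y \<in> D \<Longrightarrow> dist y z < d1 \<Longrightarrow> u y < c"
      using usc_onD[OF u z(1)] by blast
    obtain d3 where d3: "d3 > 0" "\<And>y. dist y z < d3 \<Longrightarrow> y \<in> O2"
      using O(2) z2 unfolding open_dist by blast
    have "v y < c" if "y \<in> D" "dist y z < min d1 d3" for y
      using d1(2)[of y] d3(2)[of y] v(2)[of y] that by auto
    then show ?thesis using d1(1) d3(1) by (intro exI[of _ "min d1 d3"]) auto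
  qed
qed

lemma visc_super_perron: "visc_super lsc_perron"
  unfolding visc_super_iff
proof
  fix z0 assume z0: "z0 \<in> dom0"
  then have z01: "z0 \<in> dom1" using dom0_subset by blast
  obtain B where B: "\<And>z. z \<in> dom1 \<Longrightarrow> \<bar>perron z\<bar> \<le> B" using perron_bounded by blast
  note le = subsol_le_perron
  let ?U = "usc_env dom1 perron"
  have U: "?U z = perron z" if "z \<in> dom1" for z
    using le[OF perron_subsol that] usc_env_ge[of dom1 perron, OF B that] by simp
  have Bm: "\<bar>- perron z\<bar> \<le> B" if "z \<in> dom1" for z using B[OF that] by simp
  have Lle: "lsc_perron z \<le> perron z" if "z \<in> dom1" for z
    using usc_env_ge[of dom1 "\<lambda>z. - perron z", OF Bm that] by (simp add: lsc_perron_def)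
  show "super_at lsc_perron z0"
    unfolding super_at_def
  proof (intro allI impI)
    fix \<phi> \<phi>t \<phi>\<rho> \<phi>x \<phi>xx and \<epsilon> :: real
    assume tf: "test_function T \<phi> \<phi>t \<phi>\<rho> \<phi>x \<phi>xx" and \<epsilon>: "\<epsilon> > 0"
      and ev: "\<forall>\<^sub>F y in at z0 within dom0. lsc_perron z0 - \<phi> z0 \<le> lsc_perron y - \<phi> y"
    show "\<exists>V\<in>cball 0 l. \<phi>t z0 + gen V z0 (\<phi>\<rho> z0) (\<phi>x z0) (\<phi>xx z0) + cost z0 V \<le> \<epsilon>"
    proof (rule ccontr)
      assume "\<not> ?thesis"
      then have pos: "\<epsilon> < \<phi>t z0 + gen V z0 (\<phi>\<rho> z0) (\<phi>x z0) (\<phi>xx z0) + cost z0 V"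
        if "V \<in> cball 0 l" for V using that by force
      obtain \<psi>t \<psi>\<rho> \<psi>x \<psi>xx where t': "test_function T (\<lambda>z. \<phi> z + quartic (- 1) z0 z) \<psi>t \<psi>\<rho> \<psi>x \<psi>xx"
        and at: "\<psi>t z0 = \<phi>t z0" "\<psi>\<rho> z0 = \<phi>\<rho> z0" "\<psi>x z0 = \<phi>x z0" "\<psi>xx z0 = \<phi>xx z0"
        using strict_test_function[OF tf] by blast
      obtain r0 where r0: "r0 > 0" "\<And>r. r \<le> r0 \<Longrightarrow> compact (cball z0 r \<inter> dom0)"
        "\<And>y. y \<in> dom1 \<Longrightarrow> dist y z0 \<le> r0 \<Longrightarrow> y \<in> dom0"
        using compact_nbhd_dom1[OF z0] by blast
      define E where "E q = \<psi>t (fst q) + gen (snd q) (fst q) (\<psi>\<rho> (fst q)) (\<psi>x (fst q)) (\<psi>xx (fst q))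
         + cost (fst q) (snd q)" for q
      have "continuous_on ((cball z0 r0 \<inter> dom0) \<times> cball 0 l) E"
        unfolding E_def by (rule continuous_on_subset[OF ham_continuous[OF t']]) auto
      then have "uniformly_continuous_on ((cball z0 r0 \<inter> dom0) \<times> cball 0 l) E"
        by (intro compact_uniformly_continuous compact_Times compact_cball r0(2)[OF order_refl])
      then have "\<exists>d>0. \<forall>q\<in>(cball z0 r0 \<inter> dom0) \<times> cball 0 l. \<forall>q'\<in>(cball z0 r0 \<inter> dom0) \<times> cball 0 l.
          dist q' q < d \<longrightarrow> dist (E q') (E q) < \<epsilon>"
        using \<epsilon> unfolding uniformly_continuous_on_def by blast
      then obtain d1 where d1: "d1 > 0" "\<forall>q\<in>(cball z0 r0 \<inter> dom0) \<times> cball 0 l. \<forall>q'\<in>(cball z0 r0 \<inter> dom0) \<times> cball 0 l.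
          dist q' q < d1 \<longrightarrow> dist (E q') (E q) < \<epsilon>" by blast
      obtain d2 where d2: "d2 > 0" "\<And>y. y \<in> dom0 \<Longrightarrow> dist y z0 < d2 \<Longrightarrow> lsc_perron z0 - \<phi> z0 \<le> lsc_perron y - \<phi> y"
        using eventually_within_less[OF ev] by blast
      define r where "r = min r0 (min d1 d2 / 2)"
      have r: "r > 0" "r \<le> r0" "r < d1" "r < d2" using r0(1) d1(1) d2(1) by (auto simp: r_def)
      let ?C = "cball z0 r \<inter> dom0"
      have Epos: "0 \<le> E (y, V)" if "y \<in> ?C" "V \<in> cball 0 l" for y V
      proof -
        have "dist (E (y, V)) (E (z0, V)) < \<epsilon>"
          using d1(2)[THEN bspec, of "(z0, V)", THEN bspec, of "(y, V)"] that r r0(1) z0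
          by (auto simp: dist_Pair_Pair dist_commute)
        moreover have "\<epsilon> < E (z0, V)" using pos[OF that(2)] by (simp add: E_def at)
        ultimately show ?thesis by (simp add: dist_real_def abs_less_iff)
      qed
      define k \<eta> where "k = lsc_perron z0 - \<phi> z0" and "\<eta> = (r / 2) ^ 4"
      have \<eta>: "\<eta> > 0" using r(1) by (simp add: \<eta>_def)
      define b where "b z = (\<phi> z + quartic (- 1) z0 z) + (case z of (t, \<rho>, x) \<Rightarrow> (k + \<eta> + 0 * (T - t)) * 1)" for z
      have b: "b z = \<phi> z - dist z z0 ^ 4 + k + \<eta>" for z
        by (simp add: b_def quartic_eq case_prod_beta)
      note tb = test_function_add[OF t' affine_test_function[of "k + \<eta>" 0], folded b_def[abs_def]]
      have bc: "continuous_on dom0 b" using tb by (simp add: test_function_def Let_def dom0_def)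
      have b_small: "b y \<le> perron y" if "y \<in> dom0" "r / 2 < dist y z0" "dist y z0 \<le> r" for y
      proof -
        have "\<eta> \<le> dist y z0 ^ 4" unfolding \<eta>_def using that(2) r(1) by (intro power_mono) auto
        moreover have "k + \<phi> y \<le> lsc_perron y" using d2(2)[OF that(1)] that(3) r(4) by (simp add: k_def)
        ultimately show ?thesis using Lle[of y] that(1) dom0_subset unfolding b by fastforce
      qed
      define v where "v y = (if dist y z0 < r \<and> y \<in> dom0 then max (?U y) (b y) else ?U y)" for y
      have vU: "v y = ?U y" if "y \<in> dom1" "r / 2 < dist y z0" for y
      proof (cases "dist y z0 < r \<and> y \<in> dom0")
        case True
        then show ?thesis using b_small[of y] that U[OF that(1)] by (simp add: v_def)
      next
        case False
        then show ?thesis unfolding v_def by (simp only: if_False)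
      qed
      have Uv: "?U y \<le> v y" for y by (simp add: v_def)
      have usc: "usc_on dom1 v"
      proof (rule usc_on_glue[OF usc_on_env[of dom1 perron, OF B] bc dom0_subset, of "ball z0 r" "- cball z0 (r / 2)"])
        show "dom1 \<subseteq> ball z0 r \<union> - cball z0 (r / 2)" using r(1) by auto
        show "ball z0 r \<inter> dom1 \<subseteq> dom0" using r0(3) r(2) by (auto simp: dist_commute)
        show "v y = max (?U y) (b y)" if "y \<in> ball z0 r \<inter> dom1" for y
          using that r0(3)[of y] r(2) by (simp add: v_def dist_commute)
        show "v y = ?U y" if "y \<in> - cball z0 (r / 2) \<inter> dom1" for y
          using that by (intro vU) (auto simp: dist_commute)
      qed auto
      have C: "compact ?C" by (rule r0(2)[OF r(2)])
      have "bounded (b ` ?C)"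
        by (intro compact_imp_bounded compact_continuous_image C continuous_on_subset[OF bc]) auto
      then obtain Bb where Bb: "\<forall>y\<in>b ` ?C. norm y \<le> Bb" unfolding bounded_iff by blast
      have bounded: "\<bar>v y\<bar> \<le> max B Bb" if y: "y \<in> dom1" for y
      proof (cases "dist y z0 < r \<and> y \<in> dom0")
        case True
        then have "\<bar>b y\<bar> \<le> Bb" using Bb by (auto simp: dist_commute)
        then show ?thesis using B[OF y] U[OF y] True by (auto simp: v_def max_def abs_le_iff)
      next
        case False
        then have "v y = ?U y" unfolding v_def by (simp only: if_False)
        then show ?thesis using B[OF y] U[OF y] by (simp add: le_max_iff_disj)
      qed
      have "v (T, \<rho>, x) \<le> h \<rho> x" if "\<rho> \<in> open_simplex" for \<rho> x
        using subsolD(3)[OF perron_subsol that] by (simp add: v_def dom0_def)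
      moreover have "visc_sub v"
        unfolding visc_sub_iff
      proof
        fix z assume z: "z \<in> dom0"
        show "sub_at v z"
        proof (cases "dist z z0 < r \<and> ?U z < b z")
          case False
          then have eq: "?U z = v z" by (auto simp: v_def)
          have "sub_at ?U z" using subsolD(2)[OF perron_subsol] z by (simp add: visc_sub_iff)
          then show ?thesis using eq by (rule sub_at_mono) (simp add: Uv)
        next
          case True
          have "sub_at b z"
          proof (rule sub_at_classical[OF tb z])
            fix V :: "real ^ 'n" assume V: "V \<in> cball 0 l"
            show "0 \<le> \<psi>t z + (case z of (t, \<rho>, x) \<Rightarrow> - 0 * 1)
              + gen V z (\<psi>\<rho> z + (case z of (t, \<rho>, x) \<Rightarrow> (k + \<eta> + 0 * (T - t)) *\<^sub>R 0))
                 (\<psi>x z + (case z of (t, \<rho>, x) \<Rightarrow> (k + \<eta> + 0 * (T - t)) *\<^sub>R 0))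
                 (\<psi>xx z + (case z of (t, \<rho>, x) \<Rightarrow> (k + \<eta> + 0 * (T - t)) *\<^sub>R 0)) + cost z V"
              using Epos[of z V] True z V by (simp add: E_def case_prod_beta dist_commute)
          qed
          moreover have "b z = v z" using True z by (simp add: v_def)
          moreover have "\<forall>\<^sub>F y in at z within dom0. b y \<le> v y"
          proof -
            have "\<forall>\<^sub>F y in at z. y \<in> ball z0 r"
              using True by (intro eventually_at_in_open') (auto simp: dist_commute)
            then have "\<forall>\<^sub>F y in at z within dom0. y \<in> ball z0 r"
              by (rule filter_leD[OF at_le, rotated]) simp
            moreover have "\<forall>\<^sub>F y in at z within dom0. y \<in> dom0" unfolding eventually_at_filter by simp
            ultimately show ?thesis by eventually_elim (simp add: v_def dist_commute)
          qed
          ultimately show ?thesis by (rule sub_at_mono)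
        qed
      qed
      ultimately have v: "v \<in> subsols" unfolding subsols_def using usc bounded by blast
      have bp: "b y \<le> perron y" if "y \<in> dom1" "dist y z0 < r" for y
      proof -
        have "b y \<le> v y" using that r0(3)[OF that(1)] r(2) by (simp add: v_def)
        then show ?thesis using le[OF v that(1)] by simp
      qed
      have "usc_env dom1 (\<lambda>z. - perron z) z0 \<le> - b z0 + \<eta> / 2"
      proof -
        have "continuous_on dom0 (\<lambda>y. - b y)" by (intro continuous_intros bc)
        then obtain d where d: "d > 0" "\<And>y. y \<in> dom0 \<Longrightarrow> dist y z0 < d \<Longrightarrow> - b y < - b z0 + \<eta> / 2"
          using usc_onD[OF usc_on_continuous z0, of "\<lambda>y. - b y" "- b z0 + \<eta> / 2"] \<eta> by auto
        have "- perron y \<le> - b z0 + \<eta> / 2" if "y \<in> dom1" "dist y z0 < min d r" for y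
          using bp[OF that(1)] d(2)[of y] r0(3)[OF that(1)] that(2) r(2) by simp
        then show ?thesis using d(1) r(1) by (intro usc_env_le[of dom1 "\<lambda>z. - perron z", OF Bm z01, where d = "min d r"]) auto
      qed
      then have "b z0 - \<eta> / 2 \<le> lsc_perron z0" by (simp add: lsc_perron_def)
      then show False using \<eta> by (simp add: b k_def)
    qed
  qed
qed

theorem existence:
  "continuous_on dom1 perron \<and> visc_sub perron \<and> visc_super perron \<and>
   (\<exists>B. \<forall>z\<in>dom1. \<bar>perron z\<bar> \<le> B) \<and> (\<forall>\<rho>\<in>open_simplex. \<forall>x. perron (T, \<rho>, x) = h \<rho> x)"
proof -
  obtain B where B: "\<And>z. z \<in> dom1 \<Longrightarrow> \<bar>perron z\<bar> \<le> B" using perron_bounded by blast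
  note le = subsol_le_perron
  let ?U = "usc_env dom1 perron"
  have U: "?U z = perron z" if "z \<in> dom1" for z
    using le[OF perron_subsol that] usc_env_ge[of dom1 perron, OF B that] by simp
  have Bm: "\<bar>- perron z\<bar> \<le> B" if "z \<in> dom1" for z using B[OF that] by simp
  have Lle: "lsc_perron z \<le> perron z" if "z \<in> dom1" for z
    using usc_env_ge[of dom1 "\<lambda>z. - perron z", OF Bm that] by (simp add: lsc_perron_def)
  have uscL: "usc_on dom1 (\<lambda>z. - lsc_perron z)"
    using usc_on_env[of dom1 "\<lambda>z. - perron z", OF Bm] by (simp add: lsc_perron_def[abs_def])
  have BL: "\<bar>lsc_perron z\<bar> \<le> B" if "z \<in> dom1" for z
    using usc_env_abs[of dom1 "\<lambda>z. - perron z", OF Bm that] by (simp add: lsc_perron_def)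
  have BU: "\<bar>?U z\<bar> \<le> B" if "z \<in> dom1" for z using B[OF that] U[OF that] by simp
  have hL: "h \<rho>0 x0 \<le> lsc_perron (T, \<rho>0, x0)" if \<rho>0: "\<rho>0 \<in> open_simplex" for \<rho>0 x0
  proof (rule field_le_epsilon)
    fix \<epsilon> :: real assume "\<epsilon> > 0"
    then obtain u where u: "u \<in> subsols" "continuous_on dom1 u" "h \<rho>0 x0 - \<epsilon> \<le> u (T, \<rho>0, x0)"
      using lower_barrier[OF \<rho>0] by blast
    have "u (T, \<rho>0, x0) \<le> lsc_perron (T, \<rho>0, x0)"
      by (rule lsc_perron_ge[OF u(2) _ zero_less_one le[OF u(1)]])
         (use \<rho>0 T_pos in \<open>auto simp: dom1_def\<close>)
    then show "h \<rho>0 x0 \<le> lsc_perron (T, \<rho>0, x0) + \<epsilon>" using u(3) by simp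
  qed
  have cmpT: "?U (T, \<rho>, x) \<le> lsc_perron (T, \<rho>, x)" if "\<rho> \<in> open_simplex" for \<rho> x
    using subsolD(3)[OF perron_subsol that] hL[OF that] by (rule order_trans)
  have cmp: "?U z \<le> lsc_perron z" if "z \<in> dom1" for z
    by (rule comparison[OF subsolD(1)[OF perron_subsol] uscL visc_sub_env visc_super_perron BU BL cmpT that])
  have eq: "lsc_perron z = perron z" if "z \<in> dom1" for z
    using cmp[OF that] Lle[OF that] U[OF that] by simp
  have "usc_on dom1 perron"
    using subsolD(1)[OF perron_subsol] U unfolding usc_on_def by force
  moreover have "usc_on dom1 (\<lambda>z. - perron z)"
    using uscL eq unfolding usc_on_def by force
  ultimately have "continuous_on dom1 perron" by (rule usc_imp_continuous)
  moreover have "sub_at perron z" if z: "z \<in> dom0" for z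
  proof (rule sub_at_mono[of ?U])
    show "sub_at ?U z" using visc_sub_env z by (simp add: visc_sub_iff)
    show "?U z = perron z" using U z dom0_subset by blast
    show "\<forall>\<^sub>F y in at z within dom0. ?U y \<le> perron y"
      unfolding eventually_at_filter using U dom0_subset by (auto intro!: always_eventually)
  qed
  moreover have "super_at perron z" if z: "z \<in> dom0" for z
  proof (rule super_at_mono[of lsc_perron])
    show "super_at lsc_perron z" using visc_super_perron z by (simp add: visc_super_iff)
    show "lsc_perron z = perron z" using eq z dom0_subset by blast
    show "\<forall>\<^sub>F y in at z within dom0. perron y \<le> lsc_perron y"
      unfolding eventually_at_filter using eq dom0_subset by (auto intro!: always_eventually)
  qed
  moreover have "perron (T, \<rho>, x) = h \<rho> x" if "\<rho> \<in> open_simplex" for \<rho> x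
  proof -
    have "(T, \<rho>, x) \<in> dom1" using that T_pos by (simp add: dom1_def)
    then show ?thesis using U eq hL[OF that, of x] subsolD(3)[OF perron_subsol that, of x] by simp
  qed
  ultimately show ?thesis using B unfolding visc_sub_iff visc_super_iff by blast
qed

end

section \<open>The gradients of the energy\<close>

lemma grad_eqI:
  assumes "GDERIV f x :> D"
  shows "grad f x = D"
  unfolding grad_def
proof (rule the_equality[where P = "\<lambda>D. GDERIV f x :> D"])
  show "GDERIV f x :> D" by (rule assms)
  fix D' assume "GDERIV f x :> D'"
  then have "(\<lambda>h. h \<bullet> D') = (\<lambda>h. h \<bullet> D)"
    using assms unfolding gderiv_def by (rule has_derivative_unique)
  then have "h \<bullet> (D' - D) = 0" for h by (simp add: inner_diff_right fun_eq_iff)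
  from this[of "D' - D"] show "D' = D" by simp
qed

definition bdd_lip :: "'a::real_normed_vector set \<Rightarrow> ('a \<Rightarrow> real) \<Rightarrow> bool" where
  "bdd_lip K f \<longleftrightarrow> (\<exists>B. \<forall>p\<in>K. \<bar>f p\<bar> \<le> B) \<and> (\<exists>L. \<forall>p\<in>K. \<forall>q\<in>K. \<bar>f p - f q\<bar> \<le> L * norm (p - q))"

lemma bdd_lip_const: "bdd_lip K (\<lambda>p. c)"
  unfolding bdd_lip_def
  by (rule conjI, rule exI[of _ "\<bar>c\<bar>"], simp, rule exI[of _ 0], simp)

lemma bdd_lip_add:
  assumes "bdd_lip K f" "bdd_lip K g"
  shows "bdd_lip K (\<lambda>p. f p + g p)"
proof -
  obtain B L B' L' where *: "\<forall>p\<in>K. \<bar>f p\<bar> \<le> B" "\<forall>p\<in>K. \<forall>q\<in>K. \<bar>f p - f q\<bar> \<le> L * norm (p - q)"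
    "\<forall>p\<in>K. \<bar>g p\<bar> \<le> B'" "\<forall>p\<in>K. \<forall>q\<in>K. \<bar>g p - g q\<bar> \<le> L' * norm (p - q)"
    using assms unfolding bdd_lip_def by blast
  have "\<bar>f p + g p\<bar> \<le> B + B'" if "p \<in> K" for p
    using *(1,3) that by (intro order_trans[OF abs_triangle_ineq] add_mono) auto
  moreover have "\<bar>f p + g p - (f q + g q)\<bar> \<le> (L + L') * norm (p - q)" if "p \<in> K" "q \<in> K" for p q
  proof -
    have "\<bar>f p + g p - (f q + g q)\<bar> \<le> \<bar>f p - f q\<bar> + \<bar>g p - g q\<bar>" by linarith
    also have "\<dots> \<le> L * norm (p - q) + L' * norm (p - q)" using *(2,4) that by (intro add_mono) auto
    finally show ?thesis by (simp add: distrib_right)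
  qed
  ultimately show ?thesis unfolding bdd_lip_def by blast
qed

lemma bdd_lip_mult:
  assumes "bdd_lip K f" "bdd_lip K g"
  shows "bdd_lip K (\<lambda>p. f p * g p)"
proof -
  obtain B L B' L' where *: "\<forall>p\<in>K. \<bar>f p\<bar> \<le> B" "\<forall>p\<in>K. \<forall>q\<in>K. \<bar>f p - f q\<bar> \<le> L * norm (p - q)"
    "\<forall>p\<in>K. \<bar>g p\<bar> \<le> B'" "\<forall>p\<in>K. \<forall>q\<in>K. \<bar>g p - g q\<bar> \<le> L' * norm (p - q)"
    using assms unfolding bdd_lip_def by blast
  have b: "\<bar>f p\<bar> \<le> \<bar>B\<bar>" "\<bar>g p\<bar> \<le> \<bar>B'\<bar>" if "p \<in> K" for p
    using *(1,3) that by (auto intro: order_trans[OF _ abs_ge_self])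
  have "\<bar>f p * g p\<bar> \<le> \<bar>B\<bar> * \<bar>B'\<bar>" if "p \<in> K" for p
    unfolding abs_mult using b[OF that] by (intro mult_mono) auto
  moreover have "\<bar>f p * g p - f q * g q\<bar> \<le> (\<bar>B\<bar> * L' + \<bar>B'\<bar> * L) * norm (p - q)" if pq: "p \<in> K" "q \<in> K" for p q
  proof -
    have "f p * g p - f q * g q = f p * (g p - g q) + g q * (f p - f q)" by (simp add: algebra_simps)
    then have "\<bar>f p * g p - f q * g q\<bar> \<le> \<bar>f p\<bar> * \<bar>g p - g q\<bar> + \<bar>g q\<bar> * \<bar>f p - f q\<bar>"
      by (metis abs_mult abs_triangle_ineq)
    also have "\<dots> \<le> \<bar>B\<bar> * (L' * norm (p - q)) + \<bar>B'\<bar> * (L * norm (p - q))"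
      using b pq *(2,4) by (intro add_mono mult_mono) auto
    finally show ?thesis by (simp add: algebra_simps)
  qed
  ultimately show ?thesis unfolding bdd_lip_def by blast
qed

lemma bdd_lip_cmult: "bdd_lip K f \<Longrightarrow> bdd_lip K (\<lambda>p. c * f p)"
  by (rule bdd_lip_mult[OF bdd_lip_const])

lemma bdd_lip_diff: "bdd_lip K f \<Longrightarrow> bdd_lip K g \<Longrightarrow> bdd_lip K (\<lambda>p. f p - g p)"
  using bdd_lip_add[of K f "\<lambda>p. (- 1) * g p"] bdd_lip_cmult[of K g "- 1"] by simp

lemma bdd_lip_sum: "(\<And>i. i \<in> S \<Longrightarrow> bdd_lip K (f i)) \<Longrightarrow> bdd_lip K (\<lambda>p. \<Sum>i\<in>S. f i p)"
  by (induction S rule: infinite_finite_induct) (auto intro: bdd_lip_const bdd_lip_add)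

lemma bdd_lip_ln:
  assumes f: "bdd_lip K f" and a: "a > 0" "\<And>p. p \<in> K \<Longrightarrow> a \<le> f p"
  shows "bdd_lip K (\<lambda>p. ln (f p))"
proof -
  obtain B L where *: "\<forall>p\<in>K. \<bar>f p\<bar> \<le> B" "\<forall>p\<in>K. \<forall>q\<in>K. \<bar>f p - f q\<bar> \<le> L * norm (p - q)"
    using f unfolding bdd_lip_def by blast
  have pos: "f p > 0" if "p \<in> K" for p using a that by force
  have one: "ln (f p) - ln (f q) \<le> L / a * norm (p - q)" if pq: "p \<in> K" "q \<in> K" for p q
  proof -
    have "ln (f p) - ln (f q) \<le> (f p - f q) / f q"
      using ln_diff_le pos pq by blast
    also have "\<dots> \<le> \<bar>f p - f q\<bar> / a"
      using a pos pq by (intro frac_le) auto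
    also have "\<dots> \<le> L * norm (p - q) / a"
      using * pq a by (intro divide_right_mono) auto
    finally show ?thesis by simp
  qed
  have "\<bar>ln (f p) - ln (f q)\<bar> \<le> L / a * norm (p - q)" if "p \<in> K" "q \<in> K" for p q
    using one[OF that] one[OF that(2,1)] by (simp add: abs_le_iff norm_minus_commute)
  moreover have "\<bar>ln (f p)\<bar> \<le> max (- ln a) B" if "p \<in> K" for p
  proof -
    have "ln a \<le> ln (f p)" using a that pos by simp
    moreover have "ln (f p) \<le> f p - 1" using pos[OF that] by (rule ln_le_minus_one)
    moreover have "f p \<le> B" using *(1) that by (meson abs_le_D1)
    ultimately show ?thesis by linarith
  qed
  ultimately show ?thesis unfolding bdd_lip_def by blast
qed

lemma bdd_lip_inverse:
  assumes f: "bdd_lip K f" and a: "a > 0" "\<And>p. p \<in> K \<Longrightarrow> a \<le> f p"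
  shows "bdd_lip K (\<lambda>p. 1 / f p)"
proof -
  obtain L where *: "\<forall>p\<in>K. \<forall>q\<in>K. \<bar>f p - f q\<bar> \<le> L * norm (p - q)"
    using f unfolding bdd_lip_def by blast
  have pos: "f p > 0" if "p \<in> K" for p using a that by force
  have "\<bar>1 / f p\<bar> \<le> 1 / a" if "p \<in> K" for p
    using a that pos[OF that] by (simp add: frac_le)
  moreover have "\<bar>1 / f p - 1 / f q\<bar> \<le> L / (a * a) * norm (p - q)" if pq: "p \<in> K" "q \<in> K" for p q
  proof -
    have "1 / f p - 1 / f q = (f q - f p) / (f p * f q)" using pos pq by (simp add: field_simps less_imp_neq[symmetric])
    then have "\<bar>1 / f p - 1 / f q\<bar> = \<bar>f p - f q\<bar> / (f p * f q)"
      using pos[OF pq(1)] pos[OF pq(2)] by (simp add: abs_mult abs_minus_commute abs_of_pos)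
    also have "\<dots> \<le> (L * norm (p - q)) / (a * a)"
    proof (rule frac_le)
      show le: "\<bar>f p - f q\<bar> \<le> L * norm (p - q)" using * pq by blast
      show "0 \<le> L * norm (p - q)" by (rule order_trans[OF abs_ge_zero le])
      show "0 < a * a" using a by simp
      show "a * a \<le> f p * f q" using a pq pos[OF pq(1)] by (intro mult_mono) auto
    qed
    finally show ?thesis by simp
  qed
  ultimately show ?thesis unfolding bdd_lip_def by blast
qed

lemma linear_prod_eq:
  fixes f :: "real \<times> real \<Rightarrow> real"
  assumes "linear f"
  shows "f v = fst v * f (1, 0) + snd v * f (0, 1)"
proof -
  have "f v = f (fst v *\<^sub>R (1, 0) + snd v *\<^sub>R (0, 1))" by simp
  also have "\<dots> = fst v * f (1, 0) + snd v * f (0, 1)"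
    unfolding linear_add[OF assms] linear_cmul[OF assms] by simp
  finally show ?thesis .
qed

lemma C1_lipschitz_on_box:
  fixes \<phi> :: "real \<times> real \<Rightarrow> real"
  assumes c1: "C_k_on 1 ({0<..} \<times> {0<..}) \<phi>" and a: "0 < a"
  shows "bdd_lip ({a..b} \<times> {a..b}) \<phi>"
proof -
  let ?P = "{0<..} \<times> {0<..} :: (real \<times> real) set" and ?Q = "{a..b} \<times> {a..b}"
  have QP: "?Q \<subseteq> ?P" using a by auto
  have Q: "compact ?Q" "convex ?Q" by (auto intro: compact_Times convex_Times)
  have df: "\<phi> differentiable (at p)" if "p \<in> ?P" for p
    using c1 that unfolding One_nat_def C_k_on.simps by blast
  have dc: "continuous_on ?P (\<lambda>p. frechet_derivative \<phi> (at p) v)" for v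
    using c1 unfolding One_nat_def C_k_on.simps by blast
  have c: "continuous_on ?Q \<phi>"
    using df QP by (intro continuous_at_imp_continuous_on) (auto intro!: differentiable_imp_continuous_within)
  have bd: "\<exists>B. \<forall>p\<in>?Q. \<bar>f p\<bar> \<le> B" if "continuous_on ?Q f" for f :: "real \<times> real \<Rightarrow> real"
    using compact_imp_bounded[OF compact_continuous_image[OF that Q(1)]] unfolding bounded_iff by auto
  obtain B1 where B1: "\<And>p. p \<in> ?Q \<Longrightarrow> \<bar>frechet_derivative \<phi> (at p) (1, 0)\<bar> \<le> B1"
    using bd[OF continuous_on_subset[OF dc QP]] by blast
  obtain B2 where B2: "\<And>p. p \<in> ?Q \<Longrightarrow> \<bar>frechet_derivative \<phi> (at p) (0, 1)\<bar> \<le> B2"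
    using bd[OF continuous_on_subset[OF dc QP]] by blast
  have "\<bar>\<phi> p - \<phi> q\<bar> \<le> (B1 + B2) * norm (p - q)" if pq: "p \<in> ?Q" "q \<in> ?Q" for p q
  proof -
    have "norm (\<phi> p - \<phi> q) \<le> (B1 + B2) * norm (p - q)"
    proof (rule differentiable_bound[OF Q(2) _ _ pq])
      fix x assume x: "x \<in> ?Q"
      have d: "(\<phi> has_derivative frechet_derivative \<phi> (at x)) (at x)"
        using df QP x frechet_derivative_works by blast
      then show "(\<phi> has_derivative frechet_derivative \<phi> (at x)) (at x within ?Q)"
        by (rule has_derivative_at_withinI)
      show "onorm (frechet_derivative \<phi> (at x)) \<le> B1 + B2"
      proof (rule onorm_le)
        fix v :: "real \<times> real"
        have "frechet_derivative \<phi> (at x) v = fst v * frechet_derivative \<phi> (at x) (1, 0)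
            + snd v * frechet_derivative \<phi> (at x) (0, 1)"
          by (rule linear_prod_eq[OF has_derivative_linear[OF d]])
        then have "\<bar>frechet_derivative \<phi> (at x) v\<bar> \<le> \<bar>fst v\<bar> * \<bar>frechet_derivative \<phi> (at x) (1, 0)\<bar>
            + \<bar>snd v\<bar> * \<bar>frechet_derivative \<phi> (at x) (0, 1)\<bar>"
          unfolding abs_mult[symmetric] by (simp only: abs_triangle_ineq)
        also have "\<dots> \<le> norm v * B1 + norm v * B2"
        proof -
          have "\<bar>fst v\<bar> \<le> norm v" "\<bar>snd v\<bar> \<le> norm v"
            using norm_fst_le[of "fst v" "snd v"] norm_snd_le[of "snd v" "fst v"] by simp_all
          then show ?thesis
            by (intro add_mono mult_mono B1[OF x] B2[OF x] norm_ge_zero abs_ge_zero)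
        qed
        finally show "norm (frechet_derivative \<phi> (at x) v) \<le> (B1 + B2) * norm v"
          by (simp add: algebra_simps)
      qed
    qed
    then show ?thesis by simp
  qed
  then show ?thesis unfolding bdd_lip_def using bd[OF c] by blast
qed

lemma bdd_lip_compose2:
  fixes f1 f2 :: "'a::real_normed_vector \<Rightarrow> real"
  assumes \<phi>: "bdd_lip Q \<phi>" and f: "bdd_lip K f1" "bdd_lip K f2"
    and Q: "\<And>p. p \<in> K \<Longrightarrow> (f1 p, f2 p) \<in> Q"
  shows "bdd_lip K (\<lambda>p. \<phi> (f1 p, f2 p))"
proof -
  obtain B L where *: "\<forall>p\<in>Q. \<bar>\<phi> p\<bar> \<le> B" "\<forall>p\<in>Q. \<forall>q\<in>Q. \<bar>\<phi> p - \<phi> q\<bar> \<le> L * norm (p - q)"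
    using \<phi> unfolding bdd_lip_def by blast
  obtain L1 L2 where L: "\<forall>p\<in>K. \<forall>q\<in>K. \<bar>f1 p - f1 q\<bar> \<le> L1 * norm (p - q)"
    "\<forall>p\<in>K. \<forall>q\<in>K. \<bar>f2 p - f2 q\<bar> \<le> L2 * norm (p - q)"
    using f unfolding bdd_lip_def by blast
  have "\<bar>\<phi> (f1 p, f2 p) - \<phi> (f1 q, f2 q)\<bar> \<le> \<bar>L\<bar> * (L1 + L2) * norm (p - q)" if "p \<in> K" "q \<in> K" for p q
  proof -
    have "\<bar>\<phi> (f1 p, f2 p) - \<phi> (f1 q, f2 q)\<bar> \<le> L * norm ((f1 p, f2 p) - (f1 q, f2 q))"
      using * Q that by blast
    also have "\<dots> \<le> \<bar>L\<bar> * (\<bar>f1 p - f1 q\<bar> + \<bar>f2 p - f2 q\<bar>)"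
      using norm_Pair_le[of "f1 p - f1 q" "f2 p - f2 q"] by (intro mult_mono) auto
    also have "\<dots> \<le> \<bar>L\<bar> * (L1 * norm (p - q) + L2 * norm (p - q))"
      using L that by (intro mult_left_mono add_mono) auto
    finally show ?thesis by (simp add: algebra_simps)
  qed
  then show ?thesis using *(1) Q unfolding bdd_lip_def by blast
qed

lemma bdd_lip_bounded_linear:
  assumes f: "bounded_linear f" and K: "bounded K"
  shows "bdd_lip K (f :: 'a::real_normed_vector \<Rightarrow> real)"
proof -
  interpret bounded_linear f by (rule f)
  obtain C where C: "\<And>x. norm (f x) \<le> norm x * C" using bounded by blast
  obtain k where k: "\<And>p. p \<in> K \<Longrightarrow> norm p \<le> k" using K unfolding bounded_iff by blast
  have "\<bar>f p\<bar> \<le> k * \<bar>C\<bar>" if "p \<in> K" for p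
  proof -
    have "\<bar>f p\<bar> \<le> norm p * C" using C[of p] by simp
    also have "\<dots> \<le> norm p * \<bar>C\<bar>" by (intro mult_left_mono) auto
    also have "\<dots> \<le> k * \<bar>C\<bar>" using k[OF that] by (intro mult_right_mono) auto
    finally show ?thesis .
  qed
  moreover have "\<bar>f p - f q\<bar> \<le> C * norm (p - q)" for p q
    using C[of "p - q"] by (simp add: diff mult.commute)
  ultimately show ?thesis unfolding bdd_lip_def by blast
qed

lemma bdd_lip_vec:
  fixes f :: "'a::real_normed_vector \<Rightarrow> real ^ 'n"
  assumes "\<And>i. bdd_lip K (\<lambda>p. f p $ i)"
  shows "\<exists>L. \<forall>p\<in>K. \<forall>q\<in>K. norm (f p - f q) \<le> L * norm (p - q)"
proof -
  have "\<forall>i. \<exists>L. \<forall>p\<in>K. \<forall>q\<in>K. \<bar>f p $ i - f q $ i\<bar> \<le> L * norm (p - q)"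
    using assms unfolding bdd_lip_def by blast
  then obtain L where L: "\<And>i p q. p \<in> K \<Longrightarrow> q \<in> K \<Longrightarrow> \<bar>f p $ i - f q $ i\<bar> \<le> L i * norm (p - q)"
    by metis
  have "norm (f p - f q) \<le> (\<Sum>i\<in>UNIV. L i) * norm (p - q)" if "p \<in> K" "q \<in> K" for p q
  proof -
    have "norm (f p - f q) \<le> (\<Sum>i\<in>UNIV. \<bar>(f p - f q) $ i\<bar>)" by (rule norm_le_l1_cart)
    also have "\<dots> \<le> (\<Sum>i\<in>UNIV. L i * norm (p - q))" using L that by (intro sum_mono) simp
    finally show ?thesis by (simp add: sum_distrib_right)
  qed
  then show ?thesis by blast
qed

lemma simplex_compact_lower_bound:
  fixes K :: "((real ^ 'n) \<times> (real ^ 'n)) set"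
  assumes "compact K" "K \<subseteq> open_simplex \<times> UNIV"
  obtains a where "a > 0" "\<And>p i. p \<in> K \<Longrightarrow> a \<le> fst p $ i"
proof -
  have "\<exists>a>0. \<forall>p\<in>K. a \<le> fst p $ i" for i
  proof (cases "K = {}")
    case False
    have "continuous_on K (\<lambda>p. fst p $ i)" by (intro continuous_intros)
    from continuous_attains_inf[OF assms(1) False this]
    obtain q where q: "q \<in> K" "\<forall>p\<in>K. fst q $ i \<le> fst p $ i" by blast
    moreover have "0 < fst q $ i" using q(1) assms(2) by (auto simp: open_simplexD)
    ultimately show ?thesis by blast
  qed (auto intro: exI[of _ 1])
  then obtain a where a: "\<And>i. a i > 0" "\<And>p i. p \<in> K \<Longrightarrow> a i \<le> fst p $ i" by metis
  show thesis
  proof (rule that[of "Min (range a)"])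
    show "Min (range a) > 0" using a(1) by simp
    show "Min (range a) \<le> fst p $ i" if "p \<in> K" for p i
    proof -
      have "Min (range a) \<le> a i" by (rule Min_le) auto
      then show ?thesis using a(2)[OF that, of i] by (rule order_trans)
    qed
  qed
qed

locale graph_energy =
  fixes E :: "('n::finite \<times> 'n) set" and \<omega> :: "'n \<Rightarrow> 'n \<Rightarrow> real" and g :: "real \<Rightarrow> real \<Rightarrow> real"
  assumes graph: "weighted_graph E \<omega>" and weight: "admissible_weight g"
begin

lemma \<omega>_sym: "\<omega> i j = \<omega> j i" and \<omega>_nonneg: "0 \<le> \<omega> i j" and \<omega>_pos: "(i, j) \<in> E \<Longrightarrow> 0 < \<omega> i j"
  and \<omega>_zero: "(i, j) \<notin> E \<Longrightarrow> \<omega> i j = 0" and connected: "(i, j) \<in> E\<^sup>*"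
  using graph unfolding weighted_graph_def by (auto simp: less_imp_le) (metis less_imp_le order_refl)

lemma g_bounds: "0 \<le> a \<Longrightarrow> 0 \<le> b \<Longrightarrow> min a b \<le> g a b \<and> g a b \<le> max a b"
  and g_nonneg: "0 \<le> a \<Longrightarrow> 0 \<le> b \<Longrightarrow> 0 \<le> g a b"
  using weight unfolding admissible_weight_def by blast+

lemma sum_neighbours: "(\<Sum>j\<in>neighbours E i. \<omega> i j * f j) = (\<Sum>j\<in>UNIV. \<omega> i j * f j)"
  by (rule sum.mono_neutral_left) (auto simp: neighbours_def \<omega>_zero)

lemma g_C2: "C_k_on 2 ({0<..} \<times> {0<..}) (\<lambda>(t, r). g t r)"
  using weight unfolding admissible_weight_def smooth_on_def by blast

definition g1 :: "real \<Rightarrow> real \<Rightarrow> real" where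
  "g1 a b = frechet_derivative (\<lambda>(t, r). g t r) (at (a, b)) (1, 0)"

definition g2 :: "real \<Rightarrow> real \<Rightarrow> real" where
  "g2 a b = frechet_derivative (\<lambda>(t, r). g t r) (at (a, b)) (0, 1)"

lemma g_C1: "C_k_on 1 ({0<..} \<times> {0<..}) (\<lambda>p. g (fst p) (snd p))"
  and g1_C1: "C_k_on 1 ({0<..} \<times> {0<..}) (\<lambda>p. g1 (fst p) (snd p))"
  and g2_C1: "C_k_on 1 ({0<..} \<times> {0<..}) (\<lambda>p. g2 (fst p) (snd p))"
proof -
  have C1: "C_k_on 1 ({0<..} \<times> {0<..}) (\<lambda>x. frechet_derivative (\<lambda>(t, r). g t r) (at x) v)" for v
    using g_C2 unfolding numeral_2_eq_2 One_nat_def C_k_on.simps by blast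
  show "C_k_on 1 ({0<..} \<times> {0<..}) (\<lambda>p. g1 (fst p) (snd p))"
    using C1[of "(1, 0)"] by (simp add: g1_def)
  show "C_k_on 1 ({0<..} \<times> {0<..}) (\<lambda>p. g2 (fst p) (snd p))"
    using C1[of "(0, 1)"] by (simp add: g2_def)
  have d: "(\<lambda>(t, r). g t r) differentiable (at x)" if "x \<in> {0<..} \<times> {0<..}" for x
    using g_C2 that unfolding numeral_2_eq_2 C_k_on.simps by blast
  have "continuous_on ({0<..} \<times> {0<..}) (\<lambda>x. frechet_derivative (\<lambda>(t, r). g t r) (at x) v)" for v
    using C1[of v] unfolding One_nat_def C_k_on.simps
    by (intro continuous_at_imp_continuous_on ballI differentiable_imp_continuous_within) blast
  then show "C_k_on 1 ({0<..} \<times> {0<..}) (\<lambda>p. g (fst p) (snd p))"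
    using d unfolding One_nat_def C_k_on.simps case_prod_beta' by blast
qed

lemma g_has_derivative:
  assumes "0 < a" "0 < b"
  shows "((\<lambda>p. g (fst p) (snd p)) has_derivative (\<lambda>v. fst v * g1 a b + snd v * g2 a b)) (at (a, b))"
proof -
  have "(\<lambda>(t, r). g t r) differentiable (at (a, b))"
    using g_C2 assms unfolding numeral_2_eq_2 C_k_on.simps by blast
  then have d: "((\<lambda>(t, r). g t r) has_derivative frechet_derivative (\<lambda>(t, r). g t r) (at (a, b))) (at (a, b))"
    using frechet_derivative_works by blast
  have "frechet_derivative (\<lambda>(t, r). g t r) (at (a, b)) v = fst v * g1 a b + snd v * g2 a b" for v
    unfolding g1_def g2_def by (rule linear_prod_eq[OF has_derivative_linear[OF d]])
  then have "frechet_derivative (\<lambda>(t, r). g t r) (at (a, b)) = (\<lambda>v. fst v * g1 a b + snd v * g2 a b)"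
    by (rule ext)
  then show ?thesis using d by (simp add: case_prod_beta')
qed

definition \<theta>1 :: "real \<Rightarrow> real \<Rightarrow> real" where
  "\<theta>1 a b = (a - b) * (1 / a) + (ln a - ln b)"

definition Hx :: "real ^ 'n \<Rightarrow> real ^ 'n \<Rightarrow> real ^ 'n" where
  "Hx \<rho> x = (\<chi> i. 2 * (\<Sum>j\<in>UNIV. \<omega> i j * ((x $ i - x $ j) * g (\<rho> $ i) (\<rho> $ j))))"

definition Hr :: "real ^ 'n \<Rightarrow> real ^ 'n \<Rightarrow> real ^ 'n" where
  "Hr \<rho> x = (\<chi> i. (\<Sum>j\<in>UNIV. 1 / 2 * (\<omega> i j * (x $ i - x $ j)\<^sup>2 * (g1 (\<rho> $ i) (\<rho> $ j) + g2 (\<rho> $ j) (\<rho> $ i)))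
      + 1 / 8 * (\<omega> i j * \<theta>1 (\<rho> $ i) (\<rho> $ j))) - ln (\<rho> $ i))"

abbreviation "H0 \<equiv> energy E \<omega> g"

lemma kinetic_eq:
  "kinetic E \<omega> g \<rho> x = 1 / 2 * (\<Sum>i\<in>UNIV. \<Sum>j\<in>UNIV. \<omega> i j * ((x $ i - x $ j)\<^sup>2 * g (\<rho> $ i) (\<rho> $ j)))"
  by (simp add: kinetic_def mult.assoc sum_neighbours)

lemma fisher_eq:
  assumes "\<And>i. 0 < \<rho> $ i"
  shows "fisher E \<omega> \<rho> = 1 / 2 * (\<Sum>i\<in>UNIV. \<Sum>j\<in>UNIV. \<omega> i j * ((ln (\<rho> $ i) - ln (\<rho> $ j)) * (\<rho> $ i - \<rho> $ j)))"
proof -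
  have "\<bar>ln (\<rho> $ i) - ln (\<rho> $ j)\<bar>\<^sup>2 * log_mean (\<rho> $ i) (\<rho> $ j) = (ln (\<rho> $ i) - ln (\<rho> $ j)) * (\<rho> $ i - \<rho> $ j)" for i j
    using assms[of i] assms[of j] by (simp add: log_mean_def power2_eq_square)
  then show ?thesis by (simp add: fisher_def mult.assoc sum_neighbours)
qed

lemma sum_swap_inner:
  "(\<Sum>i\<in>UNIV. \<Sum>j\<in>UNIV. A i j * v $ i + B i j * v $ j) = (\<chi> i. \<Sum>j\<in>UNIV. A i j + B j i) \<bullet> v"
  for A B :: "'n \<Rightarrow> 'n \<Rightarrow> real" and v :: "real ^ 'n"
proof -
  have "(\<Sum>i\<in>UNIV. \<Sum>j\<in>UNIV. B i j * v $ j) = (\<Sum>i\<in>UNIV. \<Sum>j\<in>UNIV. B j i * v $ i)"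
    by (rule sum.swap)
  then show ?thesis
    by (simp add: inner_vec_def sum.distrib sum_distrib_right distrib_right)
qed

lemma g_sym: "0 \<le> a \<Longrightarrow> 0 \<le> b \<Longrightarrow> g a b = g b a"
  using weight unfolding admissible_weight_def by blast

lemma vec_nth_has_derivative: "((\<lambda>r :: real ^ 'n. r $ i) has_derivative (\<lambda>v. v $ i)) F"
  by (rule bounded_linear.has_derivative[OF bounded_linear_vec_nth has_derivative_ident])

lemma GDERIV_x:
  assumes \<rho>: "\<And>i. 0 < \<rho> $ i"
  shows "GDERIV (\<lambda>y. H0 \<rho> y) x :> Hx \<rho> x"
proof -
  have d: "((\<lambda>y :: real ^ 'n. (y $ i - y $ j)\<^sup>2) has_derivative (\<lambda>v. 2 * (x $ i - x $ j) * (v $ i - v $ j))) (at x)" for i j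
    by (auto intro!: derivative_eq_intros vec_nth_has_derivative simp: fun_eq_iff algebra_simps)
  have "((\<lambda>y. kinetic E \<omega> g \<rho> y + (1 / 8 * fisher E \<omega> \<rho> - entropy \<rho>)) has_derivative
     (\<lambda>v. 1 / 2 * (\<Sum>i\<in>UNIV. \<Sum>j\<in>UNIV. \<omega> i j * ((2 * (x $ i - x $ j) * (v $ i - v $ j)) * g (\<rho> $ i) (\<rho> $ j))) + 0)) (at x)"
    unfolding kinetic_eq
    by (intro has_derivative_add has_derivative_const has_derivative_mult_right has_derivative_sum
        has_derivative_mult_left d)
  moreover have "1 / 2 * (\<Sum>i\<in>UNIV. \<Sum>j\<in>UNIV. \<omega> i j * ((2 * (x $ i - x $ j) * (v $ i - v $ j)) * g (\<rho> $ i) (\<rho> $ j))) + 0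
     = v \<bullet> Hx \<rho> x" for v
  proof -
    let ?A = "\<lambda>i j. \<omega> i j * ((x $ i - x $ j) * g (\<rho> $ i) (\<rho> $ j))"
    have "1 / 2 * (\<Sum>i\<in>UNIV. \<Sum>j\<in>UNIV. \<omega> i j * ((2 * (x $ i - x $ j) * (v $ i - v $ j)) * g (\<rho> $ i) (\<rho> $ j))) + 0
      = (\<Sum>i\<in>UNIV. \<Sum>j\<in>UNIV. ?A i j * v $ i + - ?A i j * v $ j)"
      unfolding sum_distrib_left add_0_right by (intro sum.cong refl) (simp add: algebra_simps)
    also have "\<dots> = (\<chi> i. \<Sum>j\<in>UNIV. ?A i j + - ?A j i) \<bullet> v" by (rule sum_swap_inner)
    also have "(\<chi> i. \<Sum>j\<in>UNIV. ?A i j + - ?A j i) = Hx \<rho> x"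
    proof -
      have "?A i j + - ?A j i = 2 * ?A i j" for i j
        using g_sym[of "\<rho> $ i" "\<rho> $ j"] \<rho> \<omega>_sym[of i j] by (simp add: less_imp_le algebra_simps)
      then show ?thesis by (simp add: Hx_def sum_distrib_left)
    qed
    finally show ?thesis by (simp add: inner_commute)
  qed
  ultimately show ?thesis by (simp add: gderiv_def energy_def[abs_def] algebra_simps)
qed

lemma Hx_sum:
  assumes "\<And>i. 0 < \<rho> $ i"
  shows "(\<Sum>i\<in>UNIV. Hx \<rho> x $ i) = 0"
proof -
  let ?A = "\<lambda>i j. \<omega> i j * ((x $ i - x $ j) * g (\<rho> $ i) (\<rho> $ j))"
  have "(\<Sum>i\<in>UNIV. \<Sum>j\<in>UNIV. ?A i j) = (\<Sum>i\<in>UNIV. \<Sum>j\<in>UNIV. ?A j i)" by (rule sum.swap)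
  also have "\<dots> = (\<Sum>i\<in>UNIV. \<Sum>j\<in>UNIV. - ?A i j)"
    using g_sym assms \<omega>_sym by (intro sum.cong refl) (simp add: less_imp_le algebra_simps)
  finally have "(\<Sum>i\<in>UNIV. \<Sum>j\<in>UNIV. ?A i j) = 0" by (simp add: sum_negf)
  then show ?thesis by (simp add: Hx_def sum_distrib_left[symmetric])
qed

lemma energy_eq:
  assumes "\<And>i. 0 < \<rho> $ i"
  shows "H0 \<rho> x = (\<Sum>i\<in>UNIV. \<Sum>j\<in>UNIV. 1 / 2 * (\<omega> i j * ((x $ i - x $ j)\<^sup>2 * g (\<rho> $ i) (\<rho> $ j)))
      + 1 / 16 * (\<omega> i j * ((ln (\<rho> $ i) - ln (\<rho> $ j)) * (\<rho> $ i - \<rho> $ j))))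
      - (\<Sum>i\<in>UNIV. \<rho> $ i * ln (\<rho> $ i) - \<rho> $ i)"
  unfolding energy_def kinetic_eq fisher_eq[OF assms] entropy_def
  by (simp add: sum.distrib sum_distrib_left)

lemma GDERIV_r:
  assumes \<rho>: "\<And>i. 0 < \<rho> $ i"
  shows "GDERIV (\<lambda>r. H0 r x) \<rho> :> Hr \<rho> x"
proof -
  let ?EE = "\<lambda>\<rho> :: real ^ 'n. (\<Sum>i\<in>UNIV. \<Sum>j\<in>UNIV. 1 / 2 * (\<omega> i j * ((x $ i - x $ j)\<^sup>2 * g (\<rho> $ i) (\<rho> $ j)))
      + 1 / 16 * (\<omega> i j * ((ln (\<rho> $ i) - ln (\<rho> $ j)) * (\<rho> $ i - \<rho> $ j))))
      - (\<Sum>i\<in>UNIV. \<rho> $ i * ln (\<rho> $ i) - \<rho> $ i)"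
  have dg: "((\<lambda>r. g (r $ i) (r $ j)) has_derivative (\<lambda>v. v $ i * g1 (\<rho> $ i) (\<rho> $ j) + v $ j * g2 (\<rho> $ i) (\<rho> $ j))) (at \<rho>)" for i j
    using has_derivative_compose[OF has_derivative_Pair[OF vec_nth_has_derivative[of i] vec_nth_has_derivative[of j]]
      g_has_derivative[OF \<rho> \<rho>]] by simp
  have dl: "((\<lambda>r. ln (r $ i)) has_derivative (\<lambda>v. v $ i / \<rho> $ i)) (at \<rho>)" for i
    using \<rho>[of i] by (auto intro!: derivative_eq_intros vec_nth_has_derivative simp: divide_inverse)
  have dt: "((\<lambda>r. (ln (r $ i) - ln (r $ j)) * (r $ i - r $ j)) has_derivative
      (\<lambda>v. (ln (\<rho> $ i) - ln (\<rho> $ j)) * (v $ i - v $ j) + (v $ i / \<rho> $ i - v $ j / \<rho> $ j) * (\<rho> $ i - \<rho> $ j))) (at \<rho>)" for i j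
    by (intro has_derivative_mult has_derivative_diff dl vec_nth_has_derivative)
  have de: "((\<lambda>r. r $ i * ln (r $ i) - r $ i) has_derivative (\<lambda>v. v $ i * ln (\<rho> $ i))) (at \<rho>)" for i
    by (rule has_derivative_eq_rhs[OF has_derivative_diff[OF has_derivative_mult[OF vec_nth_has_derivative dl]
          vec_nth_has_derivative]]) (use \<rho>[of i] in \<open>auto simp: fun_eq_iff\<close>)
  let ?D = "\<lambda>v. (\<Sum>i\<in>UNIV. \<Sum>j\<in>UNIV. 1 / 2 * (\<omega> i j * ((x $ i - x $ j)\<^sup>2 * (v $ i * g1 (\<rho> $ i) (\<rho> $ j) + v $ j * g2 (\<rho> $ i) (\<rho> $ j))))
      + 1 / 16 * (\<omega> i j * ((ln (\<rho> $ i) - ln (\<rho> $ j)) * (v $ i - v $ j) + (v $ i / \<rho> $ i - v $ j / \<rho> $ j) * (\<rho> $ i - \<rho> $ j))))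
      - (\<Sum>i\<in>UNIV. v $ i * ln (\<rho> $ i))"
  have "(?EE has_derivative ?D) (at \<rho>)"
    by (intro has_derivative_add has_derivative_mult_right has_derivative_sum has_derivative_diff dg dt de)
  moreover have "?D v = v \<bullet> Hr \<rho> x" for v
  proof -
    let ?A = "\<lambda>i j. 1 / 2 * (\<omega> i j * (x $ i - x $ j)\<^sup>2 * g1 (\<rho> $ i) (\<rho> $ j)) + 1 / 16 * (\<omega> i j * \<theta>1 (\<rho> $ i) (\<rho> $ j))"
    let ?B = "\<lambda>i j. 1 / 2 * (\<omega> i j * (x $ i - x $ j)\<^sup>2 * g2 (\<rho> $ i) (\<rho> $ j)) + 1 / 16 * (\<omega> i j * \<theta>1 (\<rho> $ j) (\<rho> $ i))"
    have "1 / 2 * (\<omega> i j * ((x $ i - x $ j)\<^sup>2 * (v $ i * g1 (\<rho> $ i) (\<rho> $ j) + v $ j * g2 (\<rho> $ i) (\<rho> $ j))))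
      + 1 / 16 * (\<omega> i j * ((ln (\<rho> $ i) - ln (\<rho> $ j)) * (v $ i - v $ j) + (v $ i / \<rho> $ i - v $ j / \<rho> $ j) * (\<rho> $ i - \<rho> $ j)))
      = ?A i j * v $ i + ?B i j * v $ j" for i j
    proof -
      have "(ln (\<rho> $ i) - ln (\<rho> $ j)) * (v $ i - v $ j) + (v $ i / \<rho> $ i - v $ j / \<rho> $ j) * (\<rho> $ i - \<rho> $ j)
         = \<theta>1 (\<rho> $ i) (\<rho> $ j) * v $ i + \<theta>1 (\<rho> $ j) (\<rho> $ i) * v $ j"
        unfolding \<theta>1_def divide_inverse by algebra
      then show ?thesis by (simp add: algebra_simps)
    qed
    then have "?D v = (\<chi> i. \<Sum>j\<in>UNIV. ?A i j + ?B j i) \<bullet> v - (\<Sum>i\<in>UNIV. v $ i * ln (\<rho> $ i))"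
      by (simp only: sum_swap_inner)
    also have "(\<chi> i. \<Sum>j\<in>UNIV. ?A i j + ?B j i) = (\<chi> i. Hr \<rho> x $ i + ln (\<rho> $ i))"
    proof -
      have "?A i j + ?B j i = 1 / 2 * (\<omega> i j * (x $ i - x $ j)\<^sup>2 * (g1 (\<rho> $ i) (\<rho> $ j) + g2 (\<rho> $ j) (\<rho> $ i)))
          + 1 / 8 * (\<omega> i j * \<theta>1 (\<rho> $ i) (\<rho> $ j))" for i j
        unfolding \<omega>_sym[of j i] power2_commute[of "x $ j" "x $ i"] by (simp add: algebra_simps)
      then show ?thesis by (simp only: Hr_def vec_lambda_beta diff_add_cancel)
    qed
    also have "\<dots> \<bullet> v - (\<Sum>i\<in>UNIV. v $ i * ln (\<rho> $ i)) = v \<bullet> Hr \<rho> x"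
      by (simp add: inner_vec_def distrib_left distrib_right sum.distrib mult.commute)
    finally show ?thesis .
  qed
  ultimately have "(?EE has_derivative (\<lambda>v. v \<bullet> Hr \<rho> x)) (at \<rho>)" by simp
  then have "((\<lambda>r. H0 r x) has_derivative (\<lambda>v. v \<bullet> Hr \<rho> x)) (at \<rho>)"
    by (rule has_derivative_transform_within_open[OF _ open_pos_orthant])
       (use \<rho> in \<open>auto simp: energy_eq\<close>)
  then show ?thesis by (simp add: gderiv_def)
qed

lemma linear_Hx: "linear (Hx \<rho>)"
  by (rule linearI)
     (auto simp: Hx_def vec_eq_iff sum_distrib_left sum.distrib[symmetric] algebra_simps intro!: sum.cong)

lemma Hx_has_derivative: "(Hx \<rho> has_derivative (\<lambda>v. matrix (Hx \<rho>) *v v)) (at x)"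
proof -
  have "(\<lambda>v. matrix (Hx \<rho>) *v v) = Hx \<rho>"
    using matrix_works[OF linear_Hx[of \<rho>, folded linear_matrix_vector_mul_eq]] by (simp add: fun_eq_iff)
  then show ?thesis
    using linear_imp_has_derivative[OF linear_Hx] by simp
qed

end

section \<open>Sublevel sets of the energy\<close>

lemma space_test_add:
  assumes "space_test \<phi> \<phi>\<rho> \<phi>x \<phi>xx" "space_test \<psi> \<psi>\<rho> \<psi>x \<psi>xx"
  shows "space_test (\<lambda>\<rho> x. \<phi> \<rho> x + \<psi> \<rho> x) (\<lambda>\<rho> x. \<phi>\<rho> \<rho> x + \<psi>\<rho> \<rho> x) (\<lambda>\<rho> x. \<phi>x \<rho> x + \<psi>x \<rho> x)
     (\<lambda>\<rho> x. \<phi>xx \<rho> x + \<psi>xx \<rho> x)"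
proof -
  have d: "((\<lambda>y. f y + g y) has_derivative (\<lambda>v. (A + B) *v v)) (at x)"
    if "(f has_derivative (\<lambda>v. A *v v)) (at x)" "(g has_derivative (\<lambda>v. B *v v)) (at x)"
    for f g :: "real ^ 'a \<Rightarrow> real ^ 'a" and A B x
    using has_derivative_add[OF that] by (simp add: matrix_vector_mult_add_rdistrib)
  show ?thesis
    using assms unfolding space_test_def Let_def case_prod_beta
    by (auto intro!: continuous_on_add has_simplex_derivative_add GDERIV_add d)
qed

definition root1 :: "real ^ 'n \<Rightarrow> real" where
  "root1 x = sqrt (1 + x \<bullet> x)"

lemma root1_ge: "1 \<le> root1 x" "norm x \<le> root1 x"
proof -
  show "1 \<le> root1 x" by (simp add: root1_def)
  show "norm x \<le> root1 x" unfolding root1_def norm_eq_sqrt_inner by (rule real_sqrt_le_mono) simp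
qed

lemma root1_pos: "0 < root1 x"
  using root1_ge(1)[of x] by linarith

lemma continuous_on_root1: "continuous_on A f \<Longrightarrow> continuous_on A (\<lambda>p. root1 (f p))"
  unfolding root1_def by (intro continuous_intros)

lemma root1_has_derivative: "(root1 has_derivative (\<lambda>v. (x \<bullet> v) / root1 x)) (at x)"
proof -
  have "1 + x \<bullet> x > 0" by (simp add: add_pos_nonneg)
  then show ?thesis
    unfolding root1_def[abs_def]
    by (auto intro!: derivative_eq_intros simp: fun_eq_iff inner_commute field_simps)
qed

definition root1_hess :: "real ^ 'n \<Rightarrow> real ^ 'n ^ 'n" where
  "root1_hess x = (\<chi> i j. (if i = j then 1 / root1 x else 0) - x $ i * x $ j / (root1 x) ^ 3)"

lemma root1_hess_mult: "root1_hess x *v v = (1 / root1 x) *\<^sub>R v - ((x \<bullet> v) / (root1 x) ^ 3) *\<^sub>R x"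
proof -
  have "(\<Sum>j\<in>UNIV. x $ i * x $ j / (root1 x) ^ 3 * v $ j) = (x \<bullet> v) / (root1 x) ^ 3 * x $ i" for i
    by (simp add: inner_vec_def sum_distrib_left sum_divide_distrib mult_ac)
  then show ?thesis
    by (simp add: vec_eq_iff matrix_vector_mult_def root1_hess_def left_diff_distrib sum_subtractf
        if_distrib[of "\<lambda>c. c * _"] cong: if_cong)
qed

lemma root1_hess_diag_le: "root1_hess x $ i $ i \<le> 1"
proof -
  have "1 / root1 x \<le> 1" using root1_ge(1)[of x] by simp
  moreover have "0 \<le> x $ i * x $ i / (root1 x) ^ 3" using root1_pos[of x] by simp
  ultimately show ?thesis by (simp add: root1_hess_def)
qed

lemma space_test_root1:
  "space_test (\<lambda>\<rho> x. c * root1 x) (\<lambda>\<rho> x. 0) (\<lambda>\<rho> x. (c / root1 x) *\<^sub>R x) (\<lambda>\<rho> x. c *\<^sub>R root1_hess x)"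
proof -
  have nz: "root1 x \<noteq> 0" for x :: "real ^ 'a" using root1_pos[of x] by simp
  have g: "GDERIV (\<lambda>x. c * root1 x) x :> (c / root1 x) *\<^sub>R x" for x :: "real ^ 'a"
    unfolding gderiv_def
    by (rule has_derivative_eq_rhs[OF has_derivative_mult_right[OF root1_has_derivative]])
       (simp add: fun_eq_iff inner_commute)
  have d: "((\<lambda>y. (c / root1 y) *\<^sub>R y) has_derivative (\<lambda>v. (c *\<^sub>R root1_hess x) *v v)) (at x)" for x :: "real ^ 'a"
  proof -
    have i: "((\<lambda>y. c * inverse (root1 y)) has_derivative
        (\<lambda>v. c * - (inverse (root1 x) * ((x \<bullet> v) / root1 x) * inverse (root1 x)))) (at x)"
      by (intro has_derivative_mult_right Deriv.has_derivative_inverse nz root1_has_derivative)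
    have "((\<lambda>y. (c * inverse (root1 y)) *\<^sub>R y) has_derivative
        (\<lambda>v. (c * inverse (root1 x)) *\<^sub>R v + (c * - (inverse (root1 x) * ((x \<bullet> v) / root1 x) * inverse (root1 x))) *\<^sub>R x)) (at x)"
      by (rule has_derivative_scaleR[OF i has_derivative_ident])
    moreover have "(c * inverse (root1 x)) *\<^sub>R v + (c * - (inverse (root1 x) * ((x \<bullet> v) / root1 x) * inverse (root1 x))) *\<^sub>R x
       = (c *\<^sub>R root1_hess x) *v v" for v
      unfolding scaleR_matrix_vector_assoc[symmetric] root1_hess_mult
      by (simp add: scaleR_diff_right divide_inverse power3_eq_cube mult_ac)
    ultimately show ?thesis by (simp add: divide_inverse)
  qed
  have z: "has_simplex_derivative (\<lambda>r. c * root1 x) 0 \<rho>" for \<rho> x :: "real ^ 'a"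
    by (simp add: has_simplex_derivative_def)
  have ch: "continuous_on D (\<lambda>p. root1_hess (snd p))" for D :: "((real ^ 'a) \<times> (real ^ 'a)) set"
  proof -
    have "continuous_on D (\<lambda>p. (if i = j then 1 / root1 (snd p) else 0) - snd p $ i * snd p $ j / (root1 (snd p)) ^ 3)"
      for i j
      by (cases "i = j") (auto intro!: continuous_intros continuous_on_root1 simp: nz)
    then show ?thesis unfolding root1_hess_def by (intro continuous_on_vec_lambda)
  qed
  show ?thesis
    unfolding space_test_def Let_def case_prod_beta
    by (intro conjI ballI allI g d z ch continuous_intros continuous_on_root1) (simp add: nz)
qed

context graph_energy
begin

lemma double_sum_member:
  fixes f :: "'n \<Rightarrow> 'n \<Rightarrow> real"
  assumes "\<And>i j. 0 \<le> f i j"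
  shows "f i j \<le> (\<Sum>i\<in>UNIV. \<Sum>j\<in>UNIV. f i j)"
proof -
  have "f i j \<le> (\<Sum>j\<in>UNIV. f i j)" by (rule member_le_sum) (auto simp: assms)
  also have "\<dots> \<le> (\<Sum>i\<in>UNIV. \<Sum>j\<in>UNIV. f i j)"
    by (rule member_le_sum) (auto intro: sum_nonneg assms)
  finally show ?thesis .
qed

lemma ln_diff_mult_nonneg:
  fixes a b :: real
  assumes "0 < a" "0 < b"
  shows "0 \<le> (ln a - ln b) * (a - b)"
  using assms by (cases "a \<le> b") (auto intro: mult_nonpos_nonpos mult_nonneg_nonneg)

context
  fixes \<rho> :: "real ^ 'n"
  assumes \<rho>: "\<rho> \<in> open_simplex"
begin

lemma \<rho>_pos: "0 < \<rho> $ i" by (rule open_simplexD[OF \<rho>])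

lemma \<rho>_le_1: "\<rho> $ i \<le> 1"
  by (rule simplex_le_1) (use \<rho>_pos open_simplexD(2)[OF \<rho>] in \<open>auto intro: less_imp_le\<close>)

lemma g_\<rho>: "0 \<le> g (\<rho> $ i) (\<rho> $ j)" "g (\<rho> $ i) (\<rho> $ j) \<le> 1" "min (\<rho> $ i) (\<rho> $ j) \<le> g (\<rho> $ i) (\<rho> $ j)"
  using g_bounds[of "\<rho> $ i" "\<rho> $ j"] g_nonneg[of "\<rho> $ i" "\<rho> $ j"]
    less_imp_le[OF \<rho>_pos[of i]] less_imp_le[OF \<rho>_pos[of j]] \<rho>_le_1[of i] \<rho>_le_1[of j]
  by auto

lemma kinetic_edge: "\<omega> i j * ((x $ i - x $ j)\<^sup>2 * g (\<rho> $ i) (\<rho> $ j)) \<le> 2 * kinetic E \<omega> g \<rho> x"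
  using double_sum_member[of "\<lambda>i j. \<omega> i j * ((x $ i - x $ j)\<^sup>2 * g (\<rho> $ i) (\<rho> $ j))" i j]
  by (simp add: kinetic_eq \<omega>_nonneg g_\<rho>)

lemma fisher_edge: "\<omega> i j * ((ln (\<rho> $ i) - ln (\<rho> $ j)) * (\<rho> $ i - \<rho> $ j)) \<le> 2 * fisher E \<omega> \<rho>"
  using double_sum_member[of "\<lambda>i j. \<omega> i j * ((ln (\<rho> $ i) - ln (\<rho> $ j)) * (\<rho> $ i - \<rho> $ j))" i j]
  by (simp add: fisher_eq[OF \<rho>_pos] \<omega>_nonneg \<rho>_pos ln_diff_mult_nonneg)

lemma kinetic_nonneg: "0 \<le> kinetic E \<omega> g \<rho> x"
  unfolding kinetic_eq by (intro mult_nonneg_nonneg sum_nonneg) (auto simp: \<omega>_nonneg g_\<rho>)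

lemma fisher_nonneg: "0 \<le> fisher E \<omega> \<rho>"
  by (simp add: fisher_eq[OF \<rho>_pos] sum_nonneg mult_nonneg_nonneg[OF \<omega>_nonneg] ln_diff_mult_nonneg \<rho>_pos)

lemma entropy_nonpos: "entropy \<rho> \<le> 0"
  unfolding entropy_def
proof (rule sum_nonpos)
  fix i
  have "\<rho> $ i * ln (\<rho> $ i) \<le> 0"
    using \<rho>_pos[of i] \<rho>_le_1[of i] by (intro mult_nonneg_nonpos) auto
  then show "\<rho> $ i * ln (\<rho> $ i) - \<rho> $ i \<le> 0" using \<rho>_pos[of i] by linarith
qed

lemma kinetic_le: "kinetic E \<omega> g \<rho> x \<le> H0 \<rho> x"
  using fisher_nonneg entropy_nonpos unfolding energy_def by linarith

lemma fisher_le: "fisher E \<omega> \<rho> \<le> 8 * H0 \<rho> x"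
  using kinetic_nonneg[of x] entropy_nonpos unfolding energy_def by (simp add: algebra_simps)

lemma H0_nonneg: "0 \<le> H0 \<rho> x"
  using kinetic_nonneg[of x] kinetic_le[of x] by linarith

end

lemma sublevel_step:
  assumes e: "(i, j) \<in> E" and a: "0 < a"
  shows "\<exists>a'>0. \<forall>\<rho>\<in>open_simplex. fisher E \<omega> \<rho> \<le> R \<longrightarrow> a \<le> \<rho> $ i \<longrightarrow> a' \<le> \<rho> $ j"
proof (intro exI conjI ballI impI)
  define c where "c = 4 * R / (\<omega> i j * a)"
  have w: "\<omega> i j > 0" by (rule \<omega>_pos[OF e])
  show "0 < min (a / 2) (a * exp (- c))" using a by simp
  fix \<rho> assume \<rho>: "\<rho> \<in> open_simplex" and R: "fisher E \<omega> \<rho> \<le> R" and ai: "a \<le> \<rho> $ i"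
  note pos = \<rho>_pos[OF \<rho>]
  show "min (a / 2) (a * exp (- c)) \<le> \<rho> $ j"
  proof (cases "a / 2 \<le> \<rho> $ j")
    case False
    then have d: "a / 2 \<le> \<rho> $ i - \<rho> $ j" using ai by simp
    have ln0: "0 \<le> ln (\<rho> $ i) - ln (\<rho> $ j)" using d a pos by simp
    have "(ln (\<rho> $ i) - ln (\<rho> $ j)) * (a / 2) \<le> (ln (\<rho> $ i) - ln (\<rho> $ j)) * (\<rho> $ i - \<rho> $ j)"
      using d ln0 by (intro mult_left_mono)
    then have "\<omega> i j * ((ln (\<rho> $ i) - ln (\<rho> $ j)) * (a / 2)) \<le> \<omega> i j * ((ln (\<rho> $ i) - ln (\<rho> $ j)) * (\<rho> $ i - \<rho> $ j))"
      by (rule mult_left_mono) (use w in simp)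
    also have "\<dots> \<le> 2 * R" using fisher_edge[OF \<rho>, of i j] R by linarith
    finally have "(ln (\<rho> $ i) - ln (\<rho> $ j)) * (\<omega> i j * a) \<le> 4 * R" by (simp add: mult_ac)
    then have "ln (\<rho> $ i) - ln (\<rho> $ j) \<le> c" using w a unfolding c_def by (subst pos_le_divide_eq) auto
    moreover have "ln a \<le> ln (\<rho> $ i)" using a ai pos by simp
    ultimately have "ln a - c \<le> ln (\<rho> $ j)" by linarith
    then have "exp (ln a - c) \<le> exp (ln (\<rho> $ j))" by simp
    moreover have "exp (ln a - c) = a * exp (- c)" using a by (simp only: exp_diff exp_minus exp_ln divide_inverse)
    moreover have "exp (ln (\<rho> $ j)) = \<rho> $ j" using pos by (rule exp_ln)
    ultimately show ?thesis by linarith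
  qed simp
qed

lemma sublevel_path:
  assumes "(i, j) \<in> E\<^sup>*"
  shows "\<forall>a>0. \<exists>a'>0. \<forall>\<rho>\<in>open_simplex. fisher E \<omega> \<rho> \<le> R \<longrightarrow> a \<le> \<rho> $ i \<longrightarrow> a' \<le> \<rho> $ j"
  using assms
proof (induction rule: rtrancl_induct)
  case base
  then show ?case by blast
next
  case (step j k)
  show ?case
  proof (intro allI impI)
    fix a :: real assume "a > 0"
    then obtain a1 where a1: "a1 > 0"
      "\<forall>\<rho>\<in>open_simplex. fisher E \<omega> \<rho> \<le> R \<longrightarrow> a \<le> \<rho> $ i \<longrightarrow> a1 \<le> \<rho> $ j" using step.IH by blast
    obtain a2 where "a2 > 0"
      "\<forall>\<rho>\<in>open_simplex. fisher E \<omega> \<rho> \<le> R \<longrightarrow> a1 \<le> \<rho> $ j \<longrightarrow> a2 \<le> \<rho> $ k"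
      using sublevel_step[OF step.hyps(2) a1(1), of R] by blast
    then show "\<exists>a'>0. \<forall>\<rho>\<in>open_simplex. fisher E \<omega> \<rho> \<le> R \<longrightarrow> a \<le> \<rho> $ i \<longrightarrow> a' \<le> \<rho> $ k"
      using a1(2) by blast
  qed
qed

text \<open>The Fisher information of connected neighbours controls the ratio of their masses, and some
  vertex carries mass at least \<open>1 / n\<close>.\<close>

lemma sublevel_lower_bound:
  "\<exists>r>0. \<forall>\<rho>\<in>open_simplex. \<forall>x. H0 \<rho> x \<le> R \<longrightarrow> (\<forall>i. r \<le> \<rho> $ i)"
proof -
  let ?n = "1 / real CARD('n)"
  have "\<exists>a>0. \<forall>\<rho>\<in>open_simplex. fisher E \<omega> \<rho> \<le> 8 * R \<longrightarrow> ?n \<le> \<rho> $ i \<longrightarrow> a \<le> \<rho> $ j" for i j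
    using sublevel_path[OF connected[of i j], rule_format, of ?n] by simp
  then obtain a where a: "\<And>i j. a i j > 0"
    "\<And>i j \<rho>. \<rho> \<in> open_simplex \<Longrightarrow> fisher E \<omega> \<rho> \<le> 8 * R \<Longrightarrow> ?n \<le> \<rho> $ i \<Longrightarrow> a i j \<le> \<rho> $ j" by metis
  let ?A = "(\<lambda>(i, j). a i j) ` UNIV"
  show ?thesis
  proof (intro exI[of _ "Min ?A"] conjI ballI allI impI)
    show "0 < Min ?A" using a(1) by auto
    fix \<rho> x j assume \<rho>: "\<rho> \<in> open_simplex" and H: "H0 \<rho> x \<le> R"
    have "\<exists>i. ?n \<le> \<rho> $ i"
    proof (rule ccontr)
      assume "\<not> ?thesis"
      then have "(\<Sum>i\<in>UNIV. \<rho> $ i) < (\<Sum>i\<in>(UNIV :: 'n set). ?n)" by (intro sum_strict_mono) (auto simp: not_le)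
      then show False using open_simplexD(2)[OF \<rho>] by simp
    qed
    then obtain i where "?n \<le> \<rho> $ i" by blast
    then have "a i j \<le> \<rho> $ j" using fisher_le[OF \<rho>, of x] H by (intro a(2)[OF \<rho>]) auto
    moreover have "Min ?A \<le> a i j" by (rule Min_le) (auto intro: rev_image_eqI[of "(i, j)"])
    ultimately show "Min ?A \<le> \<rho> $ j" by linarith
  qed
qed

lemma Hr_bound: "\<exists>B\<ge>1. \<forall>\<rho>\<in>open_simplex. \<forall>x. H0 \<rho> x \<le> R \<longrightarrow> norm (Hr \<rho> x) \<le> B"
proof -
  obtain r where r: "r > 0" "\<And>\<rho> x i. \<rho> \<in> open_simplex \<Longrightarrow> H0 \<rho> x \<le> R \<Longrightarrow> r \<le> \<rho> $ i"
    using sublevel_lower_bound by blast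
  obtain B1 B2 where B: "\<And>p. p \<in> {r..1} \<times> {r..1} \<Longrightarrow> \<bar>g1 (fst p) (snd p)\<bar> \<le> B1"
    "\<And>p. p \<in> {r..1} \<times> {r..1} \<Longrightarrow> \<bar>g2 (fst p) (snd p)\<bar> \<le> B2"
    using C1_lipschitz_on_box[OF g1_C1 r(1), of 1] C1_lipschitz_on_box[OF g2_C1 r(1), of 1]
    unfolding bdd_lip_def by blast
  define W where "W = (\<Sum>i\<in>UNIV. \<Sum>j\<in>UNIV. \<omega> i j)"
  define D where "D = 1 / 2 * (2 * R / r * (B1 + B2)) + 1 / 8 * (W * (1 / r + 2 * \<bar>ln r\<bar>))"
  define Bi where "Bi = real CARD('n) * D + \<bar>ln r\<bar>"
  have "norm (Hr \<rho> x) \<le> real CARD('n) * Bi" if \<rho>: "\<rho> \<in> open_simplex" and H: "H0 \<rho> x \<le> R" for \<rho> x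
  proof -
    have rr: "r \<le> \<rho> $ i" "\<rho> $ i \<le> 1" "0 < \<rho> $ i" for i
      using r(2)[OF \<rho> H] \<rho>_le_1[OF \<rho>] \<rho>_pos[OF \<rho>] by auto
    have lnr: "\<bar>ln (\<rho> $ i)\<bar> \<le> \<bar>ln r\<bar>" for i
    proof -
      have "ln r \<le> ln (\<rho> $ i)" "ln (\<rho> $ i) \<le> 0" using rr[of i] r(1) by simp_all
      then show ?thesis by linarith
    qed
    have t: "\<bar>1 / 2 * (\<omega> i j * (x $ i - x $ j)\<^sup>2 * (g1 (\<rho> $ i) (\<rho> $ j) + g2 (\<rho> $ j) (\<rho> $ i)))
      + 1 / 8 * (\<omega> i j * \<theta>1 (\<rho> $ i) (\<rho> $ j))\<bar> \<le> D" for i j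
    proof -
      have "r \<le> g (\<rho> $ i) (\<rho> $ j)" using g_\<rho>(3)[OF \<rho>, of i j] rr[of i] rr[of j] by linarith
      then have "\<omega> i j * ((x $ i - x $ j)\<^sup>2 * r) \<le> \<omega> i j * ((x $ i - x $ j)\<^sup>2 * g (\<rho> $ i) (\<rho> $ j))"
        using \<omega>_nonneg by (intro mult_left_mono) auto
      also have "\<dots> \<le> 2 * R" using kinetic_edge[OF \<rho>, of i j x] kinetic_le[OF \<rho>, of x] H by linarith
      finally have d2: "\<omega> i j * (x $ i - x $ j)\<^sup>2 \<le> 2 * R / r" using r(1) by (simp add: field_simps)
      have d0: "0 \<le> \<omega> i j * (x $ i - x $ j)\<^sup>2" using \<omega>_nonneg by simp
      have "\<bar>g1 (\<rho> $ i) (\<rho> $ j) + g2 (\<rho> $ j) (\<rho> $ i)\<bar> \<le> B1 + B2"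
        using B(1)[of "(\<rho> $ i, \<rho> $ j)"] B(2)[of "(\<rho> $ j, \<rho> $ i)"] rr
        by (intro order_trans[OF abs_triangle_ineq] add_mono) auto
      then have 1: "\<bar>\<omega> i j * (x $ i - x $ j)\<^sup>2 * (g1 (\<rho> $ i) (\<rho> $ j) + g2 (\<rho> $ j) (\<rho> $ i))\<bar> \<le> 2 * R / r * (B1 + B2)"
        unfolding abs_mult[of "\<omega> i j * _"] using d0 d2 by (intro mult_mono) auto
      have "\<bar>(\<rho> $ i - \<rho> $ j) * (1 / \<rho> $ i)\<bar> \<le> 1 * (1 / r)"
      proof -
        have "\<bar>\<rho> $ i - \<rho> $ j\<bar> \<le> 1" using rr[of i] rr[of j] by linarith
        moreover have "\<bar>1 / \<rho> $ i\<bar> \<le> 1 / r" using rr[of i] r(1) by (simp add: frac_le)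
        ultimately show ?thesis unfolding abs_mult by (intro mult_mono) auto
      qed
      then have th: "\<bar>\<theta>1 (\<rho> $ i) (\<rho> $ j)\<bar> \<le> 1 / r + 2 * \<bar>ln r\<bar>"
        using lnr[of i] lnr[of j] unfolding \<theta>1_def by linarith
      have "\<omega> i j \<le> W" unfolding W_def by (rule double_sum_member) (rule \<omega>_nonneg)
      then have 2: "\<bar>\<omega> i j * \<theta>1 (\<rho> $ i) (\<rho> $ j)\<bar> \<le> W * (1 / r + 2 * \<bar>ln r\<bar>)"
        unfolding abs_mult using th \<omega>_nonneg[of i j] by (intro mult_mono) auto
      have "\<bar>1 / 2 * a + 1 / 8 * b\<bar> \<le> 1 / 2 * A + 1 / 8 * B" if "\<bar>a\<bar> \<le> A" "\<bar>b\<bar> \<le> B" for a b A B :: real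
        using that by linarith
      from this[OF 1 2] show ?thesis unfolding D_def by (simp only: mult.assoc)
    qed
    have "\<bar>Hr \<rho> x $ i\<bar> \<le> Bi" for i
    proof -
      have "\<bar>Hr \<rho> x $ i\<bar> \<le> (\<Sum>j\<in>UNIV. \<bar>1 / 2 * (\<omega> i j * (x $ i - x $ j)\<^sup>2 * (g1 (\<rho> $ i) (\<rho> $ j) + g2 (\<rho> $ j) (\<rho> $ i)))
        + 1 / 8 * (\<omega> i j * \<theta>1 (\<rho> $ i) (\<rho> $ j))\<bar>) + \<bar>ln (\<rho> $ i)\<bar>"
        unfolding Hr_def vec_lambda_beta by (intro order_trans[OF abs_triangle_ineq4] add_mono sum_abs) auto
      also have "\<dots> \<le> (\<Sum>j\<in>(UNIV :: 'n set). D) + \<bar>ln r\<bar>" by (intro add_mono sum_mono t lnr)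
      finally show ?thesis by (simp add: Bi_def)
    qed
    then have "(\<Sum>i\<in>UNIV. \<bar>Hr \<rho> x $ i\<bar>) \<le> (\<Sum>i\<in>(UNIV :: 'n set). Bi)" by (intro sum_mono)
    then show ?thesis using norm_le_l1_cart[of "Hr \<rho> x"] by simp
  qed
  then show ?thesis by (intro exI[of _ "max 1 (real CARD('n) * Bi)"]) (auto simp: le_max_iff_disj)
qed

lemma continuous_on_pair_comp:
  assumes "C_k_on 1 ({0<..} \<times> {0<..}) (\<lambda>p. f (fst p) (snd p))"
  shows "continuous_on (open_simplex \<times> UNIV) (\<lambda>p :: (real ^ 'n) \<times> (real ^ 'n). f (fst p $ i) (fst p $ j))"
proof -
  have "continuous_on ({0<..} \<times> {0<..}) (\<lambda>p. f (fst p) (snd p))"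
    using assms unfolding One_nat_def C_k_on.simps
    by (intro continuous_at_imp_continuous_on ballI differentiable_imp_continuous_within) blast
  moreover have "continuous_on (open_simplex \<times> UNIV) (\<lambda>p :: (real ^ 'n) \<times> (real ^ 'n). (fst p $ i, fst p $ j))"
    by (intro continuous_intros)
  ultimately have "continuous_on (open_simplex \<times> UNIV)
      (\<lambda>p :: (real ^ 'n) \<times> (real ^ 'n). f (fst (fst p $ i, fst p $ j)) (snd (fst p $ i, fst p $ j)))"
    by (rule continuous_on_compose2) (auto simp: open_simplexD)
  then show ?thesis by simp
qed

lemma continuous_on_ln_comp:
  "continuous_on (open_simplex \<times> UNIV) (\<lambda>p :: (real ^ 'n) \<times> (real ^ 'n). ln (fst p $ i))"
  by (intro continuous_intros) (auto dest!: open_simplexD(1)[of _ i])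

lemma Hx_cont: "continuous_on (open_simplex \<times> UNIV) (\<lambda>p. Hx (fst p) (snd p))"
  unfolding Hx_def
  by (intro continuous_on_vec_lambda continuous_intros continuous_on_pair_comp[OF g_C1])

lemma \<theta>1_cont: "continuous_on (open_simplex \<times> UNIV) (\<lambda>p :: (real ^ 'n) \<times> (real ^ 'n). \<theta>1 (fst p $ i) (fst p $ j))"
  unfolding \<theta>1_def
  by (intro continuous_on_add continuous_on_diff continuous_on_mult continuous_on_divide
      continuous_on_ln_comp continuous_intros) (auto dest!: open_simplexD(1)[of _ i])

lemma Hr_cont: "continuous_on (open_simplex \<times> UNIV) (\<lambda>p. Hr (fst p) (snd p))"
  unfolding Hr_def
  by (intro continuous_on_vec_lambda continuous_on_add continuous_on_diff continuous_on_mult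
      continuous_on_sum continuous_on_power continuous_on_const continuous_on_ln_comp \<theta>1_cont
      continuous_on_pair_comp[OF g1_C1] continuous_on_pair_comp[OF g2_C1] continuous_on_component
      continuous_on_snd continuous_on_id)

lemma H0_cont: "continuous_on (open_simplex \<times> UNIV) (\<lambda>p. H0 (fst p) (snd p))"
proof -
  have "continuous_on (open_simplex \<times> UNIV) (\<lambda>p :: (real ^ 'n) \<times> (real ^ 'n).
     (\<Sum>i\<in>UNIV. \<Sum>j\<in>UNIV. 1 / 2 * (\<omega> i j * ((snd p $ i - snd p $ j)\<^sup>2 * g (fst p $ i) (fst p $ j)))
      + 1 / 16 * (\<omega> i j * ((ln (fst p $ i) - ln (fst p $ j)) * (fst p $ i - fst p $ j))))
      - (\<Sum>i\<in>UNIV. fst p $ i * ln (fst p $ i) - fst p $ i))"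
    by (intro continuous_on_add continuous_on_diff continuous_on_mult continuous_on_sum
        continuous_on_power continuous_on_const continuous_on_ln_comp continuous_on_pair_comp[OF g_C1]
        continuous_on_component continuous_on_snd continuous_on_fst continuous_on_id)
  then show ?thesis
    by (rule continuous_on_eq) (simp only: mem_Times_iff energy_eq[OF \<rho>_pos])
qed

lemma space_test_H0: "space_test H0 (\<lambda>\<rho> x. tang (Hr \<rho> x)) Hx (\<lambda>\<rho> x. matrix (Hx \<rho>))"
proof -
  have m: "continuous_on (open_simplex \<times> UNIV) (\<lambda>p :: (real ^ 'n) \<times> (real ^ 'n). matrix (Hx (fst p)))"
  proof -
    have "continuous_on (open_simplex \<times> UNIV) (\<lambda>p :: (real ^ 'n) \<times> (real ^ 'n). Hx (fst p) v)" for v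
      using continuous_on_compose2[OF Hx_cont, of "open_simplex \<times> UNIV" "\<lambda>p. (fst p, v)"]
      by (force intro!: continuous_intros)
    then show ?thesis unfolding matrix_def by (intro continuous_on_vec_lambda continuous_on_component)
  qed
  have r: "has_simplex_derivative (\<lambda>r. H0 r x) (tang (Hr \<rho> x)) \<rho>" if "\<rho> \<in> open_simplex" for \<rho> x
    using GDERIV_r[OF \<rho>_pos[OF that], of x] open_simplexD(2)[OF that]
    by (intro has_simplex_derivativeI) (simp_all add: gderiv_def inner_commute)
  show ?thesis
    unfolding space_test_def Let_def case_prod_beta
    by (intro conjI ballI allI H0_cont continuous_on_tang Hr_cont Hx_cont m r Hx_has_derivative
        GDERIV_x \<rho>_pos)
qed

lemma drift_lipschitz:
  assumes K: "compact K" "K \<subseteq> open_simplex \<times> UNIV"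
  shows "\<exists>L. \<forall>p\<in>K. \<forall>q\<in>K. norm (Hx (fst p) (snd p) - Hx (fst q) (snd q)) \<le> L * norm (p - q) \<and>
        norm (Hr (fst p) (snd p) - Hr (fst q) (snd q)) \<le> L * norm (p - q)"
proof -
  obtain a where a: "a > 0" "\<And>p i. p \<in> K \<Longrightarrow> a \<le> fst p $ i"
    using simplex_compact_lower_bound[OF K] by blast
  have le1: "fst p $ i \<le> 1" if "p \<in> K" for p i
    using that K(2) \<rho>_le_1 by (metis mem_Times_iff subsetD)
  have bK: "bounded K" by (rule compact_imp_bounded[OF K(1)])
  have c: "bdd_lip K (\<lambda>p. fst p $ i)" "bdd_lip K (\<lambda>p. snd p $ i)" for i
    by (intro bdd_lip_bounded_linear[OF _ bK] bounded_linear_compose[OF bounded_linear_vec_nth]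
        bounded_linear_fst bounded_linear_snd)+
  have f: "bdd_lip K (\<lambda>p. f (fst p $ i) (fst p $ j))"
    if "C_k_on 1 ({0<..} \<times> {0<..}) (\<lambda>p. f (fst p) (snd p))" for f i j
    using bdd_lip_compose2[OF C1_lipschitz_on_box[OF that a(1), of 1] c(1)[of i] c(1)[of j]] a(2) le1 by simp
  have l: "bdd_lip K (\<lambda>p. ln (fst p $ i))" for i by (rule bdd_lip_ln[OF c(1) a])
  have t: "bdd_lip K (\<lambda>p. \<theta>1 (fst p $ i) (fst p $ j))" for i j
    unfolding \<theta>1_def by (intro bdd_lip_add bdd_lip_mult bdd_lip_diff c l bdd_lip_inverse[OF c(1) a])
  have sq: "bdd_lip K (\<lambda>p. (snd p $ i - snd p $ j)\<^sup>2)" for i j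
    unfolding power2_eq_square by (intro bdd_lip_mult bdd_lip_diff c)
  have "bdd_lip K (\<lambda>p. Hx (fst p) (snd p) $ i)" for i
    unfolding Hx_def vec_lambda_beta
    by (intro bdd_lip_cmult bdd_lip_sum bdd_lip_mult bdd_lip_diff c f g_C1)
  moreover have "bdd_lip K (\<lambda>p. Hr (fst p) (snd p) $ i)" for i
    unfolding Hr_def vec_lambda_beta
    by (intro bdd_lip_diff bdd_lip_sum bdd_lip_add bdd_lip_mult bdd_lip_const l t sq f g1_C1 g2_C1)
  ultimately obtain L1 L2 where
    L: "\<forall>p\<in>K. \<forall>q\<in>K. norm (Hx (fst p) (snd p) - Hx (fst q) (snd q)) \<le> L1 * norm (p - q)"
    "\<forall>p\<in>K. \<forall>q\<in>K. norm (Hr (fst p) (snd p) - Hr (fst q) (snd q)) \<le> L2 * norm (p - q)"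
    using bdd_lip_vec[of K "\<lambda>p. Hx (fst p) (snd p)"] bdd_lip_vec[of K "\<lambda>p. Hr (fst p) (snd p)"] by blast
  have "L1 * norm (p - q) \<le> max L1 L2 * norm (p - q)" "L2 * norm (p - q) \<le> max L1 L2 * norm (p - q)"
    for p q :: "(real ^ 'n) \<times> (real ^ 'n)" by (intro mult_right_mono; simp)+
  then show ?thesis
    using L by (intro exI[of _ "max L1 L2"] ballI conjI) (meson order_trans)+
qed

end

section \<open>Well-posedness\<close>

context hjb_problem
begin

lemma bdd_below_gen_cost:
  assumes "z \<in> dom0"
  shows "bdd_below ((\<lambda>V. gen V z p q Q + cost z V) ` cball 0 l)"
proof (rule bdd_belowI2)
  fix V :: "real ^ 'n" assume V: "V \<in> cball 0 l"
  have "q \<bullet> V \<le> norm q * norm V" by (rule norm_cauchy_schwarz)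
  also have "\<dots> \<le> norm q * l" using V by (intro mult_left_mono) auto
  finally have "gen 0 z p q Q - norm q * l \<le> gen V z p q Q" by (simp add: gen_def inner_add_right)
  moreover have "0 \<le> cost z V" using assms V F_nonneg by (auto simp: cost_def dom0_def)
  ultimately show "gen 0 z p q Q - norm q * l \<le> gen V z p q Q + cost z V" by linarith
qed

lemma INF_gen_cost_ge_iff:
  assumes "z \<in> dom0"
  shows "0 \<le> c + (INF V\<in>cball 0 l. gen V z p q Q + cost z V) \<longleftrightarrow>
    (\<forall>V\<in>cball 0 l. 0 \<le> c + gen V z p q Q + cost z V)"
proof
  assume le: "0 \<le> c + (INF V\<in>cball 0 l. gen V z p q Q + cost z V)"
  show "\<forall>V\<in>cball 0 l. 0 \<le> c + gen V z p q Q + cost z V"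
  proof
    fix V :: "real ^ 'n" assume "V \<in> cball 0 l"
    then show "0 \<le> c + gen V z p q Q + cost z V"
      using cINF_lower[OF bdd_below_gen_cost[OF assms, of p q Q], of V] le by linarith
  qed
next
  assume *: "\<forall>V\<in>cball 0 l. 0 \<le> c + gen V z p q Q + cost z V"
  have "- c \<le> (INF V\<in>cball 0 l. gen V z p q Q + cost z V)"
  proof (rule cINF_greatest)
    show "cball (0 :: real ^ 'n) l \<noteq> {}" using l_nonneg by simp
    show "- c \<le> gen V z p q Q + cost z V" if "V \<in> cball 0 l" for V
      using bspec[OF * that] by linarith
  qed
  then show "0 \<le> c + (INF V\<in>cball 0 l. gen V z p q Q + cost z V)" by linarith
qed

lemma INF_gen_cost_le_iff:
  assumes "z \<in> dom0"
  shows "c + (INF V\<in>cball 0 l. gen V z p q Q + cost z V) \<le> 0 \<longleftrightarrow>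
    (\<forall>\<epsilon>>0. \<exists>V\<in>cball 0 l. c + gen V z p q Q + cost z V \<le> \<epsilon>)"
proof
  have ne: "cball (0 :: real ^ 'n) l \<noteq> {}" using l_nonneg by simp
  assume le: "c + (INF V\<in>cball 0 l. gen V z p q Q + cost z V) \<le> 0"
  show "\<forall>\<epsilon>>0. \<exists>V\<in>cball 0 l. c + gen V z p q Q + cost z V \<le> \<epsilon>"
  proof (intro allI impI)
    fix \<epsilon> :: real assume "\<epsilon> > 0"
    then have "(INF V\<in>cball 0 l. gen V z p q Q + cost z V) < \<epsilon> - c" using le by linarith
    then obtain V where V: "V \<in> cball 0 l" "gen V z p q Q + cost z V < \<epsilon> - c"
      using cINF_less_iff[OF ne bdd_below_gen_cost[OF assms]] by blast
    then have "c + gen V z p q Q + cost z V \<le> \<epsilon>" by linarith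
    with V(1) show "\<exists>V\<in>cball 0 l. c + gen V z p q Q + cost z V \<le> \<epsilon>" by blast
  qed
next
  assume *: "\<forall>\<epsilon>>0. \<exists>V\<in>cball 0 l. c + gen V z p q Q + cost z V \<le> \<epsilon>"
  show "c + (INF V\<in>cball 0 l. gen V z p q Q + cost z V) \<le> 0"
  proof (rule field_le_epsilon)
    fix \<epsilon> :: real assume "\<epsilon> > 0"
    then obtain V where V: "V \<in> cball 0 l" "c + gen V z p q Q + cost z V \<le> \<epsilon>" using * by blast
    show "c + (INF V\<in>cball 0 l. gen V z p q Q + cost z V) \<le> 0 + \<epsilon>"
      using cINF_lower[OF bdd_below_gen_cost[OF assms, of p q Q] V(1)] V(2) by linarith
  qed
qed

context
  fixes H :: "real \<Rightarrow> real ^ 'n \<Rightarrow> real ^ 'n \<Rightarrow> real ^ 'n \<Rightarrow> real ^ 'n \<Rightarrow> real ^ 'n ^ 'n \<Rightarrow> real"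
  assumes H: "\<And>t \<rho> x p q Q. \<rho> \<in> open_simplex \<Longrightarrow>
    H t \<rho> x p q Q = (INF V\<in>cball 0 l. gen V (t, \<rho>, x) p q Q + cost (t, \<rho>, x) V)"
begin

lemma viscosity_subsolution_iff:
  "viscosity_subsolution T H h U \<longleftrightarrow>
    continuous_on dom1 U \<and> (\<forall>\<rho>\<in>open_simplex. \<forall>x. U (T, \<rho>, x) \<le> h \<rho> x) \<and> visc_sub U"
proof -
  have "0 \<le> c + H t \<rho> x p q Q \<longleftrightarrow>
      (\<forall>V\<in>cball 0 l. 0 \<le> c + gen V (t, \<rho>, x) p q Q + cost (t, \<rho>, x) V)"
    if "t \<in> {0<..<T}" "\<rho> \<in> open_simplex" for t \<rho> x c p q Q
    unfolding H[OF that(2)] by (rule INF_gen_cost_ge_iff) (use that in \<open>simp add: dom0_def\<close>)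
  then show ?thesis
    unfolding viscosity_subsolution_def visc_sub_def dom0_def dom1_def
    by (simp add: Ball_def mem_Times_iff split_paired_All imp_conjL)
qed

lemma viscosity_supersolution_iff:
  "viscosity_supersolution T H h U \<longleftrightarrow>
    continuous_on dom1 U \<and> (\<forall>\<rho>\<in>open_simplex. \<forall>x. h \<rho> x \<le> U (T, \<rho>, x)) \<and> visc_super U"
proof -
  have "c + H t \<rho> x p q Q \<le> 0 \<longleftrightarrow>
      (\<forall>\<epsilon>>0. \<exists>V\<in>cball 0 l. c + gen V (t, \<rho>, x) p q Q + cost (t, \<rho>, x) V \<le> \<epsilon>)"
    if "t \<in> {0<..<T}" "\<rho> \<in> open_simplex" for t \<rho> x c p q Q
    unfolding H[OF that(2)] by (rule INF_gen_cost_le_iff) (use that in \<open>simp add: dom0_def\<close>)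
  then show ?thesis
    unfolding viscosity_supersolution_def visc_super_def dom0_def dom1_def
    by (simp add: Ball_def mem_Times_iff split_paired_All imp_conjL)
qed

theorem exists_unique_bounded_viscosity_solution:
  "\<exists>U. bounded_viscosity_solution T H h U \<and>
    (\<forall>U'. bounded_viscosity_solution T H h U' \<longrightarrow> (\<forall>z\<in>{0<..T} \<times> open_simplex \<times> UNIV. U' z = U z))"
proof -
  have bvs: "bounded_viscosity_solution T H h U \<longleftrightarrow> continuous_on dom1 U \<and> visc_sub U \<and> visc_super U \<and>
      (\<exists>M. \<forall>z\<in>dom1. \<bar>U z\<bar> \<le> M) \<and> (\<forall>\<rho>\<in>open_simplex. \<forall>x. U (T, \<rho>, x) = h \<rho> x)" for U
  proof -
    have "bounded (U ` dom1) \<longleftrightarrow> (\<exists>M. \<forall>z\<in>dom1. \<bar>U z\<bar> \<le> M)" by (simp add: bounded_iff)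
    moreover have "(\<forall>\<rho>\<in>open_simplex. \<forall>x. U (T, \<rho>, x) = h \<rho> x) \<longleftrightarrow>
        (\<forall>\<rho>\<in>open_simplex. \<forall>x. U (T, \<rho>, x) \<le> h \<rho> x) \<and> (\<forall>\<rho>\<in>open_simplex. \<forall>x. h \<rho> x \<le> U (T, \<rho>, x))"
      by (force intro: antisym)
    ultimately show ?thesis
      unfolding bounded_viscosity_solution_def viscosity_solution_def viscosity_subsolution_iff
        viscosity_supersolution_iff dom1_def[symmetric] by blast
  qed
  have le: "U z \<le> U' z"
    if U: "bounded_viscosity_solution T H h U" and U': "bounded_viscosity_solution T H h U'" and z: "z \<in> dom1"
    for U U' z
  proof -
    obtain M M' where M: "\<forall>z\<in>dom1. \<bar>U z\<bar> \<le> M" "\<forall>z\<in>dom1. \<bar>U' z\<bar> \<le> M'"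
      using U U' unfolding bvs by blast
    show ?thesis
    proof (rule comparison[where M = "max M M'"])
      show "usc_on dom1 U" "usc_on dom1 (\<lambda>z. - U' z)"
        using U U' unfolding bvs by (auto intro!: usc_on_continuous continuous_on_minus)
      show "visc_sub U" "visc_super U'" using U U' unfolding bvs by auto
      show "\<bar>U z\<bar> \<le> max M M'" "\<bar>U' z\<bar> \<le> max M M'" if "z \<in> dom1" for z
        using M that by (auto simp: le_max_iff_disj)
      show "U (T, \<rho>, x) \<le> U' (T, \<rho>, x)" if "\<rho> \<in> open_simplex" for \<rho> x
        using U U' that unfolding bvs by simp
    qed (rule z)
  qed
  have "bounded_viscosity_solution T H h perron" using existence unfolding bvs by blast
  then show ?thesis unfolding dom1_def[symmetric] using le by (intro exI[of _ perron]) (auto intro: antisym)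
qed

end

end

context graph_energy
begin

lemma hamiltonian_eq:
  assumes \<rho>: "\<rho> \<in> open_simplex"
  shows "hamiltonian H0 l (diag \<sigma>) F t \<rho> x p q Q = (INF V\<in>cball 0 l. p \<bullet> Hx \<rho> x - q \<bullet> (Hr \<rho> x + V)
    + 1 / 2 * (\<Sum>i\<in>UNIV. (\<sigma> $ i)\<^sup>2 * Q $ i $ i) + F t \<rho> x V)"
proof -
  have "grad (controlled_energy H0 V \<rho>) x = Hx \<rho> x" for V
    unfolding controlled_energy_def[abs_def]
    by (rule grad_eqI, rule GDERIV_subst[OF GDERIV_add[OF GDERIV_x[OF \<rho>_pos[OF \<rho>]] GDERIV_const]]) simp
  moreover have "grad (\<lambda>r. controlled_energy H0 V r x) \<rho> = Hr \<rho> x + V" for V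
  proof -
    have "GDERIV (\<lambda>r. V \<bullet> r) \<rho> :> V"
      unfolding gderiv_def
      by (rule has_derivative_eq_rhs[OF has_derivative_inner_right[OF has_derivative_ident]])
         (simp add: inner_commute)
    from GDERIV_add[OF GDERIV_r[OF \<rho>_pos[OF \<rho>]] this]
    show ?thesis by (intro grad_eqI) (simp add: controlled_energy_def[abs_def] inner_vec_def)
  qed
  moreover have "trace (diag \<sigma> ** transpose (diag \<sigma>) ** Q) = (\<Sum>i\<in>UNIV. (\<sigma> $ i)\<^sup>2 * Q $ i $ i)"
    by (simp add: trace_def matrix_matrix_mult_def transpose_def diag_def power2_eq_square
        if_distrib[of "\<lambda>c. c * _"] if_distrib[of "\<lambda>c. _ * c"] sum.delta sum.delta' cong: if_cong)
  ultimately show ?thesis unfolding hamiltonian_def by simp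
qed

lemma norm_Hx_le:
  assumes \<rho>: "\<rho> \<in> open_simplex"
  shows "norm (Hx \<rho> x) \<le> (\<Sum>i\<in>UNIV. \<Sum>j\<in>UNIV. \<omega> i j) + 2 * H0 \<rho> x"
proof -
  have t: "\<bar>2 * (\<omega> i j * ((x $ i - x $ j) * g (\<rho> $ i) (\<rho> $ j)))\<bar>
      \<le> \<omega> i j + \<omega> i j * ((x $ i - x $ j)\<^sup>2 * g (\<rho> $ i) (\<rho> $ j))" for i j
  proof -
    let ?d = "x $ i - x $ j" and ?g = "g (\<rho> $ i) (\<rho> $ j)"
    have "2 * \<bar>?d\<bar> \<le> 1 + ?d\<^sup>2"
      using zero_le_power2[of "\<bar>?d\<bar> - 1"] by (simp add: power2_diff)
    then have "2 * \<bar>?d\<bar> * ?g \<le> (1 + ?d\<^sup>2) * ?g" using g_\<rho>(1)[OF \<rho>] by (intro mult_right_mono)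
    also have "\<dots> \<le> 1 + ?d\<^sup>2 * ?g" using g_\<rho>(2)[OF \<rho>] by (simp add: distrib_right)
    finally have "\<omega> i j * (2 * \<bar>?d\<bar> * ?g) \<le> \<omega> i j * (1 + ?d\<^sup>2 * ?g)"
      using \<omega>_nonneg by (intro mult_left_mono)
    then show ?thesis using \<omega>_nonneg[of i j] g_\<rho>(1)[OF \<rho>, of i j] by (simp add: abs_mult distrib_left mult_ac)
  qed
  have "norm (Hx \<rho> x) \<le> (\<Sum>i\<in>UNIV. \<bar>Hx \<rho> x $ i\<bar>)" by (rule norm_le_l1_cart)
  also have "\<dots> \<le> (\<Sum>i\<in>UNIV. \<Sum>j\<in>UNIV. \<omega> i j + \<omega> i j * ((x $ i - x $ j)\<^sup>2 * g (\<rho> $ i) (\<rho> $ j)))"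
    unfolding Hx_def vec_lambda_beta sum_distrib_left
    by (intro sum_mono order_trans[OF sum_abs]) (rule t)
  also have "\<dots> = (\<Sum>i\<in>UNIV. \<Sum>j\<in>UNIV. \<omega> i j) + 2 * kinetic E \<omega> g \<rho> x"
    by (simp add: sum.distrib kinetic_eq)
  finally show ?thesis using kinetic_le[OF \<rho>, of x] by linarith
qed

lemma matrix_Hx_diag_le:
  assumes \<rho>: "\<rho> \<in> open_simplex"
  shows "matrix (Hx \<rho>) $ i $ i \<le> 2 * (\<Sum>i\<in>UNIV. \<Sum>j\<in>UNIV. \<omega> i j)"
proof -
  have "(axis i 1 $ i - axis i 1 $ j) * g (\<rho> $ i) (\<rho> $ j) \<le> 1 * 1" for j
    using g_\<rho>(1,2)[OF \<rho>, of i j] by (simp add: axis_def)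
  then have "\<omega> i j * ((axis i 1 $ i - axis i 1 $ j) * g (\<rho> $ i) (\<rho> $ j)) \<le> \<omega> i j * 1" for j
    using \<omega>_nonneg[of i j] by (intro mult_left_mono) simp_all
  then have "(\<Sum>j\<in>UNIV. \<omega> i j * ((axis i 1 $ i - axis i 1 $ j) * g (\<rho> $ i) (\<rho> $ j))) \<le> (\<Sum>j\<in>UNIV. \<omega> i j * 1)"
    by (rule sum_mono)
  also have "(\<Sum>j\<in>UNIV. \<omega> i j * 1) \<le> (\<Sum>i\<in>UNIV. \<Sum>j\<in>UNIV. \<omega> i j)"
    unfolding mult_1_right by (rule member_le_sum) (auto intro: sum_nonneg \<omega>_nonneg)
  finally show ?thesis by (simp add: matrix_def Hx_def)
qed

lemma lyapunov_level:
  fixes l R :: real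
  assumes l: "0 \<le> l" and R: "0 < R"
  defines "\<Omega> \<equiv> (\<Sum>i\<in>UNIV. \<Sum>j\<in>UNIV. \<omega> i j)"
  shows "\<exists>G0 K \<psi> \<psi>\<rho> \<psi>x \<psi>xx.
      openin (top_of_set (open_simplex \<times> UNIV)) G0 \<and> G0 \<subseteq> K \<and> compact K \<and>
      K \<subseteq> open_simplex \<times> UNIV \<and> space_test \<psi> \<psi>\<rho> \<psi>x \<psi>xx \<and>
      (\<forall>\<rho>\<in>open_simplex. \<forall>x. 0 \<le> \<psi> \<rho> x \<and> \<psi> \<rho> x \<le> H0 \<rho> x + root1 x \<and> ((\<rho>, x) \<notin> G0 \<longrightarrow> R \<le> \<psi> \<rho> x)) \<and>
      (\<forall>\<rho> x. (\<rho>, x) \<in> G0 \<longrightarrow> (\<forall>V\<in>cball 0 l.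
         \<psi>\<rho> \<rho> x \<bullet> Hx \<rho> x - \<psi>x \<rho> x \<bullet> (Hr \<rho> x + V)
           + 1 / 2 * (\<Sum>i\<in>UNIV. (\<sigma> $ i)\<^sup>2 * \<psi>xx \<rho> x $ i $ i)
         \<le> (l * \<Omega> + 2 * l + 1 + 1 / 2 * (\<Sum>i\<in>UNIV. (\<sigma> $ i)\<^sup>2) * (2 * \<Omega> + 1)) * (1 + \<psi> \<rho> x)))"
proof -
  have \<Omega>: "0 \<le> \<Omega>" unfolding \<Omega>_def by (intro sum_nonneg \<omega>_nonneg)
  obtain r where r: "r > 0" "\<And>\<rho> x i. \<rho> \<in> open_simplex \<Longrightarrow> H0 \<rho> x \<le> R \<Longrightarrow> r \<le> \<rho> $ i"
    using sublevel_lower_bound by blast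
  obtain B where B: "1 \<le> B" "\<And>\<rho> x. \<rho> \<in> open_simplex \<Longrightarrow> H0 \<rho> x \<le> R \<Longrightarrow> norm (Hr \<rho> x) \<le> B"
    using Hr_bound by blast
  define BR where "BR = B + l"
  have BR: "1 \<le> BR" using B(1) l by (simp add: BR_def)
  define S :: "((real ^ 'n) \<times> (real ^ 'n)) set" where "S = open_simplex \<times> UNIV"
  define G0 where "G0 = S \<inter> (\<lambda>p. (H0 (fst p) (snd p), root1 (snd p))) -` ({..<R} \<times> {..<R * BR})"
  define K :: "((real ^ 'n) \<times> (real ^ 'n)) set" where
    "K = (cbox (\<chi> i. r) 1 \<inter> {\<rho>. (\<Sum>i\<in>UNIV. \<rho> $ i) = 1}) \<times> cball 0 (R * BR)"
  define \<psi> where "\<psi> = (\<lambda>\<rho> x. H0 \<rho> x + 1 / BR * root1 x)"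
  define \<psi>\<rho> where "\<psi>\<rho> = (\<lambda>\<rho> x. tang (Hr \<rho> x) + 0)"
  define \<psi>x where "\<psi>x = (\<lambda>\<rho> x. Hx \<rho> x + (1 / BR / root1 x) *\<^sub>R x)"
  define \<psi>xx where "\<psi>xx = (\<lambda>\<rho> x. matrix (Hx \<rho>) + (1 / BR) *\<^sub>R root1_hess x)"
  have test: "space_test \<psi> \<psi>\<rho> \<psi>x \<psi>xx"
    unfolding \<psi>_def \<psi>\<rho>_def \<psi>x_def \<psi>xx_def by (rule space_test_add[OF space_test_H0 space_test_root1])
  have G0: "(\<rho>, x) \<in> G0 \<longleftrightarrow> \<rho> \<in> open_simplex \<and> H0 \<rho> x < R \<and> root1 x < R * BR" for \<rho> x
    by (auto simp: G0_def S_def)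
  have op: "openin (top_of_set S) G0"
    unfolding G0_def S_def
    by (intro continuous_openin_preimage_gen open_Times open_lessThan continuous_on_Pair H0_cont
        continuous_on_root1 continuous_intros)
  have "G0 \<subseteq> K"
  proof
    fix p assume p: "p \<in> G0"
    obtain \<rho> x where px: "p = (\<rho>, x)" by (cases p)
    then have *: "\<rho> \<in> open_simplex" "H0 \<rho> x < R" "root1 x < R * BR" using p G0 by auto
    then show "p \<in> K"
      using r(2)[OF *(1), of x] \<rho>_le_1[OF *(1)] open_simplexD(2)[OF *(1)] root1_ge(2)[of x]
      by (auto simp: px K_def mem_box_cart)
  qed
  moreover have "compact K"
    unfolding K_def
    by (intro compact_Times compact_cball compact_Int_closed compact_cbox closed_Collect_eq continuous_intros)
  moreover have "K \<subseteq> S"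
    using r(1) by (auto simp: K_def S_def open_simplex_eq mem_box_cart intro: less_le_trans)
  moreover have "0 \<le> \<psi> \<rho> x \<and> \<psi> \<rho> x \<le> H0 \<rho> x + root1 x \<and> ((\<rho>, x) \<notin> G0 \<longrightarrow> R \<le> \<psi> \<rho> x)"
    if \<rho>: "\<rho> \<in> open_simplex" for \<rho> x
  proof -
    have "1 / BR * root1 x \<le> 1 * root1 x" using BR root1_pos[of x] by (intro mult_right_mono) auto
    moreover have "0 \<le> 1 / BR * root1 x" using BR root1_pos[of x] by simp
    moreover have "R \<le> 1 / BR * root1 x" if "R * BR \<le> root1 x" using that BR by (simp add: field_simps)
    ultimately show ?thesis using H0_nonneg[OF \<rho>, of x] G0[of \<rho> x] \<rho> unfolding \<psi>_def by argo
  qed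
  moreover have "\<psi>\<rho> \<rho> x \<bullet> Hx \<rho> x - \<psi>x \<rho> x \<bullet> (Hr \<rho> x + V)
           + 1 / 2 * (\<Sum>i\<in>UNIV. (\<sigma> $ i)\<^sup>2 * \<psi>xx \<rho> x $ i $ i)
         \<le> (l * \<Omega> + 2 * l + 1 + 1 / 2 * (\<Sum>i\<in>UNIV. (\<sigma> $ i)\<^sup>2) * (2 * \<Omega> + 1)) * (1 + \<psi> \<rho> x)"
    if G: "(\<rho>, x) \<in> G0" and V: "V \<in> cball 0 l" for \<rho> x V
  proof -
    have \<rho>: "\<rho> \<in> open_simplex" and H: "H0 \<rho> x \<le> R" using G by (auto simp: G0)
    have t: "tang (Hr \<rho> x) \<bullet> Hx \<rho> x = Hx \<rho> x \<bullet> Hr \<rho> x"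
      by (subst tang_inner[OF Hx_sum[OF \<rho>_pos[OF \<rho>]]]) (rule inner_commute)
    have "- (Hx \<rho> x \<bullet> V) \<le> norm (Hx \<rho> x) * norm V" using Cauchy_Schwarz_ineq2[of "Hx \<rho> x" V] by linarith
    also have "\<dots> \<le> (\<Omega> + 2 * H0 \<rho> x) * l"
      using V norm_Hx_le[OF \<rho>, of x] H0_nonneg[OF \<rho>, of x] \<Omega> by (intro mult_mono) (auto simp: \<Omega>_def)
    finally have 1: "- (Hx \<rho> x \<bullet> V) \<le> (\<Omega> + 2 * H0 \<rho> x) * l" .
    have "norm ((1 / BR / root1 x) *\<^sub>R x) \<le> 1 / BR"
      using root1_ge(2)[of x] root1_pos[of x] BR by (simp add: divide_simps)
    moreover have "norm (Hr \<rho> x + V) \<le> BR"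
      using norm_triangle_ineq[of "Hr \<rho> x" V] B(2)[OF \<rho> H] V by (simp add: BR_def)
    ultimately have "norm ((1 / BR / root1 x) *\<^sub>R x) * norm (Hr \<rho> x + V) \<le> 1 / BR * BR"
      using BR by (intro mult_mono) auto
    moreover have "1 / BR * BR = 1" using BR by simp
    ultimately have 2: "- (((1 / BR / root1 x) *\<^sub>R x) \<bullet> (Hr \<rho> x + V)) \<le> 1"
      using Cauchy_Schwarz_ineq2[of "(1 / BR / root1 x) *\<^sub>R x" "Hr \<rho> x + V"] by linarith
    have "\<psi>xx \<rho> x $ i $ i \<le> 2 * \<Omega> + 1" for i
    proof -
      have "1 / BR * root1_hess x $ i $ i \<le> 1 / BR * 1"
        using BR root1_hess_diag_le[of x i] by (intro mult_left_mono) auto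
      also have "\<dots> \<le> 1" using BR by simp
      finally show ?thesis using matrix_Hx_diag_le[OF \<rho>, of i] by (simp add: \<psi>xx_def \<Omega>_def)
    qed
    then have "(\<Sum>i\<in>UNIV. (\<sigma> $ i)\<^sup>2 * \<psi>xx \<rho> x $ i $ i) \<le> (\<Sum>i\<in>UNIV. (\<sigma> $ i)\<^sup>2 * (2 * \<Omega> + 1))"
      by (intro sum_mono mult_left_mono) auto
    then have 3: "(\<Sum>i\<in>UNIV. (\<sigma> $ i)\<^sup>2 * \<psi>xx \<rho> x $ i $ i) \<le> (\<Sum>i\<in>UNIV. (\<sigma> $ i)\<^sup>2) * (2 * \<Omega> + 1)"
      by (simp only: sum_distrib_right)
    define s where "s = 1 / 2 * (\<Sum>i\<in>UNIV. (\<sigma> $ i)\<^sup>2) * (2 * \<Omega> + 1)"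
    have s: "0 \<le> s" unfolding s_def using \<Omega> by (intro mult_nonneg_nonneg sum_nonneg) auto
    have \<psi>: "H0 \<rho> x \<le> \<psi> \<rho> x" "0 \<le> H0 \<rho> x"
      using H0_nonneg[OF \<rho>, of x] BR root1_pos[of x] by (simp_all add: \<psi>_def)
    have a1: "(l * \<Omega> + 1 + s) * 1 \<le> (l * \<Omega> + 1 + s) * (1 + \<psi> \<rho> x)"
      using l \<Omega> s \<psi> by (intro mult_left_mono) auto
    have a2: "2 * l * H0 \<rho> x \<le> 2 * l * (1 + \<psi> \<rho> x)" using l \<psi> by (intro mult_left_mono) auto
    have "\<psi>\<rho> \<rho> x \<bullet> Hx \<rho> x - \<psi>x \<rho> x \<bullet> (Hr \<rho> x + V) = - (Hx \<rho> x \<bullet> V) - ((1 / BR / root1 x) *\<^sub>R x) \<bullet> (Hr \<rho> x + V)"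
      unfolding \<psi>\<rho>_def \<psi>x_def add_0_right t inner_add_left inner_add_right[of "Hx \<rho> x"] by linarith
    also have "\<dots> + 1 / 2 * (\<Sum>i\<in>UNIV. (\<sigma> $ i)\<^sup>2 * \<psi>xx \<rho> x $ i $ i) \<le> (\<Omega> + 2 * H0 \<rho> x) * l + 1 + s"
      using 1 2 3 unfolding s_def by linarith
    also have "\<dots> = (l * \<Omega> + 1 + s) * 1 + 2 * l * H0 \<rho> x" by (simp add: algebra_simps)
    also have "\<dots> \<le> (l * \<Omega> + 1 + s) * (1 + \<psi> \<rho> x) + 2 * l * (1 + \<psi> \<rho> x)" by (rule add_mono[OF a1 a2])
    also have "\<dots> = (l * \<Omega> + 2 * l + 1 + s) * (1 + \<psi> \<rho> x)" by (simp add: algebra_simps)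
    finally show ?thesis unfolding s_def .
  qed
  ultimately show ?thesis
    using op test unfolding S_def
    by (intro exI[of _ G0] exI[of _ K] exI[of _ \<psi>] exI[of _ \<psi>\<rho>] exI[of _ \<psi>x] exI[of _ \<psi>xx] conjI) blast+
qed

lemma hjb_problem_energy:
  assumes T: "T > 0" and l: "l > 0"
    and costs: "admissible_costs E H0 T l F h"
    and F: "\<exists>M. \<forall>s\<in>{0..T}. \<forall>\<rho>\<in>open_simplex. \<forall>x. \<forall>V\<in>cball 0 l. \<bar>F s \<rho> x V\<bar> \<le> M"
    and h: "\<exists>M. \<forall>\<rho>\<in>open_simplex. \<forall>x. \<bar>h \<rho> x\<bar> \<le> M"
  shows "hjb_problem T l \<sigma> F h Hx Hr"
proof
  let ?\<Omega> = "\<Sum>i\<in>UNIV. \<Sum>j\<in>UNIV. \<omega> i j"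
  let ?C = "l * ?\<Omega> + 2 * l + 1 + 1 / 2 * (\<Sum>i\<in>UNIV. (\<sigma> $ i)\<^sup>2) * (2 * ?\<Omega> + 1)"
  show "0 < T" "0 \<le> l" using T l by auto
  show "(\<Sum>i\<in>UNIV. Hx \<rho> x $ i) = 0" if "\<rho> \<in> open_simplex" for \<rho> x
    by (rule Hx_sum[OF \<rho>_pos[OF that]])
  show "continuous_on ({0..T} \<times> open_simplex \<times> UNIV \<times> cball 0 l) (\<lambda>(s, \<rho>, x, V). F s \<rho> x V)"
    and "continuous_on (open_simplex \<times> UNIV) (\<lambda>(\<rho>, x). h \<rho> x)"
    using costs unfolding admissible_costs_def by blast+
  show "0 \<le> F s \<rho> x V" if "s \<in> {0..T}" "\<rho> \<in> open_simplex" "V \<in> cball 0 l" for s \<rho> x V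
    using costs that unfolding admissible_costs_def by blast
  show "0 \<le> h \<rho> x" if "\<rho> \<in> open_simplex" for \<rho> x
    using costs that unfolding admissible_costs_def by blast
  show "\<exists>M. \<forall>s\<in>{0..T}. \<forall>\<rho>\<in>open_simplex. \<forall>x. \<forall>V\<in>cball 0 l. F s \<rho> x V \<le> M"
    using F by (meson abs_le_D1)
  show "\<exists>M. \<forall>\<rho>\<in>open_simplex. \<forall>x. h \<rho> x \<le> M" using h by (meson abs_le_D1)
  have "0 \<le> ?\<Omega>" by (intro sum_nonneg \<omega>_nonneg)
  then have "0 \<le> ?C"
    using l by (intro add_nonneg_nonneg mult_nonneg_nonneg sum_nonneg) (auto simp: \<omega>_nonneg)
  then show "\<exists>C0\<ge>0. \<exists>b. \<forall>R>0. \<exists>G0 K \<psi> \<psi>\<rho> \<psi>x \<psi>xx.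
      openin (top_of_set (open_simplex \<times> UNIV)) G0 \<and> G0 \<subseteq> K \<and> compact K \<and>
      K \<subseteq> open_simplex \<times> UNIV \<and> space_test \<psi> \<psi>\<rho> \<psi>x \<psi>xx \<and>
      (\<forall>\<rho>\<in>open_simplex. \<forall>x. 0 \<le> \<psi> \<rho> x \<and> \<psi> \<rho> x \<le> b \<rho> x \<and> ((\<rho>, x) \<notin> G0 \<longrightarrow> R \<le> \<psi> \<rho> x)) \<and>
      (\<forall>\<rho> x. (\<rho>, x) \<in> G0 \<longrightarrow> (\<forall>V\<in>cball 0 l.
         \<psi>\<rho> \<rho> x \<bullet> Hx \<rho> x - \<psi>x \<rho> x \<bullet> (Hr \<rho> x + V)
           + 1 / 2 * (\<Sum>i\<in>UNIV. (\<sigma> $ i)\<^sup>2 * \<psi>xx \<rho> x $ i $ i) \<le> C0 * (1 + \<psi> \<rho> x)))"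
    using lyapunov_level[of l _ \<sigma>] l
    by (intro exI[of _ ?C] conjI exI[of _ "\<lambda>\<rho> x. H0 \<rho> x + root1 x"] allI impI) auto
qed (rule Hx_cont Hr_cont drift_lipschitz; assumption?)+

end

theorem corollary4p2:
  fixes E :: "('n::finite \<times> 'n) set"
    and \<omega> :: "'n \<Rightarrow> 'n \<Rightarrow> real"
    and g :: "real \<Rightarrow> real \<Rightarrow> real"
    and l T :: real
    and \<sigma> :: "real ^ 'n"
    and F :: "real \<Rightarrow> real ^ 'n \<Rightarrow> real ^ 'n \<Rightarrow> real ^ 'n \<Rightarrow> real"
    and h :: "real ^ 'n \<Rightarrow> real ^ 'n \<Rightarrow> real"
  assumes "weighted_graph E \<omega>"
    and "admissible_weight g"
    and "l > 0" and "T > 0"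
    and "admissible_costs E (energy E \<omega> g) T l F h"
    and "\<exists>M. \<forall>s\<in>{0..T}. \<forall>\<rho>\<in>open_simplex. \<forall>x. \<forall>V\<in>cball 0 l. \<bar>F s \<rho> x V\<bar> \<le> M"
    and "\<exists>M. \<forall>\<rho>\<in>open_simplex. \<forall>x. \<bar>h \<rho> x\<bar> \<le> M"
  shows "\<exists>U. bounded_viscosity_solution T (hamiltonian (energy E \<omega> g) l (diag \<sigma>) F) h U \<and>
           (\<forall>U'. bounded_viscosity_solution T (hamiltonian (energy E \<omega> g) l (diag \<sigma>) F) h U' \<longrightarrow>
              (\<forall>z \<in> {0<..T} \<times> open_simplex \<times> UNIV. U' z = U z))"
proof -
  interpret graph_energy E \<omega> g by unfold_locales (rule assms(1,2))+
  interpret hjb_problem T l \<sigma> F h Hx Hr by (rule hjb_problem_energy[OF assms(4,3,5-7)])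
  show ?thesis
    by (rule exists_unique_bounded_viscosity_solution) (simp add: hamiltonian_eq gen_def cost_def)
qed

end
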